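(* Let $d>4$ and $p=\frac{2}{d-2}\in(0,1)$ (energy-critical exponent). For $b>0$, let $\lambda=\lambda(b)$ denote the value of $\lambda$ on the solution curve of ground states, i.e. such that the stationary Gross--Pitaevskii equation $$(-\Delta+|x|^2)u-|u|^{2p}u=\lambda u,\qquad x\in\mathbb{R}^d,$$ admits a radial ground state $u=u_b(r)$, $r=|x|$, with $u_b(0)=b$, $u_b'(r)<0$ for $r>0$ and $u_b(r)\to0$ as $r\to\infty$. Then, as $b\to\infty$, $$\lambda(b)\sim C_p\begin{cases} b^{-2(1-p)}, & \tfrac12<p<1,\\ b^{-1}\log b, & p=\tfrac12,\\ b^{-2p}, & 0<p<\tfrac12,\end{cases}$$ where $$C_p=\begin{cases}\displaystyle -\frac{\Gamma\left(\frac{p+1}{2p}\right)\Gamma\left(-\frac1p\right)\Gamma\left(\frac2p\right)}{(1+p)\Gamma\left(\frac{p-1}{2p}\right)\Gamma\left(\frac1p\right)\Gamma\left(\frac1p-1\right)\Gamma\left(\frac1p+1\right)}\left[\frac{4(1+p)}{p^2}\right]^{1/p}, & \tfrac12<p<1,\\[2mm] 144, & p=\tfrac12,\\[1mm] \displaystyle\frac{8(1+p)^2}{p^2(1-2p)}, & 0<p<\tfrac12.\end{cases}$$ Moreover, for every $a\in(0,\frac{p}{1+p})$ there exist $B_a,C_a>0$ such that for every $b\ge B_a$, $$\sup_{r\in[0,b^{-p(1-a)}]} b^{-1}\left|u_b(r)-U_b(r)\right|\le C_a b^{-2p(1-a)},$$ $$\sup_{r\in[b^{-p(1-a)},1]}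 r^{2/p}\left|u_b(r)-c(b)e^{-\frac12 r^2}\mathfrak{U}(r^2;\alpha,\beta)\right|\le C_a|c(b)|^{2p+1}b^{2p(1-a)},$$ $$\sup_{r\in[1,\infty)}\left|e^{\frac12 r^2}r^{\frac{d-\lambda(b)}{2}}u_b(r)-c(b)r^{\frac{d-\lambda(b)}{2}}\mathfrak{U}(r^2;\alpha,\beta)\right|\le C_a|c(b)|^{2p+1},$$ where $\alpha,\beta$ are evaluated at $\lambda=\lambda(b)$, and $c(b)\sim A_p b^{-1}$ as $b\to\infty$ for some constant $A_p>0$.
   Context: Notation: $f(b)\sim g(b)$ means $\lim_{b\to\infty} f(b)/g(b)=1$. The algebraic (Aubin--Talenti) soliton is $U_b(r)=\dfrac{b}{(1+\alpha_p b^{2p}r^2)^{1/p}}$ with $\alpha_p=\dfrac{p^2}{4(1+p)}$; it satisfies $-\Delta U_b=U_b^{2p+1}$ and $U_b(0)=b$. The parameters are $\alpha=\frac{p+1}{2p}-\frac{\lambda}{4}$ and $\beta=1+\frac1p$. $\mathfrak{U}(z;\alpha,\beta)$ denotes the Tricomi confluent hypergeometric function, i.e. the solution of Kummer's equation $zu''+(\beta-z)u'-\alpha u=0$ with $\mathfrak{U}(z;\alpha,\beta)\sim z^{-\alpha}(1+O(z^{-1}))$ as $z\to+\infty$. The quantity $c(b)$ is defined by $c(b)=\lim_{r\to\infty}u_b(r)e^{\frac12 r^2}r^{\frac{d-\lambda(b)}{2}}$. $\Gamma$ is the Gamma function. *)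

theory Defs
  imports "HOL-Analysis.Analysis" "HOL-Library.Landau_Symbols"
begin

definition crit_p :: "nat \<Rightarrow> real" where
  "crit_p d = 2 / (real d - 2)"

text \<open>Radial ground state of (-Delta + |x|^2) u - |u|^(2p) u = lambda u in R^d,
  written in the radial variable r = |x|: u is C^2 on [0,inf), regular at the origin,
  solves the radial ODE for r > 0, u(0) = b, u' < 0 for r > 0, u -> 0 at infinity.\<close>
definition radial_ground_state :: "nat \<Rightarrow> real \<Rightarrow> real \<Rightarrow> (real \<Rightarrow> real) \<Rightarrow> bool" where
  "radial_ground_state d lam b u \<longleftrightarrow>
     (\<exists>u' u''.
        (\<forall>r\<ge>0. (u has_real_derivative u' r) (at r within {0..}) \<and>
                 (u' has_real_derivative u'' r) (at r within {0..})) \<and>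
        continuous_on {0..} u'' \<and> u' 0 = 0 \<and>
        (\<forall>r>0. - u'' r - (real d - 1) / r * u' r + r\<^sup>2 * u r
                 - \<bar>u r\<bar> powr (2 * crit_p d) * u r = lam * u r) \<and>
        u 0 = b \<and> (\<forall>r>0. u' r < 0) \<and> (u \<longlongrightarrow> 0) at_top)"

text \<open>Tricomi confluent hypergeometric function U(z; a, bb): the solution of Kummer's
  equation z u'' + (bb - z) u' - a u = 0 on z > 0 with u(z) = z^(-a) (1 + O(1/z)) as
  z -> +inf (normalised to 0 for z <= 0, where it is not used).\<close>
definition tricomi_U :: "real \<Rightarrow> real \<Rightarrow> real \<Rightarrow> real" where
  "tricomi_U a bb = (THE u.
     (\<forall>z\<le>0. u z = 0) \<and>
     (\<exists>u' u''. \<forall>z>0. (u has_real_derivative u' z) (at z) \<and>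
                     (u' has_real_derivative u'' z) (at z) \<and>
                     z * u'' z + (bb - z) * u' z - a * u z = 0) \<and>
     (\<lambda>z. u z * z powr a - 1) \<in> O[at_top](\<lambda>z. 1 / z))"

definition alpha_p :: "real \<Rightarrow> real" where
  "alpha_p p = p\<^sup>2 / (4 * (1 + p))"

definition aubin_talenti :: "real \<Rightarrow> real \<Rightarrow> real \<Rightarrow> real" where
  "aubin_talenti p b r = b / (1 + alpha_p p * b powr (2 * p) * r\<^sup>2) powr (1 / p)"

definition kummer_alpha :: "real \<Rightarrow> real \<Rightarrow> real" where
  "kummer_alpha p lam = (p + 1) / (2 * p) - lam / 4"

definition kummer_beta :: "real \<Rightarrow> real" where
  "kummer_beta p = 1 + 1 / p"

definition lam_rate :: "real \<Rightarrow> real \<Rightarrow> real" where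
  "lam_rate p b =
     (if 1/2 < p then b powr (- 2 * (1 - p))
      else if p = 1/2 then ln b / b
      else b powr (- 2 * p))"

definition const_C :: "real \<Rightarrow> real" where
  "const_C p =
     (if 1/2 < p then
        - (Gamma ((p + 1) / (2 * p)) * Gamma (- 1 / p) * Gamma (2 / p)) /
          ((1 + p) * Gamma ((p - 1) / (2 * p)) * Gamma (1 / p) * Gamma (1 / p - 1)
             * Gamma (1 / p + 1))
        * (4 * (1 + p) / p\<^sup>2) powr (1 / p)
      else if p = 1/2 then 144
      else 8 * (1 + p)\<^sup>2 / (p\<^sup>2 * (1 - 2 * p)))"

definition tail_const :: "nat \<Rightarrow> real \<Rightarrow> (real \<Rightarrow> real) \<Rightarrow> real" where
  "tail_const d lam u = Lim at_top (\<lambda>r. u r * exp (r\<^sup>2 / 2) * r powr ((real d - lam) / 2))"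

end

theory Submission
  imports Defs "HOL-Real_Asymp.Real_Asymp"
begin

text \<open>The Pohozaev identity reads \<open>l * (LINT r. r ^ (d - 1) * (u r)\<^sup>2) = 2 * (LINT r. r ^ (d + 1) * (u r)\<^sup>2)\<close>.
  It is the integral of the derivative of a Pohozaev functional, whose pointwise lower bound makes
  \<open>u powr (- p)\<close> grow almost quadratically; this bounds \<open>u\<close> on \<open>[0, 1]\<close> by a multiple of the
  Aubin--Talenti soliton, uniformly in \<open>b\<close>, and a Gronwall argument then controls the difference to the
  soliton. Outside, the quotient of \<open>u\<close> by the decaying solution \<open>exp (- r\<^sup>2 / 2) * tricomi_U \<alpha> \<beta> (r\<^sup>2)\<close>
  of the linear equation increases to \<open>c b\<close>, with a gap bounded by the nonlinearity.
  The asymptotics of \<open>l\<close> come from passing to the limit in the Pohozaev identity: the second moment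
  concentrates on the soliton for \<open>d \<ge> 7\<close>, on the logarithmically many intermediate scales for \<open>d = 6\<close>,
  and on \<open>r\<close> of order \<open>1\<close> for \<open>d = 5\<close>, where the moment of the linear solution follows from
  boundary terms and a Beta integral.\<close>

section \<open>Integrals over the half line\<close>

text \<open>Only some \<open>lam b\<close> is given for each \<open>b\<close>; a priori nothing but
  \<open>0 < l < d\<close> is known, from the sign of the Pohozaev functional and from testing
  against the Gaussian. The bound by the soliton survives this ignorance because the critical
  relation \<open>p * d = 2 * p + 2\<close> makes \<open>l\<close> cancel exactly in the
  differential inequality for \<open>u powr (- p)\<close>. The linear solution depends on
  \<open>l\<close> through its Kummer parameters, so \<open>lam\<close> is first shown to tend to 0,
  without a rate, before any constant is identified. The amplitude \<open>c b\<close> is then read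
  off at radii \<open>b powr (- q)\<close> with \<open>p * (1 - p) < q < p\<close>, where the
  soliton is still accurate relative to its tail and the linear solution already is. The three
  regimes come from integrability: \<open>p = 2 / (d - 2)\<close> takes the values
  \<open>2 / 3\<close>, \<open>1 / 2\<close> and smaller ones. As the soliton decays like
  \<open>r powr (- (d - 2))\<close>, the integral of \<open>r ^ (d + 1)\<close> times its square
  converges for \<open>d \<ge> 7\<close>, diverges logarithmically for \<open>d = 6\<close> and
  linearly for \<open>d = 5\<close>.\<close>

lemma set_dominated_convergence_seq:
  fixes f :: "nat \<Rightarrow> real \<Rightarrow> real" and g w :: "real \<Rightarrow> real"
  assumes A: "A \<in> sets lborel"
    and f: "\<And>n. set_borel_measurable lborel A (f n)" and g: "set_borel_measurable lborel A g"
    and w: "set_integrable lborel A w"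
    and bnd: "\<And>n x. x \<in> A \<Longrightarrow> \<bar>f n x\<bar> \<le> w x"
    and lim: "\<And>x. x \<in> A \<Longrightarrow> (\<lambda>n. f n x) \<longlonglongrightarrow> g x"
  shows "(\<lambda>n. LINT x:A|lborel. f n x) \<longlonglongrightarrow> (LINT x:A|lborel. g x)"
proof -
  show ?thesis
    unfolding set_lebesgue_integral_def
  proof (rule integral_dominated_convergence[where w="\<lambda>x. indicator A x *\<^sub>R w x"])
    show "integrable lborel (\<lambda>x. indicator A x *\<^sub>R w x)" using w by (simp add: set_integrable_def)
    show "AE x in lborel. norm (indicat_real A x *\<^sub>R f n x) \<le> indicat_real A x *\<^sub>R w x" for n
      using bnd by (auto simp: indicator_def)
    show "AE x in lborel. (\<lambda>n. indicat_real A x *\<^sub>R f n x) \<longlonglongrightarrow> indicat_real A x *\<^sub>R g x"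
      using lim by (auto simp: indicator_def)
  qed (use f g in \<open>auto simp: set_borel_measurable_def\<close>)
qed

lemma set_dominated_convergence_at_top:
  fixes f :: "real \<Rightarrow> real \<Rightarrow> real" and g w :: "real \<Rightarrow> real"
  assumes A: "A \<in> sets lborel"
    and f: "\<forall>\<^sub>F b in at_top. set_borel_measurable lborel A (f b)" and g: "set_borel_measurable lborel A g"
    and w: "set_integrable lborel A w"
    and bnd: "\<forall>\<^sub>F b in at_top. \<forall>x\<in>A. \<bar>f b x\<bar> \<le> w x"
    and lim: "\<And>x. x \<in> A \<Longrightarrow> ((\<lambda>b. f b x) \<longlongrightarrow> g x) at_top"
  shows "((\<lambda>b. LINT x:A|lborel. f b x) \<longlongrightarrow> (LINT x:A|lborel. g x)) at_top"
proof (rule tendsto_at_topI_sequentially)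
  fix X :: "nat \<Rightarrow> real" assume X: "filterlim X at_top sequentially"
  have "\<forall>\<^sub>F b in at_top. set_borel_measurable lborel A (f b) \<and> (\<forall>x\<in>A. \<bar>f b x\<bar> \<le> w x)"
    using f bnd by eventually_elim auto
  then have "\<forall>\<^sub>F n in sequentially. set_borel_measurable lborel A (f (X n)) \<and> (\<forall>x\<in>A. \<bar>f (X n) x\<bar> \<le> w x)"
    using X by (auto simp: filterlim_iff)
  then obtain N where N: "\<And>n. n \<ge> N \<Longrightarrow> set_borel_measurable lborel A (f (X n)) \<and> (\<forall>x\<in>A. \<bar>f (X n) x\<bar> \<le> w x)"
    by (auto simp: eventually_sequentially)
  \<comment> \<open>Measurability and domination hold only eventually, while the sequential theorem
    wants them for every index; the shift by \<open>N\<close> repairs this and leaves the limit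
    unchanged.\<close>
  have X': "filterlim (\<lambda>n. X (n + N)) at_top sequentially"
    by (rule filterlim_compose[OF X]) (auto intro: filterlim_add_const_nat_at_top)
  have "(\<lambda>n. LINT x:A|lborel. f (X (n + N)) x) \<longlonglongrightarrow> (LINT x:A|lborel. g x)"
  proof (rule set_dominated_convergence_seq[OF A _ g w])
    fix x assume "x \<in> A"
    show "(\<lambda>n. f (X (n + N)) x) \<longlonglongrightarrow> g x"
      by (rule filterlim_compose[OF lim[OF \<open>x \<in> A\<close>] X'])
  qed (use N in auto)
  then show "(\<lambda>n. LINT x:A|lborel. f (X n) x) \<longlonglongrightarrow> (LINT x:A|lborel. g x)"
    by (rule LIMSEQ_offset)
qed

lemma einterval_0_PInfty: "einterval 0 \<infinity> = {0<..}"
  by (auto simp: einterval_def zero_ereal_def)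

text \<open>For a nonnegative integrand, finite limits of a primitive at both ends already yield
  integrability, so moments are computed by exhibiting a primitive.\<close>

lemma FTC_Ioi_nonneg:
  fixes F f :: "real \<Rightarrow> real"
  assumes F: "\<And>x. x > 0 \<Longrightarrow> (F has_real_derivative f x) (at x)"
    and f: "\<And>x. x > 0 \<Longrightarrow> isCont f x" and nn: "\<And>x. x > 0 \<Longrightarrow> 0 \<le> f x"
    and A: "(F \<longlongrightarrow> A) (at_right 0)" and B: "(F \<longlongrightarrow> B) at_top"
  shows "set_integrable lborel {0<..} f" and "(LINT x:{0<..}|lborel. f x) = B - A"
proof -
  have AB: "((F \<circ> real_of_ereal) \<longlongrightarrow> A) (at_right (ereal 0))" "((F \<circ> real_of_ereal) \<longlongrightarrow> B) (at_left \<infinity>)"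
    using A B by (simp_all only: ereal_tendsto_simps)
  show "set_integrable lborel {0<..} f" "(LINT x:{0<..}|lborel. f x) = B - A"
    using interval_integral_FTC_nonneg[OF _ F f _ AB] nn
    by (auto simp: einterval_0_PInfty zero_ereal_def[symmetric] interval_lebesgue_integral_def)
qed

text \<open>For integrands that change sign, integrability has to be supplied. The later identities
  apply this to total derivatives whose primitive vanishes at both ends.\<close>

lemma FTC_Ioi:
  fixes F f :: "real \<Rightarrow> real"
  assumes F: "\<And>x. x > 0 \<Longrightarrow> (F has_real_derivative f x) (at x)"
    and f: "\<And>x. x > 0 \<Longrightarrow> isCont f x" and int: "set_integrable lborel {0<..} f"
    and A: "(F \<longlongrightarrow> A) (at_right 0)" and B: "(F \<longlongrightarrow> B) at_top"
  shows "(LINT x:{0<..}|lborel. f x) = B - A"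
proof -
  have AB: "((F \<circ> real_of_ereal) \<longlongrightarrow> A) (at_right (ereal 0))" "((F \<circ> real_of_ereal) \<longlongrightarrow> B) (at_left \<infinity>)"
    using A B by (simp_all only: ereal_tendsto_simps)
  show ?thesis
    using interval_integral_FTC_integrable[OF _ _ f _ AB] F int
    by (auto simp: einterval_0_PInfty zero_ereal_def[symmetric] interval_lebesgue_integral_def
        has_real_derivative_iff_has_vector_derivative)
qed

lemma set_borel_measurable_Ioi:
  fixes f :: "real \<Rightarrow> real"
  assumes "continuous_on {0<..} f"
  shows "set_borel_measurable lborel {0<..} f"
  using assms set_measurable_continuous_on[of "{0<..}" f]
  by (simp add: set_borel_measurable_def borel_measurable_continuous_on_indicator)

lemma Gamma_integrand_integrable:
  fixes a c :: real
  assumes "a > 0" "c > 0"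
  shows "set_integrable lborel {0<..} (\<lambda>t. exp (- (c * t)) * t powr (a - 1))"
proof -
  have "(\<lambda>t. complex_of_real t powr (of_real a - 1) / of_real (exp (c * t))) absolutely_integrable_on {0<..}"
    using absolutely_integrable_Gamma_integral[of "of_real a" c] assms by simp
  then have "(\<lambda>t. norm (complex_of_real t powr (of_real a - 1) / of_real (exp (c * t)))) absolutely_integrable_on {0<..}"
    by (rule set_integrable_norm)
  then have "(\<lambda>t. exp (- (c * t)) * t powr (a - 1)) absolutely_integrable_on {0<..}"
    by (rule set_integrable_cong[THEN iffD1, rotated -1])
       (auto simp: norm_divide norm_powr_real_powr exp_minus field_simps)
  \<comment> \<open>Absolute integrability refers to Lebesgue measure; Borel measurability of the
    integrand brings the statement down to \<open>lborel\<close>.\<close>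
  moreover have "set_borel_measurable lborel {0<..} (\<lambda>t. exp (- (c * t)) * t powr (a - 1))"
    by (rule set_borel_measurable_Ioi) (auto intro!: continuous_intros)
  ultimately show ?thesis
    by (auto simp: set_integrable_def set_borel_measurable_def integrable_completion)
qed

lemma Gamma_eq_set_integral:
  fixes a :: real
  assumes "a > 0"
  shows "(LINT t:{0<..}|lborel. exp (- t) * t powr (a - 1)) = Gamma a"
proof -
  have i: "set_integrable lborel {0<..} (\<lambda>t. exp (- t) * t powr (a - 1))"
    using Gamma_integrand_integrable[OF assms, of 1] by simp
  have "(LINT t:{0<..}|lborel. exp (- t) * t powr (a - 1)) = integral {0<..} (\<lambda>t. exp (- t) * t powr (a - 1))"
    using set_borel_integral_eq_integral(2)[OF i] .
  also have "((\<lambda>t. exp (- t) * t powr (a - 1)) has_integral Gamma a) {0<..}"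
  proof -
    have "((\<lambda>t. exp (- t) * t powr (a - 1)) has_integral Gamma a) {0..}"
      using Gamma_integral_real[OF assms] by (simp add: exp_minus field_simps)
    then show ?thesis
      by (rule has_integral_spike_set_eq[THEN iffD1, rotated 2])
         (auto intro: negligible_subset[of "{0}"])
  qed
  then have "integral {0<..} (\<lambda>t. exp (- t) * t powr (a - 1)) = Gamma a"
    by (rule integral_unique)
  finally show ?thesis .
qed

text \<open>Lets a factor \<open>(1 + t) powr g\<close>, with \<open>g\<close> of either sign, be
  absorbed by part of an exponential decay. The constant comes from \<open>ln x \<le> x - 1\<close>
  at \<open>x = \<delta> * (1 + t)\<close>, with \<open>\<delta>\<close> small enough that
  \<open>\<bar>g\<bar> * \<delta> \<le> c\<close>.\<close>

lemma powr_le_exp_bound: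
  fixes g c :: real
  assumes "c > 0"
  obtains C where "C > 0" "\<And>t. t \<ge> 0 \<Longrightarrow> (1 + t) powr g \<le> C * exp (c * t)"
proof -
  define \<delta> where "\<delta> = c / (\<bar>g\<bar> + 1)"
  have \<delta>: "\<delta> > 0" "\<bar>g\<bar> * \<delta> \<le> c" using assms by (auto simp: \<delta>_def field_simps)
  define C where "C = exp (c - \<bar>g\<bar> * (1 + ln \<delta>))"
  show thesis
  proof
    show "C > 0" by (simp add: C_def)
    fix t :: real assume t: "t \<ge> 0"
    have "ln (\<delta> * (1 + t)) \<le> \<delta> * (1 + t) - 1" using \<delta> t by (intro ln_le_minus_one) auto
    then have l: "ln (1 + t) \<le> \<delta> * (1 + t) - 1 - ln \<delta>" using \<delta> t by (simp add: ln_mult)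
    have "(1 + t) powr g \<le> (1 + t) powr \<bar>g\<bar>" using t by (intro powr_mono) auto
    also have "\<dots> = exp (\<bar>g\<bar> * ln (1 + t))" using t by (simp add: powr_def)
    also have "\<dots> \<le> exp (\<bar>g\<bar> * (\<delta> * (1 + t) - 1 - ln \<delta>))"
      using l by (auto intro: mult_left_mono)
    also have "\<bar>g\<bar> * (\<delta> * (1 + t) - 1 - ln \<delta>) = (\<bar>g\<bar> * \<delta>) * (1 + t) - \<bar>g\<bar> * (1 + ln \<delta>)"
      by (simp add: algebra_simps)
    also have "\<dots> \<le> c * (1 + t) - \<bar>g\<bar> * (1 + ln \<delta>)"
      using \<delta> t by (intro diff_right_mono mult_right_mono) auto
    finally show "(1 + t) powr g \<le> C * exp (c * t)"
      by (simp add: C_def exp_add[symmetric] algebra_simps)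
  qed
qed

section \<open>The Tricomi function\<close>

text \<open>The Laplace integral is \<open>Gamma a\<close> times the Tricomi function with parameters
  \<open>a\<close> and \<open>a + g + 1\<close>.\<close>

definition kummer_int :: "real \<Rightarrow> real \<Rightarrow> real \<Rightarrow> real" where
  "kummer_int a g z = (LINT t:{0<..}|lborel. exp (- (z * t)) * t powr (a - 1) * (1 + t) powr g)"

lemma kummer_integrand_measurable:
  fixes z a g :: real
  shows "set_borel_measurable lborel {0<..} (\<lambda>t. exp (- (z * t)) * t powr (a - 1) * (1 + t) powr g)"
  by (rule set_borel_measurable_Ioi) (auto intro!: continuous_intros)

lemma kummer_integrand_integrable:
  fixes z a g :: real
  assumes "a > 0" "z > 0"
  shows "set_integrable lborel {0<..} (\<lambda>t. exp (- (z * t)) * t powr (a - 1) * (1 + t) powr g)"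
proof -
  obtain C where C: "C > 0" "\<And>t. t \<ge> 0 \<Longrightarrow> (1 + t) powr g \<le> C * exp (z / 2 * t)"
    using powr_le_exp_bound[of "z / 2" g] assms by auto
  have i: "set_integrable lborel {0<..} (\<lambda>t. C * (exp (- (z / 2 * t)) * t powr (a - 1)))"
    using Gamma_integrand_integrable[of a "z / 2"] assms by auto
  show ?thesis
  proof (rule set_integrable_bound[OF i kummer_integrand_measurable], rule AE_I2, rule impI)
    fix t :: real assume "t \<in> {0<..}"
    then have t: "t > 0" by simp
    have "exp (- (z * t)) * t powr (a - 1) * (1 + t) powr g
        \<le> exp (- (z * t)) * t powr (a - 1) * (C * exp (z / 2 * t))"
      using C(2)[of t] t by (intro mult_left_mono) auto
    also have "\<dots> = C * (exp (- (z * t) + z / 2 * t) * t powr (a - 1))"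
      unfolding exp_add by simp
    also have "- (z * t) + z / 2 * t = - (z / 2 * t)" by simp
    finally show "norm (exp (- (z * t)) * t powr (a - 1) * (1 + t) powr g)
        \<le> norm (C * (exp (- (z / 2 * t)) * t powr (a - 1)))"
      using C(1) by simp
  qed
qed

lemma abs_exp_diff_le: "\<bar>exp x - exp y\<bar> \<le> \<bar>x - y\<bar> * exp (max x y)" for x y :: real
proof -
  have *: "exp x - exp y \<le> (x - y) * exp x" for x y :: real
  proof -
    have "1 + (y - x) \<le> exp (y - x)" by (rule exp_ge_add_one_self)
    then have "exp x * (1 + (y - x)) \<le> exp x * exp (y - x)" by (intro mult_left_mono) auto
    then show ?thesis by (simp add: exp_diff algebra_simps)
  qed
  show ?thesis
  proof (cases "x \<ge> y")
    case True then show ?thesis using *[of x y] by (simp add: max_def)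
  next
    case False then show ?thesis using *[of y x] by (simp add: max_def)
  qed
qed

text \<open>Differentiation under the integral sign: the factor \<open>- t\<close> raises
  \<open>a\<close> to \<open>a + 1\<close> and keeps \<open>g\<close>. Increments below
  \<open>z / 2\<close> leave the decay \<open>exp (- (z / 2 * t))\<close> for the dominating
  function.\<close>

lemma kummer_int_deriv:
  assumes a: "a > 0" and z: "z > 0"
  shows "(kummer_int a g has_real_derivative - kummer_int (a + 1) g z) (at z)"
  unfolding DERIV_def tendsto_at_iff_sequentially
proof (intro allI impI)
  fix X :: "nat \<Rightarrow> real" assume X0: "\<forall>i. X i \<in> UNIV - {0}" and X: "X \<longlonglongrightarrow> 0"
  let ?m = "\<lambda>t. t powr (a - 1) * (1 + t) powr g"
  from X z have "\<forall>\<^sub>F i in sequentially. \<bar>X i\<bar> < z / 2"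
    by (auto dest!: tendstoD[of _ _ _ "z/2"] simp: dist_real_def)
  then obtain N where N: "\<And>i. i \<ge> N \<Longrightarrow> \<bar>X i\<bar> < z / 2" by (auto simp: eventually_sequentially)
  define Y where "Y = (\<lambda>i. X (i + N))"
  have Y0: "Y i \<noteq> 0" "\<bar>Y i\<bar> < z / 2" for i using X0 N by (auto simp: Y_def)
  have Y: "Y \<longlonglongrightarrow> 0" unfolding Y_def using X by (rule LIMSEQ_ignore_initial_segment)
  have "(\<lambda>i. LINT t:{0<..}|lborel. (exp (- ((z + Y i) * t)) - exp (- (z * t))) / Y i * ?m t)
      \<longlonglongrightarrow> (LINT t:{0<..}|lborel. - t * exp (- (z * t)) * ?m t)"
  proof (rule set_dominated_convergence_seq[where w="\<lambda>t. t * exp (- (z / 2 * t)) * ?m t"])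
    have "set_integrable lborel {0<..} (\<lambda>t. exp (- (z/2 * t)) * t powr ((a + 1) - 1) * (1 + t) powr g)"
      using a z by (intro kummer_integrand_integrable) auto
    then show "set_integrable lborel {0<..} (\<lambda>t. t * exp (- (z / 2 * t)) * ?m t)"
      by (rule set_integrable_cong[THEN iffD1, rotated -1]) (auto simp: powr_diff)
    fix i :: nat and t :: real assume "t \<in> {0<..}"
    then have t: "t > 0" by simp
    have "\<bar>exp (- ((z + Y i) * t)) - exp (- (z * t))\<bar> \<le> \<bar>- ((z + Y i) * t) - - (z * t)\<bar> * exp (max (- ((z + Y i) * t)) (- (z * t)))"
      by (rule abs_exp_diff_le)
    also have "\<bar>- ((z + Y i) * t) - - (z * t)\<bar> = \<bar>Y i\<bar> * t" using t by (simp add: algebra_simps abs_mult)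
    also have "\<bar>Y i\<bar> * t * exp (max (- ((z + Y i) * t)) (- (z * t))) \<le> \<bar>Y i\<bar> * t * exp (- (z / 2 * t))"
    proof -
      have "- ((z + Y i) * t) \<le> - (z / 2 * t)" "- (z * t) \<le> - (z / 2 * t)"
        using Y0[of i] z t by (auto intro!: mult_right_mono)
      then show ?thesis using t by (intro mult_left_mono) auto
    qed
    finally have "\<bar>(exp (- ((z + Y i) * t)) - exp (- (z * t))) / Y i\<bar> \<le> t * exp (- (z / 2 * t))"
      using Y0(1)[of i] by (simp add: field_simps)
    then show "\<bar>(exp (- ((z + Y i) * t)) - exp (- (z * t))) / Y i * ?m t\<bar> \<le> t * exp (- (z / 2 * t)) * ?m t"
      unfolding abs_mult using t by (intro mult_mono) auto
  next
    fix t :: real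
    have "((\<lambda>h. exp (- ((z + h) * t))) has_real_derivative - t * exp (- (z * t))) (at 0)"
      by (auto intro!: derivative_eq_intros)
    then have "(\<lambda>i. (exp (- ((z + Y i) * t)) - exp (- (z * t))) / Y i) \<longlonglongrightarrow> - t * exp (- (z * t))"
      unfolding has_field_derivative_iff tendsto_at_iff_sequentially using Y Y0 by (auto simp: o_def)
    then show "(\<lambda>i. (exp (- ((z + Y i) * t)) - exp (- (z * t))) / Y i * ?m t) \<longlonglongrightarrow> - t * exp (- (z * t)) * ?m t"
      by (rule tendsto_mult_right)
  qed (use Y0(1) in \<open>auto intro!: set_borel_measurable_Ioi continuous_intros\<close>)
  moreover have "(LINT t:{0<..}|lborel. (exp (- ((z + Y i) * t)) - exp (- (z * t))) / Y i * ?m t)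
     = (kummer_int a g (z + Y i) - kummer_int a g z) / Y i" for i
  proof -
    have "z + Y i > 0" using Y0[of i] z by auto
    then have "(kummer_int a g (z + Y i) - kummer_int a g z)
      = (LINT t:{0<..}|lborel. exp (- ((z + Y i) * t)) * t powr (a - 1) * (1 + t) powr g
             - exp (- (z * t)) * t powr (a - 1) * (1 + t) powr g)"
      unfolding kummer_int_def using a z
      by (intro set_integral_diff(2)[symmetric] kummer_integrand_integrable) auto
    then have "(kummer_int a g (z + Y i) - kummer_int a g z) / Y i
      = (LINT t:{0<..}|lborel. (exp (- ((z + Y i) * t)) * t powr (a - 1) * (1 + t) powr g
             - exp (- (z * t)) * t powr (a - 1) * (1 + t) powr g) / Y i)" by simp
    also have "\<dots> = (LINT t:{0<..}|lborel. (exp (- ((z + Y i) * t)) - exp (- (z * t))) / Y i * ?m t)"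
      by (intro set_lebesgue_integral_cong) (auto simp: field_simps)
    finally show ?thesis by (rule sym)
  qed
  moreover have "(LINT t:{0<..}|lborel. - t * exp (- (z * t)) * ?m t) = - kummer_int (a + 1) g z"
  proof -
    have "(LINT t:{0<..}|lborel. - t * exp (- (z * t)) * ?m t)
      = (LINT t:{0<..}|lborel. - 1 * (exp (- (z * t)) * t powr ((a + 1) - 1) * (1 + t) powr g))"
      by (intro set_lebesgue_integral_cong) (auto simp: powr_diff)
    then show ?thesis unfolding kummer_int_def set_integral_mult_right by simp
  qed
  ultimately have "(\<lambda>i. (kummer_int a g (z + X (i + N)) - kummer_int a g z) / X (i + N)) \<longlonglongrightarrow> - kummer_int (a + 1) g z"
    by (simp only: Y_def)
  then have "(\<lambda>i. (kummer_int a g (z + X i) - kummer_int a g z) / X i) \<longlonglongrightarrow> - kummer_int (a + 1) g z"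
    by (rule LIMSEQ_offset)
  then show "((\<lambda>h. (kummer_int a g (z + h) - kummer_int a g z) / h) \<circ> X) \<longlonglongrightarrow> - kummer_int (a + 1) g z"
    by (simp add: o_def)
qed

lemma set_integral_Ioi_scale:
  fixes f :: "real \<Rightarrow> real"
  assumes "z > 0"
  shows "(LINT s:{0<..}|lborel. f s) = z * (LINT t:{0<..}|lborel. f (z * t))"
proof -
  have "(LINT s:{0<..}|lborel. f s) = \<bar>z\<bar> *\<^sub>R (\<integral>x. indicator {0<..} (0 + z * x) *\<^sub>R f (0 + z * x) \<partial>lborel)"
    unfolding set_lebesgue_integral_def using assms by (subst lborel_integral_real_affine[where c=z and t=0]) auto
  also have "\<dots> = z * (LINT t:{0<..}|lborel. f (z * t))"
    unfolding set_lebesgue_integral_def using assms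
    by (auto intro!: Bochner_Integration.integral_cong simp: indicator_def zero_less_mult_iff)
  finally show ?thesis .
qed

text \<open>The substitution \<open>s = z * t\<close> exposes the behaviour for large
  \<open>z\<close>, where \<open>(1 + s / z) powr g\<close> tends to 1.\<close>

lemma kummer_int_powr_left:
  assumes z: "z > 0"
  shows "z powr a * kummer_int a g z = (LINT s:{0<..}|lborel. exp (- s) * s powr (a - 1) * (1 + s / z) powr g)"
proof -
  have "(LINT s:{0<..}|lborel. exp (- s) * s powr (a - 1) * (1 + s / z) powr g)
      = z * (LINT t:{0<..}|lborel. exp (- (z * t)) * (z * t) powr (a - 1) * (1 + z * t / z) powr g)"
    by (rule set_integral_Ioi_scale[OF z])
  also have "(LINT t:{0<..}|lborel. exp (- (z * t)) * (z * t) powr (a - 1) * (1 + z * t / z) powr g)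
     = (LINT t:{0<..}|lborel. z powr (a - 1) * (exp (- (z * t)) * t powr (a - 1) * (1 + t) powr g))"
    using z by (intro set_lebesgue_integral_cong) (auto simp: powr_mult)
  also have "\<dots> = z powr (a - 1) * kummer_int a g z" unfolding kummer_int_def by simp
  finally show ?thesis using z by (simp add: powr_diff)
qed

text \<open>The variant for small \<open>z\<close>: here the integrand has a limit as
  \<open>z\<close> tends to 0, which identifies \<open>z powr (- (a + g))\<close> as the singularity
  at the origin.\<close>

lemma kummer_int_powr_left':
  assumes z: "z > 0"
  shows "z powr (a + g) * kummer_int a g z = (LINT s:{0<..}|lborel. exp (- s) * s powr (a - 1) * (s + z) powr g)"
proof -
  have "z powr (a + g) * kummer_int a g z
     = z powr g * (LINT s:{0<..}|lborel. exp (- s) * s powr (a - 1) * (1 + s / z) powr g)"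
    unfolding kummer_int_powr_left[OF z, symmetric] using z by (simp add: powr_add)
  also have "\<dots> = (LINT s:{0<..}|lborel. z powr g * (exp (- s) * s powr (a - 1) * (1 + s / z) powr g))" by simp
  also have "\<dots> = (LINT s:{0<..}|lborel. exp (- s) * s powr (a - 1) * (s + z) powr g)"
  proof (intro set_lebesgue_integral_cong allI impI)
    fix s :: real assume "s \<in> {0<..}"
    then have "s + z = z * (1 + s / z)" "0 \<le> 1 + s / z" using z by (auto simp: field_simps)
    then have "(s + z) powr g = z powr g * (1 + s / z) powr g" using z by (simp only: powr_mult)
    then show "z powr g * (exp (- s) * s powr (a - 1) * (1 + s / z) powr g) = exp (- s) * s powr (a - 1) * (s + z) powr g"
      by simp
  qed auto
  finally show ?thesis .
qed

lemma set_integral_pos_Ioi: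
  fixes f :: "real \<Rightarrow> real"
  assumes "set_integrable lborel {0<..} f" "\<And>x. x > 0 \<Longrightarrow> f x > 0"
  shows "(LINT x:{0<..}|lborel. f x) > 0"
proof -
  have "(LINT x:{0<..}|lborel. f x) \<ge> 0"
    unfolding set_lebesgue_integral_def using assms(2)
    by (intro Bochner_Integration.integral_nonneg) (auto simp: indicator_def less_imp_le)
  moreover have "(LINT x:{0<..}|lborel. f x) \<noteq> 0"
  proof
    assume "(LINT x:{0<..}|lborel. f x) = 0"
    then have "AE x in lborel. indicator {0<..} x *\<^sub>R f x = 0"
      using assms unfolding set_lebesgue_integral_def set_integrable_def
      by (subst (asm) integral_nonneg_eq_0_iff_AE) (auto simp: indicator_def less_imp_le)
    then have "AE x in lborel. x \<notin> {0<..<1::real}"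
      by eventually_elim (use assms(2) in \<open>force simp: indicator_def split: if_splits\<close>)
    then have "{0<..<1::real} \<in> null_sets lborel"
      by (subst AE_iff_null_sets) auto
    then have "emeasure lborel {0<..<1::real} = 0" by auto
    then show False by simp
  qed
  ultimately show ?thesis by simp
qed

lemma kummer_int_pos: "a > 0 \<Longrightarrow> z > 0 \<Longrightarrow> kummer_int a g z > 0"
  unfolding kummer_int_def by (rule set_integral_pos_Ioi[OF kummer_integrand_integrable]) auto

lemma kummer_int_antimono:
  assumes "a > 0" "0 < z" "z \<le> w"
  shows "kummer_int a g w \<le> kummer_int a g z"
  unfolding kummer_int_def using assms
  by (intro set_integral_mono kummer_integrand_integrable mult_right_mono) auto

text \<open>Up to sign the combination is the integral of the derivative of
  \<open>exp (- (z * t)) * t powr a * (1 + t) powr (g + 1)\<close>, which vanishes at both ends.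
  Together with \<open>kummer_int_deriv\<close> this is Kummer's equation with second parameter
  \<open>a + g + 1\<close>.\<close>

lemma kummer_int_ode:
  assumes a: "a > 0" and z: "z > 0"
  shows "z * kummer_int (a + 2) g z - (a + g + 1 - z) * kummer_int (a + 1) g z - a * kummer_int a g z = 0"
proof -
  let ?I = "\<lambda>a t. exp (- (z * t)) * t powr (a - 1) * (1 + t) powr g"
  let ?F = "\<lambda>t. exp (- (z * t)) * t powr a * (1 + t) powr (g + 1)"
  let ?f = "\<lambda>t. (a + g + 1 - z) * ?I (a + 1) t + a * ?I a t - z * ?I (a + 2) t"
  have i: "set_integrable lborel {0<..} (?I b)" if "b > 0" for b
    using that z by (rule kummer_integrand_integrable)
  have i1: "set_integrable lborel {0<..} (?I a)" "set_integrable lborel {0<..} (?I (a + 1))"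
      "set_integrable lborel {0<..} (?I (a + 2))" using a by (intro i; simp)+
  have int: "set_integrable lborel {0<..} ?f"
    using i1 by (intro set_integral_add(1) set_integral_diff(1) set_integrable_mult_right)
  have "(LINT t:{0<..}|lborel. ?f t) = 0 - 0"
  proof (rule FTC_Ioi[OF _ _ int])
    fix t :: real assume t: "t > 0"
    have e: "t powr (a + 1 - 1) = t * t powr (a - 1)" "t powr (a + 2 - 1) = t * t * t powr (a - 1)"
      "t powr a = t * t powr (a - 1)" "(1 + t) powr (g + 1) = (1 + t) * (1 + t) powr g"
      "t powr (a+1) = t * t * t powr (a - 1)"
      using t by (simp_all add: powr_diff powr_add powr_numeral power2_eq_square)
    have "(?F has_real_derivative ((- z * exp (- (z * t))) * t powr a * (1 + t) powr (g + 1)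
       + exp (- (z * t)) * (a * t powr (a - 1)) * (1 + t) powr (g + 1)
       + exp (- (z * t)) * t powr a * ((g + 1) * (1 + t) powr g))) (at t)"
    proof -
      have d1: "((\<lambda>t. exp (- (z * t))) has_real_derivative - z * exp (- (z * t))) (at t)"
        by (auto intro!: derivative_eq_intros)
      have d2: "((\<lambda>t. t powr a) has_real_derivative a * t powr (a - 1)) (at t)"
        by (rule has_real_derivative_powr[OF t])
      have d3: "((\<lambda>t. (1 + t) powr (g + 1)) has_real_derivative (g + 1) * (1 + t) powr g) (at t)"
        using t by (auto intro!: derivative_eq_intros DERIV_chain2[where f="\<lambda>z. z powr (g + 1)" and g="\<lambda>t. 1 + t", OF has_real_derivative_powr])
      show ?thesis
        by (rule DERIV_cong[OF DERIV_mult[OF DERIV_mult[OF d1 d2] d3]]) (simp add: algebra_simps)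
    qed
    also have "(- z * exp (- (z * t))) * t powr a * (1 + t) powr (g + 1)
       + exp (- (z * t)) * (a * t powr (a - 1)) * (1 + t) powr (g + 1)
       + exp (- (z * t)) * t powr a * ((g + 1) * (1 + t) powr g) = ?f t"
      unfolding e by (simp add: algebra_simps)
    finally show "(?F has_real_derivative ?f t) (at t)" .
    show "isCont ?f t" using t by (auto intro!: continuous_intros)
  next
    show "(?F \<longlongrightarrow> 0) (at_right 0)"
    proof -
      have "((\<lambda>t::real. t powr a) \<longlongrightarrow> 0) (at_right 0)"
        using a by real_asymp
      moreover have "((\<lambda>t. exp (- (z * t))) \<longlongrightarrow> exp (- (z * 0))) (at_right 0)"
        "((\<lambda>t. (1 + t) powr (g + 1)) \<longlongrightarrow> (1 + 0) powr (g + 1)) (at_right 0)"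
        by (intro tendsto_intros; simp)+
      ultimately have "(?F \<longlongrightarrow> exp (- (z * 0)) * 0 * (1 + 0) powr (g + 1)) (at_right 0)"
        by (intro tendsto_mult)
      then show ?thesis by simp
    qed
    show "(?F \<longlongrightarrow> 0) at_top" using z a by real_asymp
  qed
  moreover have "(LINT t:{0<..}|lborel. ?f t)
     = (a + g + 1 - z) * kummer_int (a + 1) g z + a * kummer_int a g z - z * kummer_int (a + 2) g z"
    unfolding kummer_int_def using i1
    by (subst set_integral_diff set_integral_add;
        (intro set_integral_add(1) set_integrable_mult_right)?; simp)+
  ultimately show ?thesis by simp
qed

text \<open>The two bounds behind the normalisation \<open>1 + O(1 / z)\<close> of the Tricomi
  function: for \<open>g \<ge> 0\<close> the factor \<open>(1 + s / z) powr g\<close> is at least 1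
  and exceeds 1 by at most \<open>g * s / z\<close> times an integrable weight.\<close>

lemma kummer_int_powr_ge_Gamma:
  assumes a: "a > 0" and z: "z > 0"  and g: "g \<ge> 0"
  shows "z powr a * kummer_int a g z \<ge> Gamma a"
    and "z \<ge> 1 \<Longrightarrow> z powr a * kummer_int a g z \<le> Gamma a + g * kummer_int (a + 1) g 1 / z"
proof -
  have i0: "set_integrable lborel {0<..} (\<lambda>s. exp (- s) * s powr (a - 1))"
    using Gamma_integrand_integrable[of a 1] a by simp
  have i1: "set_integrable lborel {0<..} (\<lambda>s. exp (- s) * s powr (a - 1) * (1 + s) powr g)"
    using kummer_integrand_integrable[of a 1 g] a by simp
  have i2: "set_integrable lborel {0<..} (\<lambda>s. exp (- s) * s powr (a + 1 - 1) * (1 + s) powr g)"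
    using kummer_integrand_integrable[of "a + 1" 1 g] a by simp
  have iz: "set_integrable lborel {0<..} (\<lambda>s. exp (- s) * s powr (a - 1) * (1 + s / z) powr g)"
  proof -
    define C where "C = max 1 (1 / z)"
    have C: "C \<ge> 1" "C \<ge> 1 / z" by (auto simp: C_def)
    have "set_integrable lborel {0<..} (\<lambda>s. C powr g * (exp (- s) * s powr (a - 1) * (1 + s) powr g))"
      using i1 by simp
    then show ?thesis
    proof (rule set_integrable_bound)
      show "set_borel_measurable lborel {0<..} (\<lambda>s. exp (- s) * s powr (a - 1) * (1 + s / z) powr g)"
        using z by (intro set_borel_measurable_Ioi continuous_intros)
          (auto simp: add_nonneg_eq_0_iff add_pos_pos)
      show "AE s in lborel. s \<in> {0<..} \<longrightarrow> norm (exp (- s) * s powr (a - 1) * (1 + s / z) powr g)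
           \<le> norm (C powr g * (exp (- s) * s powr (a - 1) * (1 + s) powr g))"
      proof (intro AE_I2 impI)
        fix s :: real assume "s \<in> {0<..}"
        then have s: "s > 0" by simp
        have "s * (1 / z) \<le> s * C" using C s by (intro mult_left_mono) auto
        then have "1 + s / z \<le> C * (1 + s)" using C by (simp add: algebra_simps)
        then have "(1 + s / z) powr g \<le> (C * (1 + s)) powr g" using g s z by (intro powr_mono2) auto
        also have "\<dots> = C powr g * (1 + s) powr g" using C s by (simp add: powr_mult)
        finally have "exp (- s) * s powr (a - 1) * (1 + s / z) powr g
           \<le> exp (- s) * s powr (a - 1) * (C powr g * (1 + s) powr g)"
          by (intro mult_left_mono) auto
        then show "norm (exp (- s) * s powr (a - 1) * (1 + s / z) powr g)
           \<le> norm (C powr g * (exp (- s) * s powr (a - 1) * (1 + s) powr g))"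
          by (simp add: mult_ac)
      qed
    qed
  qed
  show "z powr a * kummer_int a g z \<ge> Gamma a"
    unfolding kummer_int_powr_left[OF z] Gamma_eq_set_integral[OF a, symmetric]
  proof (rule set_integral_mono[OF i0 iz])
    fix s :: real assume "s \<in> {0<..}"
    then have "1 \<le> (1 + s / z) powr g" using g z by (intro ge_one_powr_ge_zero) auto
    then show "exp (- s) * s powr (a - 1) \<le> exp (- s) * s powr (a - 1) * (1 + s / z) powr g"
      using mult_left_mono[of 1 "(1 + s / z) powr g" "exp (- s) * s powr (a - 1)"] by simp
  qed
  assume z1: "z \<ge> 1"
  have "z powr a * kummer_int a g z \<le>
     (LINT s:{0<..}|lborel. exp (- s) * s powr (a - 1) + g / z * (exp (- s) * s powr (a + 1 - 1) * (1 + s) powr g))"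
    unfolding kummer_int_powr_left[OF z]
  proof (rule set_integral_mono[OF iz])
    show "set_integrable lborel {0<..} (\<lambda>s. exp (- s) * s powr (a - 1) + g / z * (exp (- s) * s powr (a + 1 - 1) * (1 + s) powr g))"
      using i0 i2 by (intro set_integral_add(1) set_integrable_mult_right)
    fix s :: real assume "s \<in> {0<..}"
    then have s: "s > 0" by simp
    define x where "x = s / z"
    have x: "x > 0" "x \<le> s" using s z z1 by (auto simp: x_def field_simps)
    \<comment> \<open>Bernoulli's inequality for the exponent \<open>- g\<close> yields
      \<open>(1 + x) powr g \<le> 1 + g * x * (1 + x) powr g\<close>; the power on the right is then
      estimated through \<open>x \<le> s\<close>, which uses \<open>z \<ge> 1\<close>.\<close>
    have "exp (- (g * ln (1 + x))) \<ge> 1 + - (g * ln (1 + x))" by (rule exp_ge_add_one_self)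
    moreover have "g * ln (1 + x) \<le> g * x" using g x ln_add_one_self_le_self[of x] by (intro mult_left_mono) auto
    ultimately have "1 - g * x \<le> (1 + x) powr (- g)" using x by (simp add: powr_def)
    then have "(1 + x) powr g * (1 - g * x) \<le> (1 + x) powr g * (1 + x) powr (- g)"
      by (intro mult_left_mono) auto
    also have "\<dots> = 1" using x by (simp add: powr_add[symmetric])
    finally have "(1 + x) powr g \<le> 1 + g * x * (1 + x) powr g" by (simp add: algebra_simps)
    also have "\<dots> \<le> 1 + g * x * (1 + s) powr g"
      using x g by (intro add_left_mono mult_left_mono powr_mono2) auto
    finally have "exp (- s) * s powr (a - 1) * (1 + x) powr g \<le> exp (- s) * s powr (a - 1) * (1 + g * x * (1 + s) powr g)"
      by (intro mult_left_mono) auto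
    also have "\<dots> = exp (- s) * s powr (a - 1) + g / z * (exp (- s) * (s * s powr (a - 1)) * (1 + s) powr g)"
      by (simp add: x_def algebra_simps)
    also have "s * s powr (a - 1) = s powr (a + 1 - 1)" using s by (simp add: powr_diff)
    finally show "exp (- s) * s powr (a - 1) * (1 + s / z) powr g \<le>
       exp (- s) * s powr (a - 1) + g / z * (exp (- s) * s powr (a + 1 - 1) * (1 + s) powr g)"
      by (simp add: x_def)
  qed
  also have "\<dots> = Gamma a + g / z * kummer_int (a + 1) g 1"
    unfolding Gamma_eq_set_integral[OF a, symmetric] kummer_int_def
    by (subst set_integral_add(2)[OF i0]) (use i2 in \<open>auto intro!: set_integrable_mult_right\<close>)
  finally show "z powr a * kummer_int a g z \<le> Gamma a + g * kummer_int (a + 1) g 1 / z" by simp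
qed

lemma kummer_int_powr_tendsto_Gamma:
  assumes a: "a > 0" and g: "g \<ge> 0"
  shows "((\<lambda>z. z powr a * kummer_int a g z) \<longlongrightarrow> Gamma a) at_top"
proof (rule tendsto_sandwich)
  show "\<forall>\<^sub>F z in at_top. Gamma a \<le> z powr a * kummer_int a g z"
    using eventually_gt_at_top[of 0] by eventually_elim (rule kummer_int_powr_ge_Gamma(1)[OF a _ g])
  show "\<forall>\<^sub>F z in at_top. z powr a * kummer_int a g z \<le> Gamma a + g * kummer_int (a + 1) g 1 / z"
    using eventually_ge_at_top[of 1] by eventually_elim (rule kummer_int_powr_ge_Gamma(2)[OF a _ g], auto)
  show "((\<lambda>z. Gamma a + g * kummer_int (a + 1) g 1 / z) \<longlongrightarrow> Gamma a) at_top" by real_asymp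
qed simp

section \<open>Uniqueness of the recessive solution and identification of the Tricomi
  function\<close>

lemma DERIV_zero_Ioi_const:
  fixes f :: "real \<Rightarrow> real"
  assumes "\<And>x. x > 0 \<Longrightarrow> (f has_real_derivative 0) (at x)" "x > 0" "y > 0"
  shows "f x = f y"
proof -
  have "\<exists>c. \<forall>x\<in>{0<..}. f x = c"
    by (rule has_field_derivative_zero_constant)
       (auto intro: has_field_derivative_at_within assms(1))
  then show ?thesis using assms(2,3) by auto
qed

text \<open>Multiplied by the weight \<open>z powr b * exp (- z)\<close>, the Wronskian of
  \<open>v\<close> and \<open>U\<close> is a constant \<open>C\<close>, so \<open>v / U\<close> has
  derivative \<open>C * (z powr (- b) * exp z / (U z)\<^sup>2)\<close>. This grows exponentially
  unless \<open>C = 0\<close>, whereas \<open>v / U\<close> tends to 1; hence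
  \<open>v = U\<close>.\<close>

lemma kummer_solution_unique:
  fixes v v' v'' :: "real \<Rightarrow> real"
  assumes a: "a > 0" and g: "g \<ge> 0"
    and v: "\<And>z. z > 0 \<Longrightarrow> (v has_real_derivative v' z) (at z)"
           "\<And>z. z > 0 \<Longrightarrow> (v' has_real_derivative v'' z) (at z)"
           "\<And>z. z > 0 \<Longrightarrow> z * v'' z + (a + g + 1 - z) * v' z - a * v z = 0"
    and lim: "((\<lambda>z. v z * z powr a) \<longlongrightarrow> 1) at_top"
    and z: "z > 0"
  shows "v z = kummer_int a g z / Gamma a"
proof -
  define U where "U = (\<lambda>z. kummer_int a g z / Gamma a)"
  define U' where "U' = (\<lambda>z. - kummer_int (a + 1) g z / Gamma a)"
  define U'' where "U'' = (\<lambda>z. kummer_int (a + 2) g z / Gamma a)"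
  define b where "b = a + g + 1"
  have G: "Gamma a > 0" using a by (rule Gamma_real_pos)
  have U1: "(U has_real_derivative U' z) (at z)" if "z > 0" for z
    unfolding U_def U'_def using kummer_int_deriv[OF a that, of g] G by (auto intro!: derivative_eq_intros)
  have U2: "(U' has_real_derivative U'' z) (at z)" if "z > 0" for z
  proof -
    have "(kummer_int (a + 1) g has_real_derivative - kummer_int (a + 2) g z) (at z)"
      using kummer_int_deriv[of "a + 1" z g] a that by (simp add: add.assoc)
    from DERIV_cdivide[OF DERIV_minus[OF this], of "Gamma a"] show ?thesis
      unfolding U''_def U'_def by simp
  qed
  have U3: "z * U'' z + (b - z) * U' z - a * U z = 0" if "z > 0" for z
    using kummer_int_ode[OF a that, of g] G unfolding U''_def U'_def U_def b_def by (simp add: field_simps)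
  have Up: "U z > 0" if "z > 0" for z using kummer_int_pos[OF a that] G by (simp add: U_def)
  have Ul: "((\<lambda>z. U z * z powr a) \<longlongrightarrow> 1) at_top"
    using tendsto_divide[OF kummer_int_powr_tendsto_Gamma[OF a g] tendsto_const[of "Gamma a"]] G
    by (simp add: U_def mult_ac)
  define q where "q = (\<lambda>z. v z / U z - 1)"
  define W where "W = (\<lambda>z. (v' z * U z - v z * U' z) * (z powr b * exp (- z)))"
  have W: "(W has_real_derivative 0) (at z)" if "z > 0" for z
  proof -
    have "(W has_real_derivative (v'' z * U z + v' z * U' z - (v' z * U' z + v z * U'' z)) * (z powr b * exp (- z))
       + (v' z * U z - v z * U' z) * (b * z powr (b - 1) * exp (- z) + z powr b * (- exp (- z)))) (at z)"
      unfolding W_def using v U1 U2 that by (auto intro!: derivative_eq_intros simp: algebra_simps)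
    also have "(v'' z * U z + v' z * U' z - (v' z * U' z + v z * U'' z)) * (z powr b * exp (- z))
       + (v' z * U z - v z * U' z) * (b * z powr (b - 1) * exp (- z) + z powr b * (- exp (- z)))
      = exp (- z) * z powr (b - 1) * (U z * (z * v'' z + (b - z) * v' z - a * v z) - v z * (z * U'' z + (b - z) * U' z - a * U z))"
    proof -
      have "z powr b = z * z powr (b - 1)" using that by (simp add: powr_diff)
      then show ?thesis by (simp add: algebra_simps)
    qed
    also have "\<dots> = 0" using v(3)[OF that] U3[OF that] by (simp add: b_def)
    finally show ?thesis .
  qed
  obtain C where C: "\<And>z. z > 0 \<Longrightarrow> W z = C"
  proof
    fix z :: real assume "z > 0"
    show "W z = W 1"
      by (rule DERIV_zero_Ioi_const[OF W \<open>z > 0\<close> zero_less_one])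
  qed
  have q: "(q has_real_derivative C * (z powr (- b) * exp z / (U z)\<^sup>2)) (at z)" if "z > 0" for z
  proof -
    have "(q has_real_derivative (v' z * U z - v z * U' z) / (U z)\<^sup>2) (at z)"
      unfolding q_def using v U1 Up[OF that] that
      by (auto intro!: derivative_eq_intros simp: power2_eq_square)
    also have "v' z * U z - v z * U' z = W z * (z powr (- b) * exp z)"
      using that by (simp add: W_def powr_minus exp_minus field_simps)
    finally show ?thesis using C[OF that] by simp
  qed
  have ql: "(q \<longlongrightarrow> 0) at_top"
  proof -
    have "((\<lambda>z. (v z * z powr a) / (U z * z powr a) - 1) \<longlongrightarrow> 1 / 1 - 1) at_top"
      by (intro tendsto_intros lim Ul) auto
    moreover have "\<forall>\<^sub>F z in at_top. (v z * z powr a) / (U z * z powr a) - 1 = q z"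
      using eventually_gt_at_top[of 0] by eventually_elim (simp add: q_def)
    ultimately show ?thesis by (simp add: tendsto_cong)
  qed
  have "C = 0"
  proof (rule ccontr)
    assume "C \<noteq> 0"
      \<comment> \<open>The threshold 4 is the square of the eventual bound
        \<open>U z * z powr a < 2\<close>. It makes the derivative of \<open>q / C\<close> at least
        1 from some point on, so \<open>q / C\<close> would grow linearly instead of tending to
        0.\<close>
      have "filterlim (\<lambda>z::real. z powr (2 * a - b) * exp z) at_top at_top" by real_asymp
    then have e1: "\<forall>\<^sub>F z in at_top. z powr (2 * a - b) * exp z \<ge> 4" by (auto simp: filterlim_at_top)
    have e2: "\<forall>\<^sub>F z in at_top. U z * z powr a < 2" using order_tendstoD(2)[OF Ul, of 2] by simp
    from e1 e2 eventually_gt_at_top[of 0]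
    have "\<forall>\<^sub>F z in at_top. z > 0 \<and> z powr (- b) * exp z / (U z)\<^sup>2 \<ge> 1"
    proof eventually_elim
      case (elim z)
      have "(U z * z powr a)\<^sup>2 \<le> 2\<^sup>2" using elim Up[of z] by (intro power_mono) auto
      also have "\<dots> \<le> z powr (2 * a - b) * exp z" using elim by simp
      also have "z powr (2 * a - b) = z powr (- b) * (z powr a)\<^sup>2"
        using elim by (simp add: powr_add[symmetric] power2_eq_square)
      finally have "(z powr a)\<^sup>2 * (U z)\<^sup>2 \<le> (z powr a)\<^sup>2 * (z powr (- b) * exp z)"
        by (simp add: power_mult_distrib mult_ac)
      then have "(U z)\<^sup>2 \<le> z powr (- b) * exp z" using elim by (simp add: mult_le_cancel_left)
      then show ?case using Up[of z] elim by simp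
    qed
    then obtain Z where "\<And>z. z \<ge> Z \<Longrightarrow> z > 0 \<and> z powr (- b) * exp z / (U z)\<^sup>2 \<ge> 1"
      unfolding eventually_at_top_linorder by blast
    then have Z: "Z > 0" "\<And>z. z \<ge> Z \<Longrightarrow> z powr (- b) * exp z / (U z)\<^sup>2 \<ge> 1" by auto
    have lin: "q x / C - x \<ge> q Z / C - Z" if "x \<ge> Z" for x
    proof (rule DERIV_nonneg_imp_nondecreasing[OF that])
      fix y assume "Z \<le> y" "y \<le> x"
      then show "\<exists>D. ((\<lambda>x. q x / C - x) has_real_derivative D) (at y) \<and> 0 \<le> D"
        using Z(1) Z(2)[of y] \<open>C \<noteq> 0\<close>
        by (intro exI[of _ "(z powr (- b) * exp z / (U z)\<^sup>2) - 1" for z] conjI)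
          (auto intro!: derivative_eq_intros q)
    qed
    have "\<forall>\<^sub>F x in at_top. q x / C - x \<ge> q Z / C - Z"
      using eventually_ge_at_top[of Z] by (rule eventually_mono) (rule lin)
    moreover have "\<forall>\<^sub>F x in at_top. q x / C < 1"
    proof (rule order_tendstoD(2))
      show "((\<lambda>x. q x / C) \<longlongrightarrow> 0 / C) at_top" by (intro tendsto_intros ql) fact
    qed simp
    moreover have "\<forall>\<^sub>F x in at_top. x > 1 + Z - q Z / C" by (rule eventually_gt_at_top)
    ultimately have "\<forall>\<^sub>F x :: real in at_top. False" by eventually_elim simp
    then show False by simp
  qed
  have "q z = 0"
  proof -
    have qc: "q x = q z" if "x > 0" for x
    proof (rule DERIV_zero_Ioi_const[OF _ that z])
      fix y :: real assume "y > 0"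
      then show "(q has_real_derivative 0) (at y)" using q[of y] \<open>C = 0\<close> by simp
    qed
    have "\<forall>\<^sub>F x in at_top. q x = q z"
      using eventually_gt_at_top[of 0] by (rule eventually_mono) (rule qc)
    then have "(q \<longlongrightarrow> q z) at_top" by (simp add: tendsto_eventually)
    then show ?thesis using tendsto_unique[OF _ _ ql] by simp
  qed
  then have "v z = U z" using Up[OF z] by (simp add: q_def)
  then show ?thesis by (simp add: U_def)
qed

text \<open>Resolves the definite description: existence comes from the derivative formula, the
  equation and the two-sided bound of \<open>kummer_int\<close>, uniqueness from
  \<open>kummer_solution_unique\<close>. The candidate is set to 0 for \<open>z \<le> 0\<close> to
  match the normalisation in \<open>tricomi_U\<close>.\<close>

lemma tricomi_U_eq_kummer_int:
  assumes a: "a > 0" and g: "g \<ge> 0" and z: "z > 0"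
  shows "tricomi_U a (a + g + 1) z = kummer_int a g z / Gamma a"
proof -
  have G: "Gamma a > 0" using a by (rule Gamma_real_pos)
  define U where "U = (\<lambda>z. if z \<le> 0 then 0 else kummer_int a g z / Gamma a)"
  have lim1: "((\<lambda>z. u z * z powr a) \<longlongrightarrow> 1) at_top"
    if "(\<lambda>z. u z * z powr a - 1) \<in> O[at_top](\<lambda>z. 1 / z)" for u :: "real \<Rightarrow> real"
  proof -
    have "(\<lambda>z::real. 1 / z) \<in> o[at_top](\<lambda>_. 1)" by real_asymp
    with that have "(\<lambda>z. u z * z powr a - 1) \<in> o[at_top](\<lambda>_. 1)"
      by (rule landau_o.big_small_trans)
    then have "((\<lambda>z. u z * z powr a - 1) \<longlongrightarrow> 0) at_top" by (rule smalloD_tendsto[of _ _ "\<lambda>_. 1", simplified])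
    then show ?thesis by (simp add: LIM_zero_iff)
  qed
  have "tricomi_U a (a + g + 1) = U"
    unfolding tricomi_U_def
  proof (rule the_equality, intro conjI)
    show "\<forall>z\<le>0. U z = 0" by (simp add: U_def)
    have "\<forall>z>0. (U has_real_derivative - kummer_int (a + 1) g z / Gamma a) (at z) \<and>
         ((\<lambda>z. - kummer_int (a + 1) g z / Gamma a) has_real_derivative kummer_int (a + 2) g z / Gamma a) (at z) \<and>
         z * (kummer_int (a + 2) g z / Gamma a) + (a + g + 1 - z) * (- kummer_int (a + 1) g z / Gamma a) - a * U z = 0"
    proof (intro allI impI conjI)
      fix z :: real assume z: "z > 0"
      have "((\<lambda>z. kummer_int a g z / Gamma a) has_real_derivative - kummer_int (a + 1) g z / Gamma a) (at z)"
        using kummer_int_deriv[OF a z, of g] G by (auto intro!: derivative_eq_intros)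
      then show "(U has_real_derivative - kummer_int (a + 1) g z / Gamma a) (at z)"
        by (rule has_field_derivative_transform_within_open[of _ _ _ "{0<..}"]) (use z in \<open>auto simp: U_def\<close>)
      show "((\<lambda>z. - kummer_int (a + 1) g z / Gamma a) has_real_derivative kummer_int (a + 2) g z / Gamma a) (at z)"
      proof -
        have "(kummer_int (a + 1) g has_real_derivative - kummer_int (a + 2) g z) (at z)"
          using kummer_int_deriv[of "a + 1" z g] a z by (simp add: add.assoc)
        from DERIV_cdivide[OF DERIV_minus[OF this], of "Gamma a"] show ?thesis by simp
      qed
      show "z * (kummer_int (a + 2) g z / Gamma a) + (a + g + 1 - z) * (- kummer_int (a + 1) g z / Gamma a) - a * U z = 0"
        using kummer_int_ode[OF a z, of g] z G by (simp add: U_def field_simps)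
    qed
    then show "\<exists>u' u''. \<forall>z>0. (U has_real_derivative u' z) (at z) \<and> (u' has_real_derivative u'' z) (at z) \<and>
         z * u'' z + (a + g + 1 - z) * u' z - a * U z = 0" by (intro exI)
    show "(\<lambda>z. U z * z powr a - 1) \<in> O[at_top](\<lambda>z. 1 / z)"
    proof (rule bigoI[where c="g * kummer_int (a + 1) g 1 / Gamma a"])
      show "\<forall>\<^sub>F z in at_top. norm (U z * z powr a - 1) \<le> g * kummer_int (a + 1) g 1 / Gamma a * norm (1 / z)"
        using eventually_ge_at_top[of 1]
      proof eventually_elim
        case (elim z)
        have "Gamma a \<le> z powr a * kummer_int a g z"
          "z powr a * kummer_int a g z \<le> Gamma a + g * kummer_int (a + 1) g 1 / z"
          using kummer_int_powr_ge_Gamma[OF a _ g, of z] elim by auto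
        then have "1 \<le> z powr a * kummer_int a g z / Gamma a"
          "z powr a * kummer_int a g z / Gamma a \<le> (Gamma a + g * kummer_int (a + 1) g 1 / z) / Gamma a"
          using G by (simp_all only: le_divide_eq_1_pos divide_le_cancel) auto
        moreover have "(Gamma a + g * kummer_int (a + 1) g 1 / z) / Gamma a = 1 + g * kummer_int (a + 1) g 1 / Gamma a * (1 / z)"
          using G less_imp_neq[OF G] by (simp add: add_divide_distrib)
        moreover have "U z * z powr a = z powr a * kummer_int a g z / Gamma a" using elim by (simp add: U_def)
        ultimately have "\<bar>U z * z powr a - 1\<bar> \<le> g * kummer_int (a + 1) g 1 / Gamma a * (1 / z)" by linarith
        then show ?case using elim by simp
      qed
    qed
  next
    fix u :: "real \<Rightarrow> real"
    assume u: "(\<forall>z\<le>0. u z = 0) \<and>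
         (\<exists>u' u''. \<forall>z>0. (u has_real_derivative u' z) (at z) \<and> (u' has_real_derivative u'' z) (at z) \<and>
             z * u'' z + (a + g + 1 - z) * u' z - a * u z = 0) \<and>
         (\<lambda>z. u z * z powr a - 1) \<in> O[at_top](\<lambda>z. 1 / z)"
    then obtain u' u'' where uu: "\<And>z. z > 0 \<Longrightarrow> (u has_real_derivative u' z) (at z)"
       "\<And>z. z > 0 \<Longrightarrow> (u' has_real_derivative u'' z) (at z)"
       "\<And>z. z > 0 \<Longrightarrow> z * u'' z + (a + g + 1 - z) * u' z - a * u z = 0" by blast
    show "u = U"
    proof
      fix z show "u z = U z"
        using u kummer_solution_unique[OF a g uu lim1] by (cases "z > 0") (auto simp: U_def)
    qed
  qed
  then show ?thesis using z by (simp add: U_def)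
qed

section \<open>Laplace integrals with varying parameters and argument\<close>

lemma kummer_s_integrand_integrable:
  assumes a: "a > 0" and z: "z \<ge> 0" and g: "g \<ge> (0::real)"
  shows "set_integrable lborel {0<..} (\<lambda>s. exp (- s) * s powr (a - 1) * (s + z) powr g)"
proof -
  have i1: "set_integrable lborel {0<..} (\<lambda>s. (1 + z) powr g * (exp (- s) * s powr (a - 1) * (1 + s) powr g))"
    using kummer_integrand_integrable[of a 1 g] a by simp
  then show ?thesis
  proof (rule set_integrable_bound)
    show "set_borel_measurable lborel {0<..} (\<lambda>s. exp (- s) * s powr (a - 1) * (s + z) powr g)"
      using z by (intro set_borel_measurable_Ioi continuous_intros)
        (auto simp: add_nonneg_eq_0_iff)
    show "AE s in lborel. s \<in> {0<..} \<longrightarrow> norm (exp (- s) * s powr (a - 1) * (s + z) powr g)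
         \<le> norm ((1 + z) powr g * (exp (- s) * s powr (a - 1) * (1 + s) powr g))"
    proof (intro AE_I2 impI)
      fix s :: real assume "s \<in> {0<..}"
      then have s: "s > 0" by simp
      have "s + z \<le> (1 + z) * (1 + s)" using s z by (simp add: algebra_simps)
      then have "(s + z) powr g \<le> ((1 + z) * (1 + s)) powr g" using g s z by (intro powr_mono2) auto
      also have "\<dots> = (1 + z) powr g * (1 + s) powr g" using z s by (simp add: powr_mult)
      finally have "exp (- s) * s powr (a - 1) * (s + z) powr g
         \<le> exp (- s) * s powr (a - 1) * ((1 + z) powr g * (1 + s) powr g)"
        by (intro mult_left_mono) auto
      then show "norm (exp (- s) * s powr (a - 1) * (s + z) powr g)
         \<le> norm ((1 + z) powr g * (exp (- s) * s powr (a - 1) * (1 + s) powr g))"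
        by (simp add: mult_ac)
    qed
  qed
qed

text \<open>All three are monotonicity in \<open>z\<close> under the integral:
  \<open>(s + z) powr g\<close> increases and \<open>(1 + s / z) powr g\<close> decreases in
  \<open>z\<close>, so the extreme cases are \<open>z = 0\<close> and \<open>z = 1\<close>.\<close>

lemma
  assumes a: "a > 0" and g: "g \<ge> 0" and z: "z > 0"
  shows kummer_int_powr_ge: "z powr (a + g) * kummer_int a g z \<ge> Gamma (a + g)"
    and kummer_int_powr_le: "z \<le> 1 \<Longrightarrow> z powr (a + g) * kummer_int a g z \<le> kummer_int a g 1"
    and kummer_int_powr_le': "z \<ge> 1 \<Longrightarrow> z powr a * kummer_int a g z \<le> kummer_int a g 1"
proof -
  have eq: "exp (- s) * s powr (a + g - 1) = exp (- s) * s powr (a - 1) * (s + 0) powr g" if "s > 0" for s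
    using that by (simp add: powr_add[symmetric] algebra_simps)
  have "Gamma (a + g) = (LINT s:{0<..}|lborel. exp (- s) * s powr (a + g - 1))"
    using Gamma_eq_set_integral[of "a + g"] a g by simp
  also have "\<dots> = (LINT s:{0<..}|lborel. exp (- s) * s powr (a - 1) * (s + 0) powr g)"
    using eq by (intro set_lebesgue_integral_cong) auto
  also have "\<dots> \<le> (LINT s:{0<..}|lborel. exp (- s) * s powr (a - 1) * (s + z) powr g)"
    using a g z by (intro set_integral_mono kummer_s_integrand_integrable mult_left_mono powr_mono2) auto
  finally show "z powr (a + g) * kummer_int a g z \<ge> Gamma (a + g)"
    by (simp add: kummer_int_powr_left'[OF z])
  have "z powr (a + g) * kummer_int a g z \<le> 1 powr (a + g) * kummer_int a g 1" if "z \<le> 1"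
    unfolding kummer_int_powr_left'[OF z] kummer_int_powr_left'[OF zero_less_one]
    using a g z that by (intro set_integral_mono kummer_s_integrand_integrable mult_left_mono powr_mono2) auto
  then show "z powr (a + g) * kummer_int a g z \<le> kummer_int a g 1" if "z \<le> 1" using that by simp
  assume z1: "z \<ge> 1"
  have i: "set_integrable lborel {0<..} (\<lambda>s. exp (- s) * s powr (a - 1) * (1 + s / w) powr g)" if w: "w > 0" for w
  proof -
    have "set_integrable lborel {0<..} (\<lambda>s. (exp (- s) * s powr (a - 1) * (s + w) powr g) * w powr (- g))"
      using kummer_s_integrand_integrable[OF a _ g, of w] w by (intro set_integrable_mult_left) auto
    then show ?thesis
    proof (rule set_integrable_cong[THEN iffD1, rotated -1])
      fix s :: real assume "s \<in> {0<..}"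
      then have "(s + w) powr g = w powr g * (1 + s / w) powr g"
      proof -
        have "s + w = w * (1 + s / w)" "0 \<le> 1 + s / w" using w \<open>s \<in> {0<..}\<close> by (auto simp: field_simps)
        then show ?thesis using w by (simp only: powr_mult)
      qed
      then show "exp (- s) * s powr (a - 1) * (s + w) powr g * w powr - g = exp (- s) * s powr (a - 1) * (1 + s / w) powr g"
        using w by (simp add: powr_minus)
    qed simp_all
  qed
  have "z powr a * kummer_int a g z \<le> 1 powr a * kummer_int a g 1"
    unfolding kummer_int_powr_left[OF z] kummer_int_powr_left[OF zero_less_one]
  proof (intro set_integral_mono i mult_left_mono powr_mono2)
    fix s :: real assume "s \<in> {0<..}"
    then show "1 + s / z \<le> 1 + s / 1" using z1 by (simp add: field_simps)
  qed (use z g in auto)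
  then show "z powr a * kummer_int a g z \<le> kummer_int a g 1" by simp
qed

text \<open>Joint continuity in both parameters and the argument, with argument 0 included. It is
  required because the Kummer parameters move with the eigenvalue while the radius may shrink with
  \<open>b\<close>.\<close>

lemma kummer_int_powr_tendsto:
  fixes a g z :: "real \<Rightarrow> real"
  assumes a: "(a \<longlongrightarrow> a0) at_top" "a0 > 0" and g: "(g \<longlongrightarrow> g0) at_top" "g0 > 0"
    and z: "(z \<longlongrightarrow> z0) at_top" "\<forall>\<^sub>F b in at_top. z b > 0"
  shows "((\<lambda>b. z b powr (a b + g b) * kummer_int (a b) (g b) (z b)) \<longlongrightarrow>
    (LINT s:{0<..}|lborel. exp (- s) * s powr (a0 - 1) * (s + z0) powr g0)) at_top"
proof -
  have z0: "z0 \<ge> 0" by (rule tendsto_lowerbound[OF z(1)]) (use z(2) in \<open>auto elim: eventually_mono\<close>)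
  \<comment> \<open>The power \<open>s powr (a b - 1)\<close> is dominated by the exponent of
    \<open>a0 / 2\<close> for \<open>s < 1\<close> and by that of \<open>a0 + 1\<close> for
    \<open>s \<ge> 1\<close>; the sum serves both.\<close>
  define w where "w = (\<lambda>s. exp (- s) * (s powr (a0 / 2 - 1) + s powr (a0 + 1 - 1)) * (s + (z0 + 2)) powr (g0 + 1))"
  have "((\<lambda>b. LINT s:{0<..}|lborel. exp (- s) * s powr (a b - 1) * (s + z b) powr g b) \<longlongrightarrow>
    (LINT s:{0<..}|lborel. exp (- s) * s powr (a0 - 1) * (s + z0) powr g0)) at_top"
  proof (rule set_dominated_convergence_at_top[where w = w])
    show "\<forall>\<^sub>F b in at_top. set_borel_measurable lborel {0<..} (\<lambda>s. exp (- s) * s powr (a b - 1) * (s + z b) powr g b)"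
      using z(2) by eventually_elim
        (intro set_borel_measurable_Ioi continuous_intros, auto simp: add_nonneg_eq_0_iff)
    show "set_borel_measurable lborel {0<..} (\<lambda>s. exp (- s) * s powr (a0 - 1) * (s + z0) powr g0)"
      using z0 by (intro set_borel_measurable_Ioi continuous_intros) (auto simp: add_nonneg_eq_0_iff)
    have "set_integrable lborel {0<..} (\<lambda>s. exp (- s) * s powr (a0 / 2 - 1) * (s + (z0 + 2)) powr (g0 + 1)
        + exp (- s) * s powr (a0 + 1 - 1) * (s + (z0 + 2)) powr (g0 + 1))"
      using a g z0 by (intro set_integral_add(1) kummer_s_integrand_integrable) auto
    then show "set_integrable lborel {0<..} w" by (simp add: w_def algebra_simps)
    have "\<forall>\<^sub>F b in at_top. a b > a0 / 2" "\<forall>\<^sub>F b in at_top. a b < a0 + 1"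
      "\<forall>\<^sub>F b in at_top. g b < g0 + 1" "\<forall>\<^sub>F b in at_top. g b > 0" "\<forall>\<^sub>F b in at_top. z b < z0 + 1"
      using order_tendstoD(1)[OF a(1), of "a0 / 2"] order_tendstoD(2)[OF a(1), of "a0 + 1"]
        order_tendstoD(1)[OF g(1), of 0] order_tendstoD(2)[OF g(1), of "g0 + 1"]
        order_tendstoD(2)[OF z(1), of "z0 + 1"] a(2) g(2) by simp_all
    with z(2) show "\<forall>\<^sub>F b in at_top. \<forall>s\<in>{0<..}. \<bar>exp (- s) * s powr (a b - 1) * (s + z b) powr g b\<bar> \<le> w s"
    proof eventually_elim
      case (elim b)
      show ?case
      proof
        fix s :: real assume "s \<in> {0<..}"
        then have s: "s > 0" by simp
        have "s powr (a b - 1) \<le> s powr (a0 / 2 - 1) + s powr (a0 + 1 - 1)"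
        proof (cases "s \<ge> 1")
          case True
          then have "s powr (a b - 1) \<le> s powr (a0 + 1 - 1)" using elim by (intro powr_mono) auto
          then show ?thesis by (simp add: add_increasing)
        next
          case False
          then have "s powr (a b - 1) \<le> s powr (a0 / 2 - 1)" using elim s by (intro powr_mono') auto
          then show ?thesis by (simp add: add_increasing2)
        qed
        moreover have "(s + z b) powr g b \<le> (s + (z0 + 2)) powr (g0 + 1)"
        proof -
          have "(s + z b) powr g b \<le> (s + (z0 + 2)) powr g b" using elim s by (intro powr_mono2) auto
          also have "\<dots> \<le> (s + (z0 + 2)) powr (g0 + 1)" using elim s z0 by (intro powr_mono) auto
          finally show ?thesis .
        qed
        ultimately show "\<bar>exp (- s) * s powr (a b - 1) * (s + z b) powr g b\<bar> \<le> w s"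
          unfolding w_def abs_mult by (intro mult_mono) auto
      qed
    qed
    fix s :: real assume "s \<in> {0<..}"
    then show "((\<lambda>b. exp (- s) * s powr (a b - 1) * (s + z b) powr g b) \<longlongrightarrow> exp (- s) * s powr (a0 - 1) * (s + z0) powr g0) at_top"
      using z0 by (intro tendsto_intros a g z) auto
  qed simp
  moreover have "\<forall>\<^sub>F b in at_top. (LINT s:{0<..}|lborel. exp (- s) * s powr (a b - 1) * (s + z b) powr g b)
     = z b powr (a b + g b) * kummer_int (a b) (g b) (z b)"
    using z(2) by eventually_elim (simp add: kummer_int_powr_left')
  ultimately show ?thesis by (rule Lim_transform_eventually)
qed

lemma kummer_int_powr_tendsto_0:
  fixes a g z :: "real \<Rightarrow> real"
  assumes a: "(a \<longlongrightarrow> a0) at_top" "a0 > 0" and g: "(g \<longlongrightarrow> g0) at_top" "g0 > 0"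
    and z: "(z \<longlongrightarrow> 0) at_top" "\<forall>\<^sub>F b in at_top. z b > 0"
  shows "((\<lambda>b. z b powr (a b + g b) * kummer_int (a b) (g b) (z b)) \<longlongrightarrow> Gamma (a0 + g0)) at_top"
proof -
  have "(LINT s:{0<..}|lborel. exp (- s) * s powr (a0 - 1) * (s + 0) powr g0) = (LINT s:{0<..}|lborel. exp (- s) * s powr (a0 + g0 - 1))"
    by (intro set_lebesgue_integral_cong) (auto simp: powr_add[symmetric] algebra_simps)
  also have "\<dots> = Gamma (a0 + g0)" using Gamma_eq_set_integral[of "a0 + g0"] a g by simp
  finally show ?thesis using kummer_int_powr_tendsto[OF a g z] by simp
qed

lemma kummer_int_tendsto:
  fixes a g :: "real \<Rightarrow> real"
  assumes a: "(a \<longlongrightarrow> a0) at_top" "a0 > 0" and g: "(g \<longlongrightarrow> g0) at_top" "g0 > 0" and z: "z > 0"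
  shows "((\<lambda>b. kummer_int (a b) (g b) z) \<longlongrightarrow> kummer_int a0 g0 z) at_top"
proof -
  have "((\<lambda>b. z powr (a b + g b) * kummer_int (a b) (g b) z / z powr (a b + g b)) \<longlongrightarrow>
     (LINT s:{0<..}|lborel. exp (- s) * s powr (a0 - 1) * (s + z) powr g0) / z powr (a0 + g0)) at_top"
    using z by (intro tendsto_divide kummer_int_powr_tendsto a g tendsto_intros) auto
  then show ?thesis using z by (simp add: kummer_int_powr_left'[symmetric])
qed

text \<open>The decaying solution \<open>exp (- r\<^sup>2 / 2) * tricomi_U a (a + g + 1) (r\<^sup>2)\<close> of the linear radial
  equation in dimension \<open>2 * (a + g) + 2\<close> with eigenvalue \<open>2 * (g + 1 - a)\<close>, and its derivative.\<close>

definition lin_sol :: "real \<Rightarrow> real \<Rightarrow> real \<Rightarrow> real" where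
  "lin_sol a g r = exp (- r\<^sup>2 / 2) * (kummer_int a g (r\<^sup>2) / Gamma a)"

definition lin_sol' :: "real \<Rightarrow> real \<Rightarrow> real \<Rightarrow> real" where
  "lin_sol' a g r = - r * exp (- r\<^sup>2 / 2) * ((kummer_int a g (r\<^sup>2) + 2 * kummer_int (a + 1) g (r\<^sup>2)) / Gamma a)"

context
  fixes a g :: real
  assumes a: "a > 0" and g: "g \<ge> 0"
begin

lemma lin_sol_pos: "r > 0 \<Longrightarrow> lin_sol a g r > 0"
  using kummer_int_pos[OF a, of "r\<^sup>2" g] Gamma_real_pos[OF a] by (simp add: lin_sol_def)

lemma lin_sol'_neg: "r > 0 \<Longrightarrow> lin_sol' a g r < 0"
  using kummer_int_pos[OF a, of "r\<^sup>2" g] kummer_int_pos[of "a + 1" "r\<^sup>2" g] a Gamma_real_pos[OF a]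
  by (auto simp: lin_sol'_def intro!: mult_pos_pos divide_pos_pos add_pos_pos)

lemma lin_sol_deriv:
  assumes r: "r > 0"
  shows "(lin_sol a g has_real_derivative lin_sol' a g r) (at r)"
proof -
  have G: "Gamma a \<noteq> 0" using Gamma_real_pos[OF a] by simp
  have d: "((\<lambda>r. kummer_int a g (r\<^sup>2)) has_real_derivative - kummer_int (a + 1) g (r\<^sup>2) * (2 * r)) (at r)"
    using r a by (intro DERIV_chain2[where f="kummer_int a g" and g="\<lambda>r. r\<^sup>2", OF kummer_int_deriv])
      (auto intro!: derivative_eq_intros)
  have d0: "((\<lambda>r::real. exp (- r\<^sup>2 / 2)) has_real_derivative - r * exp (- r\<^sup>2 / 2)) (at r)"
    by (auto intro!: derivative_eq_intros)
  show ?thesis unfolding lin_sol_def[abs_def] lin_sol'_def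
    by (rule DERIV_cong[OF DERIV_mult[OF d0 DERIV_cdivide[OF d]]]) (use G in \<open>simp add: field_simps\<close>)
qed

lemma lin_sol'_deriv:
  assumes r: "r > 0"
  shows "(lin_sol' a g has_real_derivative
    (r\<^sup>2 - 2 * (g + 1 - a)) * lin_sol a g r - (2 * (a + g) + 1) / r * lin_sol' a g r) (at r)"
proof -
  have G: "Gamma a \<noteq> 0" using Gamma_real_pos[OF a] by simp
  define k0 k1 k2 where "k0 = kummer_int a g (r\<^sup>2)" and "k1 = kummer_int (a + 1) g (r\<^sup>2)"
    and "k2 = kummer_int (a + 2) g (r\<^sup>2)"
  have d: "((\<lambda>r. kummer_int a g (r\<^sup>2)) has_real_derivative - k1 * (2 * r)) (at r)"
    unfolding k1_def using r a by (intro DERIV_chain2[where f="kummer_int a g" and g="\<lambda>r. r\<^sup>2", OF kummer_int_deriv])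
      (auto intro!: derivative_eq_intros)
  have "(kummer_int (a + 1) g has_real_derivative - k2) (at (r\<^sup>2))"
    using kummer_int_deriv[of "a + 1" "r\<^sup>2" g] r a by (simp add: k2_def add_ac)
  then have d1: "((\<lambda>r. kummer_int (a + 1) g (r\<^sup>2)) has_real_derivative - k2 * (2 * r)) (at r)"
    by (rule DERIV_chain2) (auto intro!: derivative_eq_intros)
  have d0: "((\<lambda>r::real. exp (- r\<^sup>2 / 2)) has_real_derivative - r * exp (- r\<^sup>2 / 2)) (at r)"
    by (auto intro!: derivative_eq_intros)
  \<comment> \<open>Kummer's equation at \<open>z = r\<^sup>2\<close> eliminates the second-order
    term \<open>k2\<close>; the Gaussian factor turns the rest into the radial oscillator
    equation.\<close>
  have ode: "r\<^sup>2 * k2 - (a + g + 1 - r\<^sup>2) * k1 - a * k0 = 0"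
    using kummer_int_ode[OF a, of "r\<^sup>2" g] r by (simp add: k0_def k1_def k2_def)
  have "((\<lambda>r. - r * exp (- r\<^sup>2 / 2) * ((kummer_int a g (r\<^sup>2) + 2 * kummer_int (a + 1) g (r\<^sup>2)) / Gamma a)) has_real_derivative
     (- exp (- r\<^sup>2 / 2) + - r * (- r * exp (- r\<^sup>2 / 2))) * ((k0 + 2 * k1) / Gamma a)
      + (- r * exp (- r\<^sup>2 / 2)) * ((- k1 * (2 * r) + 2 * (- k2 * (2 * r))) / Gamma a)) (at r)"
    unfolding k0_def k1_def
    by (rule DERIV_cong[OF DERIV_mult[OF DERIV_mult[OF DERIV_minus[OF DERIV_ident] d0] DERIV_cdivide[OF DERIV_add[OF d[unfolded k1_def] DERIV_cmult[OF d1]]]]])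
       (simp add: algebra_simps)
  moreover have "(- exp (- r\<^sup>2 / 2) + - r * (- r * exp (- r\<^sup>2 / 2))) * ((k0 + 2 * k1) / Gamma a)
      + (- r * exp (- r\<^sup>2 / 2)) * ((- k1 * (2 * r) + 2 * (- k2 * (2 * r))) / Gamma a)
     = exp (- r\<^sup>2 / 2) / Gamma a * ((r\<^sup>2 - 1) * (k0 + 2 * k1) + 2 * r\<^sup>2 * k1 + 4 * (r\<^sup>2 * k2))"
    using G by (simp add: field_simps power2_eq_square)
  moreover have "r\<^sup>2 * k2 = (a + g + 1 - r\<^sup>2) * k1 + a * k0" using ode by simp
  moreover have "exp (- r\<^sup>2 / 2) / Gamma a * ((r\<^sup>2 - 1) * (k0 + 2 * k1) + 2 * r\<^sup>2 * k1 + 4 * ((a + g + 1 - r\<^sup>2) * k1 + a * k0))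
     = (r\<^sup>2 - 2 * (g + 1 - a)) * lin_sol a g r - (2 * (a + g) + 1) / r * lin_sol' a g r"
    using r G unfolding lin_sol_def lin_sol'_def k0_def[symmetric] k1_def[symmetric] by (simp add: field_simps)
  ultimately show ?thesis unfolding lin_sol'_def[abs_def] by simp
qed

text \<open>In dimension \<open>d = 2 * (a + g) + 2\<close> the solution has the size of the
  Newtonian singularity \<open>r powr (- (d - 2))\<close> near 0 and Gaussian size for
  \<open>r \<ge> 1\<close>. The constants depend on \<open>a\<close> and \<open>g\<close>
  only.\<close>

lemma lin_sol_le_near: "0 < r \<Longrightarrow> r \<le> 1 \<Longrightarrow> r powr (2 * (a + g)) * lin_sol a g r \<le> kummer_int a g 1 / Gamma a"
  and lin_sol_ge_near: "0 < r \<Longrightarrow> r \<le> 1 \<Longrightarrow> r powr (2 * (a + g)) * lin_sol a g r \<ge> exp (- 1 / 2) * Gamma (a + g) / Gamma a"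
  and lin_sol_le_far: "r \<ge> 1 \<Longrightarrow> r powr (2 * a) * exp (r\<^sup>2 / 2) * lin_sol a g r \<le> kummer_int a g 1 / Gamma a"
  and lin_sol_le_far': "r \<ge> 1 \<Longrightarrow> lin_sol a g r \<le> kummer_int a g 1 / Gamma a * exp (- r\<^sup>2 / 2)"
proof -
  note G = Gamma_real_pos[OF a]
  have p: "r powr (2 * c) = (r\<^sup>2) powr c" if "r > 0" for c
    using that by (simp add: powr_powr[symmetric] powr_numeral)
  {
    assume r: "0 < r" "r \<le> 1"
    have k: "(r\<^sup>2) powr (a + g) * kummer_int a g (r\<^sup>2) \<le> kummer_int a g 1"
      using kummer_int_powr_le[OF a g, of "r\<^sup>2"] r by (simp add: power_le_one)
    have "exp (- r\<^sup>2 / 2) * ((r\<^sup>2) powr (a + g) * kummer_int a g (r\<^sup>2)) \<le> 1 * kummer_int a g 1"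
      using kummer_int_pos[OF a, of "r\<^sup>2" g] r by (intro mult_mono k) auto
    then show "r powr (2 * (a + g)) * lin_sol a g r \<le> kummer_int a g 1 / Gamma a"
      unfolding p[OF r(1), of "a + g"] lin_sol_def using G by (simp add: field_simps)
    have k: "Gamma (a + g) \<le> (r\<^sup>2) powr (a + g) * kummer_int a g (r\<^sup>2)"
      using kummer_int_powr_ge[OF a g, of "r\<^sup>2"] r by simp
    have "exp (- 1 / 2) * Gamma (a + g) \<le> exp (- r\<^sup>2 / 2) * ((r\<^sup>2) powr (a + g) * kummer_int a g (r\<^sup>2))"
      using r Gamma_real_pos[of "a + g"] a g by (intro mult_mono k) (auto simp: power_le_one)
    then show "r powr (2 * (a + g)) * lin_sol a g r \<ge> exp (- 1 / 2) * Gamma (a + g) / Gamma a"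
      unfolding p[OF r(1), of "a + g"] lin_sol_def using G by (simp add: field_simps)
  }
  {
    assume r: "r \<ge> 1"
    have k: "(r\<^sup>2) powr a * kummer_int a g (r\<^sup>2) \<le> kummer_int a g 1"
      using kummer_int_powr_le'[OF a g, of "r\<^sup>2"] r by simp
    then show "r powr (2 * a) * exp (r\<^sup>2 / 2) * lin_sol a g r \<le> kummer_int a g 1 / Gamma a"
      using G p[of a] r by (simp add: lin_sol_def field_simps exp_minus mult_exp_exp)
    have "kummer_int a g (r\<^sup>2) \<le> kummer_int a g 1"
      using r by (intro kummer_int_antimono a) auto
    then show "lin_sol a g r \<le> kummer_int a g 1 / Gamma a * exp (- r\<^sup>2 / 2)"
      using G by (simp add: lin_sol_def field_simps)
  }
qed

lemma lin_sol'_le_far: "r \<ge> 1 \<Longrightarrow> \<bar>lin_sol' a g r\<bar> \<le> (kummer_int a g 1 + 2 * kummer_int (a + 1) g 1) / Gamma a * (r * exp (- r\<^sup>2 / 2))"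
proof -
  assume r: "r \<ge> 1"
  have "kummer_int a g (r\<^sup>2) \<le> kummer_int a g 1" "kummer_int (a + 1) g (r\<^sup>2) \<le> kummer_int (a + 1) g 1"
    using r a by (auto intro!: kummer_int_antimono)
  moreover have "0 < kummer_int a g (r\<^sup>2)" "0 < kummer_int (a + 1) g (r\<^sup>2)"
    using r a by (auto intro!: kummer_int_pos)
  ultimately have "(kummer_int a g (r\<^sup>2) + 2 * kummer_int (a + 1) g (r\<^sup>2)) / Gamma a * (r * exp (- r\<^sup>2 / 2))
      \<le> (kummer_int a g 1 + 2 * kummer_int (a + 1) g 1) / Gamma a * (r * exp (- r\<^sup>2 / 2))"
    using r Gamma_real_pos[OF a] by (intro mult_right_mono divide_right_mono) auto
  moreover have "\<bar>lin_sol' a g r\<bar> = (kummer_int a g (r\<^sup>2) + 2 * kummer_int (a + 1) g (r\<^sup>2)) / Gamma a * (r * exp (- r\<^sup>2 / 2))"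
    using r lin_sol'_neg[of r] unfolding abs_of_neg[OF lin_sol'_neg[OF less_le_trans[OF zero_less_one r]]] 
    by (simp add: lin_sol'_def)
  ultimately show ?thesis by simp
qed

lemma lin_sol_tendsto:
  "((\<lambda>r. r powr (2 * a) * exp (r\<^sup>2 / 2) * lin_sol a g r) \<longlongrightarrow> 1) at_top"
proof -
  note G = Gamma_real_pos[OF a]
  have "((\<lambda>r::real. ((r\<^sup>2) powr a * kummer_int a g (r\<^sup>2)) / Gamma a) \<longlongrightarrow> Gamma a / Gamma a) at_top"
    using G by (intro tendsto_intros filterlim_compose[OF kummer_int_powr_tendsto_Gamma[OF a g]]) (real_asymp | simp)+
  moreover have "\<forall>\<^sub>F r::real in at_top. ((r\<^sup>2) powr a * kummer_int a g (r\<^sup>2)) / Gamma a = r powr (2 * a) * exp (r\<^sup>2 / 2) * lin_sol a g r"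
    using eventually_gt_at_top[of 0]
  proof eventually_elim
    case (elim r)
    then have "r powr (2 * a) = (r\<^sup>2) powr a" by (simp add: powr_powr[symmetric] powr_numeral)
    then show ?case by (simp add: lin_sol_def exp_minus)
  qed
  ultimately show ?thesis using G by (simp add: Lim_transform_eventually)
qed

end

section \<open>Ground states and the Pohozaev functional\<close>

text \<open>Differentiability is asked only in the open interval, so 0 may be an endpoint. Most
  integral estimates on ground states are phrased as monotonicity of an explicit combination through
  this fact and its mirror image.\<close>

lemma nondecreasing_Icc:
  fixes f f' :: "real \<Rightarrow> real"
  assumes "a \<le> b" "continuous_on {a..b} f"
    and "\<And>x. a < x \<Longrightarrow> x < b \<Longrightarrow> (f has_real_derivative f' x) (at x)"
    and "\<And>x. a < x \<Longrightarrow> x < b \<Longrightarrow> f' x \<ge> 0"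
  shows "f a \<le> f b"
  by (rule DERIV_nonneg_imp_increasing_open[OF assms(1) _ assms(2)]) (use assms in blast)

lemma nonincreasing_Icc:
  fixes f f' :: "real \<Rightarrow> real"
  assumes "a \<le> b" "continuous_on {a..b} f"
    and "\<And>x. a < x \<Longrightarrow> x < b \<Longrightarrow> (f has_real_derivative f' x) (at x)"
    and "\<And>x. a < x \<Longrightarrow> x < b \<Longrightarrow> f' x \<le> 0"
  shows "f b \<le> f a"
  by (rule DERIV_nonpos_imp_decreasing_open[OF assms(1) _ assms(2)]) (use assms in blast)

lemma mvt_simple_DERIV:
  fixes f f' :: "real \<Rightarrow> real"
  assumes "a < b" "\<And>x. a \<le> x \<Longrightarrow> x \<le> b \<Longrightarrow> (f has_real_derivative f' x) (at x within {a..b})"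
  shows "\<exists>z>a. z < b \<and> f b - f a = (b - a) * f' z"
proof -
  have "\<exists>z\<in>{a<..<b}. f b - f a = f' z * (b - a)"
    by (rule mvt_simple[OF assms(1)]) (use assms(2) in \<open>auto simp: has_field_derivative_def\<close>)
  then show ?thesis by (auto simp: mult_ac)
qed

lemma abs_half_sum4_le:
  fixes a1 a2 a3 a4 b1 b2 b3 b4 :: real
  assumes "\<bar>a1\<bar> \<le> b1" "\<bar>a2\<bar> \<le> b2" "\<bar>a3\<bar> \<le> b3" "\<bar>a4\<bar> \<le> b4"
  shows "\<bar>(a1 + a2 + a3 - a4) / 2\<bar> \<le> (b1 + b2 + b3 + b4) / 2"
  using assms by (simp add: field_simps abs_le_iff)

text \<open>Skolemised form of \<open>radial_ground_state\<close> for one value of \<open>b\<close>: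
  the derivatives are parameters, so that Wronskians and the Pohozaev functional can be defined from
  them.\<close>

locale ground_state =
  fixes d :: nat and l b :: real and u u' u'' :: "real \<Rightarrow> real"
  assumes d: "d > 4" and b: "b > 0"
    and du0: "r \<ge> 0 \<Longrightarrow> (u has_real_derivative u' r) (at r within {0..})"
    and du'0: "r \<ge> 0 \<Longrightarrow> (u' has_real_derivative u'' r) (at r within {0..})"
    and cont'': "continuous_on {0..} u''" and u'0: "u' 0 = 0"
    and ode0: "r > 0 \<Longrightarrow> - u'' r - (real d - 1) / r * u' r + r\<^sup>2 * u r
                 - \<bar>u r\<bar> powr (2 * crit_p d) * u r = l * u r"
    and u0: "u 0 = b" and u'_neg: "r > 0 \<Longrightarrow> u' r < 0" and u_lim: "(u \<longlongrightarrow> 0) at_top"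
begin

abbreviation p where "p \<equiv> crit_p d"

lemma p: "p > 0" "p < 1" "p * (real d - 2) = 2" "p * real d = 2 * p + 2"
  using d by (auto simp: crit_p_def field_simps)

lemma p_eq: "2 / p = real d - 2" "1 / p = (real d - 2) / 2" "p + 1 = real d / (real d - 2)"
  using d by (auto simp: crit_p_def field_simps)

lemma alpha_p_eq: "alpha_p p = p / (2 * real d)" "alpha_p p > 0"
proof -
  have "p\<^sup>2 * (2 * real d) = 2 * p * (p * real d)" by (simp add: power2_eq_square)
  also have "\<dots> = p * (4 * (1 + p))" unfolding p(4) by (simp add: algebra_simps)
  finally have "p\<^sup>2 * (2 * real d) = p * (4 * (1 + p))" .
  then show "alpha_p p = p / (2 * real d)" using p d by (simp add: alpha_p_def field_simps)
  show "alpha_p p > 0" using p by (simp add: alpha_p_def)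
qed

lemma at_Ici: "r > 0 \<Longrightarrow> at r within {0..} = at (r::real)"
  by (rule at_within_interior) (auto simp: interior_Ici[of "-1"])

lemma du: "r > 0 \<Longrightarrow> (u has_real_derivative u' r) (at r)"
  using du0[of r] at_Ici[of r] by simp

lemma du': "r > 0 \<Longrightarrow> (u' has_real_derivative u'' r) (at r)"
  using du'0[of r] at_Ici[of r] by simp

lemma cont_u: "continuous_on {0..} u"
  by (rule DERIV_continuous_on[OF du0]) auto

lemma cont_u': "continuous_on {0..} u'"
  by (rule DERIV_continuous_on[OF du'0]) auto

lemma u_decreasing: "0 \<le> x \<Longrightarrow> x < y \<Longrightarrow> u y < u x"
proof (rule DERIV_neg_imp_decreasing_open[of x y u])
  fix z assume "0 \<le> x" "x < z"
  then show "\<exists>y. (u has_real_derivative y) (at z) \<and> y < 0"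
    using du[of z] u'_neg[of z] by auto
qed (auto intro: continuous_on_subset[OF cont_u])

lemma u_antimono: "0 \<le> x \<Longrightarrow> x \<le> y \<Longrightarrow> u y \<le> u x"
  using u_decreasing[of x y] by (cases "x = y") auto

lemma u_pos: "r \<ge> 0 \<Longrightarrow> u r > 0"
proof -
  assume r: "r \<ge> 0"
  have "0 \<le> u (r + 1)"
  proof (rule tendsto_upperbound[OF u_lim])
    show "\<forall>\<^sub>F x in at_top. u x \<le> u (r + 1)"
      using eventually_ge_at_top[of "r + 1"] by eventually_elim (use u_antimono[of "r + 1"] r in auto)
  qed simp
  also have "\<dots> < u r" using r by (intro u_decreasing) auto
  finally show "u r > 0" .
qed

lemma u_le_b: "r \<ge> 0 \<Longrightarrow> u r \<le> b"
  using u_antimono[of 0 r] u0 by simp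

lemma ode: "r > 0 \<Longrightarrow> u'' r = (r\<^sup>2 - l - u r powr (2 * p)) * u r - (real d - 1) / r * u' r"
  using ode0[of r] u_pos[of r] by (simp add: algebra_simps)

text \<open>No decay of \<open>u'\<close> is assumed. The mean value theorem yields a point in each
  unit interval where \<open>u'\<close> is controlled by \<open>u\<close>; boundary terms at
  infinity are evaluated along such points.\<close>

lemma u'_small: "R \<ge> 0 \<Longrightarrow> \<exists>x. R < x \<and> x < R + 1 \<and> \<bar>u' x\<bar> \<le> u R"
proof -
  assume R: "R \<ge> 0"
  obtain z where z: "R < z" "z < R + 1" "u (R + 1) - u R = (R + 1 - R) * u' z"
  proof -
    have "\<exists>z>R. z < R + 1 \<and> u (R + 1) - u R = (R + 1 - R) * u' z"
      by (rule mvt_simple_DERIV) (use R in \<open>auto intro!: DERIV_subset[OF du0]\<close>)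
    then show ?thesis using that by blast
  qed
  then have "\<bar>u' z\<bar> = u R - u (R + 1)" using u'_neg[of z] R by auto
  then show ?thesis using z u_pos[of "R + 1"] R by (intro exI[of _ z]) auto
qed

text \<open>\<open>real d\<close> is the lowest eigenvalue of the oscillator, with eigenfunction
  \<open>exp (- r\<^sup>2 / 2)\<close>. The weighted Wronskian \<open>Y\<close> of \<open>u\<close>
  with this Gaussian starts at 0 and would be strictly decreasing for \<open>l \<ge> d\<close>,
  against its smallness along the points of \<open>u'_small\<close>.\<close>

lemma l_less_d: "l < real d"
proof (rule ccontr)
  assume l: "\<not> l < real d"
  obtain k where k: "d = Suc (Suc k)" using d by (intro that[of "d - 2"]) simp
  define Y where "Y = (\<lambda>r. r ^ (d - 1) * exp (- r\<^sup>2 / 2) * (u' r + r * u r))"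
  define Y' where "Y' = (\<lambda>r. r ^ (d - 1) * exp (- r\<^sup>2 / 2) * u r * (real d - l - u r powr (2 * p)))"
  have d0: "((\<lambda>r::real. exp (- r\<^sup>2 / 2)) has_real_derivative - r * exp (- r\<^sup>2 / 2)) (at r)" for r
    by (auto intro!: derivative_eq_intros)
  have dY: "(Y has_real_derivative Y' r) (at r)" if r: "r > 0" for r
  proof -
    have dp: "((\<lambda>r. r ^ (d - 1)) has_real_derivative (real d - 1) * r ^ k) (at r)"
      using DERIV_pow[of "d - 1" r] by (simp add: k)
    have "(Y has_real_derivative ((real d - 1) * r ^ k * exp (- r\<^sup>2 / 2) + - r * exp (- r\<^sup>2 / 2) * r ^ (d - 1)) * (u' r + r * u r)
        + (u'' r + (1 * u r + u' r * r)) * (r ^ (d - 1) * exp (- r\<^sup>2 / 2))) (at r)"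
      unfolding Y_def by (rule DERIV_mult[OF DERIV_mult[OF dp d0] DERIV_add[OF du'[OF r] DERIV_mult[OF DERIV_ident du[OF r]]]])
    also have "((real d - 1) * r ^ k * exp (- r\<^sup>2 / 2) + - r * exp (- r\<^sup>2 / 2) * r ^ (d - 1)) * (u' r + r * u r)
        + (u'' r + (1 * u r + u' r * r)) * (r ^ (d - 1) * exp (- r\<^sup>2 / 2)) = Y' r"
      unfolding ode[OF r] Y'_def using r by (simp add: k field_simps power2_eq_square)
    finally show ?thesis .
  qed
  have Y'neg: "Y' r < 0" if "r > 0" for r
  proof -
    have "u r powr (2 * p) > 0" using u_pos[OF less_imp_le[OF that]] by (simp only: powr_gt_zero)
    then have "real d - l - u r powr (2 * p) < 0" using l by linarith
    then show ?thesis unfolding Y'_def using that u_pos[of r] by (intro mult_pos_neg mult_pos_pos) auto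
  qed
  have contY: "continuous_on {0..} Y"
    unfolding Y_def by (intro continuous_intros cont_u cont_u') auto
  have "Y 1 < Y 0"
  proof (rule DERIV_neg_imp_decreasing_open[of 0 1 Y])
    fix z :: real assume "0 < z"
    then show "\<exists>y. (Y has_real_derivative y) (at z) \<and> y < 0"
      using dY[of z] Y'neg[of z] by auto
  qed (auto intro: continuous_on_subset[OF contY])
  moreover have "Y 0 = 0" by (simp add: Y_def k)
  ultimately have Y1: "Y 1 < 0" by simp
  have Yle: "Y r \<le> Y 1" if "r \<ge> 1" for r
    by (rule nonincreasing_Icc[OF that _ dY]) (use Y'neg in \<open>auto intro: continuous_on_subset[OF contY] less_imp_le\<close>)
  have "((\<lambda>r::real. r ^ (d - 1) * exp (- r\<^sup>2 / 2) * (b * (1 + r))) \<longlongrightarrow> 0) at_top" by real_asymp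
  then have "\<forall>\<^sub>F r in at_top. r ^ (d - 1) * exp (- r\<^sup>2 / 2) * (b * (1 + r)) < - Y 1"
    using Y1 by (intro order_tendstoD) auto
  then obtain R where R: "\<And>r. r \<ge> R \<Longrightarrow> r ^ (d - 1) * exp (- r\<^sup>2 / 2) * (b * (1 + r)) < - Y 1"
    by (auto simp: eventually_at_top_linorder)
  define S where "S = max R 1"
  have "S \<ge> 0" by (simp add: S_def)
  from u'_small[OF this] obtain x where x: "S < x" "\<bar>u' x\<bar> \<le> u S" by blast
  have x1: "x \<ge> 1" "x \<ge> R" "S \<ge> 0" using x by (auto simp: S_def)
  have "\<bar>u' x + x * u x\<bar> \<le> b * (1 + x)"
  proof -
    have "x * u x \<le> x * b" using u_le_b[of x] x1 by (intro mult_left_mono) auto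
    moreover have "x * u x \<ge> 0" using u_pos[of x] x1 by auto
    ultimately show ?thesis using x(2) u_le_b[OF x1(3)] by (simp add: algebra_simps)
  qed
  then have "\<bar>Y x\<bar> \<le> x ^ (d - 1) * exp (- x\<^sup>2 / 2) * (b * (1 + x))"
    unfolding Y_def abs_mult using x1 by (intro mult_mono) auto
  then show False using R[OF x1(2)] Yle[OF x1(1)] Y1 by auto
qed

text \<open>Beyond \<open>R\<close> the function \<open>k = u' + r / 2 * u\<close> satisfies
  \<open>k' \<ge> r / 2 * k\<close>. A positive value would force growth like
  \<open>exp (r\<^sup>2 / 4)\<close>, although \<open>k \<le> r / 2 * b\<close>. Hence
  \<open>k \<le> 0\<close>, which says that \<open>u * exp (r\<^sup>2 / 4)\<close>
  decreases.\<close>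

lemma u_gaussian_decay:
  assumes R: "R > 0" and big: "\<And>r. r \<ge> R \<Longrightarrow> r\<^sup>2 / 2 \<ge> l + u r powr (2 * p)" and r: "r \<ge> R"
  shows "u r * exp (r\<^sup>2 / 4) \<le> u R * exp (R\<^sup>2 / 4)"
proof -
  define k where "k = (\<lambda>r. u' r + r / 2 * u r)"
  define k' where "k' = (\<lambda>r. u'' r + (1 / 2 * u r + u' r * (r / 2)))"
  have dk: "(k has_real_derivative k' r) (at r)" if r: "r > 0" for r
    unfolding k_def k'_def by (intro DERIV_add du'[OF r] DERIV_mult du[OF r]) (auto intro!: derivative_eq_intros)
  have k': "k' r \<ge> r / 2 * k r" if r: "r \<ge> R" for r
  proof -
    have r0: "r > 0" using r R by simp
    have "(r\<^sup>2 - l - u r powr (2 * p)) * u r \<ge> (r\<^sup>2 / 2) * u r"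
      using big[OF r] u_pos[of r] r0 by (intro mult_right_mono) auto
    then have "(r\<^sup>2 - l - u r powr (2 * p)) * u r \<ge> r\<^sup>2 * u r / 2" by simp
    moreover have "(real d - 1) / r * u' r \<le> 0" using u'_neg[OF r0] r0 d by (intro mult_nonneg_nonpos) auto
    moreover have "r\<^sup>2 * u r \<ge> 0" using u_pos[of r] r0 by simp
    moreover have "k' r - r / 2 * k r = (r\<^sup>2 - l - u r powr (2 * p)) * u r - (real d - 1) / r * u' r
        + u r / 2 - r\<^sup>2 * u r / 4"
      unfolding k'_def k_def ode[OF r0] by (simp add: algebra_simps power2_eq_square)
    moreover have "u r > 0" using u_pos r0 by simp
    moreover have "h \<le> kk" if "c / 2 \<le> A" "B \<le> 0" "0 \<le> c" "kk - h = A - B + v / 2 - c / 4" "v > 0" for h kk A B c v :: real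
      using that by linarith
    ultimately show ?thesis by blast
  qed
  have dE: "((\<lambda>r::real. exp (- r\<^sup>2 / 4)) has_real_derivative - (r / 2) * exp (- r\<^sup>2 / 4)) (at r)" for r
    by (auto intro!: derivative_eq_intros)
  have kneg: "k x \<le> 0" if x: "x \<ge> R" for x
  proof (rule ccontr)
    assume kx: "\<not> k x \<le> 0"
    define c where "c = k x * exp (- x\<^sup>2 / 4)"
    have c: "c > 0" using kx by (simp add: c_def)
    have ge: "c \<le> k y * exp (- y\<^sup>2 / 4)" if y: "y \<ge> x" for y
      unfolding c_def
    proof (rule nondecreasing_Icc[OF y])
      show d1: "((\<lambda>r. k r * exp (- r\<^sup>2 / 4)) has_real_derivative k' z * exp (- z\<^sup>2 / 4) + - (z / 2) * exp (- z\<^sup>2 / 4) * k z) (at z)"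
        if "x < z" for z
        using that x R by (intro DERIV_mult dk dE) auto
      show "continuous_on {x..y} (\<lambda>r. k r * exp (- r\<^sup>2 / 4))"
        unfolding k_def using x R
        by (intro continuous_intros continuous_on_subset[OF cont_u] continuous_on_subset[OF cont_u']) auto
      fix z assume "x < z"
      then have "(k' z - z / 2 * k z) * exp (- z\<^sup>2 / 4) \<ge> 0" using k'[of z] x by (intro mult_nonneg_nonneg) auto
      then show "0 \<le> k' z * exp (- z\<^sup>2 / 4) + - (z / 2) * exp (- z\<^sup>2 / 4) * k z" by (simp add: algebra_simps)
    qed
    have "((\<lambda>y::real. y / 2 * b * exp (- y\<^sup>2 / 4)) \<longlongrightarrow> 0) at_top" by real_asymp
    then have "\<forall>\<^sub>F y in at_top. y / 2 * b * exp (- y\<^sup>2 / 4) < c" using c by (intro order_tendstoD) auto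
    then have "\<forall>\<^sub>F y in at_top. y / 2 * b * exp (- y\<^sup>2 / 4) < c \<and> y \<ge> x" using eventually_ge_at_top by eventually_elim auto
    then obtain y where y: "y / 2 * b * exp (- y\<^sup>2 / 4) < c" "y \<ge> x" by (auto simp: eventually_at_top_linorder)
    have y0: "y > 0" using y x R by simp
    have "k y \<le> y / 2 * u y" using u'_neg[OF y0] by (simp add: k_def)
    also have "\<dots> \<le> y / 2 * b" using u_le_b[of y] y0 by (intro mult_left_mono) auto
    finally have "k y * exp (- y\<^sup>2 / 4) \<le> y / 2 * b * exp (- y\<^sup>2 / 4)" by (intro mult_right_mono) auto
    then show False using ge[OF y(2)] y(1) by linarith
  qed
  have dE': "((\<lambda>r::real. exp (r\<^sup>2 / 4)) has_real_derivative (r / 2) * exp (r\<^sup>2 / 4)) (at r)" for r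
    by (auto intro!: derivative_eq_intros)
  show ?thesis
  proof (rule nonincreasing_Icc[OF r])
    show "((\<lambda>r. u r * exp (r\<^sup>2 / 4)) has_real_derivative u' z * exp (z\<^sup>2 / 4) + (z / 2) * exp (z\<^sup>2 / 4) * u z) (at z)"
      if "R < z" for z
      using that R by (intro DERIV_mult du dE') auto
    show "continuous_on {R..r} (\<lambda>r. u r * exp (r\<^sup>2 / 4))"
      using R by (intro continuous_intros continuous_on_subset[OF cont_u]) auto
    fix z assume "R < z"
    then have "k z * exp (z\<^sup>2 / 4) \<le> 0" using kneg[of z] by (intro mult_nonpos_nonneg) auto
    then show "u' z * exp (z\<^sup>2 / 4) + (z / 2) * exp (z\<^sup>2 / 4) * u z \<le> 0" by (simp add: k_def algebra_simps)
  qed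
qed

lemma u_gaussian_bound: "\<exists>C>0. \<exists>R\<ge>1. \<forall>r\<ge>R. u r \<le> C * exp (- r\<^sup>2 / 4)"
proof -
  \<comment> \<open>This radius depends on \<open>b\<close>, so the bound gives qualitative facts at
    fixed \<open>b\<close>; the version uniform in \<open>b\<close> is
    \<open>u_le_far\<close>.\<close>
  define R where "R = max 1 (2 * (\<bar>l\<bar> + b powr (2 * p)))"
  have R1: "R \<ge> 1" by (simp add: R_def)
  have big: "r\<^sup>2 / 2 \<ge> l + u r powr (2 * p)" if r: "r \<ge> R" for r
  proof -
    have "u r powr (2 * p) \<le> b powr (2 * p)" using r R1 p u_le_b[of r] u_pos[of r] by (intro powr_mono2) auto
    moreover have "r \<le> r\<^sup>2" using r R1 by (simp add: power2_eq_square)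
    moreover have "2 * \<bar>l\<bar> + 2 * b powr (2 * p) \<le> r" using r by (simp add: R_def)
    moreover have "l \<le> \<bar>l\<bar>" by simp
    ultimately show ?thesis by argo
  qed
  have "u r \<le> u R * exp (R\<^sup>2 / 4) * exp (- r\<^sup>2 / 4)" if "r \<ge> R" for r
    using u_gaussian_decay[OF _ big that] R1 by (simp add: exp_minus field_simps)
  moreover have "u R * exp (R\<^sup>2 / 4) > 0" using u_pos[of R] R1 by simp
  ultimately show ?thesis using R1 by blast
qed

section \<open>The Pohozaev functional: derivative, sign and lower bound\<close>

definition poho :: "real \<Rightarrow> real" where
  "poho r = (r ^ d * (u' r)\<^sup>2 + (real d - 2) * (r ^ (d - 1) * (u r * u' r)) + r ^ d * u r powr (2 * p + 2) / (p + 1)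
      - (r ^ (d + 2) - l * r ^ d) * (u r)\<^sup>2) / 2"

lemma poho_0: "poho 0 = 0"
  using d by (simp add: poho_def power_0_left)

lemma cont_poho: "continuous_on {0..} poho"
  unfolding poho_def using p u_pos by (intro continuous_intros cont_u cont_u') (auto simp: less_imp_neq[symmetric])

text \<open>\<open>poho\<close> is the primitive obtained by multiplying the equation by
  \<open>r ^ d * u' + (d - 2) / 2 * r ^ (d - 1) * u\<close>. At the critical exponent
  \<open>d / (p + 1) = d - 2\<close>, so the nonlinear terms cancel and only the weight
  \<open>l - 2 * r\<^sup>2\<close> is left.\<close>

lemma poho_deriv:
  assumes r: "r > 0"
  shows "(poho has_real_derivative (l - 2 * r\<^sup>2) * (u r)\<^sup>2 * r ^ (d - 1)) (at r)"
proof -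
  obtain k where k: "d = k + 2" using d by (intro that[of "d - 2"]) simp
  have ur: "u r > 0" using u_pos r by simp
  have dw: "((\<lambda>r. u r powr (2 * p + 2)) has_real_derivative (2 * p + 2) * u r powr (2 * p + 1) * u' r) (at r)"
    using DERIV_chain2[where f="\<lambda>x. x powr (2 * p + 2)" and g=u, OF has_real_derivative_powr[OF ur] du[OF r]]
    by (simp add: add.commute)
  have dsq: "((\<lambda>r. (u r)\<^sup>2) has_real_derivative 2 * u r * u' r) (at r)"
    using DERIV_power[OF du[OF r], of 2] by (simp add: mult_ac)
  have dsq': "((\<lambda>r. (u' r)\<^sup>2) has_real_derivative 2 * u' r * u'' r) (at r)"
    using DERIV_power[OF du'[OF r], of 2] by (simp add: mult_ac)
  have dr: "((\<lambda>r. r ^ d) has_real_derivative real d * r ^ (d - 1)) (at r)"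
    using DERIV_pow[of d r] by simp
  have dr1: "((\<lambda>r. r ^ (d - 1)) has_real_derivative (real d - 1) * r ^ k) (at r)"
    using DERIV_pow[of "d - 1" r] by (simp add: k)
  have dr2: "((\<lambda>r. r ^ (d + 2)) has_real_derivative (real d + 2) * r ^ (d + 1)) (at r)"
    using DERIV_pow[of "d + 2" r] by (simp add: add.commute)
  define x where "x = r ^ k"
  have pw: "r ^ d = r\<^sup>2 * x" "r ^ (d - 1) = r * x" "r ^ (d + 2) = r\<^sup>2 * r\<^sup>2 * x" "r ^ (d + 1) = r * r\<^sup>2 * x"
    by (simp_all add: k x_def power_add power2_eq_square)
  define w where "w = u r powr (2 * p)"
  have w: "u r powr (2 * p + 1) = w * u r" "u r powr (2 * p + 2) = w * (u r)\<^sup>2"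
    using ur by (simp_all add: w_def powr_add powr_numeral)
  have "(poho has_real_derivative
     (((real d * r ^ (d - 1)) * (u' r)\<^sup>2 + 2 * u' r * u'' r * r ^ d)
      + (real d - 2) * (((real d - 1) * r ^ k) * (u r * u' r) + (u' r * u' r + u'' r * u r) * r ^ (d - 1))
      + ((real d * r ^ (d - 1)) * u r powr (2 * p + 2) + (2 * p + 2) * u r powr (2 * p + 1) * u' r * r ^ d) / (p + 1)
      - (((real d + 2) * r ^ (d + 1) - l * (real d * r ^ (d - 1))) * (u r)\<^sup>2 + 2 * u r * u' r * (r ^ (d + 2) - l * r ^ d))) / 2) (at r)"
    unfolding poho_def[abs_def]
    by (intro DERIV_cdivide DERIV_diff DERIV_add DERIV_mult DERIV_cmult dr dr1 dr2 dsq dsq' dw du[OF r] du'[OF r])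
  moreover have "(((real d * r ^ (d - 1)) * (u' r)\<^sup>2 + 2 * u' r * u'' r * r ^ d)
      + (real d - 2) * (((real d - 1) * r ^ k) * (u r * u' r) + (u' r * u' r + u'' r * u r) * r ^ (d - 1))
      + ((real d * r ^ (d - 1)) * u r powr (2 * p + 2) + (2 * p + 2) * u r powr (2 * p + 1) * u' r * r ^ d) / (p + 1)
      - (((real d + 2) * r ^ (d + 1) - l * (real d * r ^ (d - 1))) * (u r)\<^sup>2 + 2 * u r * u' r * (r ^ (d + 2) - l * r ^ d))) / 2
     = (l - 2 * r\<^sup>2) * (u r)\<^sup>2 * r ^ (d - 1)"
  proof -
    have e1: "real d / (p + 1) = real d - 2" "(2 * p + 2) / (p + 1) = 2" using p p_eq(3) d by (simp_all add: field_simps)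
    have "((real d * r ^ (d - 1)) * u r powr (2 * p + 2) + (2 * p + 2) * u r powr (2 * p + 1) * u' r * r ^ d) / (p + 1)
       = (real d / (p + 1)) * (r * x * (w * (u r)\<^sup>2)) + ((2 * p + 2) / (p + 1)) * (w * u r * u' r * (r\<^sup>2 * x))"
    proof -
      have "(c * A + c' * B) / s = c / s * A + c' / s * B" for c c' A B s :: real
        by (simp add: add_divide_distrib)
      from this[of "real d" "r * x * (w * (u r)\<^sup>2)" "2 * p + 2" "w * u r * u' r * (r\<^sup>2 * x)" "p + 1"]
      show ?thesis unfolding pw w by (simp only: mult.assoc)
    qed
    also have "\<dots> = (real d - 2) * (r * x * (w * (u r)\<^sup>2)) + 2 * (w * u r * u' r * (r\<^sup>2 * x))" unfolding e1 ..
    finally have e2: "((real d * r ^ (d - 1)) * u r powr (2 * p + 2) + (2 * p + 2) * u r powr (2 * p + 1) * u' r * r ^ d) / (p + 1)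
       = (real d - 2) * (r * x * (w * (u r)\<^sup>2)) + 2 * (w * u r * u' r * (r\<^sup>2 * x))" .
    have e3: "r * u'' r = r * ((r\<^sup>2 - l - w) * u r) - (real d - 1) * u' r"
      unfolding ode[OF r] w_def using r by (simp add: field_simps)
    define v where "v = u'' r"
    have "(((real d * r ^ (d - 1)) * (u' r)\<^sup>2 + 2 * u' r * u'' r * r ^ d)
      + (real d - 2) * (((real d - 1) * r ^ k) * (u r * u' r) + (u' r * u' r + u'' r * u r) * r ^ (d - 1))
      + ((real d * r ^ (d - 1)) * u r powr (2 * p + 2) + (2 * p + 2) * u r powr (2 * p + 1) * u' r * r ^ d) / (p + 1)
      - (((real d + 2) * r ^ (d + 1) - l * (real d * r ^ (d - 1))) * (u r)\<^sup>2 + 2 * u r * u' r * (r ^ (d + 2) - l * r ^ d))) / 2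
     = (((real d * (r * x)) * (u' r)\<^sup>2 + 2 * u' r * (r * x * (r * v)))
      + (real d - 2) * (((real d - 1) * x) * (u r * u' r) + (u' r * u' r * (r * x) + x * u r * (r * v)))
      + ((real d - 2) * (r * x * (w * (u r)\<^sup>2)) + 2 * (w * u r * u' r * (r\<^sup>2 * x)))
      - (((real d + 2) * (r * r\<^sup>2 * x) - l * (real d * (r * x))) * (u r)\<^sup>2 + 2 * u r * u' r * (r\<^sup>2 * r\<^sup>2 * x - l * (r\<^sup>2 * x)))) / 2"
      unfolding e2 unfolding pw x_def[symmetric] v_def[symmetric] by (simp add: algebra_simps power2_eq_square)
    also have "\<dots> = (l - 2 * r\<^sup>2) * (u r)\<^sup>2 * (r * x)"
      unfolding e3[folded v_def] by (simp add: field_simps power2_eq_square)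
    finally show ?thesis unfolding pw .
  qed
  ultimately show ?thesis by simp
qed

text \<open>Smallness is claimed only at some arbitrarily large radii because \<open>u'\<close> is
  controlled only at selected points; monotonicity upgrades it to a limit in
  \<open>poho_tendsto_0\<close>.\<close>

lemma poho_small: "e > 0 \<Longrightarrow> \<exists>x>R. \<bar>poho x\<bar> < e"
proof -
  assume e: "e > 0"
  obtain C S where C: "C > 0" "S \<ge> 1" "\<And>r. r \<ge> S \<Longrightarrow> u r \<le> C * exp (- r\<^sup>2 / 4)"
    using u_gaussian_bound by blast
  define D where "D = C * exp (1/2)"
  have lim0: "((\<lambda>x::real. x ^ k * (exp (- (x - 1)\<^sup>2 / 4))\<^sup>2) \<longlongrightarrow> 0) at_top" for k
    by real_asymp
  have "((\<lambda>x::real. D\<^sup>2 * (x ^ d * (exp (- (x - 1)\<^sup>2 / 4))\<^sup>2 + (real d - 2) * (x ^ (d - 1) * (exp (- (x - 1)\<^sup>2 / 4))\<^sup>2)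
     + b powr (2 * p) / (p + 1) * (x ^ d * (exp (- (x - 1)\<^sup>2 / 4))\<^sup>2)
      + (x ^ (d + 2) * (exp (- (x - 1)\<^sup>2 / 4))\<^sup>2 + \<bar>l\<bar> * (x ^ d * (exp (- (x - 1)\<^sup>2 / 4))\<^sup>2))) / 2) \<longlongrightarrow> D\<^sup>2 * (0 + (real d - 2) * 0 + b powr (2 * p) / (p + 1) * 0 + (0 + \<bar>l\<bar> * 0)) / 2) at_top"
    by (intro lim0 tendsto_divide tendsto_mult[OF tendsto_const] tendsto_add tendsto_const) simp
  then have "\<forall>\<^sub>F x in at_top. D\<^sup>2 * (x ^ d * (exp (- (x - 1)\<^sup>2 / 4))\<^sup>2 + (real d - 2) * (x ^ (d - 1) * (exp (- (x - 1)\<^sup>2 / 4))\<^sup>2)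
     + b powr (2 * p) / (p + 1) * (x ^ d * (exp (- (x - 1)\<^sup>2 / 4))\<^sup>2)
      + (x ^ (d + 2) * (exp (- (x - 1)\<^sup>2 / 4))\<^sup>2 + \<bar>l\<bar> * (x ^ d * (exp (- (x - 1)\<^sup>2 / 4))\<^sup>2))) / 2 < e"
    using e by (intro order_tendstoD) auto
  then obtain T where T: "\<And>x. x \<ge> T \<Longrightarrow> D\<^sup>2 * (x ^ d * (exp (- (x - 1)\<^sup>2 / 4))\<^sup>2 + (real d - 2) * (x ^ (d - 1) * (exp (- (x - 1)\<^sup>2 / 4))\<^sup>2)
     + b powr (2 * p) / (p + 1) * (x ^ d * (exp (- (x - 1)\<^sup>2 / 4))\<^sup>2)
      + (x ^ (d + 2) * (exp (- (x - 1)\<^sup>2 / 4))\<^sup>2 + \<bar>l\<bar> * (x ^ d * (exp (- (x - 1)\<^sup>2 / 4))\<^sup>2))) / 2 < e"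
    by (auto simp: eventually_at_top_linorder)
  define Q where "Q = max (max R S) T"
  have Q: "Q \<ge> R" "Q \<ge> S" "Q \<ge> T" "Q \<ge> 1" using C(2) by (auto simp: Q_def)
  obtain x where x: "Q < x" "x < Q + 1" "\<bar>u' x\<bar> \<le> u Q" using u'_small[of Q] Q by auto
  define m where "m = D * exp (- (x - 1)\<^sup>2 / 4)"
  \<comment> \<open>At \<open>x\<close> the derivative is bounded by the value of \<open>u\<close>
    at \<open>Q\<close>, which lies less than 1 to the left; the Gaussian is therefore taken at
    \<open>x - 1\<close>.\<close>
  have "exp (- Q\<^sup>2 / 4) \<le> exp (1 / 2 + - (x - 1)\<^sup>2 / 4)"
  proof -
    have "(x - 1)\<^sup>2 \<le> Q\<^sup>2" using x Q by (intro power_mono) auto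
    then show ?thesis by simp
  qed
  then have "C * exp (- Q\<^sup>2 / 4) \<le> C * exp (1 / 2 + - (x - 1)\<^sup>2 / 4)" using C(1) by (intro mult_left_mono) auto
  also have "\<dots> = m" unfolding m_def D_def exp_add by simp
  finally have "u Q \<le> m" using C(3)[OF Q(2)] by linarith
  moreover have "u x \<le> u Q" using x Q by (intro u_antimono) auto
  ultimately have m: "\<bar>u' x\<bar> \<le> m" "u x \<le> m" "0 < u x" using x u_pos[of x] Q by auto
  have sq: "(u' x)\<^sup>2 \<le> m\<^sup>2" "(u x)\<^sup>2 \<le> m\<^sup>2" "\<bar>u x * u' x\<bar> \<le> m\<^sup>2"
    using m power_mono[of "\<bar>u' x\<bar>" m 2] power_mono[of "u x" m 2] mult_mono[of "u x" m "\<bar>u' x\<bar>" m]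
    by (auto simp: abs_mult power2_eq_square)
  have uw: "u x powr (2 * p + 2) \<le> b powr (2 * p) * m\<^sup>2"
  proof -
    have "u x powr (2 * p + 2) = u x powr (2 * p) * (u x)\<^sup>2" using m by (simp add: powr_add powr_numeral)
    also have "\<dots> \<le> b powr (2 * p) * m\<^sup>2" using m p sq u_le_b[of x] x Q by (intro mult_mono powr_mono2) auto
    finally show ?thesis .
  qed
  have x0: "x > 0" "x \<ge> T" using x Q by auto
  have "\<bar>poho x\<bar> \<le> (x ^ d * m\<^sup>2 + (real d - 2) * (x ^ (d - 1) * m\<^sup>2) + x ^ d * (b powr (2 * p) * m\<^sup>2) / (p + 1)
      + (x ^ (d + 2) + \<bar>l\<bar> * x ^ d) * m\<^sup>2) / 2"
  proof -
    have "\<bar>x ^ d * (u' x)\<^sup>2\<bar> \<le> x ^ d * m\<^sup>2" using sq x0 by (simp add: abs_mult mult_left_mono)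
    moreover have "\<bar>(real d - 2) * (x ^ (d - 1) * (u x * u' x))\<bar> \<le> (real d - 2) * (x ^ (d - 1) * m\<^sup>2)"
    proof -
      have "\<bar>(real d - 2) * (x ^ (d - 1) * (u x * u' x))\<bar> = (real d - 2) * (x ^ (d - 1) * \<bar>u x * u' x\<bar>)"
        using x0 d by (simp add: abs_mult)
      also have "\<dots> \<le> (real d - 2) * (x ^ (d - 1) * m\<^sup>2)"
        using x0 d sq by (intro mult_left_mono) auto
      finally show ?thesis .
    qed
    moreover have "\<bar>x ^ d * u x powr (2 * p + 2) / (p + 1)\<bar> \<le> x ^ d * (b powr (2 * p) * m\<^sup>2) / (p + 1)"
    proof -
      have "\<bar>x ^ d * u x powr (2 * p + 2) / (p + 1)\<bar> = x ^ d * u x powr (2 * p + 2) / (p + 1)"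
        using x0 p by simp
      also have "\<dots> \<le> x ^ d * (b powr (2 * p) * m\<^sup>2) / (p + 1)"
        using uw x0 p by (intro divide_right_mono mult_left_mono) auto
      finally show ?thesis .
    qed
    moreover have "\<bar>(x ^ (d + 2) - l * x ^ d) * (u x)\<^sup>2\<bar> \<le> (x ^ (d + 2) + \<bar>l\<bar> * x ^ d) * m\<^sup>2"
    proof -
      have "\<bar>x ^ (d + 2) - l * x ^ d\<bar> \<le> \<bar>x ^ (d + 2)\<bar> + \<bar>l * x ^ d\<bar>" by (rule abs_triangle_ineq4)
      also have "\<dots> = x ^ (d + 2) + \<bar>l\<bar> * x ^ d" using x0 by (simp add: abs_mult)
      finally show ?thesis unfolding abs_mult using sq x0 by (intro mult_mono) auto
    qed
    ultimately show ?thesis unfolding poho_def by (rule abs_half_sum4_le)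
  qed
  also have "\<dots> < e" using T[OF x0(2)] unfolding m_def by (simp add: power_mult_distrib algebra_simps)
  finally show "\<exists>x>R. \<bar>poho x\<bar> < e" using x Q by (intro exI[of _ x]) auto
qed

end

lemma (in ground_state) poho_le:
  assumes "0 \<le> x" "x \<le> y" "\<And>r. x < r \<Longrightarrow> r < y \<Longrightarrow> l \<ge> 2 * r\<^sup>2"
  shows "poho x \<le> poho y"
proof (rule nondecreasing_Icc[OF assms(2) continuous_on_subset[OF cont_poho] poho_deriv])
  fix r assume "x < r" "r < y"
  then show "0 \<le> (l - 2 * r\<^sup>2) * (u r)\<^sup>2 * r ^ (d - 1)"
    using assms(1) assms(3)[of r] by (intro mult_nonneg_nonneg) auto
qed (use assms in auto)

lemma (in ground_state) poho_ge:
  assumes "0 \<le> x" "x \<le> y" "\<And>r. x < r \<Longrightarrow> r < y \<Longrightarrow> l \<le> 2 * r\<^sup>2"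
  shows "poho y \<le> poho x"
proof (rule nonincreasing_Icc[OF assms(2) continuous_on_subset[OF cont_poho] poho_deriv])
  fix r assume "x < r" "r < y"
  then show "(l - 2 * r\<^sup>2) * (u r)\<^sup>2 * r ^ (d - 1) \<le> 0"
    using assms(1) assms(3)[of r] by (intro mult_nonpos_nonneg) auto
qed (use assms in auto)

context ground_state
begin

text \<open>With \<open>l \<le> 0\<close> the functional would decrease strictly from its value 0 at
  the origin and then stay below \<open>poho 1 < 0\<close>, against
  \<open>poho_small\<close>.\<close>

lemma l_pos: "l > 0"
proof (rule ccontr)
  assume l: "\<not> l > 0"
  have "poho 1 < poho 0"
  proof (rule DERIV_neg_imp_decreasing_open[of 0 1 poho])
    fix r :: real assume r: "0 < r"
    have "l - 2 * r\<^sup>2 < 0" using l zero_less_power[OF r, of 2] by linarith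
    then have "(l - 2 * r\<^sup>2) * (u r)\<^sup>2 * r ^ (d - 1) < 0"
      using r u_pos[of r] by (intro mult_neg_pos) auto
    then show "\<exists>y. (poho has_real_derivative y) (at r) \<and> y < 0"
      using poho_deriv[OF r] by blast
  qed (auto intro: continuous_on_subset[OF cont_poho])
  then have neg: "- poho 1 > 0" using poho_0 by simp
  obtain x where x: "x > 1" "\<bar>poho x\<bar> < - poho 1" using poho_small[OF neg, of 1] by blast
  have "poho x \<le> poho 1"
    by (rule poho_ge) (use x l in \<open>auto intro: order_trans[of _ 0]\<close>)
  then show False using x by linarith
qed

text \<open>The functional rises from 0 while \<open>2 * r\<^sup>2 \<le> l\<close> and falls
  afterwards; a negative value could not return to the smallness at infinity.\<close>

lemma poho_nonneg: "r \<ge> 0 \<Longrightarrow> poho r \<ge> 0"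
proof -
  assume r: "r \<ge> 0"
  show ?thesis
  proof (cases "2 * r\<^sup>2 \<le> l")
    case True
    have "poho 0 \<le> poho r"
    proof (rule poho_le)
      fix x assume "0 < x" "x < r"
      then have "x\<^sup>2 \<le> r\<^sup>2" by (intro power_mono) auto
      then show "2 * x\<^sup>2 \<le> l" using True by simp
    qed (use r in auto)
    then show ?thesis by (simp add: poho_0)
  next
    case False
    show ?thesis
    proof (rule ccontr)
      assume "\<not> poho r \<ge> 0"
      then have neg: "- poho r > 0" by simp
      obtain x where x: "x > r" "\<bar>poho x\<bar> < - poho r" using poho_small[OF neg] by blast
      have "poho x \<le> poho r"
      proof (rule poho_ge)
        fix y assume "r < y"
        then have "r\<^sup>2 \<le> y\<^sup>2" using r by (intro power_mono) auto
        then show "l \<le> 2 * y\<^sup>2" using False by simp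
      qed (use x r in auto)
      then show False using x by linarith
    qed
  qed
qed

text \<open>Replaces \<open>u\<close> by its value at the right endpoint in the integral of
  \<open>(l - 2 * r\<^sup>2) * (u r)\<^sup>2 * r ^ (d - 1)\<close>. \<open>S\<close> is the integral
  of the weight alone; if \<open>S r \<ge> 0\<close>, then \<open>S \<ge> 0\<close> on the whole
  interval and monotonicity of \<open>u\<close> makes \<open>poho - u\<^sup>2 * S\<close>
  nondecreasing, and if \<open>S r < 0\<close>, nonnegativity of \<open>poho\<close>
  suffices.\<close>

lemma poho_lower:
  assumes r: "r \<ge> 0"
  shows "poho r \<ge> (u r)\<^sup>2 * (l * r ^ d / real d - 2 * r ^ (d + 2) / (real d + 2))"
proof -
  define S where "S = (\<lambda>r::real. l * r ^ d / real d - 2 * r ^ (d + 2) / (real d + 2))"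
  have S: "S r = r ^ d * (l / real d - 2 * r\<^sup>2 / (real d + 2))" for r
    by (simp add: S_def power_add algebra_simps power2_eq_square)
  have dS: "(S has_real_derivative (l - 2 * r\<^sup>2) * r ^ (d - 1)) (at r)" for r
  proof -
    have "(S has_real_derivative (l * (real d * r ^ (d - 1)) / real d - 2 * (real (d + 2) * r ^ (d + 2 - 1)) / (real d + 2))) (at r)"
      unfolding S_def using DERIV_pow[of d r] DERIV_pow[of "d + 2" r]
      by (intro DERIV_diff DERIV_cdivide DERIV_cmult) auto
    also have "l * (real d * r ^ (d - 1)) / real d = l * r ^ (d - 1)" using d by simp
    also have "2 * (real (d + 2) * r ^ (d + 2 - 1)) / (real d + 2) = 2 * r ^ (d + 1)" by (simp add: field_simps)
    also have "r ^ (d + 1) = r\<^sup>2 * r ^ (d - 1)"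
      using d by (subst power_add[symmetric]) (rule arg_cong[where f="power r"], simp)
    finally show ?thesis by (simp add: algebra_simps power2_eq_square)
  qed
  show ?thesis
  proof (cases "S r \<ge> 0 \<and> r > 0")
    case False
    show ?thesis
    proof (cases "r = 0")
      case True
      then show ?thesis using poho_0 d by (simp add: power_0_left)
    next
      case r0: False
      with False r have "S r < 0" by auto
      then have "(u r)\<^sup>2 * S r \<le> 0" by (intro mult_nonneg_nonpos) auto
      then show ?thesis using poho_nonneg[OF r] by (simp add: S_def)
    qed
  next
    case True
    have Sx: "S x \<ge> 0" if x: "0 < x" "x < r" for x
    proof -
      have "l / real d - 2 * r\<^sup>2 / (real d + 2) \<ge> 0" 
      proof (rule ccontr)
        assume "\<not> l / real d - 2 * r\<^sup>2 / (real d + 2) \<ge> 0"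
        then have "S r < 0" unfolding S using True by (intro mult_pos_neg zero_less_power) auto
        then show False using True by simp
      qed
      moreover have "2 * x\<^sup>2 / (real d + 2) \<le> 2 * r\<^sup>2 / (real d + 2)"
        using x by (intro divide_right_mono mult_left_mono power_mono) auto
      ultimately show ?thesis using x unfolding S by (intro mult_nonneg_nonneg) auto
    qed
    have "poho 0 - (u 0)\<^sup>2 * S 0 \<le> poho r - (u r)\<^sup>2 * S r"
    proof (rule nondecreasing_Icc[OF r])
      show "continuous_on {0..r} (\<lambda>r. poho r - (u r)\<^sup>2 * S r)"
        unfolding S_def using d by (intro continuous_intros continuous_on_subset[OF cont_poho] continuous_on_subset[OF cont_u]) auto
      fix x assume x: "0 < x" "x < r"
      have dsq: "((\<lambda>r. (u r)\<^sup>2) has_real_derivative 2 * u x * u' x) (at x)"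
        using DERIV_power[OF du[OF x(1)], of 2] by (simp add: mult_ac)
      show "((\<lambda>r. poho r - (u r)\<^sup>2 * S r) has_real_derivative (l - 2 * x\<^sup>2) * (u x)\<^sup>2 * x ^ (d - 1)
          - (2 * u x * u' x * S x + (l - 2 * x\<^sup>2) * x ^ (d - 1) * (u x)\<^sup>2)) (at x)"
        by (intro DERIV_diff poho_deriv[OF x(1)] DERIV_mult dsq dS)
      have "u x * u' x * S x \<le> 0" using Sx[OF x] u'_neg[OF x(1)] u_pos[of x] x
        by (intro mult_nonpos_nonneg mult_nonneg_nonpos) auto
      then show "(l - 2 * x\<^sup>2) * (u x)\<^sup>2 * x ^ (d - 1)
          - (2 * u x * u' x * S x + (l - 2 * x\<^sup>2) * x ^ (d - 1) * (u x)\<^sup>2) \<ge> 0" by (simp add: algebra_simps)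
    qed
    then show ?thesis using poho_0 d by (simp add: S_def power_0_left)
  qed
qed

section \<open>Behaviour at the origin and the uniform bound by the soliton\<close>

lemma u_at_0: "(u \<longlongrightarrow> b) (at_right 0)"
proof -
  have "(u \<longlongrightarrow> u 0) (at 0 within {0..})" using cont_u by (simp add: continuous_on_def)
  then show ?thesis by (simp add: u0 at_within_Ici_at_right)
qed

text \<open>As \<open>r\<close> tends to 0, \<open>u' r / r\<close> tends to \<open>u'' 0\<close>,
  so the limit of the equation reads \<open>d * u'' 0 = - (b powr (2 * p) + l) * b\<close>.\<close>

lemma u''_0: "u'' 0 = - (b powr (2 * p) + l) * b / real d"
proof -
  have c: "(u'' \<longlongrightarrow> u'' 0) (at_right 0)"
  proof -
    have "(u'' \<longlongrightarrow> u'' 0) (at 0 within {0..})" using cont'' by (simp add: continuous_on_def)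
    then show ?thesis by (simp add: at_within_Ici_at_right)
  qed
  have "((\<lambda>r. (u' r - u' 0) / (r - 0)) \<longlongrightarrow> u'' 0) (at 0 within {0..})"
    using du'0[of 0] by (simp add: has_field_derivative_iff)
  then have q: "((\<lambda>r. u' r / r) \<longlongrightarrow> u'' 0) (at_right 0)" by (simp add: u'0 at_within_Ici_at_right)
  have cu: "(u \<longlongrightarrow> b) (at_right 0)" by (rule u_at_0)
  have "((\<lambda>r. (r\<^sup>2 - l - u r powr (2 * p)) * u r - (real d - 1) * (u' r / r)) \<longlongrightarrow>
     (0\<^sup>2 - l - b powr (2 * p)) * b - (real d - 1) * u'' 0) (at_right 0)"
    using b by (intro tendsto_intros cu q) auto
  moreover have "\<forall>\<^sub>F r in at_right 0. (r\<^sup>2 - l - u r powr (2 * p)) * u r - (real d - 1) * (u' r / r) = u'' r"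
    using eventually_at_right_less[of 0] by eventually_elim (simp add: ode)
  ultimately have "(u'' \<longlongrightarrow> (0\<^sup>2 - l - b powr (2 * p)) * b - (real d - 1) * u'' 0) (at_right 0)"
    by (rule Lim_transform_eventually)
  from tendsto_unique[OF _ c this] show ?thesis using d by (simp add: field_simps)
qed

text \<open>The function \<open>w = u powr (- p)\<close> is exactly quadratic in \<open>r\<close> for the Aubin--Talenti soliton.
  By the lower bound on the Pohozaev functional its derivative with respect to \<open>r\<^sup>2 / 2\<close>
  is almost nondecreasing, independently of \<open>l\<close>.\<close>

lemma u_le_aubin_talenti:
  assumes r: "0 \<le> r" "r \<le> 1"
  shows "u r \<le> 2 powr (1 / p) * aubin_talenti p b r"
proof -
  define w where "w = (\<lambda>r. u r powr (- p))"
  define q where "q = (\<lambda>r. - p * u r powr (- p - 1) * (u' r / r))"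
  define q' where "q' = (\<lambda>r. (p / r) * u r powr (- p - 2) * ((p + 1) * (u' r)\<^sup>2 + real d * (u r * u' r / r)
       - (r\<^sup>2 - l - u r powr (2 * p)) * (u r)\<^sup>2))"
  \<comment> \<open>The correction is designed so that its derivative is
    \<open>- r * (r\<^sup>2 / 2)\<close>: the terms with \<open>q\<close> then cancel in the
    derivative \<open>q' * \<psi> + r * w\<close> of \<open>X\<close>, and the quotient rule makes
    \<open>r * X / \<psi>\<^sup>2\<close> the derivative of \<open>w / \<psi>\<close>. Thus
    \<open>q' \<ge> - r * w\<close> drives both monotonicity steps.\<close>
  define \<psi> where "\<psi> = (\<lambda>r::real. 1 - r ^ 4 / 8)"
  define X where "X = (\<lambda>r. q r * \<psi> r + w r * (r\<^sup>2 / 2))"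
  define q0 where "q0 = p / real d * (b powr p + l * b powr (- p))"
  have q0: "q0 \<ge> p / real d * b powr p" "q0 \<ge> 0"
  proof -
    have "b powr p \<le> b powr p + l * b powr (- p)" using l_pos b by simp
    then show *: "q0 \<ge> p / real d * b powr p" unfolding q0_def using p d by (intro mult_left_mono) auto
    show "q0 \<ge> 0" by (rule order_trans[OF _ *]) (use p d b in auto)
  qed
  have wpos: "w r > 0" if "r \<ge> 0" for r using u_pos[OF that] by (simp add: w_def)
  have dw: "(w has_real_derivative r * q r) (at r)" if r: "r > 0" for r
  proof -
    have "(w has_real_derivative (- p * u r powr (- p - 1)) * u' r) (at r)"
      unfolding w_def using u_pos[of r] r
      by (intro DERIV_chain2[where f="\<lambda>x. x powr (- p)" and g=u, OF has_real_derivative_powr du]) auto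
    then show ?thesis using r by (simp add: q_def)
  qed
  have dq: "(q has_real_derivative q' r) (at r)" if r: "r > 0" for r
  proof -
    have ur: "u r > 0" using u_pos r by simp
    have d1: "((\<lambda>r. u r powr (- p - 1)) has_real_derivative ((- p - 1) * u r powr (- p - 1 - 1)) * u' r) (at r)"
      using ur r by (intro DERIV_chain2[where f="\<lambda>x. x powr (- p - 1)" and g=u, OF has_real_derivative_powr du]) auto
    have d2: "((\<lambda>r. u' r / r) has_real_derivative (u'' r * r - u' r * 1) / (r * r)) (at r)"
      using r by (intro DERIV_divide du' DERIV_ident) auto
    have "(q has_real_derivative - p * (((- p - 1) * u r powr (- p - 1 - 1)) * u' r * (u' r / r)
        + (u'' r * r - u' r * 1) / (r * r) * u r powr (- p - 1))) (at r)"
      unfolding q_def using DERIV_cmult[OF DERIV_mult[OF d1 d2], of "- p"] by (simp add: mult.assoc)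
    also have "- p * (((- p - 1) * u r powr (- p - 1 - 1)) * u' r * (u' r / r)
        + (u'' r * r - u' r * 1) / (r * r) * u r powr (- p - 1)) = q' r"
    proof -
      have e: "u r powr (- p - 1) = u r * u r powr (- p - 2)" "- p - 1 - 1 = - p - 2"
      proof -
        have h: "1 + (- p - 2) = - p - 1" by simp
        show "u r powr (- p - 1) = u r * u r powr (- p - 2)"
          using powr_mult_base[of "u r" "- p - 2"] ur unfolding h by simp
      qed simp
      show ?thesis unfolding q'_def ode[OF r] e using r by (simp add: field_simps power2_eq_square)
    qed
    finally show ?thesis .
  qed
  \<comment> \<open>\<open>T\<close> is \<open>2 * poho r / r ^ d\<close>. The last bracket in
    \<open>q'\<close> equals \<open>(p + 1) * T + p * (r\<^sup>2 - l) * (u r)\<^sup>2\<close>, so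
    \<open>poho_lower\<close> bounds it from below.\<close>
  have q'_ge: "q' r \<ge> - r * w r" if r: "r > 0" for r
  proof -
    have ur: "u r > 0" using u_pos r by simp
    define T where "T = (u' r)\<^sup>2 + (real d - 2) * (u r * u' r / r) + u r powr (2 * p) * (u r)\<^sup>2 / (p + 1) - (r\<^sup>2 - l) * (u r)\<^sup>2"
    have pw: "r ^ (d - 1) = r ^ d / r" "r ^ (d + 2) = r ^ d * r\<^sup>2"
      using r d by (simp_all add: power_diff power_add power2_eq_square)
    have w2: "u r powr (2 * p + 2) = u r powr (2 * p) * (u r)\<^sup>2" using ur by (simp add: powr_add powr_numeral)
    define ip where "ip = inverse (p + 1)"
    have ip: "x / (p + 1) = x * ip" for x by (simp add: divide_inverse ip_def)
    have "2 * poho r = r ^ d * T"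
      unfolding poho_def T_def pw w2 ip using r
      by (simp add: algebra_simps add_divide_distrib diff_divide_distrib)
    then have "r ^ d * T \<ge> 2 * ((u r)\<^sup>2 * (l * r ^ d / real d - 2 * r ^ (d + 2) / (real d + 2)))"
      using poho_lower[of r] r by linarith
    also have "2 * ((u r)\<^sup>2 * (l * r ^ d / real d - 2 * r ^ (d + 2) / (real d + 2)))
       = r ^ d * (2 * (u r)\<^sup>2 * (l / real d - 2 * r\<^sup>2 / (real d + 2)))"
      unfolding pw by (simp add: algebra_simps)
    finally have T: "T \<ge> 2 * (u r)\<^sup>2 * (l / real d - 2 * r\<^sup>2 / (real d + 2))"
      using r by (simp add: mult_le_cancel_left)
    have pd: "(p + 1) * (real d - 2) = real d" using p_eq(3) d by simp
    have "(p + 1) * (u' r)\<^sup>2 + real d * (u r * u' r / r) - (r\<^sup>2 - l - u r powr (2 * p)) * (u r)\<^sup>2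
       = (p + 1) * T + p * (r\<^sup>2 - l) * (u r)\<^sup>2"
    proof -
      have "(p + 1) * T = (p + 1) * (u' r)\<^sup>2 + ((p + 1) * (real d - 2)) * (u r * u' r / r)
        + u r powr (2 * p) * (u r)\<^sup>2 - (p + 1) * (r\<^sup>2 - l) * (u r)\<^sup>2"
      proof -
        have "(p + 1) * (A + m * B + W / (p + 1) - c * C) = (p + 1) * A + ((p + 1) * m) * B + W - (p + 1) * c * C"
          for A B C W c m :: real using p(1) by (simp add: field_simps)
        then show ?thesis unfolding T_def by blast
      qed
      then show ?thesis unfolding pd by (simp add: algebra_simps)
    qed
    also have "\<dots> \<ge> (p + 1) * (2 * (u r)\<^sup>2 * (l / real d - 2 * r\<^sup>2 / (real d + 2))) + p * (r\<^sup>2 - l) * (u r)\<^sup>2"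
      using T p by (intro add_right_mono mult_left_mono) auto
    finally have ge: "(p + 1) * (u' r)\<^sup>2 + real d * (u r * u' r / r) - (r\<^sup>2 - l - u r powr (2 * p)) * (u r)\<^sup>2
       \<ge> (p + 1) * (2 * (u r)\<^sup>2 * (l / real d - 2 * r\<^sup>2 / (real d + 2))) + p * (r\<^sup>2 - l) * (u r)\<^sup>2" .
    have "(p + 1) * (2 * (u r)\<^sup>2 * (l / real d - 2 * r\<^sup>2 / (real d + 2))) + p * (r\<^sup>2 - l) * (u r)\<^sup>2
      = (u r)\<^sup>2 * (2 * (p + 1) / real d * l - p * l + r\<^sup>2 * (p - 4 * (p + 1) / (real d + 2)))"
      by (simp add: field_simps)
    \<comment> \<open>The eigenvalue drops out here by the critical relation; only a term of size
      \<open>r\<^sup>2 * (u r)\<^sup>2\<close> is left to bound.\<close>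
    also have "2 * (p + 1) / real d = p" using p(4) d by (simp add: field_simps)
    also have "(u r)\<^sup>2 * (p * l - p * l + r\<^sup>2 * (p - 4 * (p + 1) / (real d + 2))) \<ge> (u r)\<^sup>2 * (- (r\<^sup>2))"
    proof -
      have "4 * (p + 1) / (real d + 2) \<le> p + 1" 
        using mult_left_mono[of 4 "real d + 2" "p + 1"] p d by (simp add: divide_le_eq algebra_simps)
      then have "p - 4 * (p + 1) / (real d + 2) \<ge> - 1" by linarith
      then have "r\<^sup>2 * (p - 4 * (p + 1) / (real d + 2)) \<ge> r\<^sup>2 * (- 1)" by (intro mult_left_mono) auto
      then show ?thesis by (intro mult_left_mono) auto
    qed
    finally have ge2: "(p + 1) * (u' r)\<^sup>2 + real d * (u r * u' r / r) - (r\<^sup>2 - l - u r powr (2 * p)) * (u r)\<^sup>2 \<ge> (u r)\<^sup>2 * (- (r\<^sup>2))"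
      using ge by linarith
    have "q' r \<ge> (p / r) * u r powr (- p - 2) * ((u r)\<^sup>2 * (- (r\<^sup>2)))"
      unfolding q'_def using p r by (intro mult_left_mono ge2) auto
    also have "(p / r) * u r powr (- p - 2) * ((u r)\<^sup>2 * (- (r\<^sup>2))) = - p * (r * w r)"
      using r ur by (simp add: w_def powr_diff powr_numeral field_simps power2_eq_square)
    also have "- p * (r * w r) \<ge> - 1 * (r * w r)" using p r wpos[of r] by (intro mult_right_mono) auto
    finally show ?thesis by simp
  qed
  have dpsi: "(\<psi> has_real_derivative (- (r ^ 3) / 2)) (at r)" for r
    unfolding \<psi>_def by (auto intro!: derivative_eq_intros)
  have psi: "7 / 8 \<le> \<psi> r" "\<psi> r \<le> 1" if "0 \<le> r" "r \<le> 1" for r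
    using that by (auto simp: \<psi>_def power_le_one)
  have dX: "(X has_real_derivative q' r * \<psi> r + r * w r) (at r)" if r: "r > 0" for r
  proof -
    have d1: "((\<lambda>r::real. r\<^sup>2 / 2) has_real_derivative r) (at r)" by (auto intro!: derivative_eq_intros)
    have "(X has_real_derivative (q' r * \<psi> r + (- (r ^ 3) / 2) * q r) + (r * q r * (r\<^sup>2 / 2) + r * w r)) (at r)"
      unfolding X_def by (intro DERIV_add DERIV_mult dq dpsi dw d1 r)
    also have "(q' r * \<psi> r + (- (r ^ 3) / 2) * q r) + (r * q r * (r\<^sup>2 / 2) + r * w r) = q' r * \<psi> r + r * w r"
      by (simp add: power3_eq_cube power2_eq_square)
    finally show ?thesis .
  qed
  have X0: "(X \<longlongrightarrow> q0) (at_right 0)"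
  proof -
    have "((\<lambda>r. (u' r - u' 0) / (r - 0)) \<longlongrightarrow> u'' 0) (at 0 within {0..})"
      using du'0[of 0] by (simp add: has_field_derivative_iff)
    then have t: "((\<lambda>r. u' r / r) \<longlongrightarrow> u'' 0) (at_right 0)" by (simp add: u'0 at_within_Ici_at_right)
    have cu: "(u \<longlongrightarrow> b) (at_right 0)" by (rule u_at_0)
    have "(X \<longlongrightarrow> - p * b powr (- p - 1) * u'' 0 * (1 - 0 ^ 4 / 8) + b powr (- p) * (0\<^sup>2 / 2)) (at_right 0)"
      unfolding X_def q_def w_def \<psi>_def using b by (intro tendsto_intros t cu) auto
    also have "- p * b powr (- p - 1) * u'' 0 * (1 - 0 ^ 4 / 8) + b powr (- p) * (0\<^sup>2 / 2) = q0"
    proof -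
      have e1: "b powr (- p - 1) * b = b powr (- p)" using b by (simp add: powr_diff)
      have e2: "b powr (- p) * b powr (2 * p) = b powr p" by (simp add: powr_add[symmetric])
      have "- p * b powr (- p - 1) * u'' 0 * (1 - 0 ^ 4 / 8) + b powr (- p) * (0\<^sup>2 / 2)
         = p / real d * ((b powr (- p - 1) * b) * (b powr (2 * p) + l))"
        unfolding u''_0 using d by (simp add: field_simps)
      also have "\<dots> = q0" unfolding e1 distrib_left e2 q0_def by (simp add: algebra_simps)
      finally show ?thesis .
    qed
    finally show ?thesis .
  qed
  have Xge: "X r \<ge> q0" if r: "0 < r" "r \<le> 1" for r
  proof (rule tendsto_upperbound[OF X0])
    have "X s \<le> X r" if s: "0 < s" "s < r" for s
    proof (rule nondecreasing_Icc[of s r])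
      show "(X has_real_derivative q' x * \<psi> x + x * w x) (at x)" if "s < x" for x
        using that s by (intro dX) auto
      show "continuous_on {s..r} X"
        by (intro continuous_at_imp_continuous_on ballI DERIV_isCont[OF dX]) (use s in auto)
      fix x assume x: "s < x" "x < r"
      have "q' x * \<psi> x \<ge> (- x * w x) * \<psi> x"
        using q'_ge[of x] psi(1)[of x] x s r by (intro mult_right_mono) auto
      moreover have "x * w x * \<psi> x \<le> x * w x * 1"
        using psi(2)[of x] x s r wpos[of x] by (intro mult_left_mono) auto
      ultimately show "0 \<le> q' x * \<psi> x + x * w x" by simp
    qed (use s in auto)
    then show "\<forall>\<^sub>F s in at_right 0. X s \<le> X r"
      using r by (auto simp: eventually_at_right_field)
  qed simp
  have "w 0 / \<psi> 0 - q0 * 0\<^sup>2 / 2 \<le> w r / \<psi> r - q0 * r\<^sup>2 / 2"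
  proof (rule nondecreasing_Icc[OF r(1)])
    have nz: "\<psi> x \<noteq> 0" "u x \<noteq> 0" if "x \<in> {0..r}" for x
      using psi(1)[of x] u_pos[of x] that r by auto
    show "continuous_on {0..r} (\<lambda>r. w r / \<psi> r - q0 * r\<^sup>2 / 2)"
      unfolding w_def
      by (intro continuous_intros continuous_on_subset[OF cont_u]
          continuous_at_imp_continuous_on[of _ \<psi>] ballI DERIV_isCont[OF dpsi]) (use nz in auto)
    fix x assume x: "0 < x" "x < r"
    have p1: "\<psi> x > 0" "\<psi> x \<le> 1" using psi[of x] x r by auto
    have dd: "((\<lambda>r::real. q0 * r\<^sup>2 / 2) has_real_derivative q0 * x) (at x)" by (auto intro!: derivative_eq_intros)
    have "((\<lambda>r. w r / \<psi> r - q0 * r\<^sup>2 / 2) has_real_derivative ((x * q x * \<psi> x - w x * (- (x ^ 3) / 2)) / (\<psi> x * \<psi> x)) - q0 * x) (at x)"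
      using p1 by (intro DERIV_diff DERIV_divide dw dpsi dd x) auto
    also have "x * q x * \<psi> x - w x * (- (x ^ 3) / 2) = x * X x"
      by (simp add: X_def algebra_simps power3_eq_cube power2_eq_square)
    finally show "((\<lambda>r. w r / \<psi> r - q0 * r\<^sup>2 / 2) has_real_derivative x * X x / (\<psi> x * \<psi> x) - q0 * x) (at x)" .
    have "\<psi> x * \<psi> x \<le> 1" using p1 by (simp add: mult_le_one)
    moreover have "x * X x \<ge> x * q0" using Xge[of x] x r by (intro mult_left_mono) auto
    moreover have "x * q0 \<ge> 0" using q0 x by simp
    ultimately have "x * q0 * (\<psi> x * \<psi> x) \<le> x * X x"
      by (meson mult_left_le order_trans)
    then show "x * X x / (\<psi> x * \<psi> x) - q0 * x \<ge> 0" using p1 by (simp add: field_simps)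
  qed
  then have "b powr (- p) + q0 * r\<^sup>2 / 2 \<le> w r / \<psi> r" by (simp add: w_def u0 \<psi>_def)
  \<comment> \<open>On \<open>[0, 1]\<close> the loss \<open>1 / \<psi> \<le> 8 / 7\<close> is
    rounded up to 2; raised to the power \<open>1 / p\<close> it becomes the factor
    \<open>2 powr (1 / p)\<close>.\<close>
  moreover have "w r / \<psi> r \<le> w r / (7 / 8)"
    using psi(1)[OF r] wpos[OF r(1)] by (intro divide_left_mono) auto
  ultimately have "b powr (- p) + q0 * r\<^sup>2 / 2 \<le> 2 * w r" using wpos[OF r(1)] by simp
  moreover have "(p / real d * b powr p) * r\<^sup>2 / 2 \<le> q0 * r\<^sup>2 / 2"
    using q0 by (intro divide_right_mono mult_right_mono) auto
  ultimately have "b powr (- p) + (p / real d * b powr p) * r\<^sup>2 / 2 \<le> 2 * w r" by linarith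
  also have "b powr (- p) + (p / real d * b powr p) * r\<^sup>2 / 2 = b powr (- p) * (1 + alpha_p p * b powr (2 * p) * r\<^sup>2)"
  proof -
    have "b powr (- p) * b powr (2 * p) = b powr p" by (simp add: powr_add[symmetric])
    then show ?thesis unfolding alpha_p_eq(1) by (simp add: algebra_simps)
  qed
  finally have main: "b powr (- p) * (1 + alpha_p p * b powr (2 * p) * r\<^sup>2) \<le> 2 * u r powr (- p)"
    by (simp add: w_def)
  define K where "K = 1 + alpha_p p * b powr (2 * p) * r\<^sup>2"
  have K: "K \<ge> 1" using alpha_p_eq(2) by (simp add: K_def)
  have "u r = (u r powr (- p)) powr (- 1 / p)"
    using u_pos[OF r(1)] p by (simp add: powr_powr)
  also have "\<dots> \<le> (b powr (- p) * K / 2) powr (- 1 / p)"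
    using main K b p by (intro powr_mono2') (auto simp: K_def)
  also have "\<dots> = (b powr (- p)) powr (- 1 / p) * K powr (- 1 / p) * (1 / 2) powr (- 1 / p)"
    using K b by (simp add: powr_mult powr_divide powr_minus field_simps)
  also have "(b powr (- p)) powr (- 1 / p) = b" using b p by (simp add: powr_powr)
  also have "K powr (- 1 / p) = 1 / K powr (1 / p)" using K by (simp add: powr_minus_divide)
  also have "(1 / 2) powr (- 1 / p) = 2 powr (1 / p)" by (simp add: powr_divide powr_minus_divide)
  finally show ?thesis by (simp add: aubin_talenti_def K_def mult.commute)
qed

end

section \<open>Comparison with the Aubin--Talenti soliton\<close>

lemma aubin_talenti_pos: "b > 0 \<Longrightarrow> p > 0 \<Longrightarrow> aubin_talenti p b r > 0"
proof -
  assume *: "b > 0" "p > 0"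
  have "1 + alpha_p p * b powr (2 * p) * r\<^sup>2 > 0" using * by (intro add_pos_nonneg) (auto simp: alpha_p_def)
  then show ?thesis using * by (simp add: aubin_talenti_def)
qed

text \<open>Dropping the 1 in the denominator leaves the tail of the soliton, which at fixed radius
  is of size \<open>1 / b\<close>.\<close>

lemma aubin_talenti_le:
  assumes b: "b > 0" and p: "p > 0" and r: "r > 0"
  shows "aubin_talenti p b r \<le> alpha_p p powr (- 1 / p) / (b * r powr (2 / p))"
proof -
  have al: "alpha_p p > 0" using p by (simp add: alpha_p_def)
  have "(alpha_p p * b powr (2 * p) * r\<^sup>2) powr (1 / p) = alpha_p p powr (1 / p) * b\<^sup>2 * r powr (2 / p)"
  proof -
    have "(b powr (2 * p)) powr (1 / p) = b\<^sup>2" using b p by (simp add: powr_powr powr_numeral)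
    moreover have "(r\<^sup>2) powr (1 / p) = r powr (2 / p)" 
    proof -
      have "r\<^sup>2 = r powr 2" using r by simp
      then show ?thesis by (simp add: powr_powr del: powr_numeral)
    qed
    ultimately show ?thesis using b r al by (simp add: powr_mult)
  qed
  moreover have "(alpha_p p * b powr (2 * p) * r\<^sup>2) powr (1 / p) \<le> (1 + alpha_p p * b powr (2 * p) * r\<^sup>2) powr (1 / p)"
    using al p by (intro powr_mono2) auto
  ultimately have le: "alpha_p p powr (1 / p) * b\<^sup>2 * r powr (2 / p) \<le> (1 + alpha_p p * b powr (2 * p) * r\<^sup>2) powr (1 / p)"
    by simp
  have pos: "0 < alpha_p p powr (1 / p) * b\<^sup>2 * r powr (2 / p)" using al b r by simp
  have "aubin_talenti p b r \<le> b / (alpha_p p powr (1 / p) * b\<^sup>2 * r powr (2 / p))"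
    unfolding aubin_talenti_def using b pos le by (intro divide_left_mono mult_pos_pos) auto
  also have "\<dots> = alpha_p p powr (- 1 / p) / (b * r powr (2 / p))"
    using b r al by (simp add: powr_minus_divide power2_eq_square)
  finally show ?thesis .
qed

lemma aubin_talenti_powr:
  assumes "b > 0" "p > 0"
  shows "aubin_talenti p b r powr (2 * p) = b powr (2 * p) / (1 + alpha_p p * b powr (2 * p) * r\<^sup>2)\<^sup>2"
proof -
  have "1 + alpha_p p * b powr (2 * p) * r\<^sup>2 > 0" using assms by (simp add: alpha_p_def add_pos_nonneg)
  then show ?thesis unfolding aubin_talenti_def using assms
    by (simp add: powr_divide powr_powr powr_numeral)
qed

text \<open>The equation is multiplied by \<open>r\<close> so that it also holds at the origin. The
  critical value \<open>2 * (1 / p + 1) = d\<close> collapses the bracket to the constant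
  \<open>d\<close>, and \<open>alpha_p p = p / (2 * d)\<close> then fixes the coefficient.\<close>

lemma aubin_talenti_ode:
  assumes d: "d > 2" and b: "b > 0" and p_def: "p = crit_p d"
  obtains U1 U2 where
    "\<And>r. (aubin_talenti p b has_real_derivative U1 r) (at r)"
    "\<And>r. (U1 has_real_derivative U2 r) (at r)"
    "\<And>r. r * U2 r + (real d - 1) * U1 r = - r * (aubin_talenti p b r powr (2 * p) * aubin_talenti p b r)"
proof -
  have p: "p > 0" "2 * (1 / p + 1) = real d" using d by (auto simp: p_def crit_p_def field_simps)
  have al: "alpha_p p = p / (2 * real d)"
  proof -
    have pd: "p * real d = 2 * (1 + p)" using p by (simp add: field_simps)
    have "p * (p * (2 * real d)) = 2 * p * (p * real d)" by simp
    also have "\<dots> = p * (4 * (1 + p))" unfolding pd by (simp add: algebra_simps)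
    finally show ?thesis using p d unfolding alpha_p_def by (simp add: field_simps power2_eq_square)
  qed
  have alp: "alpha_p p > 0" using p by (simp add: alpha_p_def)
  define B where "B = alpha_p p * b powr (2 * p)"
  have B: "B > 0" using alp b by (simp add: B_def)
  define K where "K = (\<lambda>r::real. 1 + B * r\<^sup>2)"
  have K: "K r > 0" for r using B by (simp add: K_def add_pos_nonneg)
  have dK: "(K has_real_derivative 2 * B * r) (at r)" for r
    unfolding K_def by (auto intro!: derivative_eq_intros)
  have dKp: "((\<lambda>r. K r powr e) has_real_derivative e * K r powr (e - 1) * (2 * B * r)) (at r)" for e r
    by (rule DERIV_chain2[where f="\<lambda>x. x powr e" and g=K, OF has_real_derivative_powr[OF K] dK])
  have U: "aubin_talenti p b r = b * K r powr (- 1 / p)" for r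
    unfolding aubin_talenti_def K_def B_def by (simp add: powr_minus_divide)
  define U1 where "U1 = (\<lambda>r. b * ((- 1 / p) * K r powr (- 1 / p - 1) * (2 * B * r)))"
  define U2 where "U2 = (\<lambda>r. b * ((- 1 / p) * (2 * B)) * (K r powr (- 1 / p - 1) + r * ((- 1 / p - 1) * K r powr (- 1 / p - 1 - 1) * (2 * B * r))))"
  show thesis
  proof
    show "(aubin_talenti p b has_real_derivative U1 r) (at r)" for r
      unfolding U[abs_def] U1_def by (intro DERIV_cmult dKp)
    show "(U1 has_real_derivative U2 r) (at r)" for r
    proof -
      have "((\<lambda>r. b * ((- 1 / p) * (2 * B)) * (r * K r powr (- 1 / p - 1))) has_real_derivative
         b * ((- 1 / p) * (2 * B)) * (1 * K r powr (- 1 / p - 1) + ((- 1 / p - 1) * K r powr (- 1 / p - 1 - 1) * (2 * B * r)) * r)) (at r)"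
        by (intro DERIV_cmult DERIV_mult dKp DERIV_ident)
      then show ?thesis unfolding U1_def U2_def by (simp add: mult_ac)
    qed
    show "r * U2 r + (real d - 1) * U1 r = - r * (aubin_talenti p b r powr (2 * p) * aubin_talenti p b r)" for r
    proof -
      define k where "k = K r powr (- 1 / p - 1 - 1)"
      have k1: "K r powr (- 1 / p - 1) = K r * k"
      proof -
        have h: "1 + (- 1 / p - 1 - 1) = - 1 / p - 1" by simp
        show ?thesis using powr_mult_base[of "K r" "- 1 / p - 1 - 1"] K[of r] unfolding h k_def by simp
      qed
      have k2: "K r powr (- 1 / p) = (K r)\<^sup>2 * k"
      proof -
        have "K r powr (- 1 / p) = K r powr (2 + (- 1 / p - 1 - 1))" by simp
        also have "\<dots> = (K r)\<^sup>2 * k" unfolding powr_add k_def using K[of r] by (simp add: powr_numeral)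
        finally show ?thesis .
      qed
      have "r * U2 r + (real d - 1) * U1 r = - r * (b * (2 * B / p) * k) * (K r + (real d - 1) * K r - 2 * (1 / p + 1) * (B * r\<^sup>2))"
        unfolding U1_def U2_def k1 k_def[symmetric] using p(1) by (simp add: field_simps power2_eq_square)
      also have "K r + (real d - 1) * K r - 2 * (1 / p + 1) * (B * r\<^sup>2) = real d"
        unfolding p(2) by (simp add: K_def algebra_simps)
      also have "- r * (b * (2 * B / p) * k) * real d = - r * (b powr (2 * p) * b * k)"
        unfolding B_def al using p d by (simp add: field_simps)
      also have "b powr (2 * p) * b * k = aubin_talenti p b r powr (2 * p) * aubin_talenti p b r"
        unfolding aubin_talenti_powr[OF b p(1)] unfolding U k2 using K[of r]
        unfolding K_def B_def by (simp add: field_simps)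
      finally show ?thesis .
    qed
  qed
qed

lemma powr_diff_le:
  fixes x y M e :: real
  assumes "0 < x" "x \<le> M" "0 < y" "y \<le> M" "e \<ge> 0"
  shows "\<bar>x powr e * x - y powr e * y\<bar> \<le> (e + 1) * M powr e * \<bar>x - y\<bar>"
proof -
  have *: "\<bar>x powr (e + 1) - y powr (e + 1)\<bar> \<le> (e + 1) * M powr e * \<bar>x - y\<bar>"
    if "0 < x" "x \<le> M" "0 < y" "y \<le> M" "x < y" for x y :: real
  proof -
    have "\<exists>z>x. z < y \<and> y powr (e + 1) - x powr (e + 1) = (y - x) * ((e + 1) * z powr e)"
    proof (rule mvt_simple_DERIV[OF \<open>x < y\<close>])
      fix z assume "x \<le> z" "z \<le> y"
      then have "z > 0" using that by simp
      from has_real_derivative_powr[OF this, of "e + 1"]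
      show "((\<lambda>x. x powr (e + 1)) has_real_derivative (e + 1) * z powr e) (at z within {x..y})"
        by (simp add: has_field_derivative_at_within)
    qed
    then obtain z where z: "x < z" "z < y" "y powr (e + 1) - x powr (e + 1) = (y - x) * ((e + 1) * z powr e)" by blast
    have "(e + 1) * z powr e \<le> (e + 1) * M powr e"
      using z that assms(5) by (intro mult_left_mono powr_mono2) auto
    then have "(y - x) * ((e + 1) * z powr e) \<le> (y - x) * ((e + 1) * M powr e)"
      by (rule mult_left_mono) (use that in auto)
    moreover have "0 \<le> (y - x) * ((e + 1) * z powr e)" using that assms(5) by simp
    ultimately have "\<bar>x powr (e + 1) - y powr (e + 1)\<bar> \<le> (y - x) * ((e + 1) * M powr e)"
      using z(3) by linarith
    also have "\<dots> = (e + 1) * M powr e * \<bar>x - y\<bar>" using that by simp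
    finally show ?thesis .
  qed
  have e: "x powr e * x = x powr (e + 1)" "y powr e * y = y powr (e + 1)"
    using assms by (simp_all add: powr_add)
  consider "x < y" | "x = y" | "y < x" by linarith
  then show ?thesis
  proof cases
    case 1 then show ?thesis using *[of x y] assms unfolding e by simp
  next
    case 3 then show ?thesis using *[of y x] assms unfolding e by (simp add: abs_minus_commute)
  qed simp
qed

context ground_state
begin

lemma r_powr: "r > 0 \<Longrightarrow> r powr (2 / p) = r ^ (d - 2)"
  unfolding p_eq using d by (simp add: powr_realpow[symmetric] of_nat_diff)

text \<open>\<open>K1\<close> is the loss factor of \<open>u_le_aubin_talenti\<close> times the
  coefficient of the soliton tail. The exponent in \<open>K2\<close> is \<open>R\<^sup>2 / 4\<close>
  for the radius with \<open>R\<^sup>2 = 2 * (d + 1)\<close> beyond which the Gaussian decay is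
  established.\<close>

definition K1 where "K1 = 2 powr (1 / p) * alpha_p p powr (- 1 / p)"
definition K2 where "K2 = K1 * exp ((real d + 1) / 2)"

lemma K12: "K1 > 0" "K2 > 0" "K1 \<le> K2"
  using alpha_p_eq(2) by (auto simp: K1_def K2_def)

lemma u_le_near: 
  assumes r: "0 < r" "r \<le> 1"
  shows "u r \<le> K1 / (b * r ^ (d - 2))"
proof -
  have "u r \<le> 2 powr (1 / p) * aubin_talenti p b r" using r by (intro u_le_aubin_talenti) auto
  also have "\<dots> \<le> 2 powr (1 / p) * (alpha_p p powr (- 1 / p) / (b * r powr (2 / p)))"
    using b p r by (intro mult_left_mono aubin_talenti_le) auto
  finally show ?thesis using r_powr[OF r(1)] by (simp add: K1_def)
qed

text \<open>For \<open>b \<ge> K1\<close> one has \<open>u \<le> 1\<close> on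
  \<open>[1, \<infinity>)\<close>, hence
  \<open>l + u powr (2 * p) \<le> d + 1 \<le> r\<^sup>2 / 2\<close> from a radius depending on
  \<open>d\<close> only. This makes the Gaussian bound uniform in \<open>b\<close>.\<close>

lemma u_le_far: 
  assumes r: "r \<ge> 1" and bK: "b \<ge> K1"
  shows "u r \<le> K2 / b * exp (- r\<^sup>2 / 4)"
proof -
  have u1: "u 1 \<le> K1 / b" using u_le_near[of 1] by simp
  define R where "R = sqrt (2 * (real d + 1))"
  have R2: "R\<^sup>2 = 2 * (real d + 1)" by (simp add: R_def)
  have "1\<^sup>2 \<le> R\<^sup>2" unfolding R2 by simp
  then have R: "R \<ge> 1" unfolding R_def by (intro power2_le_imp_le[of 1]) auto
  have K2: "K1 * exp (R\<^sup>2 / 4) = K2" unfolding R2 K2_def by (simp add: field_simps)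
  show ?thesis
  proof (cases "r \<ge> R")
    case True
    have "u r * exp (r\<^sup>2 / 4) \<le> u R * exp (R\<^sup>2 / 4)"
    proof (rule u_gaussian_decay[OF _ _ True])
      fix s assume s: "s \<ge> R"
      have "u s \<le> u 1" using s R by (intro u_antimono) auto
      also have "\<dots> \<le> 1" using u1 bK b by (auto intro: order_trans simp: divide_le_eq)
      finally have "u s powr (2 * p) \<le> 1 powr (2 * p)" using u_pos[of s] s R p by (intro powr_mono2) auto
      moreover have "R\<^sup>2 \<le> s\<^sup>2" using s R by (intro power_mono) auto
      ultimately show "l + u s powr (2 * p) \<le> s\<^sup>2 / 2" using l_less_d unfolding R2 by simp
    qed (use R in auto)
    also have "\<dots> \<le> K1 / b * exp (R\<^sup>2 / 4)"
      using u_antimono[of 1 R] u1 R by (intro mult_right_mono) auto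
    also have "\<dots> = K2 / b" using K2 by simp
    finally have "u r * exp (r\<^sup>2 / 4) * exp (- r\<^sup>2 / 4) \<le> K2 / b * exp (- r\<^sup>2 / 4)" by (intro mult_right_mono) auto
    then show ?thesis by (simp add: mult.assoc mult_exp_exp)
  next
    case False
    have "u r \<le> K1 / b" using u_antimono[of 1 r] u1 r by simp
    also have "\<dots> \<le> K1 / b * exp (R\<^sup>2 / 4 - r\<^sup>2 / 4)"
    proof -
      have "r\<^sup>2 \<le> R\<^sup>2" using False r by (intro power_mono) auto
      then have "1 \<le> exp (R\<^sup>2 / 4 - r\<^sup>2 / 4)" by simp
      then show ?thesis using K12 b mult_left_mono[of 1 "exp (R\<^sup>2 / 4 - r\<^sup>2 / 4)" "K1 / b"] by simp
    qed
    also have "\<dots> = K1 * exp (R\<^sup>2 / 4) / b * exp (- r\<^sup>2 / 4)" 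
    proof -
      have "exp (R\<^sup>2 / 4 - r\<^sup>2 / 4) = exp (R\<^sup>2 / 4) * exp (- r\<^sup>2 / 4)" by (simp add: mult_exp_exp)
      then show ?thesis by simp
    qed
    finally show ?thesis unfolding K2 .
  qed
qed

text \<open>Gronwall factor times forcing. The exponent bounds the integral of
  \<open>r * L r\<close>, free of \<open>b\<close> because \<open>r * U powr (2 * p)\<close> is
  scale invariant for the soliton \<open>U\<close>; the second factor comes from the integral of
  \<open>r * U\<close>, whose scaled limit is finite since \<open>1 / p > 1\<close>.\<close>

definition D1 where "D1 = exp ((2 * p + 1) * 4 / (2 * alpha_p p)) * (real d * 2 powr (1 / p) / (2 * alpha_p p * (1 / p - 1)))"

lemma D1_nonneg: "D1 \<ge> 0"
  using p alpha_p_eq(2) by (auto simp: D1_def)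

text \<open>The difference \<open>D\<close> satisfies \<open>D'' + (d - 1) / r * D' = h\<close> with
  zero data at 0. The integral \<open>E\<close> of a majorant \<open>e\<close> of
  \<open>\<bar>r * h\<bar>\<close> bounds \<open>\<bar>D\<bar>\<close>, and as \<open>e\<close>
  contains \<open>\<bar>D\<bar>\<close> itself, this closes to a Gronwall inequality.\<close>

lemma u_minus_aubin_talenti:
  assumes r: "0 \<le> r" "r \<le> 1"
  shows "\<bar>u r - aubin_talenti p b r\<bar> \<le> D1 * b powr (1 - 2 * p)"
proof -
  let ?U = "aubin_talenti p b"
  obtain U1 U2 where dU: "\<And>r. (?U has_real_derivative U1 r) (at r)"
    and dU1: "\<And>r. (U1 has_real_derivative U2 r) (at r)"
    and odeU: "\<And>r. r * U2 r + (real d - 1) * U1 r = - r * (?U r powr (2 * p) * ?U r)"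
    by (rule aubin_talenti_ode[of d b p]) (use d b in auto)
  have Upos: "?U r > 0" for r using b p by (intro aubin_talenti_pos)
  have contU: "continuous_on S ?U" for S by (intro continuous_at_imp_continuous_on ballI DERIV_isCont[OF dU])
  have contU1: "continuous_on S U1" for S by (intro continuous_at_imp_continuous_on ballI DERIV_isCont[OF dU1])
  define D where "D = (\<lambda>r. u r - ?U r)"
  define D' where "D' = (\<lambda>r. u' r - U1 r)"
  \<comment> \<open>Lipschitz constant of \<open>x powr (2 * p) * x\<close> up to
    \<open>2 powr (1 / p)\<close> times the soliton; the factor 4 is
    \<open>(2 powr (1 / p)) powr (2 * p)\<close>.\<close>
  define L where "L = (\<lambda>r. (2 * p + 1) * 4 * (b powr (2 * p) / (1 + alpha_p p * b powr (2 * p) * r\<^sup>2)\<^sup>2))"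
  define h where "h = (\<lambda>r. (r\<^sup>2 - l) * u r - (u r powr (2 * p) * u r - ?U r powr (2 * p) * ?U r))"
  define e where "e = (\<lambda>r. r * (L r * \<bar>D r\<bar> + real d * u r))"
  define E where "E = (\<lambda>r. integral {0..r} e)"
  have Xpos: "1 + alpha_p p * b powr (2 * p) * r\<^sup>2 > 0" for r
    using alpha_p_eq(2) by (simp add: add_pos_nonneg)
  have L0: "L r \<ge> 0" for r using p by (simp add: L_def)
  have conte: "continuous_on {0..1} e"
    unfolding e_def D_def L_def
    by (intro continuous_intros continuous_on_subset[OF cont_u] contU) (use Xpos in \<open>auto simp: less_imp_neq[symmetric]\<close>)
  have dE: "(E has_real_derivative e x) (at x)" if x: "0 < x" "x < 1" for x
  proof -
    have "(E has_real_derivative e x) (at x within {0..1})"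
      unfolding E_def by (rule integral_has_real_derivative[OF conte]) (use x in auto)
    then show ?thesis using x by (simp add: at_within_Icc_at)
  qed
  have contE: "continuous_on {0..1} E"
    unfolding E_def by (rule indefinite_integral_continuous_1[OF integrable_continuous_interval[OF conte]])
  have E0: "E 0 = 0" by (simp add: E_def)
  have e0: "e x \<ge> 0" if "0 \<le> x" for x
    unfolding e_def using that L0[of x] u_pos[OF that] by simp
  have Epos: "E x \<ge> 0" if "0 \<le> x" "x \<le> 1" for x
    unfolding E_def by (intro integral_nonneg integrable_continuous_interval continuous_on_subset[OF conte])
      (use that e0 in auto)
  have habs: "\<bar>x * h x\<bar> \<le> e x" if x: "0 \<le> x" "x \<le> 1" for x
  proof -
    have "\<bar>u x powr (2 * p) * u x - ?U x powr (2 * p) * ?U x\<bar>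
       \<le> (2 * p + 1) * (2 powr (1 / p) * ?U x) powr (2 * p) * \<bar>u x - ?U x\<bar>"
    proof (rule powr_diff_le)
      show "?U x \<le> 2 powr (1 / p) * ?U x"
        using Upos[of x] p ge_one_powr_ge_zero[of 2 "1 / p"] by simp
    qed (use u_pos x Upos u_le_aubin_talenti p in auto)
    also have "(2 powr (1 / p) * ?U x) powr (2 * p) = 4 * (b powr (2 * p) / (1 + alpha_p p * b powr (2 * p) * x\<^sup>2)\<^sup>2)"
      unfolding aubin_talenti_powr[OF b p(1), symmetric] using p Upos[of x] by (simp add: powr_mult powr_powr powr_numeral)
    finally have 1: "\<bar>u x powr (2 * p) * u x - ?U x powr (2 * p) * ?U x\<bar> \<le> L x * \<bar>D x\<bar>"
      unfolding L_def D_def by (simp only: mult.assoc)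
    have "x\<^sup>2 \<le> 1" using x by (simp add: power_le_one)
    then have "\<bar>x\<^sup>2 - l\<bar> \<le> real d" using l_pos l_less_d d zero_le_power2[of x] by (intro abs_leI) linarith+
    then have 2: "\<bar>(x\<^sup>2 - l) * u x\<bar> \<le> real d * u x"
      unfolding abs_mult using u_pos[OF x(1)] by (simp add: mult_right_mono)
    have "\<bar>h x\<bar> \<le> L x * \<bar>D x\<bar> + real d * u x"
      unfolding h_def using abs_triangle_ineq4[of "(x\<^sup>2 - l) * u x" "u x powr (2 * p) * u x - ?U x powr (2 * p) * ?U x"] 1 2
      by linarith
    then show ?thesis unfolding e_def abs_mult using x by (simp add: mult_left_mono)
  qed
  have dD: "(D has_real_derivative D' x) (at x)" if "x > 0" for x
    unfolding D_def D'_def by (intro DERIV_diff du dU that)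
  have dD': "(D' has_real_derivative (u'' x - U2 x)) (at x)" if "x > 0" for x
    unfolding D'_def by (intro DERIV_diff du' dU1 that)
  have odeD: "x * (u'' x - U2 x) = x * h x - (real d - 1) * D' x" if x: "x > 0" for x
  proof -
    have "x * u'' x = x * ((x\<^sup>2 - l - u x powr (2 * p)) * u x) - (real d - 1) * u' x"
      unfolding ode[OF x] using x by (simp add: field_simps)
    then show ?thesis using odeU[of x] by (simp add: h_def D'_def algebra_simps)
  qed
  have contD: "continuous_on {0..1} D" "continuous_on {0..1} D'"
    unfolding D_def D'_def by (intro continuous_intros continuous_on_subset[OF cont_u] continuous_on_subset[OF cont_u'] contU contU1; simp)+
  obtain k where k: "d = k + 3" using d by (intro that[of "d - 3"]) simp
  have pw: "x ^ (d - 1) = x * x ^ (d - 2)" "x ^ (d - 2) = x * x ^ k" for x :: real by (simp_all add: k)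
  have est1: "\<bar>x * D' x\<bar> \<le> E x" if x: "0 \<le> x" "x \<le> 1" for x
  proof (cases "x = 0")
    case True then show ?thesis by (simp add: E0)
  next
    case False
    have sg: "0 \<le> x ^ (d - 2) * E x + s * (x ^ (d - 1) * D' x)" if s: "s = 1 \<or> s = -1" for s :: real
    proof -
      have "0 ^ (d - 2) * E 0 + s * (0 ^ (d - 1) * D' 0) \<le> x ^ (d - 2) * E x + s * (x ^ (d - 1) * D' x)"
      proof (rule nondecreasing_Icc[OF x(1)])
        show "continuous_on {0..x} (\<lambda>x. x ^ (d - 2) * E x + s * (x ^ (d - 1) * D' x))"
          by (intro continuous_intros continuous_on_subset[OF contE] continuous_on_subset[OF contD(2)]) (use x in auto)
        fix y assume y: "0 < y" "y < x"
        have dp: "((\<lambda>r. r ^ (d - 2)) has_real_derivative (real d - 2) * y ^ k) (at y)"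
          using DERIV_pow[of "d - 2" y] by (simp add: k)
        have dp1: "((\<lambda>r. r ^ (d - 1)) has_real_derivative (real d - 1) * y ^ (d - 2)) (at y)"
          using DERIV_pow[of "d - 1" y] by (simp add: k)
        show "((\<lambda>x. x ^ (d - 2) * E x + s * (x ^ (d - 1) * D' x)) has_real_derivative
          ((real d - 2) * y ^ k * E y + e y * y ^ (d - 2)) + s * ((real d - 1) * y ^ (d - 2) * D' y + (u'' y - U2 y) * y ^ (d - 1))) (at y)"
          by (intro DERIV_add DERIV_mult DERIV_cmult dp dp1 dE dD') (use y x in auto)
        have "(real d - 1) * y ^ (d - 2) * D' y + (u'' y - U2 y) * y ^ (d - 1)
           = y ^ (d - 2) * ((real d - 1) * D' y + y * (u'' y - U2 y))" unfolding pw(1) by (simp add: algebra_simps)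
        also have "\<dots> = y ^ (d - 2) * (y * h y)" unfolding odeD[OF y(1)] by simp
        finally have eq: "(real d - 1) * y ^ (d - 2) * D' y + (u'' y - U2 y) * y ^ (d - 1) = y ^ (d - 2) * (y * h y)" .
        have "e y + s * (y * h y) \<ge> 0" using habs[of y] y x s by (auto simp: abs_le_iff)
        then have "y ^ (d - 2) * (e y + s * (y * h y)) \<ge> 0" using y by (intro mult_nonneg_nonneg) auto
        moreover have "(real d - 2) * y ^ k * E y \<ge> 0" using y x d Epos[of y] by (intro mult_nonneg_nonneg) auto
        ultimately show "0 \<le> ((real d - 2) * y ^ k * E y + e y * y ^ (d - 2)) + s * ((real d - 1) * y ^ (d - 2) * D' y + (u'' y - U2 y) * y ^ (d - 1))"
          unfolding eq by (simp add: algebra_simps)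
      qed
      moreover have "0 ^ (d - 2) * E 0 + s * (0 ^ (d - 1) * D' 0) = 0" using d by (simp add: E0 power_0_left)
      ultimately show ?thesis by simp
    qed
    have ab: "0 \<le> x ^ (d - 2) * E x + x ^ (d - 1) * D' x" "0 \<le> x ^ (d - 2) * E x - x ^ (d - 1) * D' x"
      using sg[of 1] sg[of "-1"] by auto
    have xp: "x ^ (d - 2) > 0" using False x by simp
    from ab have "0 \<le> x ^ (d - 2) * (E x + x * D' x)" "0 \<le> x ^ (d - 2) * (E x - x * D' x)"
      unfolding pw(1) by (simp_all add: algebra_simps)
    then have "0 \<le> E x + x * D' x" "0 \<le> E x - x * D' x" using xp by (simp_all add: zero_le_mult_iff)
    then show ?thesis by (simp add: abs_le_iff)
  qed
  \<comment> \<open>\<open>(d - 2) * D + r * D'\<close> has derivative \<open>r * h\<close>.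
    Together with the bound on \<open>r * D'\<close> this isolates \<open>D\<close> without a second
    integration.\<close>
  have est2: "\<bar>(real d - 2) * D x + x * D' x\<bar> \<le> E x" if x: "0 \<le> x" "x \<le> 1" for x
  proof -
    have "0 \<le> E x + s * ((real d - 2) * D x + x * D' x)" if s: "s = 1 \<or> s = -1" for s :: real
    proof -
      have "E 0 + s * ((real d - 2) * D 0 + 0 * D' 0) \<le> E x + s * ((real d - 2) * D x + x * D' x)"
      proof (rule nondecreasing_Icc[OF x(1)])
        show "continuous_on {0..x} (\<lambda>x. E x + s * ((real d - 2) * D x + x * D' x))"
          by (intro continuous_intros continuous_on_subset[OF contE] continuous_on_subset[OF contD(1)] continuous_on_subset[OF contD(2)]) (use x in auto)
        fix y assume y: "0 < y" "y < x"
        show "((\<lambda>x. E x + s * ((real d - 2) * D x + x * D' x)) has_real_derivative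
          e y + s * ((real d - 2) * D' y + (1 * D' y + (u'' y - U2 y) * y))) (at y)"
          by (intro DERIV_add DERIV_mult DERIV_cmult DERIV_ident dE dD' dD) (use y x in auto)
        have "(real d - 2) * D' y + (1 * D' y + (u'' y - U2 y) * y) = y * h y"
          using odeD[OF y(1)] by (simp add: algebra_simps)
        then show "0 \<le> e y + s * ((real d - 2) * D' y + (1 * D' y + (u'' y - U2 y) * y))"
          using habs[of y] y x s by (auto simp: abs_le_iff)
      qed
      moreover have "D 0 = 0" by (simp add: D_def u0 aubin_talenti_def)
      ultimately show ?thesis using E0 by simp
    qed
    from this[of 1] this[of "-1"] show ?thesis by (simp add: abs_le_iff)
  qed
  have est: "\<bar>D x\<bar> \<le> E x" if x: "0 \<le> x" "x \<le> 1" for x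
  proof -
    have "\<bar>(real d - 2) * D x\<bar> \<le> 2 * E x" using est1[OF x] est2[OF x] by linarith
    then have "(real d - 2) * \<bar>D x\<bar> \<le> 2 * E x" using d by (simp add: abs_mult)
    moreover have "2 * \<bar>D x\<bar> \<le> (real d - 2) * \<bar>D x\<bar>" using d by (intro mult_right_mono) auto
    ultimately show ?thesis by simp
  qed
  define A where "A = alpha_p p * b powr (2 * p)"
  have A: "A > 0" using alpha_p_eq(2) b by (simp add: A_def)
  \<comment> \<open>A bounded primitive of \<open>r * L r\<close>; \<open>exp (- M)\<close> is the
    integrating factor of the Gronwall argument.\<close>
  define M where "M = (\<lambda>r. (2 * p + 1) * 4 / (2 * alpha_p p) * (1 - 1 / (1 + A * r\<^sup>2)))"
  have dM: "(M has_real_derivative x * L x) (at x)" for x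
  proof -
    have K: "1 + A * x\<^sup>2 > 0" using A by (simp add: add_pos_nonneg)
    have "((\<lambda>r. 1 + A * r\<^sup>2) has_real_derivative 2 * A * x) (at x)" by (auto intro!: derivative_eq_intros)
    from DERIV_divide[OF DERIV_const[of 1] this] K
    have d1: "((\<lambda>r. 1 / (1 + A * r\<^sup>2)) has_real_derivative - (2 * A * x / (1 + A * x\<^sup>2)\<^sup>2)) (at x)"
      by (simp add: power2_eq_square)
    have "(M has_real_derivative (2 * p + 1) * 4 / (2 * alpha_p p) * (2 * A * x / (1 + A * x\<^sup>2)\<^sup>2)) (at x)"
      unfolding M_def by (rule DERIV_cong[OF DERIV_cmult[OF DERIV_diff[OF DERIV_const d1]]]) simp
    also have "(2 * p + 1) * 4 / (2 * alpha_p p) * (2 * A * x / (1 + A * x\<^sup>2)\<^sup>2) = x * L x"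
      unfolding L_def A_def using alpha_p_eq(2) Xpos[of x] by (simp add: field_simps)
    finally show ?thesis .
  qed
  have M0: "M 0 = 0" by (simp add: M_def)
  have Mb: "0 \<le> M x" "M x \<le> (2 * p + 1) * 4 / (2 * alpha_p p)" for x
  proof -
    have K: "1 + A * x\<^sup>2 \<ge> 1" using A by simp
    have c: "(2 * p + 1) * 4 / (2 * alpha_p p) \<ge> 0" using p alpha_p_eq(2) by simp
    have q: "0 \<le> 1 - 1 / (1 + A * x\<^sup>2)" "1 - 1 / (1 + A * x\<^sup>2) \<le> 1" using K by (auto simp: divide_le_eq)
    show "0 \<le> M x" unfolding M_def using c q by (intro mult_nonneg_nonneg)
    show "M x \<le> (2 * p + 1) * 4 / (2 * alpha_p p)" unfolding M_def using mult_left_mono[OF q(2) c] by simp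
  qed
  \<comment> \<open>\<open>N\<close> is a primitive of the forcing
    \<open>d * 2 powr (1 / p) * r * U\<close>, negative with \<open>N 0 = - cN\<close>, and
    \<open>cN\<close> is a multiple of \<open>b powr (1 - 2 * p)\<close>.\<close>
  define cN where "cN = real d * 2 powr (1 / p) * b / (2 * A * (1 / p - 1))"
  define N where "N = (\<lambda>r. - cN * (1 + A * r\<^sup>2) powr (1 - 1 / p))"
  have ip: "1 / p - 1 > 0" using p by simp
  have dN: "(N has_real_derivative real d * (2 powr (1 / p) * (x * ?U x))) (at x)" for x
  proof -
    have K: "1 + A * x\<^sup>2 > 0" using A by (simp add: add_pos_nonneg)
    have "((\<lambda>r. 1 + A * r\<^sup>2) has_real_derivative 2 * A * x) (at x)" by (auto intro!: derivative_eq_intros)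
    from DERIV_cmult[OF DERIV_chain2[where f="\<lambda>y. y powr (1 - 1 / p)", OF has_real_derivative_powr[OF K] this], of "- cN"]
    have "(N has_real_derivative - cN * ((1 - 1 / p) * (1 + A * x\<^sup>2) powr (1 - 1 / p - 1) * (2 * A * x))) (at x)"
      unfolding N_def by simp
    also have "- cN * ((1 - 1 / p) * (1 + A * x\<^sup>2) powr (1 - 1 / p - 1) * (2 * A * x))
        = (cN * (2 * A * (1 / p - 1))) * ((1 + A * x\<^sup>2) powr (- (1 / p)) * x)" by (simp add: algebra_simps)
    also have "cN * (2 * A * (1 / p - 1)) = real d * 2 powr (1 / p) * b" 
    proof -
      have "2 * A * (1 / p - 1) > 0" using A ip by (intro mult_pos_pos) auto
      moreover have "x / q * q = x" if "q > 0" for x q :: real using that by simp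
      ultimately show ?thesis unfolding cN_def by blast
    qed
    also have "(1 + A * x\<^sup>2) powr (- (1 / p)) = ?U x / b"
      unfolding aubin_talenti_def A_def using b by (simp add: powr_minus_divide)
    finally show ?thesis using b by (simp add: mult_ac)
  qed
  have "E 0 * exp (- M 0) - N 0 \<ge> E r * exp (- M r) - N r"
  proof (rule nonincreasing_Icc[OF r(1)])
    show "continuous_on {0..r} (\<lambda>r. E r * exp (- M r) - N r)"
      by (intro continuous_intros continuous_on_subset[OF contE] continuous_at_imp_continuous_on[of _ M] continuous_at_imp_continuous_on[of _ N]
          ballI DERIV_isCont[OF dM] DERIV_isCont[OF dN]) (use r in auto)
    fix x assume x: "0 < x" "x < r"
    have "((\<lambda>r. exp (- M r)) has_real_derivative exp (- M x) * (- (x * L x))) (at x)"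
      by (intro DERIV_chain2[where f=exp and g="\<lambda>r. - M r"] DERIV_exp DERIV_minus dM)
    then show "((\<lambda>r. E r * exp (- M r) - N r) has_real_derivative
      e x * exp (- M x) + exp (- M x) * (- (x * L x)) * E x - real d * (2 powr (1 / p) * (x * ?U x))) (at x)"
      by (intro DERIV_diff DERIV_mult dE dN) (use x r in auto)
    have "e x \<le> x * L x * E x + real d * (x * u x)"
    proof -
      have "x * L x * \<bar>D x\<bar> \<le> x * L x * E x" using est[of x] x r L0[of x] by (intro mult_left_mono) auto
      then show ?thesis unfolding e_def by (simp add: algebra_simps)
    qed
    then have "exp (- M x) * (e x - x * L x * E x) \<le> exp (- M x) * (real d * (x * u x))" by (intro mult_left_mono) auto
    also have "\<dots> \<le> 1 * (real d * (x * u x))"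
      using Mb(1)[of x] u_pos[of x] x by (intro mult_right_mono) auto
    also have "\<dots> \<le> real d * (x * (2 powr (1 / p) * ?U x))"
      using u_le_aubin_talenti[of x] x r by (auto intro!: mult_left_mono)
    finally show "e x * exp (- M x) + exp (- M x) * (- (x * L x)) * E x - real d * (2 powr (1 / p) * (x * ?U x)) \<le> 0"
      by (simp add: algebra_simps)
  qed
  then have "E r * exp (- M r) \<le> N r - N 0" using E0 by simp
  also have "\<dots> \<le> cN"
  proof -
    have "cN \<ge> 0" using A ip b by (simp add: cN_def)
    then have "N r \<le> 0" by (simp add: N_def)
    then show ?thesis by (simp add: N_def)
  qed
  finally have "E r * exp (- M r) * exp (M r) \<le> cN * exp (M r)" by (intro mult_right_mono) auto
  then have "E r \<le> cN * exp (M r)" by (simp add: mult.assoc exp_minus)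
  also have "\<dots> \<le> cN * exp ((2 * p + 1) * 4 / (2 * alpha_p p))"
    using Mb(2)[of r] A ip b by (intro mult_left_mono) (auto simp: cN_def)
  also have "cN = (real d * 2 powr (1 / p) / (2 * alpha_p p * (1 / p - 1))) * b powr (1 - 2 * p)"
    unfolding cN_def A_def using b by (simp add: powr_diff)
  finally show ?thesis using est[OF r] by (simp add: D_def D1_def mult_ac)
qed

end

section \<open>Comparison with the linear solution\<close>

lemma power_exp_bound:
  fixes q :: real
  assumes "q > 0"
  obtains G where "G \<ge> 1" "\<And>r. r \<ge> 0 \<Longrightarrow> r ^ n * exp (- q * r\<^sup>2) \<le> G"
proof -
  have "((\<lambda>r::real. r ^ n * exp (- q * r\<^sup>2)) \<longlongrightarrow> 0) at_top" using assms by real_asymp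
  then have "\<forall>\<^sub>F r in at_top. r ^ n * exp (- q * r\<^sup>2) < 1" by (intro order_tendstoD) auto
  then obtain R where R: "\<And>r. r \<ge> R \<Longrightarrow> r ^ n * exp (- q * r\<^sup>2) < 1" by (auto simp: eventually_at_top_linorder)
  define S where "S = max R 1"
  have S: "S \<ge> R" "S \<ge> 1" by (auto simp: S_def)
  show thesis
  proof (rule that[of "S ^ n"])
    show "S ^ n \<ge> 1" using S by simp
    fix r :: real assume r: "r \<ge> 0"
    show "r ^ n * exp (- q * r\<^sup>2) \<le> S ^ n"
    proof (cases "r \<ge> S")
      case True
      then have "r ^ n * exp (- q * r\<^sup>2) < 1" using R S by auto
      also have "1 \<le> S ^ n" using S by simp
      finally show ?thesis by simp
    next
      case False
      have "r ^ n * exp (- q * r\<^sup>2) \<le> S ^ n * 1"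
        using r False assms S by (intro mult_mono power_mono) auto
      then show ?thesis by simp
    qed
  qed
qed

context ground_state
begin

text \<open>\<open>ka\<close> is the Kummer parameter \<alpha> and \<open>kg\<close> is
  \<open>\<beta> - \<alpha> - 1\<close>, both expressed through \<open>d\<close> and
  \<open>l\<close>. The bounds on \<open>l\<close> make them positive, as the lemmas on the Laplace
  integral ask.\<close>

definition ka where "ka = (real d - l) / 4"
definition kg where "kg = (real d - 4 + l) / 4"
abbreviation \<phi> where "\<phi> \<equiv> lin_sol ka kg"
abbreviation \<phi>' where "\<phi>' \<equiv> lin_sol' ka kg"

lemma kag: "ka > 0" "kg > 0" "kg \<ge> 0" "2 * (ka + kg) = real d - 2" "ka + kg + 1 = real d / 2"
    "2 * (kg + 1 - ka) = l" "2 * (ka + kg) + 1 = real d - 1"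
  using l_pos l_less_d d by (auto simp: ka_def kg_def field_simps)

lemma dphi: "r > 0 \<Longrightarrow> (\<phi> has_real_derivative \<phi>' r) (at r)"
  by (rule lin_sol_deriv[OF kag(1,3)])

lemma dphi': "r > 0 \<Longrightarrow> (\<phi>' has_real_derivative (r\<^sup>2 - l) * \<phi> r - (real d - 1) / r * \<phi>' r) (at r)"
  using lin_sol'_deriv[OF kag(1,3), of r] unfolding kag(6,7) .

lemma phi_pos: "r > 0 \<Longrightarrow> \<phi> r > 0"
  by (rule lin_sol_pos[OF kag(1,3)])

lemma phi'_neg: "r > 0 \<Longrightarrow> \<phi>' r < 0"
  by (rule lin_sol'_neg[OF kag(1,3)])

section \<open>Wronskian and quotient against the decaying linear solution\<close>

definition wr where "wr r = r ^ (d - 1) * (u' r * \<phi> r - u r * \<phi>' r)"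
definition quo where "quo r = u r / \<phi> r"

text \<open>The linear terms cancel because \<open>u\<close> and \<open>\<phi>\<close> share the
  eigenvalue \<open>l\<close>; what remains is the nonlinearity, with a sign.\<close>

lemma dwr: "r > 0 \<Longrightarrow> (wr has_real_derivative - (r ^ (d - 1) * (u r powr (2 * p) * u r * \<phi> r))) (at r)"
proof -
  assume r: "r > 0"
  obtain k where k: "d = k + 2" using d by (intro that[of "d - 2"]) simp
  have dp: "((\<lambda>r. r ^ (d - 1)) has_real_derivative (real d - 1) * r ^ k) (at r)"
    using DERIV_pow[of "d - 1" r] by (simp add: k)
  have "(wr has_real_derivative (real d - 1) * r ^ k * (u' r * \<phi> r - u r * \<phi>' r)
     + ((u'' r * \<phi> r + \<phi>' r * u' r) - (u' r * \<phi>' r + ((r\<^sup>2 - l) * \<phi> r - (real d - 1) / r * \<phi>' r) * u r)) * r ^ (d - 1)) (at r)"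
    unfolding wr_def by (intro DERIV_mult DERIV_diff dp du du' dphi dphi' r)
  also have "(real d - 1) * r ^ k * (u' r * \<phi> r - u r * \<phi>' r)
     + ((u'' r * \<phi> r + \<phi>' r * u' r) - (u' r * \<phi>' r + ((r\<^sup>2 - l) * \<phi> r - (real d - 1) / r * \<phi>' r) * u r)) * r ^ (d - 1)
    = - (r ^ (d - 1) * (u r powr (2 * p) * u r * \<phi> r))"
    unfolding ode[OF r] using r by (simp add: k field_simps)
  finally show ?thesis .
qed

lemma wr_small: "e > 0 \<Longrightarrow> \<exists>x>R. \<bar>wr x\<bar> < e"
proof -
  assume e: "e > 0"
  define M1 where "M1 = kummer_int ka kg 1 / Gamma ka"
  define M2 where "M2 = (kummer_int ka kg 1 + 2 * kummer_int (ka + 1) kg 1) / Gamma ka"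
  have M: "M1 \<ge> 0" "M2 \<ge> 0"
    unfolding M1_def M2_def using kag Gamma_real_pos[of ka] kummer_int_pos[of ka 1 kg] kummer_int_pos[of "ka + 1" 1 kg] by auto
  have "((\<lambda>x::real. x ^ (d - 1) * (exp (- x\<^sup>2 / 2) * (b * M1 + b * M2 * x))) \<longlongrightarrow> 0) at_top" by real_asymp
  then have "\<forall>\<^sub>F x in at_top. x ^ (d - 1) * (exp (- x\<^sup>2 / 2) * (b * M1 + b * M2 * x)) < e" using e by (intro order_tendstoD) auto
  then obtain T where T: "\<And>x. x \<ge> T \<Longrightarrow> x ^ (d - 1) * (exp (- x\<^sup>2 / 2) * (b * M1 + b * M2 * x)) < e"
    by (auto simp: eventually_at_top_linorder)
  define Q where "Q = max (max R T) 1"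
  have Q: "Q \<ge> R" "Q \<ge> T" "Q \<ge> 1" by (auto simp: Q_def)
  obtain x where x: "Q < x" "\<bar>u' x\<bar> \<le> u Q" using u'_small[of Q] Q by auto
  have x1: "x \<ge> 1" "x > R" "x \<ge> T" using x Q by auto
  have "\<bar>u' x\<bar> \<le> b" "\<bar>u x\<bar> \<le> b" using x(2) u_le_b[of Q] u_le_b[of x] u_pos[of x] x1 Q by auto
  moreover have "\<bar>\<phi> x\<bar> \<le> M1 * exp (- x\<^sup>2 / 2)"
    using lin_sol_le_far'[OF kag(1,3) x1(1)] phi_pos[of x] x1 by (simp add: M1_def)
  moreover have "\<bar>\<phi>' x\<bar> \<le> M2 * (x * exp (- x\<^sup>2 / 2))"
    using lin_sol'_le_far[OF kag(1,3) x1(1)] by (simp add: M2_def)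
  ultimately have "\<bar>u' x * \<phi> x\<bar> \<le> b * (M1 * exp (- x\<^sup>2 / 2))" "\<bar>u x * \<phi>' x\<bar> \<le> b * (M2 * (x * exp (- x\<^sup>2 / 2)))"
    unfolding abs_mult using b by (auto intro!: mult_mono)
  then have "\<bar>u' x * \<phi> x - u x * \<phi>' x\<bar> \<le> exp (- x\<^sup>2 / 2) * (b * M1 + b * M2 * x)"
    using abs_triangle_ineq4[of "u' x * \<phi> x" "u x * \<phi>' x"] by (simp add: algebra_simps)
  then have "\<bar>wr x\<bar> \<le> x ^ (d - 1) * (exp (- x\<^sup>2 / 2) * (b * M1 + b * M2 * x))"
    unfolding wr_def abs_mult using x1 by (simp add: mult_left_mono)
  also have "\<dots> < e" by (rule T[OF x1(3)])
  finally show ?thesis using x1 by blast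
qed

lemma cont_wr: "x > 0 \<Longrightarrow> continuous_on {x..y} wr"
  by (intro continuous_at_imp_continuous_on ballI DERIV_isCont[OF dwr]) auto

text \<open>Barrier principle in place of the integral of the nonlinearity over
  \<open>[r, \<infinity>)\<close>: \<open>wr\<close> becomes small at large radii while
  \<open>Z\<close> stays nonnegative, so a \<open>Z\<close> that falls at least as fast as
  \<open>wr\<close> lies above it.\<close>

lemma wr_le:
  assumes r: "r > 0"
    and Z: "\<And>x. x \<ge> r \<Longrightarrow> Z x \<ge> 0" "\<And>x. x \<ge> r \<Longrightarrow> (Z has_real_derivative Z' x) (at x)"
      "\<And>x. x \<ge> r \<Longrightarrow> Z' x \<le> - (x ^ (d - 1) * (u x powr (2 * p) * u x * \<phi> x))"
  shows "wr r \<le> Z r"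
proof (rule ccontr)
  assume "\<not> wr r \<le> Z r"
  then have e: "wr r - Z r > 0" by simp
  obtain x where x: "x > r" "\<bar>wr x\<bar> < wr r - Z r" using wr_small[OF e] by blast
  have "wr r - Z r \<le> wr x - Z x"
  proof (rule nondecreasing_Icc[of r x])
    show "continuous_on {r..x} (\<lambda>x. wr x - Z x)"
      by (intro continuous_on_diff cont_wr r continuous_at_imp_continuous_on ballI DERIV_isCont[OF Z(2)]) auto
    fix y assume "r < y" "y < x"
    then show "((\<lambda>x. wr x - Z x) has_real_derivative - (y ^ (d - 1) * (u y powr (2 * p) * u y * \<phi> y)) - Z' y) (at y)"
      using r by (intro DERIV_diff dwr Z) auto
    show "0 \<le> - (y ^ (d - 1) * (u y powr (2 * p) * u y * \<phi> y)) - Z' y" using Z(3)[of y] \<open>r < y\<close> by simp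
  qed (use x in auto)
  then show False using x Z(1)[of x] by simp
qed

lemma nonlin_nonneg: "r > 0 \<Longrightarrow> r ^ (d - 1) * (u r powr (2 * p) * u r * \<phi> r) \<ge> 0"
  using u_pos[of r] phi_pos[of r] by (intro mult_nonneg_nonneg) auto

text \<open>\<open>wr\<close> decreases and becomes small at arbitrarily large radii, so it cannot
  be negative. This sign makes \<open>quo\<close> nondecreasing.\<close>

lemma wr_nonneg: assumes r: "r > 0" shows "wr r \<ge> 0"
proof (rule ccontr)
  assume "\<not> wr r \<ge> 0"
  then have e: "- wr r > 0" by simp
  obtain x where x: "x > r" "\<bar>wr x\<bar> < - wr r" using wr_small[OF e] by blast
  have "wr x \<le> wr r"
    by (rule nonincreasing_Icc[OF _ cont_wr dwr]) (use x r nonlin_nonneg in auto)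
  then show False using x by simp
qed

lemma dquo: "r > 0 \<Longrightarrow> (quo has_real_derivative wr r / (r ^ (d - 1) * (\<phi> r)\<^sup>2)) (at r)"
proof -
  assume r: "r > 0"
  have "(quo has_real_derivative (u' r * \<phi> r - u r * \<phi>' r) / (\<phi> r * \<phi> r)) (at r)"
    unfolding quo_def using phi_pos[OF r] by (intro DERIV_divide du dphi r) auto
  moreover have "(u' r * \<phi> r - u r * \<phi>' r) / (\<phi> r * \<phi> r) = wr r / (r ^ (d - 1) * (\<phi> r)\<^sup>2)"
    using r by (simp add: wr_def power2_eq_square)
  ultimately show ?thesis by simp
qed

lemma cont_quo: "x > 0 \<Longrightarrow> continuous_on {x..y} quo"
  by (intro continuous_at_imp_continuous_on ballI DERIV_isCont[OF dquo]) auto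

lemma quo_mono: "0 < x \<Longrightarrow> x \<le> y \<Longrightarrow> quo x \<le> quo y"
  by (rule nondecreasing_Icc[OF _ cont_quo dquo]) (auto intro!: divide_nonneg_nonneg wr_nonneg)

lemma quo_pos: "r > 0 \<Longrightarrow> quo r > 0"
  using u_pos[of r] phi_pos[of r] by (simp add: quo_def)

text \<open>The barrier is \<open>u * \<phi> * (c / r)\<close>: \<open>u * \<phi>\<close> decreases
  and \<open>r ^ (d - 1) * u powr (2 * p) \<le> c / r\<^sup>2\<close>. It yields the derivative
  bound \<open>quo * (c / r\<^sup>2)\<close> for \<open>quo\<close>, so
  \<open>quo * exp (c / r)\<close> is nonincreasing.\<close>

lemma quo_le:
  assumes r1: "r1 \<ge> 1" and c: "c \<ge> 0" and bnd: "\<And>r. r \<ge> r1 \<Longrightarrow> r ^ (d + 1) * u r powr (2 * p) \<le> c"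
    and r: "r \<ge> r1"
  shows "quo r \<le> quo r1 * exp (c / r1)"
proof -
  have wrle: "wr r \<le> u r * \<phi> r * (c / r)" if r: "r \<ge> r1" for r
  proof (rule wr_le)
    show "r > 0" using r r1 by simp
    fix x assume "x \<ge> r"
    then have x: "x \<ge> r1" "x > 0" using r r1 by auto
    show "0 \<le> u x * \<phi> x * (c / x)" using c x u_pos[of x] phi_pos[of x] by simp
    have dd: "((\<lambda>x. c / x) has_real_derivative - (c / x\<^sup>2)) (at x)"
      using x by (auto intro!: derivative_eq_intros simp: power2_eq_square)
    show "((\<lambda>x. u x * \<phi> x * (c / x)) has_real_derivative (u' x * \<phi> x + \<phi>' x * u x) * (c / x) + - (c / x\<^sup>2) * (u x * \<phi> x)) (at x)"
      using x by (intro DERIV_mult du dphi dd) auto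
    have "(u' x * \<phi> x + \<phi>' x * u x) * (c / x) \<le> 0"
      using x c u'_neg[of x] phi'_neg[of x] u_pos[of x] phi_pos[of x]
      by (intro mult_nonpos_nonneg add_nonpos_nonpos mult_nonpos_nonneg) auto
    moreover have "x ^ (d - 1) * u x powr (2 * p) \<le> c / x\<^sup>2"
    proof -
      have "x ^ (d + 1) = x\<^sup>2 * x ^ (d - 1)" using d by (subst power_add[symmetric]) (rule arg_cong[where f="power x"], simp)
      then show ?thesis using bnd[OF x(1)] x by (simp add: field_simps)
    qed
    then have "(x ^ (d - 1) * u x powr (2 * p)) * (u x * \<phi> x) \<le> c / x\<^sup>2 * (u x * \<phi> x)"
      using x u_pos[of x] phi_pos[of x] by (intro mult_right_mono) auto
    ultimately show "(u' x * \<phi> x + \<phi>' x * u x) * (c / x) + - (c / x\<^sup>2) * (u x * \<phi> x) \<le> - (x ^ (d - 1) * (u x powr (2 * p) * u x * \<phi> x))"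
      by (simp add: mult_ac)
  qed
  have "quo r * exp (c / r) \<le> quo r1 * exp (c / r1)"
  proof (rule nonincreasing_Icc[OF r])
    show "continuous_on {r1..r} (\<lambda>r. quo r * exp (c / r))"
      using r1 by (intro continuous_intros cont_quo) auto
    fix x assume "r1 < x"
    then have x: "x \<ge> r1" "x > 0" "x \<ge> 1" using r1 by auto
    have "((\<lambda>x. c / x) has_real_derivative - (c / x\<^sup>2)) (at x)"
      using x by (auto intro!: derivative_eq_intros simp: power2_eq_square)
    then have de: "((\<lambda>x. exp (c / x)) has_real_derivative exp (c / x) * - (c / x\<^sup>2)) (at x)"
      by (intro DERIV_chain2[where f=exp] DERIV_exp)
    show "((\<lambda>r. quo r * exp (c / r)) has_real_derivative wr x / (x ^ (d - 1) * (\<phi> x)\<^sup>2) * exp (c / x) + exp (c / x) * - (c / x\<^sup>2) * quo x) (at x)"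
      using x by (intro DERIV_mult dquo de) auto
    have "wr x / (x ^ (d - 1) * (\<phi> x)\<^sup>2) \<le> (u x * \<phi> x * (c / x)) / (x ^ (d - 1) * (\<phi> x)\<^sup>2)"
      using wrle[OF x(1)] x by (intro divide_right_mono) auto
    also have "\<dots> = quo x * (c / (x * x ^ (d - 1)))"
      using x phi_pos[of x] by (simp add: quo_def power2_eq_square)
    also have "\<dots> \<le> quo x * (c / x\<^sup>2)"
    proof -
      have "x ^ 1 \<le> x ^ (d - 1)" using x d by (intro power_increasing) auto
      then have "x\<^sup>2 \<le> x * x ^ (d - 1)" using x by (simp add: power2_eq_square)
      then show ?thesis using x c quo_pos[of x] by (intro mult_left_mono divide_left_mono) auto
    qed
    finally have "(wr x / (x ^ (d - 1) * (\<phi> x)\<^sup>2) - quo x * (c / x\<^sup>2)) * exp (c / x) \<le> 0" by (intro mult_nonpos_nonneg) auto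
    then show "wr x / (x ^ (d - 1) * (\<phi> x)\<^sup>2) * exp (c / x) + exp (c / x) * - (c / x\<^sup>2) * quo x \<le> 0"
      by (simp add: algebra_simps)
  qed
  moreover have "quo r * 1 \<le> quo r * exp (c / r)" using c r r1 quo_pos[of r] by (intro mult_left_mono) auto
  ultimately show ?thesis by simp
qed

lemma quo_bounded: "\<exists>C. \<forall>r\<ge>1. quo r \<le> C"
proof -
  obtain C R where C: "C > 0" "R \<ge> 1" "\<And>r. r \<ge> R \<Longrightarrow> u r \<le> C * exp (- r\<^sup>2 / 4)"
    using u_gaussian_bound by blast
  obtain G where G: "G \<ge> 1" "\<And>r. r \<ge> 0 \<Longrightarrow> r ^ (d + 1) * exp (- (p / 2) * r\<^sup>2) \<le> G"
    using power_exp_bound[of "p / 2" "d + 1"] p by auto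
  have bnd: "r ^ (d + 1) * u r powr (2 * p) \<le> G * C powr (2 * p)" if r: "r \<ge> R" for r
  proof -
    have "u r powr (2 * p) \<le> (C * exp (- r\<^sup>2 / 4)) powr (2 * p)"
      using C(3)[OF r] u_pos[of r] r C p by (intro powr_mono2) auto
    also have "\<dots> = C powr (2 * p) * exp (- (p / 2) * r\<^sup>2)"
      using C by (simp add: powr_mult exp_powr_real)
    finally have "r ^ (d + 1) * u r powr (2 * p) \<le> r ^ (d + 1) * (C powr (2 * p) * exp (- (p / 2) * r\<^sup>2))"
      using r C by (intro mult_left_mono) auto
    also have "\<dots> = C powr (2 * p) * (r ^ (d + 1) * exp (- (p / 2) * r\<^sup>2))" by simp
    also have "\<dots> \<le> C powr (2 * p) * G" using G(2)[rule_format, of r] r C by (intro mult_left_mono) auto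
    finally show ?thesis by (simp add: mult_ac)
  qed
  have "quo r \<le> quo R * exp (G * C powr (2 * p) / R)" if "r \<ge> 1" for r
  proof (cases "r \<ge> R")
    case True
    then show ?thesis using quo_le[OF C(2) _ bnd] G C by simp
  next
    case False
    have "quo r \<le> quo R" using False that by (intro quo_mono) auto
    also have "\<dots> \<le> quo R * exp (G * C powr (2 * p) / R)"
      using quo_le[OF C(2) _ bnd, of R] G C by simp
    finally show ?thesis .
  qed
  then show ?thesis by blast
qed

text \<open>A supremum, so that no limit is presupposed; monotonicity of \<open>quo\<close> makes it
  the limit, and the normalisation of \<open>\<phi>\<close> makes it the tail constant
  \<open>c(b)\<close>.\<close>

definition tl where "tl = (SUP r\<in>{1..}. quo r)"

lemma quo_le_tl: "r > 0 \<Longrightarrow> quo r \<le> tl"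
proof -
  assume r: "r > 0"
  obtain C where "\<And>r. r \<ge> 1 \<Longrightarrow> quo r \<le> C" using quo_bounded by blast
  then have "bdd_above (quo ` {1..})" by (auto simp: bdd_above_def)
  then have "quo (max r 1) \<le> tl" unfolding tl_def by (intro cSUP_upper) auto
  moreover have "quo r \<le> quo (max r 1)" using r by (intro quo_mono) auto
  ultimately show ?thesis by simp
qed

lemma tl_pos: "tl > 0"
  using quo_le_tl[of 1] quo_pos[of 1] by simp

lemma tl_le: "(\<And>r. r \<ge> 1 \<Longrightarrow> quo r \<le> C) \<Longrightarrow> tl \<le> C"
  unfolding tl_def by (rule cSUP_least) auto

lemma quo_tendsto: "(quo \<longlongrightarrow> tl) at_top"
proof (rule increasing_tendsto)
  show "\<forall>\<^sub>F r in at_top. quo r \<le> tl"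
    using eventually_gt_at_top[of 0] by (rule eventually_mono) (rule quo_le_tl)
  fix x assume "x < tl"
  then have "\<exists>r\<in>{1..}. x < quo r"
    unfolding tl_def using quo_bounded by (subst (asm) less_cSUP_iff) (auto simp: bdd_above_def)
  then obtain r where r: "r \<ge> 1" "x < quo r" by auto
  have "x < quo n" if "n \<ge> r" for n
    using r quo_mono[of r n] that by simp
  then show "\<forall>\<^sub>F n in at_top. x < quo n"
    by (rule eventually_at_top_linorderI[of r])
qed

lemma u_tail_tendsto: "((\<lambda>r. u r * exp (r\<^sup>2 / 2) * r powr ((real d - l) / 2)) \<longlongrightarrow> tl) at_top"
proof -
  have "((\<lambda>r. quo r * (r powr (2 * ka) * exp (r\<^sup>2 / 2) * \<phi> r)) \<longlongrightarrow> tl * 1) at_top"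
    by (intro tendsto_mult quo_tendsto lin_sol_tendsto kag)
  moreover have "\<forall>\<^sub>F r in at_top. quo r * (r powr (2 * ka) * exp (r\<^sup>2 / 2) * \<phi> r) = u r * exp (r\<^sup>2 / 2) * r powr ((real d - l) / 2)"
    using eventually_gt_at_top[of 0]
  proof eventually_elim
    case (elim r)
    have e: "(real d - l) / 2 = 2 * ka" by (simp add: ka_def)
    show ?case unfolding e using phi_pos[OF elim] by (simp add: quo_def)
  qed
  ultimately show ?thesis by (simp add: Lim_transform_eventually)
qed

lemma tail_const_eq: "tail_const d l u = tl"
  unfolding tail_const_def by (rule tendsto_Lim[OF _ u_tail_tendsto]) simp

lemma u_le_tl_phi: "r > 0 \<Longrightarrow> u r \<le> tl * \<phi> r"
  using quo_le_tl[of r] phi_pos[of r] by (simp add: quo_def field_simps)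

text \<open>For \<open>b \<ge> K2\<close> the bound \<open>u \<le> exp (- r\<^sup>2 / 4)\<close>
  beyond 1 is free of \<open>b\<close>, so the tail constant is comparable to the quotient at radius
  1 uniformly in \<open>b\<close>. With \<open>u_le_near\<close> this gives \<open>c(b)\<close> the
  order \<open>1 / b\<close>.\<close>

lemma tl_le_u1:
  assumes bK: "b \<ge> K2" "b \<ge> K1" and G: "G \<ge> 1" "\<forall>r\<ge>0. r ^ (d + 1) * exp (- (p / 2) * r\<^sup>2) \<le> G"
  shows "tl \<le> quo 1 * exp G"
proof (rule tl_le)
  have bnd: "r ^ (d + 1) * u r powr (2 * p) \<le> G" if r: "r \<ge> 1" for r
  proof -
    have "u r \<le> K2 / b * exp (- r\<^sup>2 / 4)" using r bK by (intro u_le_far) auto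
    also have "\<dots> \<le> 1 * exp (- r\<^sup>2 / 4)" using bK b by (intro mult_right_mono) auto
    finally have "u r \<le> exp (- r\<^sup>2 / 4)" by simp
    then have "u r powr (2 * p) \<le> (exp (- r\<^sup>2 / 4)) powr (2 * p)"
      using u_pos[of r] r p by (intro powr_mono2) auto
    also have "\<dots> = exp (- (p / 2) * r\<^sup>2)" by (simp add: exp_powr_real)
    finally have "r ^ (d + 1) * u r powr (2 * p) \<le> r ^ (d + 1) * exp (- (p / 2) * r\<^sup>2)"
      using r by (intro mult_left_mono) auto
    also have "\<dots> \<le> G" using G(2)[rule_format, of r] r by simp
    finally show ?thesis .
  qed
  fix r :: real assume "r \<ge> 1"
  then show "quo r \<le> quo 1 * exp G" using quo_le[of 1 G r, OF _ _ bnd] G by simp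
qed

text \<open>The constants are named by hypotheses on \<open>m\<close> and \<open>L\<close> so that
  their convergence for large \<open>b\<close> can be used afterwards. The lower bound by
  \<open>L\<close> is there because \<open>(\<phi> r)\<^sup>2\<close> stands in the denominator of
  the derivative of \<open>quo\<close>.\<close>

lemma phi_bounds:
  assumes G: "G \<ge> 1" "\<forall>r\<ge>0. r ^ (d + 1) * exp (- (p / 2) * r\<^sup>2) \<le> G"
    and m: "m = kummer_int ka kg 1 / Gamma ka" and L: "L = exp (- 1 / 2) * Gamma (ka + kg) / Gamma ka"
  shows "0 < r \<Longrightarrow> r ^ (d - 2) * \<phi> r \<le> m * G" "0 < r \<Longrightarrow> r \<le> 1 \<Longrightarrow> r ^ (d - 2) * \<phi> r \<ge> L"
    "0 < r \<Longrightarrow> r \<le> 1 \<Longrightarrow> r ^ (d - 2) * \<phi> r \<le> m"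
    "r \<ge> 1 \<Longrightarrow> r ^ (d + 1) * \<phi> r powr (2 * p) \<le> m powr (2 * p) * G" "m > 0" "L > 0"
proof -
  show m0: "m > 0" "L > 0"
    unfolding m L using kag kummer_int_pos[of ka 1 kg] Gamma_real_pos[of ka] Gamma_real_pos[of "ka + kg"] by auto
  have pw: "r powr (2 * (ka + kg)) = r ^ (d - 2)" if "r > 0" for r
    unfolding kag(4) using d that by (simp add: powr_realpow[symmetric] of_nat_diff)
  show near: "r ^ (d - 2) * \<phi> r \<le> m" if "0 < r" "r \<le> 1" for r
    using lin_sol_le_near[OF kag(1,3) that] that unfolding pw[OF that(1)] m by simp
  show "r ^ (d - 2) * \<phi> r \<ge> L" if "0 < r" "r \<le> 1"
    using lin_sol_ge_near[OF kag(1,3) that] that unfolding pw[OF that(1)] L by simp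
  have far: "\<phi> r \<le> m * exp (- r\<^sup>2 / 2)" if "r \<ge> 1" for r
    unfolding m using lin_sol_le_far'[OF kag(1,3) that] .
  show "r ^ (d - 2) * \<phi> r \<le> m * G" if r: "0 < r"
  proof (cases "r \<le> 1")
    case True
    then have "r ^ (d - 2) * \<phi> r \<le> m * 1" using near[OF r] by simp
    also have "\<dots> \<le> m * G" using m0 G by (intro mult_left_mono) auto
    finally show ?thesis .
  next
    case False
    have "r ^ (d - 2) * \<phi> r \<le> r ^ (d + 1) * (m * exp (- r\<^sup>2 / 2))"
      using False far[of r] phi_pos[OF r] by (intro mult_mono power_increasing) auto
    also have "\<dots> \<le> r ^ (d + 1) * (m * exp (- (p / 2) * r\<^sup>2))"
    proof -
      have "(p / 2) * r\<^sup>2 \<le> 1 / 2 * r\<^sup>2" using p by (intro mult_right_mono) auto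
      then show ?thesis using r m0 by (intro mult_left_mono) auto
    qed
    also have "\<dots> = m * (r ^ (d + 1) * exp (- (p / 2) * r\<^sup>2))" by simp
    also have "\<dots> \<le> m * G" using G(2)[rule_format, of r] r m0 by (intro mult_left_mono) auto
    finally show ?thesis .
  qed
  show "r ^ (d + 1) * \<phi> r powr (2 * p) \<le> m powr (2 * p) * G" if r: "r \<ge> 1"
  proof -
    have "\<phi> r powr (2 * p) \<le> (m * exp (- r\<^sup>2 / 2)) powr (2 * p)"
      using far[OF r] phi_pos[of r] r p by (intro powr_mono2) auto
    also have "\<dots> = m powr (2 * p) * exp (- p * r\<^sup>2)"
      using m0 by (simp add: powr_mult exp_powr_real)
    also have "\<dots> \<le> m powr (2 * p) * exp (- (p / 2) * r\<^sup>2)"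
      using p by (intro mult_left_mono) (auto intro!: mult_right_mono)
    finally have "r ^ (d + 1) * \<phi> r powr (2 * p) \<le> r ^ (d + 1) * (m powr (2 * p) * exp (- (p / 2) * r\<^sup>2))"
      using r by (intro mult_left_mono) auto
    also have "\<dots> = m powr (2 * p) * (r ^ (d + 1) * exp (- (p / 2) * r\<^sup>2))" by simp
    also have "\<dots> \<le> m powr (2 * p) * G" using G(2)[rule_format, of r] r by (intro mult_left_mono) auto
    finally show ?thesis .
  qed
qed

text \<open>Feeding \<open>u \<le> tl * \<phi>\<close> back into the Wronskian produces the factor
  \<open>tl powr (2 * p + 1)\<close>. Near 0, criticality gives
  \<open>(d - 2) * (2 * p + 2) = 2 * d\<close>, so \<open>wr\<close> is at most of order
  \<open>r powr (- d)\<close> and the derivative of \<open>quo\<close> at most of order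
  \<open>r powr (- 3)\<close>; integration costs \<open>1 / r\<^sup>2\<close>.\<close>

lemma tl_minus_quo:
  assumes G: "G \<ge> 1" "\<forall>r\<ge>0. r ^ (d + 1) * exp (- (p / 2) * r\<^sup>2) \<le> G"
    and m: "m = kummer_int ka kg 1 / Gamma ka" and L: "L = exp (- 1 / 2) * Gamma (ka + kg) / Gamma ka"
    and H: "H = (m * G) powr (2 * p + 2) / (real d * L\<^sup>2) + m powr (2 * p) * G"
  shows "r \<ge> 1 \<Longrightarrow> tl - quo r \<le> tl powr (2 * p + 1) * H"
    and "0 < r \<Longrightarrow> r \<le> 1 \<Longrightarrow> tl - quo r \<le> tl powr (2 * p + 1) * H / r\<^sup>2"
proof -
  note pb = phi_bounds[OF G m L]
  have mG: "m * G > 0" using pb(5) G by simp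
  define H1 where "H1 = (m * G) powr (2 * p + 2) / (real d * L\<^sup>2)"
  define H2 where "H2 = m powr (2 * p) * G"
  have HH: "H1 \<ge> 0" "H2 \<ge> 0" "H = H1 + H2" using G d by (auto simp: H1_def H2_def H)
  define T where "T = tl powr (2 * p + 1)"
  have T: "T > 0" using tl_pos by (simp add: T_def)
  have nl: "u x powr (2 * p) * u x \<le> T * (\<phi> x powr (2 * p) * \<phi> x)" if x: "x > 0" for x
  proof -
    have "u x powr (2 * p) * u x = u x powr (2 * p + 1)" using u_pos[of x] x by (simp add: powr_add)
    also have "\<dots> \<le> (tl * \<phi> x) powr (2 * p + 1)"
      using u_le_tl_phi[OF x] u_pos[of x] x p by (intro powr_mono2) auto
    also have "\<dots> = T * \<phi> x powr (2 * p + 1)" using tl_pos phi_pos[OF x] by (simp add: powr_mult T_def)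
    also have "\<phi> x powr (2 * p + 1) = \<phi> x powr (2 * p) * \<phi> x" using phi_pos[OF x] by (simp add: powr_add)
    finally show ?thesis .
  qed
  have wr_far: "wr r \<le> T * (\<phi> r)\<^sup>2 * (H2 / r)" if r: "r \<ge> 1" for r
  proof (rule wr_le)
    show "r > 0" using r by simp
    fix x assume "x \<ge> r"
    then have x: "x \<ge> 1" "x > 0" using r by auto
    show "0 \<le> T * (\<phi> x)\<^sup>2 * (H2 / x)" using T HH x by simp
    have dd: "((\<lambda>x. H2 / x) has_real_derivative - (H2 / x\<^sup>2)) (at x)"
      using x by (auto intro!: derivative_eq_intros simp: power2_eq_square)
    have dsq: "((\<lambda>x. (\<phi> x)\<^sup>2) has_real_derivative 2 * \<phi> x * \<phi>' x) (at x)"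
      using DERIV_power[OF dphi[OF x(2)], of 2] by (simp add: mult_ac)
    show "((\<lambda>x. T * (\<phi> x)\<^sup>2 * (H2 / x)) has_real_derivative T * (2 * \<phi> x * \<phi>' x) * (H2 / x) + - (H2 / x\<^sup>2) * (T * (\<phi> x)\<^sup>2)) (at x)"
      by (intro DERIV_mult DERIV_cmult dsq dd)
    have "T * (2 * \<phi> x * \<phi>' x) * (H2 / x) \<le> 0"
      using T HH x phi'_neg[of x] phi_pos[of x]
      by (intro mult_nonpos_nonneg mult_nonneg_nonpos) auto
    moreover have "x ^ (d - 1) * \<phi> x powr (2 * p) \<le> H2 / x\<^sup>2"
    proof -
      have "x ^ (d + 1) = x\<^sup>2 * x ^ (d - 1)" using d by (subst power_add[symmetric]) (rule arg_cong[where f="power x"], simp)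
      then show ?thesis using pb(4)[OF x(1)] x by (simp add: H2_def field_simps)
    qed
    then have "T * (\<phi> x)\<^sup>2 * (x ^ (d - 1) * \<phi> x powr (2 * p)) \<le> T * (\<phi> x)\<^sup>2 * (H2 / x\<^sup>2)"
      using T by (intro mult_left_mono) auto
    moreover have "x ^ (d - 1) * (u x powr (2 * p) * u x * \<phi> x) \<le> x ^ (d - 1) * (T * (\<phi> x powr (2 * p) * \<phi> x) * \<phi> x)"
      using nl[OF x(2)] phi_pos[OF x(2)] x by (intro mult_left_mono mult_right_mono) auto
    ultimately show "T * (2 * \<phi> x * \<phi>' x) * (H2 / x) + - (H2 / x\<^sup>2) * (T * (\<phi> x)\<^sup>2) \<le> - (x ^ (d - 1) * (u x powr (2 * p) * u x * \<phi> x))"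
      by (simp add: mult_ac power2_eq_square)
  qed
  have far': "tl \<le> quo r + T * H2 / r" if r: "r \<ge> 1" for r
  proof (rule tendsto_upperbound[OF quo_tendsto])
    have "quo x \<le> quo r + T * H2 / r" if x: "x \<ge> r" for x
    proof -
      have "quo x + T * H2 / x \<le> quo r + T * H2 / r"
      proof (rule nonincreasing_Icc[OF x])
        show "continuous_on {r..x} (\<lambda>x. quo x + T * H2 / x)" using r by (intro continuous_intros cont_quo) auto
        fix y assume "r < y"
        then have y: "y \<ge> 1" "y > 0" using r by auto
        have dd: "((\<lambda>x. T * H2 / x) has_real_derivative - (T * H2 / y\<^sup>2)) (at y)"
          using y by (auto intro!: derivative_eq_intros simp: power2_eq_square)
        show "((\<lambda>x. quo x + T * H2 / x) has_real_derivative wr y / (y ^ (d - 1) * (\<phi> y)\<^sup>2) + - (T * H2 / y\<^sup>2)) (at y)"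
          by (intro DERIV_add dquo dd y)
        have "wr y / (y ^ (d - 1) * (\<phi> y)\<^sup>2) \<le> (T * (\<phi> y)\<^sup>2 * (H2 / y)) / (y ^ (d - 1) * (\<phi> y)\<^sup>2)"
          using wr_far[OF y(1)] y by (intro divide_right_mono) auto
        also have "\<dots> = T * H2 / (y * y ^ (d - 1))" using y phi_pos[OF y(2)] by simp
        also have "\<dots> \<le> T * H2 / y\<^sup>2"
        proof -
          have "y ^ 1 \<le> y ^ (d - 1)" using y d by (intro power_increasing) auto
          then have "y\<^sup>2 \<le> y * y ^ (d - 1)" using y by (simp add: power2_eq_square)
          then show ?thesis using y T HH by (intro divide_left_mono) auto
        qed
        finally show "wr y / (y ^ (d - 1) * (\<phi> y)\<^sup>2) + - (T * H2 / y\<^sup>2) \<le> 0" by simp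
      qed
      moreover have "T * H2 / x \<ge> 0" using T HH x r by simp
      ultimately show ?thesis by simp
    qed
    then show "\<forall>\<^sub>F x in at_top. quo x \<le> quo r + T * H2 / r"
      by (rule eventually_at_top_linorderI[of r])
  qed simp
  have far: "tl - quo r \<le> T * H2" if r: "r \<ge> 1" for r
  proof -
    have "T * H2 / r \<le> T * H2" using r T HH by (intro divide_left_mono[of 1 r "T * H2", simplified]) auto
    then show ?thesis using far'[OF r] by simp
  qed
  show "tl - quo r \<le> tl powr (2 * p + 1) * H" if r: "r \<ge> 1"
  proof -
    have "T * H2 \<le> T * H" using T HH by (intro mult_left_mono) auto
    then show ?thesis using far[OF r] by (simp add: T_def)
  qed
  assume r: "0 < r" "r \<le> 1"
  \<comment> \<open>\<open>Z0 / x ^ d\<close> is the integral over \<open>[x, \<infinity>)\<close>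
    of the bound \<open>d * Z0 / y ^ (d + 1)\<close> for the nonlinearity.\<close>
  define Z0 where "Z0 = T * (m * G) powr (2 * p + 2) / real d"
  have Z0: "Z0 \<ge> 0" using T by (simp add: Z0_def)
  have wr_near: "wr x \<le> Z0 / x ^ d" if x: "x > 0" for x
  proof (rule wr_le[OF x])
    fix y assume "y \<ge> x"
    then have y: "y > 0" using x by simp
    show "0 \<le> Z0 / y ^ d" using Z0 y by simp
    have "((\<lambda>y. Z0 / y ^ d) has_real_derivative (0 * y ^ d - Z0 * (real d * y ^ (d - 1))) / (y ^ d * y ^ d)) (at y)"
      using y DERIV_pow[of d y] by (intro DERIV_divide DERIV_const) auto
    also have "(0 * y ^ d - Z0 * (real d * y ^ (d - 1))) / (y ^ d * y ^ d) = - (real d * Z0 / y ^ (d + 1))"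
    proof -
      have "y ^ d = y * y ^ (d - 1)" using d by (simp flip: power_Suc)
      then show ?thesis using y by (simp add: field_simps)
    qed
    finally show "((\<lambda>y. Z0 / y ^ d) has_real_derivative - (real d * Z0 / y ^ (d + 1))) (at y)" .
    have "\<phi> y powr (2 * p) * \<phi> y * \<phi> y = \<phi> y powr (2 * p + 2)"
      using phi_pos[OF y] by (simp add: powr_add powr_numeral power2_eq_square)
    also have "\<dots> \<le> (m * G / y ^ (d - 2)) powr (2 * p + 2)"
      using pb(1)[OF y] phi_pos[OF y] y p by (intro powr_mono2) (auto simp: field_simps)
    also have "\<dots> = (m * G) powr (2 * p + 2) / y ^ (2 * d)"
    proof -
      have "(real d - 2) * (2 * p + 2) = real (2 * d)" using p by (simp add: algebra_simps)
      then have "(y powr (real d - 2)) powr (2 * p + 2) = y powr (real (2 * d))" unfolding powr_powr by simp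
      moreover have "y powr (real d - 2) = y ^ (d - 2)" using d y by (simp add: powr_realpow[symmetric] of_nat_diff)
      ultimately have "(y ^ (d - 2)) powr (2 * p + 2) = y ^ (2 * d)" using y by (metis powr_realpow)
      then show ?thesis using mG y by (simp add: powr_divide)
    qed
    finally have ph: "\<phi> y powr (2 * p) * \<phi> y * \<phi> y \<le> (m * G) powr (2 * p + 2) / y ^ (2 * d)" .
    have "y ^ (d - 1) * (u y powr (2 * p) * u y * \<phi> y) \<le> y ^ (d - 1) * (T * (\<phi> y powr (2 * p) * \<phi> y) * \<phi> y)"
      using nl[OF y] phi_pos[OF y] y by (intro mult_left_mono mult_right_mono) auto
    also have "\<dots> = y ^ (d - 1) * T * (\<phi> y powr (2 * p) * \<phi> y * \<phi> y)" by simp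
    also have "\<dots> \<le> y ^ (d - 1) * T * ((m * G) powr (2 * p + 2) / y ^ (2 * d))"
      using T y by (intro mult_left_mono ph) auto
    also have "\<dots> = real d * Z0 / y ^ (d + 1)"
    proof -
      have "y ^ (2 * d) = y ^ (d - 1) * y ^ (d + 1)" using d by (subst power_add[symmetric]) (rule arg_cong[where f="power y"], simp)
      then show ?thesis using y d by (simp add: Z0_def)
    qed
    finally show "- (real d * Z0 / y ^ (d + 1)) \<le> - (y ^ (d - 1) * (u y powr (2 * p) * u y * \<phi> y))" by simp
  qed
  have "quo 1 + T * H1 / 2 * (1 / 1\<^sup>2) \<le> quo r + T * H1 / 2 * (1 / r\<^sup>2)"
  proof (rule nonincreasing_Icc[OF r(2)])
    show "continuous_on {r..1} (\<lambda>x. quo x + T * H1 / 2 * (1 / x\<^sup>2))" using r by (intro continuous_intros cont_quo) auto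
    fix y assume "r < y" "y < 1"
    then have y: "y > 0" "y \<le> 1" using r by auto
    have dd: "((\<lambda>x. T * H1 / 2 * (1 / x\<^sup>2)) has_real_derivative - (T * H1 / y ^ 3)) (at y)"
      using y by (auto intro!: derivative_eq_intros simp: power2_eq_square power3_eq_cube)
    show "((\<lambda>x. quo x + T * H1 / 2 * (1 / x\<^sup>2)) has_real_derivative wr y / (y ^ (d - 1) * (\<phi> y)\<^sup>2) + - (T * H1 / y ^ 3)) (at y)"
      by (intro DERIV_add dquo dd y)
    have L2: "L\<^sup>2 / y ^ (2 * (d - 2)) \<le> (\<phi> y)\<^sup>2"
    proof -
      have "L\<^sup>2 \<le> (y ^ (d - 2) * \<phi> y)\<^sup>2" using pb(2)[OF y] pb(6) by (intro power_mono) auto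
      also have "\<dots> = y ^ (2 * (d - 2)) * (\<phi> y)\<^sup>2" by (simp add: power_mult_distrib power_mult[symmetric] mult.commute)
      finally show ?thesis using y by (simp add: field_simps)
    qed
    have "wr y / (y ^ (d - 1) * (\<phi> y)\<^sup>2) \<le> (Z0 / y ^ d) / (y ^ (d - 1) * (\<phi> y)\<^sup>2)"
      using wr_near[OF y(1)] y by (intro divide_right_mono) auto
    also have "\<dots> \<le> (Z0 / y ^ d) / (y ^ (d - 1) * (L\<^sup>2 / y ^ (2 * (d - 2))))"
      using L2 y Z0 pb(6) phi_pos[OF y(1)] by (intro divide_left_mono mult_left_mono mult_pos_pos) auto
    also have "\<dots> = T * H1 / y ^ 3"
    proof -
      have "y ^ d * y ^ (d - 1) = y ^ 3 * y ^ (2 * (d - 2))"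
        using d by (simp only: power_add[symmetric]) (rule arg_cong[where f="power y"], simp)
      moreover have "(z / p1) / (p2 * (c / w)) = z * w / (c * (p1 * p2))" for z p1 p2 c w :: real
        by (simp add: divide_inverse mult_ac)
      ultimately have "(Z0 / y ^ d) / (y ^ (d - 1) * (L\<^sup>2 / y ^ (2 * (d - 2)))) = Z0 * y ^ (2 * (d - 2)) / (L\<^sup>2 * (y ^ 3 * y ^ (2 * (d - 2))))"
        by metis
      then show ?thesis using y by (simp add: Z0_def H1_def)
    qed
    finally show "wr y / (y ^ (d - 1) * (\<phi> y)\<^sup>2) + - (T * H1 / y ^ 3) \<le> 0" by simp
  qed
  moreover have "T * H1 / 2 * (1 / 1\<^sup>2) \<ge> 0" using T HH by simp
  ultimately have "quo 1 \<le> quo r + T * H1 / 2 * (1 / r\<^sup>2)" by linarith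
  moreover have "tl \<le> quo 1 + T * H2" using far[of 1] by simp
  moreover have "T * H2 \<le> T * H2 * (1 / r\<^sup>2)"
    using mult_left_mono[of 1 "1 / r\<^sup>2" "T * H2"] T HH r by (simp add: power_le_one)
  moreover have "T * H1 / 2 * (1 / r\<^sup>2) \<le> T * H1 * (1 / r\<^sup>2)" using T HH by (intro mult_right_mono) auto
  moreover have "T * (H1 + H2) * (1 / r\<^sup>2) = T * H1 * (1 / r\<^sup>2) + T * H2 * (1 / r\<^sup>2)"
    by (simp only: distrib_left distrib_right)
  ultimately have "tl - quo r \<le> T * (H1 + H2) * (1 / r\<^sup>2)" by linarith
  then show "tl - quo r \<le> tl powr (2 * p + 1) * H / r\<^sup>2" by (simp add: T_def HH)
qed

end

section \<open>Dominating functions for the moments\<close>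

lemma inverse_square_integrable:
  "set_integrable lborel {0<..} (\<lambda>r::real. C / (1 + r)\<^sup>2)"
proof -
  have "set_integrable lborel {0<..} (\<lambda>r::real. 1 / (1 + r)\<^sup>2)"
  proof (rule FTC_Ioi_nonneg(1)[where F="\<lambda>r. - 1 / (1 + r)" and A="-1" and B=0])
    fix x :: real assume x: "x > 0"
    then show "((\<lambda>r. - 1 / (1 + r)) has_real_derivative 1 / (1 + x)\<^sup>2) (at x)"
      by (auto intro!: derivative_eq_intros simp: power2_eq_square)
    show "isCont (\<lambda>r::real. 1 / (1 + r)\<^sup>2) x" using x by (auto intro!: continuous_intros)
  next
    show "((\<lambda>r::real. - 1 / (1 + r)) \<longlongrightarrow> -1) (at_right 0)" by real_asymp
    show "((\<lambda>r::real. - 1 / (1 + r)) \<longlongrightarrow> 0) at_top" by real_asymp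
  qed auto
  then have "set_integrable lborel {0<..} (\<lambda>r::real. C * (1 / (1 + r)\<^sup>2))" by (intro set_integrable_mult_right)
  then show ?thesis by simp
qed

lemma le_inverse_square:
  fixes f r A B :: real
  assumes "r \<ge> 0" "f \<le> A" "r\<^sup>2 * f \<le> B" "0 \<le> f"
  shows "f \<le> 2 * (A + B) / (1 + r)\<^sup>2"
proof -
  have "2 * r \<le> 1 + r\<^sup>2" using zero_le_power2[of "1 - r"] by (simp add: power2_eq_square algebra_simps)
  then have "(1 + r)\<^sup>2 \<le> 2 * (1 + r\<^sup>2)" by (simp add: power2_eq_square algebra_simps)
  then have "(1 + r)\<^sup>2 * f \<le> 2 * (1 + r\<^sup>2) * f" using assms by (intro mult_right_mono) auto
  also have "\<dots> \<le> 2 * (A + B)" using assms by (simp add: algebra_simps)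
  finally show ?thesis using assms by (simp add: field_simps)
qed

text \<open>The condition on \<open>k\<close> is where the dimensions part: \<open>k = d - 1\<close>
  is admissible for all \<open>d \<ge> 5\<close>, but \<open>k = d + 1\<close> only for
  \<open>d \<ge> 7\<close>. Two powers are kept in reserve so that the bound is an integrable
  inverse square.\<close>

lemma power_times_square_le:
  fixes t y C :: real
  assumes t: "t > 0" and y: "y \<ge> 0" "t \<le> 1 \<Longrightarrow> y \<le> 1" and C: "t ^ (d - 2) * y \<le> C" and k: "k + 2 \<le> 2 * (d - 2)"
  shows "\<bar>t ^ k * y\<^sup>2\<bar> \<le> (4 * (1 + C\<^sup>2)) / (1 + t)\<^sup>2"
proof -
  have f0: "0 \<le> t ^ k * y\<^sup>2" using t by simp
  have "t ^ k * y\<^sup>2 \<le> 1 + C\<^sup>2 \<and> t\<^sup>2 * (t ^ k * y\<^sup>2) \<le> 1 + C\<^sup>2"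
  proof (cases "t \<le> 1")
    case True
    have "y\<^sup>2 \<le> 1" using y True by (simp add: power_le_one)
    with True t have 1: "t ^ k * y\<^sup>2 \<le> 1" by (intro mult_le_one) (auto simp: power_le_one)
    with True t f0 have "t\<^sup>2 * (t ^ k * y\<^sup>2) \<le> 1" by (intro mult_le_one[OF _ f0 1]) (auto simp: power_le_one)
    then show ?thesis using 1 zero_le_power2[of C] by linarith
  next
    case False
    have "(t ^ (d - 2) * y)\<^sup>2 \<le> C\<^sup>2" using C t y by (intro power_mono) auto
    then have a: "t ^ (2 * (d - 2)) * y\<^sup>2 \<le> C\<^sup>2" by (simp add: power_mult_distrib power_mult[symmetric] mult.commute)
    have "t ^ j * y\<^sup>2 \<le> C\<^sup>2" if "j \<le> 2 * (d - 2)" for j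
    proof -
      have "t ^ j * y\<^sup>2 \<le> t ^ (2 * (d - 2)) * y\<^sup>2" using False that by (intro mult_right_mono power_increasing) auto
      then show ?thesis using a by simp
    qed
    from this[of k] this[of "k + 2"] k show ?thesis by (simp add: power_add power2_eq_square mult_ac)
  qed
  then have "t ^ k * y\<^sup>2 \<le> 2 * ((1 + C\<^sup>2) + (1 + C\<^sup>2)) / (1 + t)\<^sup>2"
    using t f0 by (intro le_inverse_square) auto
  then show ?thesis using f0 by simp
qed

context ground_state
begin

text \<open>The additional factor \<open>1 + r\<close>, paid for by the Gaussian decay beyond 1,
  compensates for the slow decay of the soliton tail in dimensions 5 and 6.\<close>

lemma u_global_bound:
  assumes bK: "b \<ge> K1" and G: "G \<ge> 1" "\<forall>r\<ge>0. r ^ (d - 1) * exp (- (1 / 4) * r\<^sup>2) \<le> G" and r: "r > 0"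
  shows "r ^ (d - 2) * (1 + r) * u r \<le> 2 * K2 * G / b"
proof (cases "r \<le> 1")
  case True
  have "r ^ (d - 2) * u r \<le> K1 / b" using u_le_near[OF r True] r b by (simp add: field_simps)
  then have "(1 + r) * (r ^ (d - 2) * u r) \<le> 2 * (K1 / b)"
    using True r u_pos[of r] by (intro mult_mono) auto
  also have "\<dots> \<le> 2 * K2 * G / b"
  proof -
    have "K1 * 1 \<le> K2 * G" using K12 G by (intro mult_mono) auto
    then show ?thesis using b by (simp add: divide_right_mono)
  qed
  finally show ?thesis by (simp add: mult_ac)
next
  case False
  have "r ^ (d - 2) * (1 + r) \<le> r ^ (d - 2) * (2 * r)" using False by (intro mult_left_mono) auto
  also have "\<dots> = 2 * r ^ (d - 1)" using d by (simp add: mult.commute mult.left_commute flip: power_Suc)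
     (simp add: Suc_diff_Suc numeral_2_eq_2)
  finally have "r ^ (d - 2) * (1 + r) * u r \<le> 2 * r ^ (d - 1) * (K2 / b * exp (- r\<^sup>2 / 4))"
    by (rule mult_mono) (use False u_le_far[of r] bK u_pos[of r] in auto)
  also have "\<dots> = 2 * K2 / b * (r ^ (d - 1) * exp (- (1 / 4) * r\<^sup>2))" by simp
  also have "\<dots> \<le> 2 * K2 / b * G" using G(2) r K12 b by (intro mult_left_mono) auto
  finally show ?thesis by simp
qed

text \<open>For large radii the functional is nonnegative and decreasing, so smallness at one point
  spreads to all larger radii.\<close>

lemma poho_tendsto_0: "(poho \<longlongrightarrow> 0) at_top"
proof (rule tendstoI)
  fix e :: real assume e: "e > 0"
  obtain x where x: "x > \<bar>l\<bar> + 1" "\<bar>poho x\<bar> < e" using poho_small[OF e] by blast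
  have "dist (poho y) 0 < e" if y: "y \<ge> x" for y
  proof -
    have "poho y \<le> poho x"
    proof (rule poho_ge)
      fix r assume "x < r"
      then have "r > \<bar>l\<bar>" "r > 1" using x by auto
      then have "r * 1 \<le> r * r" by (intro mult_left_mono) auto
      then show "l \<le> 2 * r\<^sup>2" using \<open>r > \<bar>l\<bar>\<close> by (simp add: power2_eq_square)
    qed (use x y in auto)
    then show ?thesis using poho_nonneg[of y] x y by auto
  qed
  then show "\<forall>\<^sub>F y in at_top. dist (poho y) 0 < e" by (rule eventually_at_top_linorderI[of x])
qed

lemma pohozaev_identity:
  assumes i1: "set_integrable lborel {0<..} (\<lambda>r. r ^ (d - 1) * (u r)\<^sup>2)"
    and i2: "set_integrable lborel {0<..} (\<lambda>r. r ^ (d + 1) * (u r)\<^sup>2)"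
  shows "l * (LINT r:{0<..}|lborel. r ^ (d - 1) * (u r)\<^sup>2) = 2 * (LINT r:{0<..}|lborel. r ^ (d + 1) * (u r)\<^sup>2)"
proof -
  have pw: "x ^ (d + 1) = x\<^sup>2 * x ^ (d - 1)" for x :: real
    using d by (subst power_add[symmetric]) (rule arg_cong[where f="power x"], simp)
  have eq: "l * (r ^ (d - 1) * (u r)\<^sup>2) - 2 * (r ^ (d + 1) * (u r)\<^sup>2) = (l - 2 * r\<^sup>2) * (u r)\<^sup>2 * r ^ (d - 1)" for r
    unfolding pw by (simp add: algebra_simps)
  have int: "set_integrable lborel {0<..} (\<lambda>r. l * (r ^ (d - 1) * (u r)\<^sup>2) - 2 * (r ^ (d + 1) * (u r)\<^sup>2))"
    by (intro set_integral_diff(1) set_integrable_mult_right i1 i2)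
  have "(LINT r:{0<..}|lborel. l * (r ^ (d - 1) * (u r)\<^sup>2) - 2 * (r ^ (d + 1) * (u r)\<^sup>2)) = 0 - 0"
  proof (rule FTC_Ioi[OF _ _ int])
    fix x :: real assume x: "x > 0"
    show "(poho has_real_derivative l * (x ^ (d - 1) * (u x)\<^sup>2) - 2 * (x ^ (d + 1) * (u x)\<^sup>2)) (at x)"
      unfolding eq by (rule poho_deriv[OF x])
    show "isCont (\<lambda>r. l * (r ^ (d - 1) * (u r)\<^sup>2) - 2 * (r ^ (d + 1) * (u r)\<^sup>2)) x"
      by (intro continuous_intros DERIV_isCont[OF du[OF x]])
  next
    have "(poho \<longlongrightarrow> poho 0) (at 0 within {0..})" using cont_poho by (simp add: continuous_on_def)
    then show "(poho \<longlongrightarrow> 0) (at_right 0)" by (simp add: poho_0 at_within_Ici_at_right)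
  qed (rule poho_tendsto_0)
  moreover have "(LINT r:{0<..}|lborel. l * (r ^ (d - 1) * (u r)\<^sup>2) - 2 * (r ^ (d + 1) * (u r)\<^sup>2))
     = (LINT r:{0<..}|lborel. l * (r ^ (d - 1) * (u r)\<^sup>2)) - (LINT r:{0<..}|lborel. 2 * (r ^ (d + 1) * (u r)\<^sup>2))"
    by (rule set_integral_diff(2)) (intro set_integrable_mult_right i1 i2)+
  ultimately show ?thesis by simp
qed

end

section \<open>The limit of large central value\<close>

text \<open>Nothing relates the ground states at different values of \<open>b\<close>; all limits
  rest on bounds uniform in \<open>b\<close>.\<close>

locale ground_family =
  fixes d :: nat and lam :: "real \<Rightarrow> real" and u u' u'' :: "real \<Rightarrow> real \<Rightarrow> real"
  assumes gs: "b > 0 \<Longrightarrow> ground_state d (lam b) b (u b) (u' b) (u'' b)"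
begin

abbreviation p where "p \<equiv> crit_p d"

lemma d: "d > 4" using ground_state.d[OF gs[of 1]] by simp

lemmas p = ground_state.p[OF gs[OF zero_less_one]]
lemmas p_eq = ground_state.p_eq[OF gs[OF zero_less_one]]
lemmas alpha_p_eq = ground_state.alpha_p_eq[OF gs[OF zero_less_one]]

abbreviation K1 where "K1 \<equiv> ground_state.K1 d"
abbreviation K2 where "K2 \<equiv> ground_state.K2 d"
abbreviation D1 where "D1 \<equiv> ground_state.D1 d"
lemmas K12 = ground_state.K12[OF gs[OF zero_less_one]]
lemmas D1_nonneg = ground_state.D1_nonneg[OF gs[OF zero_less_one]]

section \<open>The soliton scale and the vanishing of the eigenvalue\<close>

definition sol where "sol b t = u b (b powr (- p) * t) / b"
definition bub where "bub t = 1 / (1 + alpha_p p * t\<^sup>2) powr (1 / p)"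

text \<open>One estimate in two variables: with \<open>r = b powr (- p) * t\<close>, criticality
  gives \<open>(b powr (- p)) ^ (d - 2) = b powr (- 2)\<close>.\<close>

lemma sol_bounds: "\<exists>C>0. \<forall>\<^sub>F b in at_top. b \<ge> 1 \<and> (\<forall>r>0. b * (r ^ (d - 2) * (1 + r) * u b r) \<le> C) \<and>
     (\<forall>t>0. 0 < sol b t \<and> sol b t \<le> 1 \<and> t ^ (d - 2) * (1 + b powr (- p) * t) * sol b t \<le> C)"
proof -
  obtain G :: real where G: "G \<ge> 1" "\<And>r. r \<ge> 0 \<Longrightarrow> r ^ (d - 1) * exp (- (1 / 4) * r\<^sup>2) \<le> G"
    using power_exp_bound[of "1 / 4" "d - 1"] by (metis zero_less_divide_1_iff zero_less_numeral)
  have "\<forall>\<^sub>F b in at_top. b \<ge> 1 \<and> (\<forall>r>0. b * (r ^ (d - 2) * (1 + r) * u b r) \<le> 2 * K2 * G) \<and>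
     (\<forall>t>0. 0 < sol b t \<and> sol b t \<le> 1 \<and> t ^ (d - 2) * (1 + b powr (- p) * t) * sol b t \<le> 2 * K2 * G)"
    using eventually_ge_at_top[of "max 1 K1"]
  proof eventually_elim
    case (elim b)
    then have b: "b \<ge> 1" "b \<ge> K1" "b > 0" by auto
    interpret g: ground_state d "lam b" b "u b" "u' b" "u'' b" by (rule gs) (use b in simp)
    have 1: "b * (r ^ (d - 2) * (1 + r) * u b r) \<le> 2 * K2 * G" if "r > 0" for r
      using g.u_global_bound[OF b(2) G(1) _ that] G(2) b by (simp add: field_simps)
    have 2: "0 < sol b t \<and> sol b t \<le> 1 \<and> t ^ (d - 2) * (1 + b powr (- p) * t) * sol b t \<le> 2 * K2 * G" if t: "t > 0" for t
    proof -
      define r where "r = b powr (- p) * t"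
      have r: "r > 0" using b t by (simp add: r_def)
      have "(b powr (- p)) ^ (d - 2) = (b powr (- p)) powr (real d - 2)"
        using b d by (simp add: powr_realpow[symmetric] of_nat_diff)
      also have "\<dots> = b powr (- (p * (real d - 2)))" by (simp add: powr_powr)
      also have "\<dots> = b powr (- 2)" unfolding p(3) ..
      finally have bp: "(b powr (- p)) ^ (d - 2) = b powr (- 2)" .
      have "r ^ (d - 2) = b powr (- 2) * t ^ (d - 2)" unfolding r_def power_mult_distrib bp ..
      then have "t ^ (d - 2) = b\<^sup>2 * r ^ (d - 2)" using b by (simp add: powr_minus powr_numeral)
      then have "t ^ (d - 2) * (1 + r) * sol b t = b * (r ^ (d - 2) * (1 + r) * u b r)"
        using b by (simp add: sol_def r_def[symmetric] power2_eq_square)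
      then show ?thesis using 1[OF r] g.u_pos[of r] g.u_le_b[of r] r b unfolding r_def[symmetric] sol_def by simp
    qed
    show ?case using b 1 2 by blast
  qed
  moreover have "2 * K2 * G > 0" using K12 G by simp
  ultimately show ?thesis by blast
qed

lemma sol_tendsto: 
  assumes t: "t > 0"
  shows "((\<lambda>b. sol b t) \<longlongrightarrow> bub t) at_top"
proof -
  have "((\<lambda>b. b powr (- p) * t) \<longlongrightarrow> 0) at_top" using p(1) by real_asymp
  then have "\<forall>\<^sub>F b in at_top. b powr (- p) * t < 1" by (rule order_tendstoD) simp
  then have bd: "\<forall>\<^sub>F b in at_top. norm (sol b t - bub t) \<le> D1 * b powr (- 2 * p)"
    using eventually_gt_at_top[of 0]
  proof eventually_elim
    case (elim b)
    interpret g: ground_state d "lam b" b "u b" "u' b" "u'' b" by (rule gs) (use elim in simp)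
    define r where "r = b powr (- p) * t"
    have r: "0 \<le> r" "r \<le> 1" using elim t by (auto simp: r_def)
    have "r\<^sup>2 = b powr (- 2 * p) * t\<^sup>2"
      unfolding r_def power_mult_distrib by (simp add: power2_eq_square powr_add[symmetric])
    then have "b powr (2 * p) * r\<^sup>2 = t\<^sup>2" using elim by (simp add: powr_minus)
    then have "aubin_talenti p b r = b * bub t" unfolding aubin_talenti_def bub_def by (simp add: mult.assoc)
    then have "sol b t - bub t = (u b r - aubin_talenti p b r) / b"
      using elim by (simp add: sol_def r_def[symmetric] diff_divide_distrib)
    then have "\<bar>sol b t - bub t\<bar> = \<bar>u b r - aubin_talenti p b r\<bar> / b" using elim by simp
    also have "\<dots> \<le> D1 * b powr (1 - 2 * p) / b"
      using g.u_minus_aubin_talenti[OF r] elim by (intro divide_right_mono) auto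
    also have "\<dots> = D1 * b powr (- 2 * p)" using elim by (simp add: powr_diff powr_minus field_simps)
    finally show ?case by simp
  qed
  have "((\<lambda>b. D1 * b powr (- 2 * p)) \<longlongrightarrow> 0) at_top"
  proof -
    have "((\<lambda>b::real. b powr (- 2 * p)) \<longlongrightarrow> 0) at_top" using p(1) by real_asymp
    then show ?thesis by (rule tendsto_mult_right_zero)
  qed
  with bd have "((\<lambda>b. sol b t - bub t) \<longlongrightarrow> 0) at_top" by (rule Lim_null_comparison)
  then show ?thesis by (simp add: LIM_zero_iff)
qed

lemma bub_bounds: "t > 0 \<Longrightarrow> 0 < bub t" "t > 0 \<Longrightarrow> bub t \<le> 1" "t > 0 \<Longrightarrow> t ^ (d - 2) * bub t \<le> alpha_p p powr (- 1 / p)"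
proof -
  assume t: "t > 0"
  have K: "1 + alpha_p p * t\<^sup>2 \<ge> 1" using alpha_p_eq(2) by simp
  then show "bub t > 0" by (simp add: bub_def)
  have "(1 + alpha_p p * t\<^sup>2) powr (1 / p) \<ge> 1" using K p by (intro ge_one_powr_ge_zero) auto
  then show "bub t \<le> 1" 
  proof -
    have "1 / x \<le> 1" if "x \<ge> 1" for x :: real using that by (simp add: divide_le_eq_1_pos)
    then show ?thesis unfolding bub_def using \<open>(1 + alpha_p p * t\<^sup>2) powr (1 / p) \<ge> 1\<close> by blast
  qed
  have "bub t = aubin_talenti p 1 t" by (simp add: bub_def aubin_talenti_def)
  also have "\<dots> \<le> alpha_p p powr (- 1 / p) / t powr (2 / p)" using aubin_talenti_le[of 1 p t] p t by simp
  also have "t powr (2 / p) = t ^ (d - 2)" by (rule ground_state.r_powr[OF gs[OF zero_less_one] t])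
  finally show "t ^ (d - 2) * bub t \<le> alpha_p p powr (- 1 / p)" using t by (simp add: field_simps)
qed

lemma bub_cont: "continuous_on {0<..} bub"
proof -
  have "1 + alpha_p p * t\<^sup>2 > 0" for t using alpha_p_eq(2) by (simp add: add_pos_nonneg)
  then show ?thesis unfolding bub_def by (intro continuous_intros) (auto simp: less_imp_neq[symmetric])
qed

lemma sol_cont: "b > 0 \<Longrightarrow> continuous_on {0<..} (sol b)"
proof -
  assume b: "b > 0"
  have "continuous_on {0<..} (\<lambda>t. u b (b powr (- p) * t))"
    by (rule continuous_on_compose2[OF ground_state.cont_u[OF gs[OF b]]]) (use b in \<open>auto intro!: continuous_intros\<close>)
  then show ?thesis unfolding sol_def using b by (intro continuous_intros) auto
qed

definition mom where "mom k b = (LINT t:{0<..}|lborel. t ^ k * (sol b t)\<^sup>2)"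
definition bmom where "bmom k = (LINT t:{0<..}|lborel. t ^ k * (bub t)\<^sup>2)"

lemma bmom_integrable: "k + 2 \<le> 2 * (d - 2) \<Longrightarrow> set_integrable lborel {0<..} (\<lambda>t. t ^ k * (bub t)\<^sup>2)"
proof -
  assume k: "k + 2 \<le> 2 * (d - 2)"
  show ?thesis
  proof (rule set_integrable_bound[OF inverse_square_integrable])
    show "set_borel_measurable lborel {0<..} (\<lambda>t. t ^ k * (bub t)\<^sup>2)"
      by (intro set_borel_measurable_Ioi continuous_intros bub_cont)
    show "AE t in lborel. t \<in> {0<..} \<longrightarrow> norm (t ^ k * (bub t)\<^sup>2) \<le> norm (4 * (1 + (alpha_p p powr (- 1 / p))\<^sup>2) / (1 + t)\<^sup>2)"
    proof (intro AE_I2 impI)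
      fix t :: real assume "t \<in> {0<..}"
      then have "\<bar>t ^ k * (bub t)\<^sup>2\<bar> \<le> 4 * (1 + (alpha_p p powr (- 1 / p))\<^sup>2) / (1 + t)\<^sup>2"
        using bub_bounds[of t] k by (intro power_times_square_le[where d=d]) auto
      then show "norm (t ^ k * (bub t)\<^sup>2) \<le> norm (4 * (1 + (alpha_p p powr (- 1 / p))\<^sup>2) / (1 + t)\<^sup>2)"
        using abs_ge_self[of "4 * (1 + (alpha_p p powr (- 1 / p))\<^sup>2) / (1 + t)\<^sup>2"] unfolding real_norm_def by linarith
    qed
  qed
qed

lemma bmom_pos: "k + 2 \<le> 2 * (d - 2) \<Longrightarrow> bmom k > 0"
  unfolding bmom_def 
  by (rule set_integral_pos_Ioi[OF bmom_integrable]) (auto intro!: mult_pos_pos zero_less_power bub_bounds(1))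

lemma mom_tendsto:
  assumes k: "k + 2 \<le> 2 * (d - 2)"
  shows "(mom k \<longlongrightarrow> bmom k) at_top"
proof -
  obtain C where C: "C > 0" "\<forall>\<^sub>F b in at_top. b \<ge> 1 \<and> (\<forall>r>0. b * (r ^ (d - 2) * (1 + r) * u b r) \<le> C) \<and>
     (\<forall>t>0. 0 < sol b t \<and> sol b t \<le> 1 \<and> t ^ (d - 2) * (1 + b powr (- p) * t) * sol b t \<le> C)"
    using sol_bounds by blast
  show ?thesis unfolding mom_def bmom_def
  proof (rule set_dominated_convergence_at_top[OF _ _ _ inverse_square_integrable[of "4 * (1 + C\<^sup>2)"]])
    show "\<forall>\<^sub>F b in at_top. set_borel_measurable lborel {0<..} (\<lambda>t. t ^ k * (sol b t)\<^sup>2)"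
      using eventually_gt_at_top[of 0] by eventually_elim (intro set_borel_measurable_Ioi continuous_intros sol_cont)
    show "set_borel_measurable lborel {0<..} (\<lambda>t. t ^ k * (bub t)\<^sup>2)"
      by (intro set_borel_measurable_Ioi continuous_intros bub_cont)
    show "\<forall>\<^sub>F b in at_top. \<forall>t\<in>{0<..}. \<bar>t ^ k * (sol b t)\<^sup>2\<bar> \<le> 4 * (1 + C\<^sup>2) / (1 + t)\<^sup>2"
      using C(2)
    proof eventually_elim
      case (elim b)
      show ?case
      proof
        fix t :: real assume "t \<in> {0<..}"
        then have t: "t > 0" by simp
        then have s: "0 < sol b t" "sol b t \<le> 1" "t ^ (d - 2) * (1 + b powr (- p) * t) * sol b t \<le> C" using elim by auto
        have "t ^ (d - 2) * 1 * sol b t \<le> t ^ (d - 2) * (1 + b powr (- p) * t) * sol b t"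
          using s t by (intro mult_right_mono mult_left_mono) auto
        then have "t ^ (d - 2) * sol b t \<le> C" using s(3) by simp
        then show "\<bar>t ^ k * (sol b t)\<^sup>2\<bar> \<le> 4 * (1 + C\<^sup>2) / (1 + t)\<^sup>2"
          using s by (intro power_times_square_le[OF t _ _ _ k]) auto
      qed
    qed
    fix t :: real assume "t \<in> {0<..}"
    then show "((\<lambda>b. t ^ k * (sol b t)\<^sup>2) \<longlongrightarrow> t ^ k * (bub t)\<^sup>2) at_top"
      by (intro tendsto_intros sol_tendsto) auto
  qed simp
qed

text \<open>For \<open>d = 5\<close> and \<open>d = 6\<close> the moment itself need not stay
  bounded. Writing the integrand as
  \<open>t ^ (d - 1) * (b powr (- p) * t * sol b t)\<^sup>2\<close>, the additional decay
  \<open>1 + b powr (- p) * t\<close> in \<open>sol_bounds\<close> lets the lower moment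
  \<open>d - 1\<close> dominate, while the integrand tends to 0 pointwise.\<close>

lemma mom_vanish: "((\<lambda>b. b powr (- 2 * p) * mom (d + 1) b) \<longlongrightarrow> 0) at_top"
proof -
  obtain C where C: "C > 0" "\<forall>\<^sub>F b in at_top. b \<ge> 1 \<and> (\<forall>r>0. b * (r ^ (d - 2) * (1 + r) * u b r) \<le> C) \<and>
     (\<forall>t>0. 0 < sol b t \<and> sol b t \<le> 1 \<and> t ^ (d - 2) * (1 + b powr (- p) * t) * sol b t \<le> C)"
    using sol_bounds by blast
  have pw: "x ^ (d + 1) = x\<^sup>2 * x ^ (d - 1)" for x :: real
    using d by (subst power_add[symmetric]) (rule arg_cong[where f="power x"], simp)
  have eq: "b powr (- 2 * p) * (t ^ (d + 1) * (sol b t)\<^sup>2) = t ^ (d - 1) * (b powr (- p) * t * sol b t)\<^sup>2" for b t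
  proof -
    have "b powr (- 2 * p) = (b powr (- p))\<^sup>2" by (simp add: power2_eq_square powr_add[symmetric])
    then show ?thesis unfolding pw by (simp add: power_mult_distrib mult_ac)
  qed
  have "((\<lambda>b. LINT t:{0<..}|lborel. b powr (- 2 * p) * (t ^ (d + 1) * (sol b t)\<^sup>2)) \<longlongrightarrow> (LINT t:{0::real<..}|lborel. 0)) at_top"
  proof (rule set_dominated_convergence_at_top[where g="\<lambda>_. 0", OF _ _ _ inverse_square_integrable[of "4 * (1 + C\<^sup>2)"]])
    show "\<forall>\<^sub>F b in at_top. set_borel_measurable lborel {0<..} (\<lambda>t. b powr (- 2 * p) * (t ^ (d + 1) * (sol b t)\<^sup>2))"
      using eventually_gt_at_top[of 0] by eventually_elim (intro set_borel_measurable_Ioi continuous_intros sol_cont)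
    show "set_borel_measurable lborel {0<..} (\<lambda>t::real. 0::real)" by (simp add: set_borel_measurable_def)
    show "\<forall>\<^sub>F b in at_top. \<forall>t\<in>{0<..}. \<bar>b powr (- 2 * p) * (t ^ (d + 1) * (sol b t)\<^sup>2)\<bar> \<le> 4 * (1 + C\<^sup>2) / (1 + t)\<^sup>2"
      using C(2)
    proof eventually_elim
      case (elim b)
      show ?case
      proof
        fix t :: real assume "t \<in> {0<..}"
        then have t: "t > 0" by simp
        then have s: "0 < sol b t" "sol b t \<le> 1" "t ^ (d - 2) * (1 + b powr (- p) * t) * sol b t \<le> C" using elim by auto
        have bp: "b powr (- p) \<le> 1" using elim p powr_mono[of "- p" 0 b] by simp
        show "\<bar>b powr (- 2 * p) * (t ^ (d + 1) * (sol b t)\<^sup>2)\<bar> \<le> 4 * (1 + C\<^sup>2) / (1 + t)\<^sup>2"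
          unfolding eq
        proof (rule power_times_square_le[where d=d])
          have "t ^ (d - 2) * (b powr (- p) * t) * sol b t \<le> t ^ (d - 2) * (1 + b powr (- p) * t) * sol b t"
            using s t by (intro mult_right_mono mult_left_mono) auto
          then have "t ^ (d - 2) * (b powr (- p) * t) * sol b t \<le> C" using s(3) by (rule order_trans)
          then show "t ^ (d - 2) * (b powr (- p) * t * sol b t) \<le> C" by (simp only: mult.assoc)
          show "d - 1 + 2 \<le> 2 * (d - 2)" using d by simp
          show "b powr (- p) * t * sol b t \<le> 1" if "t \<le> 1"
            using that t s bp by (intro mult_le_one) auto
        qed (use t s in auto)
      qed
    qed
    fix t :: real assume "t \<in> {0<..}"
    have "((\<lambda>b. b powr (- 2 * p)) \<longlongrightarrow> 0) at_top" using p(1) by real_asymp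
    then have "((\<lambda>b. b powr (- 2 * p) * (t ^ (d + 1) * (sol b t)\<^sup>2)) \<longlongrightarrow> 0 * (t ^ (d + 1) * (bub t)\<^sup>2)) at_top"
      using \<open>t \<in> {0<..}\<close> by (intro tendsto_intros sol_tendsto) auto
    then show "((\<lambda>b. b powr (- 2 * p) * (t ^ (d + 1) * (sol b t)\<^sup>2)) \<longlongrightarrow> 0) at_top" by simp
  qed simp
  then show ?thesis by (simp add: mom_def)
qed

lemma mom_scale:
  assumes b: "b > 0"
  shows "(LINT r:{0<..}|lborel. r ^ k * (u b r)\<^sup>2) = b powr (2 - p * (real k + 1)) * mom k b"
proof -
  define s where "s = b powr (- p)"
  have s: "s > 0" using b by (simp add: s_def)
  have "(LINT r:{0<..}|lborel. r ^ k * (u b r)\<^sup>2) = s * (LINT t:{0<..}|lborel. (s * t) ^ k * (u b (s * t))\<^sup>2)"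
    by (rule set_integral_Ioi_scale[OF s])
  also have "(LINT t:{0<..}|lborel. (s * t) ^ k * (u b (s * t))\<^sup>2) = (LINT t:{0<..}|lborel. s ^ k * b\<^sup>2 * (t ^ k * (sol b t)\<^sup>2))"
    using b by (intro set_lebesgue_integral_cong) (auto simp: sol_def s_def power_mult_distrib power_divide)
  also have "\<dots> = s ^ k * b\<^sup>2 * mom k b" by (simp add: mom_def)
  also have "s * (s ^ k * b\<^sup>2 * mom k b) = (s ^ (k + 1) * b\<^sup>2) * mom k b" by simp
  also have "s ^ (k + 1) = b powr (- p * (real k + 1))"
    using s by (simp add: s_def powr_realpow[symmetric] powr_powr powr_add[symmetric] algebra_simps)
  also have "b powr (- p * (real k + 1)) * b\<^sup>2 = b powr (2 - p * (real k + 1))"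
    using b by (simp add: powr_diff powr_minus powr_numeral divide_simps)
  finally show ?thesis .
qed

lemma sol_integrable: "\<forall>\<^sub>F b in at_top. set_integrable lborel {0<..} (\<lambda>r. r ^ (d - 1) * (u b r)\<^sup>2)
    \<and> set_integrable lborel {0<..} (\<lambda>r. r ^ (d + 1) * (u b r)\<^sup>2)"
proof -
  obtain C where C: "C > 0" "\<forall>\<^sub>F b in at_top. b \<ge> 1 \<and> (\<forall>r>0. b * (r ^ (d - 2) * (1 + r) * u b r) \<le> C) \<and>
     (\<forall>t>0. 0 < sol b t \<and> sol b t \<le> 1 \<and> t ^ (d - 2) * (1 + b powr (- p) * t) * sol b t \<le> C)"
    using sol_bounds by blast
  from C(2) show ?thesis
  proof eventually_elim
    case (elim b)
    then have b: "b > 0" "b \<ge> 1" by auto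
    interpret g: ground_state d "lam b" b "u b" "u' b" "u'' b" by (rule gs[OF b(1)])
    define C' where "C' = C / b"
    have r: "0 < r \<Longrightarrow> r ^ (d - 2) * (1 + r) * u b r \<le> C'" for r
    proof -
      assume "0 < r"
      then have "b * (r ^ (d - 2) * (1 + r) * u b r) \<le> C" using elim by blast
      then show ?thesis unfolding C'_def pos_le_divide_eq[OF b(1)] by (simp only: mult.commute)
    qed
    have bd: "\<bar>r ^ (d - 1) * (y * u b r / b)\<^sup>2\<bar> \<le> (4 * (1 + (C' / b)\<^sup>2)) / (1 + r)\<^sup>2" if "r > 0" "y = 1 \<or> y = r" for r y
    proof (rule power_times_square_le[where d=d])
      have "r ^ (d - 2) * y * u b r \<le> r ^ (d - 2) * (1 + r) * u b r"
        using that g.u_pos[of r] by (intro mult_right_mono mult_left_mono) auto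
      then show "r ^ (d - 2) * (y * u b r / b) \<le> C' / b" using r[OF that(1)] b by (simp add: divide_right_mono mult.assoc)
      show "d - 1 + 2 \<le> 2 * (d - 2)" using d by simp
      show "y * u b r / b \<le> 1" if "r \<le> 1"
        using that \<open>r > 0\<close> \<open>y = 1 \<or> y = r\<close> g.u_le_b[of r] b g.u_pos[of r] mult_mono[of r 1 "u b r" b] by auto
    qed (use that g.u_pos[of r] b in auto)
    have i: "set_integrable lborel {0<..} (\<lambda>r. r ^ (d - 1) * (y r * u b r)\<^sup>2)"
      if y: "\<And>r. r > 0 \<Longrightarrow> y r = 1 \<or> y r = r" "continuous_on {0<..} y" for y
    proof (rule set_integrable_bound[OF inverse_square_integrable[of "b\<^sup>2 * (4 * (1 + (C' / b)\<^sup>2))"]])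
      show "set_borel_measurable lborel {0<..} (\<lambda>r. r ^ (d - 1) * (y r * u b r)\<^sup>2)"
        by (intro set_borel_measurable_Ioi continuous_intros y(2) continuous_on_subset[OF g.cont_u]) auto
      show "AE r in lborel. r \<in> {0<..} \<longrightarrow> norm (r ^ (d - 1) * (y r * u b r)\<^sup>2) \<le> norm (b\<^sup>2 * (4 * (1 + (C' / b)\<^sup>2)) / (1 + r)\<^sup>2)"
      proof (intro AE_I2 impI)
        fix r :: real assume "r \<in> {0<..}"
        then have r: "r > 0" by simp
        have "r ^ (d - 1) * (y r * u b r)\<^sup>2 = b\<^sup>2 * (r ^ (d - 1) * (y r * u b r / b)\<^sup>2)"
          using b by (simp add: power_divide)
        moreover have "b\<^sup>2 * (r ^ (d - 1) * (y r * u b r / b)\<^sup>2) \<le> b\<^sup>2 * ((4 * (1 + (C' / b)\<^sup>2)) / (1 + r)\<^sup>2)"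
          using bd[OF r y(1)[OF r]] by (intro mult_left_mono) auto
        ultimately have "r ^ (d - 1) * (y r * u b r)\<^sup>2 \<le> b\<^sup>2 * (4 * (1 + (C' / b)\<^sup>2)) / (1 + r)\<^sup>2"
          by (simp only: times_divide_eq_right)
        moreover have "0 \<le> r ^ (d - 1) * (y r * u b r)\<^sup>2" using r by simp
        ultimately show "norm (r ^ (d - 1) * (y r * u b r)\<^sup>2) \<le> norm (b\<^sup>2 * (4 * (1 + (C' / b)\<^sup>2)) / (1 + r)\<^sup>2)"
          using abs_ge_self[of "b\<^sup>2 * (4 * (1 + (C' / b)\<^sup>2)) / (1 + r)\<^sup>2"] unfolding real_norm_def by linarith
      qed
    qed
    have pw: "x ^ (d + 1) * (u b x)\<^sup>2 = x ^ (d - 1) * (x * u b x)\<^sup>2" for x :: real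
    proof -
      have "x ^ (d + 1) = x\<^sup>2 * x ^ (d - 1)" using d by (subst power_add[symmetric]) (rule arg_cong[where f="power x"], simp)
      then show ?thesis by (simp add: power_mult_distrib)
    qed
    have i1: "set_integrable lborel {0<..} (\<lambda>r. r ^ (d - 1) * (u b r)\<^sup>2)" using i[of "\<lambda>_. 1"] by simp
    have i2: "set_integrable lborel {0<..} (\<lambda>r. r ^ (d + 1) * (u b r)\<^sup>2)" unfolding pw using i[of "\<lambda>r. r"] by simp
    show ?case using i1 i2 by blast
  qed
qed

text \<open>The Pohozaev identity in the soliton variable: the scaling exponents
  \<open>2 - p * d = - 2 * p\<close> and \<open>2 - p * (d + 2) = - 4 * p\<close> leave one factor
  \<open>b powr (- 2 * p)\<close>.\<close>

lemma lam_eq: "\<forall>\<^sub>F b in at_top. lam b = 2 * (b powr (- 2 * p) * mom (d + 1) b) / mom (d - 1) b"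
proof -
  have "(mom (d - 1) \<longlongrightarrow> bmom (d - 1)) at_top" "bmom (d - 1) > 0" using d by (intro mom_tendsto bmom_pos; simp)+
  then have "\<forall>\<^sub>F b in at_top. mom (d - 1) b > 0" by (intro order_tendstoD) auto
  with sol_integrable eventually_gt_at_top[of 0] show ?thesis
  proof eventually_elim
    case (elim b)
    then have b: "b > 0" and i1: "set_integrable lborel {0<..} (\<lambda>r. r ^ (d - 1) * (u b r)\<^sup>2)"
      and i2: "set_integrable lborel {0<..} (\<lambda>r. r ^ (d + 1) * (u b r)\<^sup>2)" by auto
    interpret g: ground_state d "lam b" b "u b" "u' b" "u'' b" by (rule gs[OF b])
    have "lam b * (b powr (2 - p * (real (d - 1) + 1)) * mom (d - 1) b) = 2 * (b powr (2 - p * (real (d + 1) + 1)) * mom (d + 1) b)"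
      using g.pohozaev_identity[OF i1 i2] unfolding mom_scale[OF b] .
    moreover have "2 - p * (real (d - 1) + 1) = - 2 * p" "2 - p * (real (d + 1) + 1) = - 2 * p + - 2 * p"
      using p(4) d by (simp_all add: algebra_simps of_nat_diff)
    ultimately have "lam b * (b powr (- 2 * p) * mom (d - 1) b) = 2 * (b powr (- 2 * p) * b powr (- 2 * p) * mom (d + 1) b)"
      by (simp only: powr_add)
    then have "b powr (- 2 * p) * (lam b * mom (d - 1) b) = b powr (- 2 * p) * (2 * (b powr (- 2 * p) * mom (d + 1) b))"
      by (simp only: mult_ac)
    then have "lam b * mom (d - 1) b = 2 * (b powr (- 2 * p) * mom (d + 1) b)" using b by simp
    then show ?case using elim by (simp add: field_simps)
  qed
qed

text \<open>A limit without a rate, obtained from the soliton side alone; it makes the Kummer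
  parameters converge.\<close>

lemma lam_tendsto_0: "(lam \<longlongrightarrow> 0) at_top"
proof -
  have I: "(mom (d - 1) \<longlongrightarrow> bmom (d - 1)) at_top" "bmom (d - 1) > 0" using d by (intro mom_tendsto bmom_pos; simp)+
  have "((\<lambda>b. 2 * (b powr (- 2 * p) * mom (d + 1) b) / mom (d - 1) b) \<longlongrightarrow> 2 * 0 / bmom (d - 1)) at_top"
    using I by (intro tendsto_intros mom_vanish) auto
  moreover have "\<forall>\<^sub>F b in at_top. 2 * (b powr (- 2 * p) * mom (d + 1) b) / mom (d - 1) b = lam b"
    using lam_eq by eventually_elim simp
  ultimately have "(lam \<longlongrightarrow> 2 * 0 / bmom (d - 1)) at_top" by (rule Lim_transform_eventually)
  then show ?thesis by simp
qed

end

context ground_family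
begin

section \<open>Matching the soliton to the linear solution\<close>

definition c where "c b = ground_state.tl d (lam b) (u b)"
definition quo where "quo b = ground_state.quo d (lam b) (u b)"
definition ka where "ka b = ground_state.ka d (lam b)"
definition kg where "kg b = ground_state.kg d (lam b)"
abbreviation a0 where "a0 \<equiv> real d / 4"
abbreviation g0 where "g0 \<equiv> (real d - 4) / 4"

lemma ka_eq: "ka b = (real d - lam b) / 4" and kg_eq: "kg b = (real d - 4 + lam b) / 4" if "b > 0"
  using ground_state.ka_def[OF gs[OF that]] ground_state.kg_def[OF gs[OF that]] by (simp_all add: ka_def kg_def)

lemma quo_eq: "b > 0 \<Longrightarrow> quo b r = u b r / lin_sol (ka b) (kg b) r"
  using ground_state.quo_def[OF gs, of b r] by (simp add: quo_def ka_def kg_def)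

lemma u_eq: "b > 0 \<Longrightarrow> r > 0 \<Longrightarrow> u b r = quo b r * lin_sol (ka b) (kg b) r"
  using quo_eq[of b r] ground_state.phi_pos[OF gs, of b r] by (simp add: ka_def kg_def)

lemma c_pos: "b > 0 \<Longrightarrow> c b > 0"
  using ground_state.tl_pos[OF gs] by (simp add: c_def)

lemma quo_le_c: "b > 0 \<Longrightarrow> r > 0 \<Longrightarrow> quo b r \<le> c b"
  using ground_state.quo_le_tl[OF gs] by (simp add: c_def quo_def)

lemma ka_tendsto: "(ka \<longlongrightarrow> a0) at_top" and kg_tendsto: "(kg \<longlongrightarrow> g0) at_top"
proof -
  have "((\<lambda>b. (real d - lam b) / 4) \<longlongrightarrow> (real d - 0) / 4) at_top"
    by (intro tendsto_intros lam_tendsto_0) simp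
  moreover have "\<forall>\<^sub>F b in at_top. (real d - lam b) / 4 = ka b"
    using eventually_gt_at_top[of 0] by eventually_elim (simp add: ka_eq)
  ultimately show "(ka \<longlongrightarrow> a0) at_top" using Lim_transform_eventually by fastforce
  have "((\<lambda>b. (real d - 4 + lam b) / 4) \<longlongrightarrow> (real d - 4 + 0) / 4) at_top"
    by (intro tendsto_intros lam_tendsto_0) simp
  moreover have "\<forall>\<^sub>F b in at_top. (real d - 4 + lam b) / 4 = kg b"
    using eventually_gt_at_top[of 0] by eventually_elim (simp add: kg_eq)
  ultimately show "(kg \<longlongrightarrow> g0) at_top" using Lim_transform_eventually by fastforce
qed

lemma a0g0: "a0 > 0" "g0 > 0" "a0 + g0 = 1 / p"
  using d p_eq(2) by (auto simp: field_simps)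

lemma Gamma_nz: "Gamma (1 / p) \<noteq> 0" "Gamma a0 \<noteq> 0"
  using less_imp_neq[OF Gamma_real_pos[of "1 / p"]] less_imp_neq[OF Gamma_real_pos[OF a0g0(1)]] p by auto

lemma Gamma_ka_tendsto: "((\<lambda>b. Gamma (ka b)) \<longlongrightarrow> Gamma a0) at_top"
proof (rule tendsto_Gamma[OF ka_tendsto])
  show "a0 \<notin> \<int>\<^sub>\<le>\<^sub>0" using a0g0(1) by (auto elim!: nonpos_Ints_cases)
qed

lemma lin_sol_lim: "r > 0 \<Longrightarrow> ((\<lambda>b. lin_sol (ka b) (kg b) r) \<longlongrightarrow> lin_sol a0 g0 r) at_top"
  unfolding lin_sol_def using Gamma_real_pos[OF a0g0(1)]
  by (intro tendsto_intros kummer_int_tendsto ka_tendsto kg_tendsto a0g0 Gamma_ka_tendsto) auto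

text \<open>The constants of \<open>tl_minus_quo\<close> converge together with the Kummer
  parameters, so one \<open>M\<close> eventually bounds them all. \<open>c b \<le> M / b\<close>
  combines \<open>tl_le_u1\<close>, the soliton tail at radius 1 and the lower bound for the linear
  solution there.\<close>

lemma uniform_bounds:
  "\<exists>M>0. \<forall>\<^sub>F b in at_top. b \<ge> 1 \<and> c b \<le> M / b \<and>
     (\<forall>r. 0 < r \<longrightarrow> r \<le> 1 \<longrightarrow> r ^ (d - 2) * lin_sol (ka b) (kg b) r \<le> M \<and> c b - quo b r \<le> c b powr (2 * p + 1) * M / r\<^sup>2) \<and>
     (\<forall>r\<ge>1. r powr (2 * ka b) * exp (r\<^sup>2 / 2) * lin_sol (ka b) (kg b) r \<le> M \<and> c b - quo b r \<le> c b powr (2 * p + 1) * M)"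
proof -
  obtain G :: real where G: "G \<ge> 1" "\<And>r. r \<ge> 0 \<Longrightarrow> r ^ (d + 1) * exp (- (p / 2) * r\<^sup>2) \<le> G"
    using power_exp_bound[of "p / 2" "d + 1"] p by auto
  define m where "m b = kummer_int (ka b) (kg b) 1 / Gamma (ka b)" for b
  define L where "L b = exp (- 1 / 2) * Gamma (ka b + kg b) / Gamma (ka b)" for b
  define H where "H b = (m b * G) powr (2 * p + 2) / (real d * (L b)\<^sup>2) + m b powr (2 * p) * G" for b
  define m0 where "m0 = kummer_int a0 g0 1 / Gamma a0"
  define L0 where "L0 = exp (- 1 / 2) * Gamma (a0 + g0) / Gamma a0"
  have Ga: "Gamma a0 > 0" "Gamma (a0 + g0) > 0" using a0g0 p by (auto intro!: Gamma_real_pos)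
  have m: "(m \<longlongrightarrow> m0) at_top"
    unfolding m_def m0_def using Ga by (intro tendsto_intros kummer_int_tendsto ka_tendsto kg_tendsto a0g0 Gamma_ka_tendsto) auto
  have m0: "m0 > 0" unfolding m0_def using Ga a0g0 by (intro divide_pos_pos kummer_int_pos) auto
  have "((\<lambda>b. Gamma (ka b + kg b)) \<longlongrightarrow> Gamma (a0 + g0)) at_top"
  proof (rule tendsto_Gamma)
    show "a0 + g0 \<notin> \<int>\<^sub>\<le>\<^sub>0"
    proof
      assume "a0 + g0 \<in> \<int>\<^sub>\<le>\<^sub>0"
      from nonpos_Ints_nonpos[OF this] a0g0(1,2) show False by linarith
    qed
  qed (intro tendsto_intros ka_tendsto kg_tendsto)
  then have L: "(L \<longlongrightarrow> L0) at_top" unfolding L_def L0_def using Ga(1)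
    by (intro tendsto_divide tendsto_mult Gamma_ka_tendsto tendsto_const) auto
  have L0: "L0 > 0" using Ga by (simp add: L0_def)
  define H0 where "H0 = (m0 * G) powr (2 * p + 2) / (real d * L0\<^sup>2) + m0 powr (2 * p) * G"
  have H: "(H \<longlongrightarrow> H0) at_top"
    unfolding H_def H0_def using m0 L0 G d by (intro tendsto_intros m L) auto
  have H0: "H0 \<ge> 0" using G by (simp add: H0_def)
  define M1 where "M1 = 2 * K1 * exp G / L0"
  define M where "M = M1 + (m0 + 1) + (H0 + 1)"
  have M1: "M1 > 0" using K12 L0 by (simp add: M1_def)
  then have M: "M > 0" "M \<ge> M1" "M \<ge> m0 + 1" "M \<ge> H0 + 1" using m0 H0 by (auto simp: M_def)
  have "\<forall>\<^sub>F b in at_top. m b < m0 + 1" "\<forall>\<^sub>F b in at_top. L b > L0 / 2" "\<forall>\<^sub>F b in at_top. H b < H0 + 1"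
    using order_tendstoD(2)[OF m, of "m0 + 1"] order_tendstoD(1)[OF L, of "L0 / 2"] order_tendstoD(2)[OF H, of "H0 + 1"] L0 by auto
  then have "\<forall>\<^sub>F b in at_top. b \<ge> 1 \<and> c b \<le> M / b \<and>
     (\<forall>r. 0 < r \<longrightarrow> r \<le> 1 \<longrightarrow> r ^ (d - 2) * lin_sol (ka b) (kg b) r \<le> M \<and> c b - quo b r \<le> c b powr (2 * p + 1) * M / r\<^sup>2) \<and>
     (\<forall>r\<ge>1. r powr (2 * ka b) * exp (r\<^sup>2 / 2) * lin_sol (ka b) (kg b) r \<le> M \<and> c b - quo b r \<le> c b powr (2 * p + 1) * M)"
    using eventually_ge_at_top[of "max 1 (max K1 K2)"]
  proof eventually_elim
    case (elim b)
    then have b: "b \<ge> 1" "b \<ge> K1" "b \<ge> K2" "b > 0" by auto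
    interpret g: ground_state d "lam b" b "u b" "u' b" "u'' b" by (rule gs[OF b(4)])
    note k = ka_def[of b, symmetric] kg_def[of b, symmetric]
    have G': "\<forall>r\<ge>0. r ^ (d + 1) * exp (- (p / 2) * r\<^sup>2) \<le> G" using G(2) by blast
    have me: "m b = kummer_int g.ka g.kg 1 / Gamma g.ka" and Le: "L b = exp (- 1 / 2) * Gamma (g.ka + g.kg) / Gamma g.ka"
      by (simp_all add: m_def L_def ka_def kg_def)
    note pb = g.phi_bounds[OF G(1) G' me Le, unfolded k]
    note tq = g.tl_minus_quo[OF G(1) G' me Le H_def, folded c_def quo_def]
    have T: "c b powr (2 * p + 1) \<ge> 0" by simp
    have THM: "c b powr (2 * p + 1) * H b \<le> c b powr (2 * p + 1) * M"
      using elim M by (intro mult_left_mono) auto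
    have near: "r ^ (d - 2) * lin_sol (ka b) (kg b) r \<le> M \<and> c b - quo b r \<le> c b powr (2 * p + 1) * M / r\<^sup>2" if r: "0 < r" "r \<le> 1" for r
    proof
      show "r ^ (d - 2) * lin_sol (ka b) (kg b) r \<le> M" using pb(3)[OF r] elim M by linarith
      have "c b powr (2 * p + 1) * H b / r\<^sup>2 \<le> c b powr (2 * p + 1) * M / r\<^sup>2"
        using THM by (intro divide_right_mono) auto
      then show "c b - quo b r \<le> c b powr (2 * p + 1) * M / r\<^sup>2" using tq(2)[OF r] by linarith
    qed
    have far: "r powr (2 * ka b) * exp (r\<^sup>2 / 2) * lin_sol (ka b) (kg b) r \<le> M \<and> c b - quo b r \<le> c b powr (2 * p + 1) * M" if r: "r \<ge> 1" for r
    proof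
      have "r powr (2 * ka b) * exp (r\<^sup>2 / 2) * lin_sol (ka b) (kg b) r \<le> m b"
        unfolding m_def by (rule lin_sol_le_far[OF g.kag(1,3)[unfolded k] r])
      then show "r powr (2 * ka b) * exp (r\<^sup>2 / 2) * lin_sol (ka b) (kg b) r \<le> M" using elim M by linarith
      show "c b - quo b r \<le> c b powr (2 * p + 1) * M" using tq(1)[OF r] THM by linarith
    qed
    have "c b \<le> M / b"
    proof -
      have "c b \<le> quo b 1 * exp G" using g.tl_le_u1[OF b(3,2) G(1) G'] by (simp add: c_def quo_def)
      also have "quo b 1 = u b 1 / lin_sol (ka b) (kg b) 1" by (rule quo_eq[OF b(4)])
      also have "\<dots> \<le> (K1 / b) / (L0 / 2)"
      proof (rule frac_le)
        show "u b 1 \<le> K1 / b" using g.u_le_near[of 1] by simp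
        show "L0 / 2 \<le> lin_sol (ka b) (kg b) 1" using pb(2)[of 1] elim by simp
      qed (use K12 b L0 in auto)
      finally have "c b \<le> (K1 / b) / (L0 / 2) * exp G" by simp
      also have "\<dots> = M1 / b" by (simp add: M1_def field_simps)
      also have "\<dots> \<le> M / b" using M b by (intro divide_right_mono) auto
      finally show ?thesis .
    qed
    then show ?case using b near far by blast
  qed
  then show ?thesis using M by blast
qed

text \<open>As \<open>c b\<close> is at most of order \<open>1 / b\<close>, the product
  \<open>b * c b powr (2 * p + 1)\<close> is at most of order \<open>b powr (- 2 * p)\<close>: after
  scaling by \<open>b\<close>, quotient and tail constant agree wherever \<open>r\<close> is large
  against \<open>b powr (- p)\<close>.\<close>

lemma quo_close: "\<exists>M>0. \<forall>\<^sub>F b in at_top. \<forall>r>0. norm (b * (c b - quo b r)) \<le> M * (b powr (- 2 * p) * (1 + 1 / r\<^sup>2))"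
proof -
  obtain M where M: "M > 0" "\<forall>\<^sub>F b in at_top. b \<ge> 1 \<and> c b \<le> M / b \<and>
     (\<forall>r. 0 < r \<longrightarrow> r \<le> 1 \<longrightarrow> r ^ (d - 2) * lin_sol (ka b) (kg b) r \<le> M \<and> c b - quo b r \<le> c b powr (2 * p + 1) * M / r\<^sup>2) \<and>
     (\<forall>r\<ge>1. r powr (2 * ka b) * exp (r\<^sup>2 / 2) * lin_sol (ka b) (kg b) r \<le> M \<and> c b - quo b r \<le> c b powr (2 * p + 1) * M)"
    using uniform_bounds by blast
  have "\<forall>\<^sub>F b in at_top. \<forall>r>0. norm (b * (c b - quo b r)) \<le> (M powr (2 * p + 1) * M) * (b powr (- 2 * p) * (1 + 1 / r\<^sup>2))"
    using M(2)
  proof eventually_elim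
    case (elim b)
    then have b: "b > 0" "b \<ge> 1" "c b \<le> M / b" by auto
    show ?case
    proof (intro allI impI)
      fix r :: real assume r: "r > 0"
      have cp: "c b powr (2 * p + 1) * M \<ge> 0" using M by simp
      have "c b - quo b r \<le> (c b powr (2 * p + 1) * M) * (1 + 1 / r\<^sup>2)"
      proof (cases "r \<le> 1")
        case True
        then have "c b - quo b r \<le> (c b powr (2 * p + 1) * M) * (1 / r\<^sup>2)" using elim r by simp
        then show ?thesis using cp by (simp add: distrib_left)
      next
        case False
        then have "c b - quo b r \<le> c b powr (2 * p + 1) * M" using elim by simp
        moreover have "(c b powr (2 * p + 1) * M) * (1 / r\<^sup>2) \<ge> 0" using cp by simp
        ultimately show ?thesis by (simp add: distrib_left)
      qed
      also have "\<dots> \<le> ((M / b) powr (2 * p + 1) * M) * (1 + 1 / r\<^sup>2)"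
        using b p M c_pos[OF b(1)] by (intro mult_right_mono powr_mono2) auto
      finally have "b * (c b - quo b r) \<le> b * (((M / b) powr (2 * p + 1) * M) * (1 + 1 / r\<^sup>2))"
        using b by (intro mult_left_mono) auto
      also have "\<dots> = (M powr (2 * p + 1) * M) * ((b * (1 / b) powr (2 * p + 1)) * (1 + 1 / r\<^sup>2))"
        using b M by (simp add: powr_divide mult_ac)
      also have "b * (1 / b) powr (2 * p + 1) = b powr (- 2 * p)"
        using b by (simp add: powr_divide powr_add powr_minus field_simps)
      finally show "norm (b * (c b - quo b r)) \<le> (M powr (2 * p + 1) * M) * (b powr (- 2 * p) * (1 + 1 / r\<^sup>2))"
        using quo_le_c[OF b(1) r] b by (simp add: abs_mult)
    qed
  qed
  moreover have "M powr (2 * p + 1) * M > 0" using M by simp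
  ultimately show ?thesis by blast
qed

lemma quo_close_tendsto:
  assumes r: "\<forall>\<^sub>F b in at_top. r b > 0" and lim: "((\<lambda>b. b powr (- 2 * p) * (1 + 1 / (r b)\<^sup>2)) \<longlongrightarrow> 0) at_top"
  shows "((\<lambda>b. b * (c b - quo b (r b))) \<longlongrightarrow> 0) at_top"
proof -
  obtain M where M: "M > 0" "\<forall>\<^sub>F b in at_top. \<forall>r>0. norm (b * (c b - quo b r)) \<le> M * (b powr (- 2 * p) * (1 + 1 / r\<^sup>2))"
    using quo_close by blast
  have "\<forall>\<^sub>F b in at_top. norm (b * (c b - quo b (r b))) \<le> M * (b powr (- 2 * p) * (1 + 1 / (r b)\<^sup>2))"
    using M(2) r by eventually_elim auto
  moreover have "((\<lambda>b. M * (b powr (- 2 * p) * (1 + 1 / (r b)\<^sup>2))) \<longlongrightarrow> 0) at_top"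
    by (rule tendsto_mult_right_zero[OF lim])
  ultimately show ?thesis by (rule Lim_null_comparison)
qed

lemma quo_close_fixed: "r > 0 \<Longrightarrow> ((\<lambda>b. b * (c b - quo b r)) \<longlongrightarrow> 0) at_top"
proof (rule quo_close_tendsto)
  assume "r > 0"
  have "((\<lambda>b. b powr (- 2 * p)) \<longlongrightarrow> 0) at_top" using p(1) by real_asymp
  then show "((\<lambda>b. b powr (- 2 * p) * (1 + 1 / r\<^sup>2)) \<longlongrightarrow> 0) at_top" by (rule tendsto_mult_left_zero)
qed simp

lemma quo_close_power:
  assumes q: "0 \<le> q" "q < p"
  shows "((\<lambda>b. b * (c b - quo b (b powr (- q)))) \<longlongrightarrow> 0) at_top"
proof (rule quo_close_tendsto)
  show "\<forall>\<^sub>F b in at_top. b powr (- q) > 0" using eventually_gt_at_top[of 0] by eventually_elim simp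
  have "((\<lambda>b::real. b powr (- 2 * p)) \<longlongrightarrow> 0) at_top" "((\<lambda>b::real. b powr (2 * q - 2 * p)) \<longlongrightarrow> 0) at_top"
    using p(1) q by real_asymp+
  from tendsto_add[OF this] have "((\<lambda>b. b powr (- 2 * p) + b powr (2 * q - 2 * p)) \<longlongrightarrow> 0) at_top" by simp
  moreover have "\<forall>\<^sub>F b in at_top. b powr (- 2 * p) + b powr (2 * q - 2 * p) = b powr (- 2 * p) * (1 + 1 / (b powr (- q))\<^sup>2)"
    using eventually_gt_at_top[of 0]
  proof eventually_elim
    case (elim b)
    have "1 / (b powr (- q))\<^sup>2 = b powr (2 * q)"
      using elim by (simp add: power2_eq_square powr_minus powr_add[symmetric] field_simps)
    then show ?case using elim by (simp add: distrib_left powr_add[symmetric] powr_diff powr_minus field_simps)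
  qed
  ultimately show "((\<lambda>b. b powr (- 2 * p) * (1 + 1 / (b powr (- q))\<^sup>2)) \<longlongrightarrow> 0) at_top"
    by (rule Lim_transform_eventually)
qed

text \<open>Leading coefficient of the singularity \<open>r powr (- (d - 2))\<close>. Radius and
  Kummer parameters vary together, hence the joint limit
  \<open>kummer_int_powr_tendsto_0\<close>.\<close>

lemma lin_sol_small:
  assumes q: "q > 0"
  shows "((\<lambda>b. (b powr (- q)) ^ (d - 2) * lin_sol (ka b) (kg b) (b powr (- q))) \<longlongrightarrow> Gamma (1 / p) / Gamma a0) at_top"
proof -
  define z where "z b = (b powr (- q))\<^sup>2" for b :: real
  have "((\<lambda>b::real. b powr (- q)) \<longlongrightarrow> 0) at_top" using q by real_asymp
  then have "((\<lambda>b::real. (b powr (- q))\<^sup>2) \<longlongrightarrow> 0\<^sup>2) at_top" by (rule tendsto_power)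
  then have z: "(z \<longlongrightarrow> 0) at_top" unfolding z_def by simp
  have z0: "\<forall>\<^sub>F b in at_top. z b > 0" using eventually_gt_at_top[of 0] by eventually_elim (simp add: z_def)
  have "((\<lambda>b. exp (- z b / 2) * (z b powr (ka b + kg b) * kummer_int (ka b) (kg b) (z b) / Gamma (ka b))) \<longlongrightarrow>
      exp (- 0 / 2) * (Gamma (a0 + g0) / Gamma a0)) at_top"
    using Gamma_real_pos[OF a0g0(1)]
    by (intro tendsto_intros z kummer_int_powr_tendsto_0 z0 ka_tendsto kg_tendsto a0g0(1,2) Gamma_ka_tendsto) auto
  moreover have "\<forall>\<^sub>F b in at_top. exp (- z b / 2) * (z b powr (ka b + kg b) * kummer_int (ka b) (kg b) (z b) / Gamma (ka b))
     = (b powr (- q)) ^ (d - 2) * lin_sol (ka b) (kg b) (b powr (- q))"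
    using eventually_gt_at_top[of 0]
  proof eventually_elim
    case (elim b)
    define r where "r = b powr (- q)"
    have r: "r > 0" using elim by (simp add: r_def)
    have s: "ka b + kg b = (real d - 2) / 2" using elim by (simp add: ka_eq kg_eq field_simps)
    have "(r\<^sup>2) powr (ka b + kg b) = (r powr 2) powr ((real d - 2) / 2)" unfolding s using r by simp
    also have "\<dots> = r powr (real d - 2)"
      unfolding powr_powr by (rule arg_cong[where f="\<lambda>x. r powr x"]) simp
    also have "\<dots> = r ^ (d - 2)" using r d by (simp add: powr_realpow[symmetric] of_nat_diff)
    finally show ?case unfolding z_def r_def[symmetric] lin_sol_def by simp
  qed
  ultimately show ?thesis using a0g0(3) by (simp add: Lim_transform_eventually)
qed

text \<open>\<open>\<kappa>\<close> is the tail coefficient of the soliton. \<open>A\<close> is its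
  ratio to the coefficient \<open>Gamma (1 / p) / Gamma a0\<close> of the linear solution at
  eigenvalue 0, and so the limit of \<open>b * c b\<close>.\<close>

definition \<kappa> where "\<kappa> = alpha_p p powr (- 1 / p)"
definition A where "A = \<kappa> * Gamma a0 / Gamma (1 / p)"

lemma kA: "\<kappa> > 0" "A > 0"
  using alpha_p_eq(2) p a0g0 Gamma_real_pos[of a0] Gamma_real_pos[of "1 / p"] by (auto simp: \<kappa>_def A_def)

text \<open>The soliton error \<open>b powr (1 - 2 * p)\<close> is negligible against the tail
  \<open>b powr (- 1) * r powr (- (d - 2))\<close> at \<open>r = b powr (- q)\<close> exactly when
  \<open>q > p * (1 - p)\<close>, and \<open>q < p\<close> puts the radius beyond the soliton
  core.\<close>

lemma u_intermediate:
  assumes q: "p * (1 - p) < q" "q < p"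
  shows "((\<lambda>b. b * ((b powr (- q)) ^ (d - 2) * u b (b powr (- q)))) \<longlongrightarrow> \<kappa>) at_top"
proof -
  have "0 < p * (1 - p)" using p by simp
  then have q0: "q > 0" using q by linarith
  let ?r = "\<lambda>b. b powr (- q)"
  have pd: "(real d - 2) * q = 2 * q / p" using p by (simp add: field_simps)
  have rp: "(?r b) ^ (d - 2) = b powr (- 2 * q / p)" if "b > 0" for b
  proof -
    have "(?r b) ^ (d - 2) = (b powr (- q)) powr (real d - 2)" using that d by (simp add: powr_realpow[symmetric] of_nat_diff)
    also have "\<dots> = b powr (- ((real d - 2) * q))" by (simp add: powr_powr mult.commute)
    finally show ?thesis unfolding pd by simp
  qed
  have "((\<lambda>b. b * ((?r b) ^ (d - 2) * (u b (?r b) - aubin_talenti p b (?r b)))) \<longlongrightarrow> 0) at_top"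
  proof (rule Lim_null_comparison)
    have e: "2 - 2 * p - 2 * q / p < 0"
    proof -
      have "p * (1 - p) / p < q / p" using q p by (intro divide_strict_right_mono) auto
      then show ?thesis using p by simp
    qed
    show "((\<lambda>b. D1 * b powr (2 - 2 * p - 2 * q / p)) \<longlongrightarrow> 0) at_top"
    proof (rule tendsto_mult_right_zero)
      show "((\<lambda>b::real. b powr (2 - 2 * p - 2 * q / p)) \<longlongrightarrow> 0) at_top"
        by (rule tendsto_neg_powr[OF e filterlim_ident])
    qed
    show "\<forall>\<^sub>F b in at_top. norm (b * ((?r b) ^ (d - 2) * (u b (?r b) - aubin_talenti p b (?r b)))) \<le> D1 * b powr (2 - 2 * p - 2 * q / p)"
      using eventually_ge_at_top[of 1]
    proof eventually_elim
      case (elim b)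
      then have b: "b > 0" by simp
      have r: "0 \<le> ?r b" "?r b \<le> 1" using elim q0 powr_mono[of "- q" 0 b] by auto
      have "norm (b * ((?r b) ^ (d - 2) * (u b (?r b) - aubin_talenti p b (?r b)))) = b * b powr (- 2 * q / p) * \<bar>u b (?r b) - aubin_talenti p b (?r b)\<bar>"
        unfolding rp[OF b] using b by (simp add: abs_mult)
      also have "\<dots> \<le> b * b powr (- 2 * q / p) * (D1 * b powr (1 - 2 * p))"
        using ground_state.u_minus_aubin_talenti[OF gs[OF b] r] b by (intro mult_left_mono) auto
      also have "\<dots> = D1 * (b powr 1 * b powr (- 2 * q / p) * b powr (1 - 2 * p))" using b by simp
      also have "b powr 1 * b powr (- 2 * q / p) * b powr (1 - 2 * p) = b powr (2 - 2 * p - 2 * q / p)"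
        unfolding powr_add[symmetric] by (rule arg_cong[where f="\<lambda>x. b powr x"]) simp
      finally show ?case .
    qed
  qed
  moreover have "((\<lambda>b. b * ((?r b) ^ (d - 2) * aubin_talenti p b (?r b))) \<longlongrightarrow> \<kappa>) at_top"
  proof -
    have "((\<lambda>b::real. b powr (2 * q - 2 * p)) \<longlongrightarrow> 0) at_top" using q by (intro tendsto_neg_powr filterlim_ident) auto
    then have "((\<lambda>b. (b powr (2 * q - 2 * p) + alpha_p p) powr (- 1 / p)) \<longlongrightarrow> (0 + alpha_p p) powr (- 1 / p)) at_top"
      using alpha_p_eq(2) by (intro tendsto_intros) auto
    moreover have "\<forall>\<^sub>F b in at_top. (b powr (2 * q - 2 * p) + alpha_p p) powr (- 1 / p) = b * ((?r b) ^ (d - 2) * aubin_talenti p b (?r b))"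
      using eventually_gt_at_top[of 0]
    proof eventually_elim
      case (elim b)
      define s where "s = b powr (2 * p - 2 * q)"
      have s: "s > 0" using elim by (simp add: s_def)
      have "b powr (2 * p) * (?r b)\<^sup>2 = s"
        unfolding s_def power2_eq_square powr_add[symmetric] by simp
      then have "aubin_talenti p b (?r b) = b / (1 + alpha_p p * s) powr (1 / p)"
        unfolding aubin_talenti_def by (simp add: mult.assoc)
      moreover have "1 + alpha_p p * s = s * (b powr (2 * q - 2 * p) + alpha_p p)"
        unfolding s_def using elim by (simp add: distrib_left powr_add[symmetric])
      moreover have "(s * (b powr (2 * q - 2 * p) + alpha_p p)) powr (1 / p) = s powr (1 / p) * (b powr (2 * q - 2 * p) + alpha_p p) powr (1 / p)"
        using s alpha_p_eq(2) by (intro powr_mult)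
      moreover have "s powr (1 / p) = b powr (2 - 2 * q / p)" unfolding s_def powr_powr using p by (simp add: field_simps)
      ultimately have "b * ((?r b) ^ (d - 2) * aubin_talenti p b (?r b))
         = (b * b * b powr (- 2 * q / p)) / b powr (2 - 2 * q / p) / (b powr (2 * q - 2 * p) + alpha_p p) powr (1 / p)"
        unfolding rp[OF elim] by simp
      also have "b * b * b powr (- 2 * q / p) = b powr (2 - 2 * q / p)"
        using elim by (simp add: powr_diff powr_minus powr_numeral power2_eq_square field_simps)
      finally show ?case using elim by (simp add: powr_minus_divide)
    qed
    ultimately show ?thesis unfolding \<kappa>_def by (simp add: Lim_transform_eventually)
  qed
  ultimately have "((\<lambda>b. b * ((?r b) ^ (d - 2) * (u b (?r b) - aubin_talenti p b (?r b))) + b * ((?r b) ^ (d - 2) * aubin_talenti p b (?r b))) \<longlongrightarrow> 0 + \<kappa>) at_top"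
    by (rule tendsto_add)
  then show ?thesis by (simp add: algebra_simps)
qed

lemma c_tendsto: "((\<lambda>b. b * c b) \<longlongrightarrow> A) at_top"
proof -
  \<comment> \<open>The midpoint of the admissible window between \<open>p * (1 - p)\<close> and
    \<open>p\<close>.\<close>
  define q where "q = p * (1 - p / 2)"
  have q: "p * (1 - p) < q" "q < p" "q > 0" using p by (auto simp: q_def intro!: mult_strict_left_mono)
  have "((\<lambda>b. b * ((b powr (- q)) ^ (d - 2) * u b (b powr (- q))) / ((b powr (- q)) ^ (d - 2) * lin_sol (ka b) (kg b) (b powr (- q))))
     \<longlongrightarrow> \<kappa> / (Gamma (1 / p) / Gamma a0)) at_top"
    using q Gamma_nz
    by (intro tendsto_divide u_intermediate lin_sol_small) auto
  moreover have "\<forall>\<^sub>F b in at_top. b * ((b powr (- q)) ^ (d - 2) * u b (b powr (- q))) / ((b powr (- q)) ^ (d - 2) * lin_sol (ka b) (kg b) (b powr (- q)))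
     = b * quo b (b powr (- q))"
    using eventually_gt_at_top[of 0] by eventually_elim (simp add: quo_eq)
  ultimately have "((\<lambda>b. b * quo b (b powr (- q))) \<longlongrightarrow> A) at_top"
    unfolding A_def by (simp add: Lim_transform_eventually)
  from tendsto_add[OF quo_close_power[of q] this] q show ?thesis by (simp add: algebra_simps)
qed

lemma bu_fixed: "r > 0 \<Longrightarrow> ((\<lambda>b. b * u b r) \<longlongrightarrow> A * lin_sol a0 g0 r) at_top"
proof -
  assume r: "r > 0"
  have "((\<lambda>b. (b * c b - b * (c b - quo b r)) * lin_sol (ka b) (kg b) r) \<longlongrightarrow> (A - 0) * lin_sol a0 g0 r) at_top"
    by (intro tendsto_intros c_tendsto quo_close_fixed lin_sol_lim r)
  moreover have "\<forall>\<^sub>F b in at_top. (b * c b - b * (c b - quo b r)) * lin_sol (ka b) (kg b) r = b * u b r"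
    using eventually_gt_at_top[of 0] by eventually_elim (simp add: u_eq r algebra_simps)
  ultimately show ?thesis by (simp add: Lim_transform_eventually)
qed

text \<open>With \<open>c b\<close> known, the linear solution extends the intermediate limit to all
  exponents in \<open>(0, p)\<close>, beyond the window where the soliton error is small; dimension
  6 uses the whole range.\<close>

lemma bu_power: 
  assumes q: "0 < q" "q < p"
  shows "((\<lambda>b. b * ((b powr (- q)) ^ (d - 2) * u b (b powr (- q)))) \<longlongrightarrow> \<kappa>) at_top"
proof -
  have "((\<lambda>b. (b * c b - b * (c b - quo b (b powr (- q)))) * ((b powr (- q)) ^ (d - 2) * lin_sol (ka b) (kg b) (b powr (- q))))
     \<longlongrightarrow> (A - 0) * (Gamma (1 / p) / Gamma a0)) at_top"
    using q by (intro tendsto_intros c_tendsto quo_close_power lin_sol_small) auto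
  also have "(A - 0) * (Gamma (1 / p) / Gamma a0) = \<kappa>"
    using Gamma_nz by (simp add: A_def)
  finally have "((\<lambda>b. (b * c b - b * (c b - quo b (b powr (- q)))) * ((b powr (- q)) ^ (d - 2) * lin_sol (ka b) (kg b) (b powr (- q)))) \<longlongrightarrow> \<kappa>) at_top" .
  moreover have "\<forall>\<^sub>F b in at_top. (b * c b - b * (c b - quo b (b powr (- q)))) * ((b powr (- q)) ^ (d - 2) * lin_sol (ka b) (kg b) (b powr (- q)))
      = b * ((b powr (- q)) ^ (d - 2) * u b (b powr (- q)))"
    using eventually_gt_at_top[of 0] by eventually_elim (simp add: u_eq algebra_simps)
  ultimately show ?thesis by (rule Lim_transform_eventually)
qed

end

section \<open>The asymptotics of the eigenvalue\<close>

text \<open>The substitution \<open>x = t / (1 + t)\<close> in the Beta integral, carried out on the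
  primitive \<open>G\<close>, which is continuous up to both endpoints although the integrand is
  singular there.\<close>

lemma kummer_Beta_integral:
  shows "set_integrable lborel {0<..} (\<lambda>t::real. t powr (- 3 / 4) * (1 + t) powr (- 3 / 4))"
    and "(LINT t:{0<..}|lborel. t powr (- 3 / 4) * (1 + t) powr (- 3 / 4)) = Beta (1 / 4) (1 / 2 :: real)"
proof -
  define \<beta> where "\<beta> x = x powr (- 3 / 4) * (1 - x) powr (- 1 / 2)" for x :: real
  have hb: "(\<beta> has_integral Beta (1 / 4) (1 / 2)) {0..1}"
    using has_integral_Beta_real[of "1 / 4" "1 / 2"] unfolding \<beta>_def by simp
  then have ib: "\<beta> integrable_on {0..1}" by blast
  define G where "G y = integral {0..y} \<beta>" for y
  have G1: "G 1 = Beta (1 / 4) (1 / 2)" unfolding G_def using hb by (rule integral_unique)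
  have contG: "continuous_on {0..1} G" unfolding G_def by (rule indefinite_integral_continuous_1[OF ib])
  have dG: "(G has_real_derivative \<beta> y) (at y)" if y: "0 < y" "y < 1" for y
  proof -
    have "isCont \<beta> y"
      unfolding \<beta>_def using y by (intro continuous_intros) auto
    then have "continuous (at y within {0..1}) \<beta>" by (rule continuous_at_imp_continuous_at_within)
    then have "(G has_real_derivative \<beta> y) (at y within {0..1})"
      unfolding G_def has_real_derivative_iff_has_vector_derivative
      using integral_has_vector_derivative_continuous_at[OF ib, of y "{}"] y by simp
    then show ?thesis using y by (simp add: at_within_Icc_at)
  qed
  define F where "F t = G (t / (1 + t))" for t
  have f1: "(F has_real_derivative t powr (- 3 / 4) * (1 + t) powr (- 3 / 4)) (at t)" if t: "t > 0" for t
  proof -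
    have "((\<lambda>t. t / (1 + t)) has_real_derivative 1 / (1 + t)\<^sup>2) (at t)"
      using t by (auto intro!: derivative_eq_intros simp: power2_eq_square field_simps)
    then have "(F has_real_derivative \<beta> (t / (1 + t)) * (1 / (1 + t)\<^sup>2)) (at t)"
      unfolding F_def using t by (intro DERIV_chain2[where f=G] dG) auto
    also have "\<beta> (t / (1 + t)) * (1 / (1 + t)\<^sup>2) = t powr (- 3 / 4) * (1 + t) powr (- 3 / 4)"
    proof -
      have "1 - t / (1 + t) = 1 / (1 + t)" using t by (simp add: field_simps)
      then have "\<beta> (t / (1 + t)) = t powr (- 3 / 4) * (1 + t) powr (3 / 4) * (1 + t) powr (1 / 2)"
        unfolding \<beta>_def using t by (simp add: powr_divide powr_minus_divide)
      moreover have "1 / (1 + t)\<^sup>2 = (1 + t) powr (- 2)" using t by (simp add: powr_minus_divide powr_numeral)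
      ultimately have "\<beta> (t / (1 + t)) * (1 / (1 + t)\<^sup>2) = t powr (- 3 / 4) * ((1 + t) powr (3 / 4) * (1 + t) powr (1 / 2) * (1 + t) powr (- 2))"
        by simp
      then show ?thesis unfolding powr_add[symmetric] by simp
    qed
    finally show ?thesis .
  qed
  have lim0: "(F \<longlongrightarrow> G 0) (at_right 0)"
    unfolding F_def
  proof (rule continuous_on_tendsto_compose[OF contG])
    show "((\<lambda>t::real. t / (1 + t)) \<longlongrightarrow> 0) (at_right 0)" by real_asymp
    show "\<forall>\<^sub>F x::real in at_right 0. x / (1 + x) \<in> {0..1}"
      using eventually_at_right_less[of 0] by eventually_elim (auto simp: divide_le_eq)
  qed simp
  have lim1: "(F \<longlongrightarrow> G 1) at_top"
    unfolding F_def
  proof (rule continuous_on_tendsto_compose[OF contG])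
    show "((\<lambda>t::real. t / (1 + t)) \<longlongrightarrow> 1) at_top" by real_asymp
    show "\<forall>\<^sub>F x::real in at_top. x / (1 + x) \<in> {0..1}"
      using eventually_gt_at_top[of 0] by eventually_elim (auto simp: divide_le_eq)
  qed simp
  have ct: "isCont (\<lambda>t. t powr (- 3 / 4) * (1 + t) powr (- 3 / 4)) x" if "x > 0" for x :: real
    using that by (intro continuous_intros) auto
  note ftc = FTC_Ioi_nonneg[OF f1 ct _ lim0 lim1]
  show "set_integrable lborel {0<..} (\<lambda>t::real. t powr (- 3 / 4) * (1 + t) powr (- 3 / 4))" by (rule ftc(1)) auto
  have "G 0 = 0" by (simp add: G_def)
  then show "(LINT t:{0<..}|lborel. t powr (- 3 / 4) * (1 + t) powr (- 3 / 4)) = Beta (1 / 4) (1 / 2 :: real)"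
    using ftc(2) G1 by simp
qed

text \<open>Up to the factor \<open>exp (- r\<^sup>2 / 2) / Gamma (5 / 4)\<close> the left side is
  \<open>r * \<phi>' + 3 * \<phi>\<close> in dimension 5 at eigenvalue 0, with
  \<open>z = r\<^sup>2\<close>. Subtracting the derivative of
  \<open>exp (- (z * t)) * (2 * t + 1) * (t * (1 + t)) powr (1 / 4)\<close> cancels the singularity
  of order \<open>r powr (- 3)\<close>; the remainder has a finite limit at 0.\<close>

lemma kummer_int_quarter:
  assumes z: "z > 0"
  shows "3 * kummer_int (5 / 4) (1 / 4) z - z * kummer_int (5 / 4) (1 / 4) z - 2 * z * kummer_int (9 / 4) (1 / 4) z
     = - kummer_int (1 / 4) (- 3 / 4) z / 4"
proof -
  let ?I = "\<lambda>a g t. exp (- (z * t)) * t powr (a - 1) * (1 + t) powr g"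
  let ?F = "\<lambda>t. exp (- (z * t)) * ((2 * t + 1) * (t powr (1 / 4) * (1 + t) powr (1 / 4)))"
  let ?f = "\<lambda>t. (3 - z) * ?I (5 / 4) (1 / 4) t - (2 * z) * ?I (9 / 4) (1 / 4) t + 1 / 4 * ?I (1 / 4) (- 3 / 4) t"
  have i: "set_integrable lborel {0<..} (?I a g)" if "a > 0" for a g
    using that z by (rule kummer_integrand_integrable)
  have i1: "set_integrable lborel {0<..} (?I (5 / 4) (1 / 4))" "set_integrable lborel {0<..} (?I (9 / 4) (1 / 4))"
      "set_integrable lborel {0<..} (?I (1 / 4) (- 3 / 4))" by (intro i; simp)+
  have int: "set_integrable lborel {0<..} ?f"
    by (intro set_integral_add(1) set_integral_diff(1) set_integrable_mult_right i1)
  have "(LINT t:{0<..}|lborel. ?f t) = 0 - 0"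
  proof (rule FTC_Ioi[OF _ _ int])
    fix t :: real assume t: "t > 0"
    define P where "P = t powr (- 3 / 4) * (1 + t) powr (- 3 / 4)"
    have t14: "t powr (1 / 4) = t * t powr (- 3 / 4)" using powr_mult_base[of t "- 3 / 4"] t by simp
    have s14: "(1 + t) powr (1 / 4) = (1 + t) * (1 + t) powr (- 3 / 4)" using powr_mult_base[of "1 + t" "- 3 / 4"] t by simp
    have t54: "t powr (5 / 4) = t * (t * t powr (- 3 / 4))" using powr_mult_base[of t "1 / 4"] t t14 by simp
    have d1: "((\<lambda>t. exp (- (z * t))) has_real_derivative - z * exp (- (z * t))) (at t)"
      by (auto intro!: derivative_eq_intros)
    have d2: "((\<lambda>t. t powr (1 / 4)) has_real_derivative 1 / 4 * t powr (- 3 / 4)) (at t)"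
      using has_real_derivative_powr[OF t, of "1 / 4"] by simp
    have d3: "((\<lambda>t. (1 + t) powr (1 / 4)) has_real_derivative 1 / 4 * (1 + t) powr (- 3 / 4)) (at t)"
      using t by (auto intro!: derivative_eq_intros DERIV_chain2[where f="\<lambda>z. z powr (1 / 4)" and g="\<lambda>t. 1 + t", OF has_real_derivative_powr])
    have d4: "((\<lambda>t::real. 2 * t + 1) has_real_derivative 2) (at t)" by (auto intro!: derivative_eq_intros)
    have "(?F has_real_derivative - z * exp (- (z * t)) * ((2 * t + 1) * (t powr (1 / 4) * (1 + t) powr (1 / 4)))
       + (2 * (t powr (1 / 4) * (1 + t) powr (1 / 4)) + ((1 / 4 * t powr (- 3 / 4)) * (1 + t) powr (1 / 4)
          + (1 / 4 * (1 + t) powr (- 3 / 4)) * t powr (1 / 4)) * (2 * t + 1)) * exp (- (z * t))) (at t)"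
      by (intro DERIV_mult d1 d2 d3 d4)
    also have "- z * exp (- (z * t)) * ((2 * t + 1) * (t powr (1 / 4) * (1 + t) powr (1 / 4)))
       + (2 * (t powr (1 / 4) * (1 + t) powr (1 / 4)) + ((1 / 4 * t powr (- 3 / 4)) * (1 + t) powr (1 / 4)
          + (1 / 4 * (1 + t) powr (- 3 / 4)) * t powr (1 / 4)) * (2 * t + 1)) * exp (- (z * t))
      = exp (- (z * t)) * (P * (- z * (2 * t + 1) * (t * (1 + t)) + 2 * (t * (1 + t)) + 1 / 4 * ((1 + t) + t) * (2 * t + 1)))"
      unfolding t14 s14 P_def by (simp add: field_simps)
    also have "- z * (2 * t + 1) * (t * (1 + t)) + 2 * (t * (1 + t)) + 1 / 4 * ((1 + t) + t) * (2 * t + 1)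
      = (3 - z) * (t * (1 + t)) - 2 * z * (t * (t * (1 + t))) + 1 / 4" by (simp add: field_simps)
    also have "exp (- (z * t)) * (P * ((3 - z) * (t * (1 + t)) - 2 * z * (t * (t * (1 + t))) + 1 / 4)) = ?f t"
      unfolding P_def using t14 s14 t54 by (simp add: field_simps)
    finally show "(?F has_real_derivative ?f t) (at t)" .
    show "isCont ?f t" using t by (intro continuous_intros) auto
  next
    show "(?F \<longlongrightarrow> 0) (at_right 0)" by real_asymp
    show "(?F \<longlongrightarrow> 0) at_top" using z by real_asymp
  qed
  moreover have "(LINT t:{0<..}|lborel. ?f t)
     = (3 - z) * kummer_int (5 / 4) (1 / 4) z - (2 * z) * kummer_int (9 / 4) (1 / 4) z + 1 / 4 * kummer_int (1 / 4) (- 3 / 4) z"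
  proof -
    have "(LINT t:{0<..}|lborel. ?f t) = (LINT t:{0<..}|lborel. (3 - z) * ?I (5 / 4) (1 / 4) t - (2 * z) * ?I (9 / 4) (1 / 4) t)
       + (LINT t:{0<..}|lborel. 1 / 4 * ?I (1 / 4) (- 3 / 4) t)"
      by (intro set_integral_add(2) set_integral_diff(1) set_integrable_mult_right i1)
    also have "(LINT t:{0<..}|lborel. (3 - z) * ?I (5 / 4) (1 / 4) t - (2 * z) * ?I (9 / 4) (1 / 4) t)
       = (LINT t:{0<..}|lborel. (3 - z) * ?I (5 / 4) (1 / 4) t) - (LINT t:{0<..}|lborel. (2 * z) * ?I (9 / 4) (1 / 4) t)"
      by (intro set_integral_diff(2) set_integrable_mult_right i1)
    finally show ?thesis unfolding set_integral_mult_right kummer_int_def[symmetric] .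
  qed
  ultimately show ?thesis by (simp add: algebra_simps)
qed

text \<open>\<open>Q\<close> is the Pohozaev functional of the linear solution for
  \<open>d = 5\<close> and \<open>l = 0\<close>. Its derivative is
  \<open>- 2 * r ^ 6 * \<phi>\<^sup>2\<close>, so the moment is half of its limit at 0.\<close>

lemma lin_sol_quarter_moment:
  shows "(LINT r:{0<..}|lborel. r ^ 6 * (lin_sol (5 / 4) (1 / 4) r)\<^sup>2)
     = 3 / 16 * Gamma (3 / 2) * Beta (1 / 4) (1 / 2) / (Gamma (5 / 4))\<^sup>2"
proof -
  let ?\<phi> = "lin_sol (5 / 4) (1 / 4)" and ?\<phi>' = "lin_sol' (5 / 4) (1 / 4)"
  define G where "G = Gamma (5 / 4 :: real)"
  have G: "G > 0" by (simp add: G_def)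
  define B where "B = Beta (1 / 4) (1 / 2 :: real)"
  define Q where "Q r = (r ^ 5 * (?\<phi>' r)\<^sup>2 + 3 * r ^ 4 * (?\<phi> r * ?\<phi>' r) - r ^ 7 * (?\<phi> r)\<^sup>2) / 2" for r
  have dphi: "(?\<phi> has_real_derivative ?\<phi>' r) (at r)" if "r > 0" for r
    by (rule lin_sol_deriv) (use that in auto)
  have dphi': "(?\<phi>' has_real_derivative (r\<^sup>2 * ?\<phi> r - 4 / r * ?\<phi>' r)) (at r)" if "r > 0" for r
    using lin_sol'_deriv[of "5/4" "1/4" r] that by simp
  have dQ: "((\<lambda>r. - Q r / 2) has_real_derivative r ^ 6 * (?\<phi> r)\<^sup>2) (at r)" if r: "r > 0" for r
  proof -
    define f f' where "f = ?\<phi> r" and "f' = ?\<phi>' r"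
    have sq: "((\<lambda>r. (?\<phi> r)\<^sup>2) has_real_derivative 2 * f * f') (at r)"
      using DERIV_power[OF dphi[OF r], of 2] by (simp add: f_def f'_def mult_ac)
    have sq': "((\<lambda>r. (?\<phi>' r)\<^sup>2) has_real_derivative 2 * f' * (r\<^sup>2 * f - 4 / r * f')) (at r)"
      using DERIV_power[OF dphi'[OF r], of 2] by (simp add: f_def f'_def mult_ac)
    have p5: "((\<lambda>r::real. r ^ 5) has_real_derivative 5 * r ^ 4) (at r)"
      and p4: "((\<lambda>r::real. 3 * r ^ 4) has_real_derivative 12 * r ^ 3) (at r)"
      and p7: "((\<lambda>r::real. r ^ 7) has_real_derivative 7 * r ^ 6) (at r)"
      by (auto intro!: derivative_eq_intros)
    have "((\<lambda>r. - Q r / 2) has_real_derivative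
      - (((5 * r ^ 4 * (?\<phi>' r)\<^sup>2 + 2 * f' * (r\<^sup>2 * f - 4 / r * f') * r ^ 5)
       + (12 * r ^ 3 * (?\<phi> r * ?\<phi>' r) + (?\<phi>' r * ?\<phi>' r + (r\<^sup>2 * ?\<phi> r - 4 / r * ?\<phi>' r) * ?\<phi> r) * (3 * r ^ 4))
       - (7 * r ^ 6 * (?\<phi> r)\<^sup>2 + 2 * f * f' * r ^ 7)) / 2) / 2) (at r)"
      unfolding Q_def by (intro DERIV_cdivide DERIV_minus DERIV_diff DERIV_add DERIV_mult p4 p5 p7 sq sq' dphi dphi' r)
    also have "- (((5 * r ^ 4 * (?\<phi>' r)\<^sup>2 + 2 * f' * (r\<^sup>2 * f - 4 / r * f') * r ^ 5)
       + (12 * r ^ 3 * (?\<phi> r * ?\<phi>' r) + (?\<phi>' r * ?\<phi>' r + (r\<^sup>2 * ?\<phi> r - 4 / r * ?\<phi>' r) * ?\<phi> r) * (3 * r ^ 4))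
       - (7 * r ^ 6 * (?\<phi> r)\<^sup>2 + 2 * f * f' * r ^ 7)) / 2) / 2 = r ^ 6 * (?\<phi> r)\<^sup>2"
      unfolding f_def[symmetric] f'_def[symmetric] using r
      by (simp add: field_simps power2_eq_square eval_nat_numeral)
    finally show ?thesis .
  qed
  have iQ: "isCont (\<lambda>r. r ^ 6 * (?\<phi> r)\<^sup>2) r" if "r > 0" for r
    by (intro continuous_intros DERIV_isCont[OF dphi[OF that]])
  define z where "z b = (inverse b)\<^sup>2" for b :: real
  have zl: "(z \<longlongrightarrow> 0) at_top" unfolding z_def by real_asymp
  have zp: "\<forall>\<^sub>F b in at_top. z b > 0" using eventually_gt_at_top[of 0] by eventually_elim (simp add: z_def)
  have lim_phi: "((\<lambda>b. (inverse b) ^ 3 * ?\<phi> (inverse b)) \<longlongrightarrow> Gamma (3 / 2) / G) at_top"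
  proof -
    have "((\<lambda>b. exp (- z b / 2) * (z b powr (5 / 4 + 1 / 4) * kummer_int (5 / 4) (1 / 4) (z b) / G)) \<longlongrightarrow> exp (- 0 / 2) * (Gamma (5 / 4 + 1 / 4) / G)) at_top"
      using G by (intro tendsto_intros zl kummer_int_powr_tendsto_0[OF tendsto_const _ tendsto_const _ zl zp]) auto
    moreover have "\<forall>\<^sub>F b in at_top. exp (- z b / 2) * (z b powr (5 / 4 + 1 / 4) * kummer_int (5 / 4) (1 / 4) (z b) / G) = (inverse b) ^ 3 * ?\<phi> (inverse b)"
      using eventually_gt_at_top[of 0]
    proof eventually_elim
      case (elim b)
      have "(inverse b)\<^sup>2 powr (3 / 2) = (inverse b powr 2) powr (3 / 2)" using elim by simp
      also have "\<dots> = inverse b powr 3" unfolding powr_powr by simp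
      also have "\<dots> = (inverse b) ^ 3" using elim by (simp add: powr_numeral)
      finally show ?case by (simp add: lin_sol_def z_def G_def)
    qed
    ultimately show ?thesis by (simp add: Lim_transform_eventually)
  qed
  have lim_S: "((\<lambda>b. inverse b * ?\<phi>' (inverse b) + 3 * ?\<phi> (inverse b)) \<longlongrightarrow> - B / (4 * G)) at_top"
  proof -
    have "((\<lambda>b. LINT t:{0<..}|lborel. exp (- (z b * t)) * t powr (1 / 4 - 1) * (1 + t) powr (- 3 / 4)) \<longlongrightarrow>
        (LINT t:{0<..}|lborel. t powr (- 3 / 4) * (1 + t) powr (- 3 / 4))) at_top"
    proof (rule set_dominated_convergence_at_top[OF _ _ _ kummer_Beta_integral(1)])
      show "\<forall>\<^sub>F b in at_top. set_borel_measurable lborel {0<..} (\<lambda>t. exp (- (z b * t)) * t powr (1 / 4 - 1) * (1 + t) powr (- 3 / 4))"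
        by (intro always_eventually allI kummer_integrand_measurable)
      show "set_borel_measurable lborel {0<..} (\<lambda>t::real. t powr (- 3 / 4) * (1 + t) powr (- 3 / 4))"
        by (intro set_borel_measurable_Ioi continuous_intros) auto
      show "\<forall>\<^sub>F b in at_top. \<forall>t\<in>{0<..}. \<bar>exp (- (z b * t)) * t powr (1 / 4 - 1) * (1 + t) powr (- 3 / 4)\<bar> \<le> t powr (- 3 / 4) * (1 + t) powr (- 3 / 4)"
        using zp
      proof eventually_elim
        case (elim b)
        then show ?case by (auto simp: abs_mult intro!: mult_left_le_one_le mult_right_mono)
      qed
      fix t :: real assume "t \<in> {0<..}"
      then have "((\<lambda>b. exp (- (z b * t)) * t powr (1 / 4 - 1) * (1 + t) powr (- 3 / 4)) \<longlongrightarrow> exp (- (0 * t)) * t powr (1 / 4 - 1) * (1 + t) powr (- 3 / 4)) at_top"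
        by (intro tendsto_intros zl)
      then show "((\<lambda>b. exp (- (z b * t)) * t powr (1 / 4 - 1) * (1 + t) powr (- 3 / 4)) \<longlongrightarrow> t powr (- 3 / 4) * (1 + t) powr (- 3 / 4)) at_top" by simp
    qed simp
    then have "((\<lambda>b. kummer_int (1 / 4) (- 3 / 4) (z b)) \<longlongrightarrow> B) at_top"
      unfolding kummer_int_def[symmetric] kummer_Beta_integral(2) B_def .
    then have "((\<lambda>b. exp (- z b / 2) * (- kummer_int (1 / 4) (- 3 / 4) (z b) / 4) / G) \<longlongrightarrow> exp (- 0 / 2) * (- B / 4) / G) at_top"
      using G by (intro tendsto_intros zl) auto
    moreover have "\<forall>\<^sub>F b in at_top. exp (- z b / 2) * (- kummer_int (1 / 4) (- 3 / 4) (z b) / 4) / G = inverse b * ?\<phi>' (inverse b) + 3 * ?\<phi> (inverse b)"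
      using zp
    proof eventually_elim
      case (elim b)
      have gen: "r * (- r * E * ((K + 2 * L) / G)) + 3 * (E * (K / G)) = E * (3 * K - r\<^sup>2 * K - 2 * r\<^sup>2 * L) / G"
        for r E K L :: real using G by (simp add: field_simps power2_eq_square)
      have kk: "5 / 4 + 1 = (9 / 4 :: real)" by simp
      show ?case unfolding kummer_int_quarter[OF elim, symmetric] unfolding lin_sol_def lin_sol'_def G_def[symmetric] kk z_def gen
        by (rule refl)
    qed
    ultimately show ?thesis by (simp add: Lim_transform_eventually)
  qed
  have Q0: "(Q \<longlongrightarrow> 3 / 8 * Gamma (3 / 2) * B / G\<^sup>2) (at_right 0)"
    unfolding filterlim_at_right_to_top
  proof -
    \<comment> \<open>The first two terms of \<open>Q\<close> are singular at 0. In terms of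
      \<open>s = r * \<phi>' + 3 * \<phi>\<close> and \<open>f = r ^ 3 * \<phi>\<close>, with
      \<open>r = inverse b\<close>, everything is a polynomial in quantities with finite
      limits.\<close>
    let ?s = "\<lambda>b. inverse b * ?\<phi>' (inverse b) + 3 * ?\<phi> (inverse b)" and ?f = "\<lambda>b. (inverse b) ^ 3 * ?\<phi> (inverse b)"
    have i0: "((\<lambda>b::real. inverse b) \<longlongrightarrow> 0) at_top" by real_asymp
    have "((\<lambda>b. (((inverse b) ^ 3 * ?s b - 3 * ?f b) * ?s b - inverse b * (?f b)\<^sup>2) / 2) \<longlongrightarrow>
       ((0 ^ 3 * (- B / (4 * G)) - 3 * (Gamma (3 / 2) / G)) * (- B / (4 * G)) - 0 * (Gamma (3 / 2) / G)\<^sup>2) / 2) at_top"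
      by (intro tendsto_intros i0 lim_S lim_phi) simp
    moreover have "(((inverse b) ^ 3 * ?s b - 3 * ?f b) * ?s b - inverse b * (?f b)\<^sup>2) / 2 = Q (inverse b)" for b
      unfolding Q_def by (simp add: algebra_simps power2_eq_square eval_nat_numeral)
    ultimately show "((\<lambda>x. Q (inverse x)) \<longlongrightarrow> 3 / 8 * Gamma (3 / 2) * B / G\<^sup>2) at_top"
      using G by (simp add: power2_eq_square)
  qed
  have Q1: "(Q \<longlongrightarrow> 0) at_top"
  proof (rule Lim_null_comparison)
    define M1 where "M1 = kummer_int (5 / 4) (1 / 4) 1 / Gamma (5 / 4)"
    define M2 where "M2 = (kummer_int (5 / 4) (1 / 4) 1 + 2 * kummer_int (5 / 4 + 1) (1 / 4) 1) / Gamma (5 / 4)"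
    have M: "M1 \<ge> 0" "M2 \<ge> 0"
      unfolding M1_def M2_def using kummer_int_pos[of "5/4" 1 "1/4"] kummer_int_pos[of "5/4 + 1" 1 "1/4"] G unfolding G_def by auto
    have e: "((\<lambda>r::real. r ^ 7 * (exp (- r\<^sup>2 / 2))\<^sup>2) \<longlongrightarrow> 0) at_top" by real_asymp
    show "((\<lambda>r. (M2\<^sup>2 + 3 * M1 * M2 + M1\<^sup>2) / 2 * (r ^ 7 * (exp (- r\<^sup>2 / 2))\<^sup>2)) \<longlongrightarrow> 0) at_top"
      by (rule tendsto_mult_right_zero[OF e])
    show "\<forall>\<^sub>F r in at_top. norm (Q r) \<le> (M2\<^sup>2 + 3 * M1 * M2 + M1\<^sup>2) / 2 * (r ^ 7 * (exp (- r\<^sup>2 / 2))\<^sup>2)"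
      using eventually_ge_at_top[of 1]
    proof eventually_elim
      case (elim r)
      define E where "E = exp (- r\<^sup>2 / 2)"
      have E: "E > 0" by (simp add: E_def)
      have 1: "\<bar>?\<phi> r\<bar> \<le> M1 * E"
        using lin_sol_le_far'[of "5/4" "1/4" r] lin_sol_pos[of "5/4" "1/4" r] elim by (simp add: M1_def E_def)
      have 2: "\<bar>?\<phi>' r\<bar> \<le> M2 * (r * E)"
        using lin_sol'_le_far[of "5/4" "1/4" r] elim by (simp add: M2_def E_def)
      have a: "\<bar>r ^ 5 * (?\<phi>' r)\<^sup>2\<bar> \<le> M2\<^sup>2 * (r ^ 7 * E\<^sup>2)"
      proof -
        have "(?\<phi>' r)\<^sup>2 \<le> (M2 * (r * E))\<^sup>2" using power_mono[OF 2, of 2] by simp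
        then have "r ^ 5 * (?\<phi>' r)\<^sup>2 \<le> r ^ 5 * (M2 * (r * E))\<^sup>2" using elim by (intro mult_left_mono) auto
        then show ?thesis using elim by (simp add: power_mult_distrib eval_nat_numeral mult_ac)
      qed
      have b: "\<bar>3 * r ^ 4 * (?\<phi> r * ?\<phi>' r)\<bar> \<le> 3 * M1 * M2 * (r ^ 7 * E\<^sup>2)"
      proof -
        have "\<bar>?\<phi> r * ?\<phi>' r\<bar> \<le> (M1 * E) * (M2 * (r * E))" unfolding abs_mult using 1 2 M E elim by (intro mult_mono) auto
        then have "3 * r ^ 4 * \<bar>?\<phi> r * ?\<phi>' r\<bar> \<le> 3 * r ^ 4 * ((M1 * E) * (M2 * (r * E)))" using elim by (intro mult_left_mono) auto
        also have "\<dots> = 3 * M1 * M2 * (r ^ 5 * E\<^sup>2)" by (simp add: eval_nat_numeral mult_ac)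
        also have "\<dots> \<le> 3 * M1 * M2 * (r ^ 7 * E\<^sup>2)" using elim M by (intro mult_left_mono mult_right_mono power_increasing) auto
        finally show ?thesis using elim by (simp add: abs_mult)
      qed
      have c: "\<bar>r ^ 7 * (?\<phi> r)\<^sup>2\<bar> \<le> M1\<^sup>2 * (r ^ 7 * E\<^sup>2)"
      proof -
        have "(?\<phi> r)\<^sup>2 \<le> (M1 * E)\<^sup>2" using power_mono[OF 1, of 2] by simp
        then have "r ^ 7 * (?\<phi> r)\<^sup>2 \<le> r ^ 7 * (M1 * E)\<^sup>2" using elim by (intro mult_left_mono) auto
        then show ?thesis using elim by (simp add: power_mult_distrib mult_ac)
      qed
      have "\<bar>Q r\<bar> \<le> (M2\<^sup>2 * (r ^ 7 * E\<^sup>2) + 3 * M1 * M2 * (r ^ 7 * E\<^sup>2) + 0 + M1\<^sup>2 * (r ^ 7 * E\<^sup>2)) / 2"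
        using abs_half_sum4_le[OF a b _ c, of 0 0] unfolding Q_def by simp
      then show ?case unfolding E_def[symmetric] by (simp add: algebra_simps)
    qed
  qed
  have lim0: "((\<lambda>r. - Q r / 2) \<longlongrightarrow> - (3 / 8 * Gamma (3 / 2) * B / G\<^sup>2) / 2) (at_right 0)"
    by (intro tendsto_intros Q0) simp
  have lim1: "((\<lambda>r. - Q r / 2) \<longlongrightarrow> - 0 / 2) at_top" by (intro tendsto_intros Q1) simp
  have "(LINT r:{0<..}|lborel. r ^ 6 * (?\<phi> r)\<^sup>2) = - 0 / 2 - - (3 / 8 * Gamma (3 / 2) * B / G\<^sup>2) / 2"
    by (rule FTC_Ioi_nonneg(2)[OF dQ iQ _ lim0 lim1]) auto
  then show ?thesis by (simp add: B_def G_def)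
qed

context ground_family
begin

section \<open>Exact moments of the soliton\<close>

lemma bub_sq: "t > 0 \<Longrightarrow> (bub t)\<^sup>2 = 1 / (1 + alpha_p p * t\<^sup>2) ^ (d - 2)"
proof -
  have K: "1 + alpha_p p * t\<^sup>2 > 0" using alpha_p_eq(2) by (simp add: add_pos_nonneg)
  have "((1 + alpha_p p * t\<^sup>2) powr (1 / p))\<^sup>2 = (1 + alpha_p p * t\<^sup>2) powr (2 / p)"
    by (simp add: power2_eq_square powr_add[symmetric])
  also have "\<dots> = (1 + alpha_p p * t\<^sup>2) ^ (d - 2)"
    using ground_state.r_powr[OF gs[OF zero_less_one] K] .
  finally show ?thesis by (simp add: bub_def power_divide)
qed

text \<open>Integrates the derivative of
  \<open>t ^ d / (1 + alpha_p p * t\<^sup>2) ^ (d - 3)\<close>, which vanishes at infinity once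
  \<open>d < 2 * (d - 3)\<close>, that is \<open>d \<ge> 7\<close>. Only this ratio of moments
  enters the eigenvalue.\<close>

lemma bmom_ratio: "d \<ge> 7 \<Longrightarrow> real d * bmom (d - 1) = (real d - 6) * alpha_p p * bmom (d + 1)"
proof -
  assume d7: "d \<ge> 7"
  define al where "al = alpha_p p"
  have al: "al > 0" using alpha_p_eq(2) by (simp add: al_def)
  have K: "1 + al * t\<^sup>2 > 0" for t using al by (simp add: add_pos_nonneg)
  obtain k where k: "d = k + 7" using d7 by (metis add.commute le_Suc_ex)
  let ?F = "\<lambda>t::real. t ^ d / (1 + al * t\<^sup>2) ^ (d - 3)"
  let ?f = "\<lambda>t. real d * (t ^ (d - 1) * (bub t)\<^sup>2) - (real d - 6) * al * (t ^ (d + 1) * (bub t)\<^sup>2)"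
  have i1: "set_integrable lborel {0<..} (\<lambda>t. t ^ (d - 1) * (bub t)\<^sup>2)" "set_integrable lborel {0<..} (\<lambda>t. t ^ (d + 1) * (bub t)\<^sup>2)"
    using d7 by (auto intro!: bmom_integrable simp del: power_Suc power_add)
  have int: "set_integrable lborel {0<..} ?f" by (intro set_integral_diff(1) set_integrable_mult_right i1)
  have "(LINT t:{0<..}|lborel. ?f t) = 0 - 0"
  proof (rule FTC_Ioi[OF _ _ int])
    fix t :: real assume t: "t > 0"
    have dk: "((\<lambda>t. (1 + al * t\<^sup>2) ^ (d - 3)) has_real_derivative real (d - 3) * (1 + al * t\<^sup>2) ^ (d - 4) * (2 * al * t)) (at t)"
      by (rule derivative_eq_intros refl)+ (simp add: k)
    have dt: "((\<lambda>t. t ^ d) has_real_derivative real d * t ^ (d - 1)) (at t)" using DERIV_pow[of d t] by simp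
    have "(?F has_real_derivative (real d * t ^ (d - 1) * (1 + al * t\<^sup>2) ^ (d - 3) - t ^ d * (real (d - 3) * (1 + al * t\<^sup>2) ^ (d - 4) * (2 * al * t)))
        / ((1 + al * t\<^sup>2) ^ (d - 3) * (1 + al * t\<^sup>2) ^ (d - 3))) (at t)"
      using K[of t] by (intro DERIV_divide dt dk) auto
    also have "(real d * t ^ (d - 1) * (1 + al * t\<^sup>2) ^ (d - 3) - t ^ d * (real (d - 3) * (1 + al * t\<^sup>2) ^ (d - 4) * (2 * al * t)))
        / ((1 + al * t\<^sup>2) ^ (d - 3) * (1 + al * t\<^sup>2) ^ (d - 3)) = ?f t"
    proof -
      define X where "X = 1 + al * t\<^sup>2"
      have X: "X > 0" using K by (simp add: X_def)
      have de: "d - 3 = Suc (d - 4)" "d - 2 = Suc (Suc (d - 4))" using d7 by auto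
      have xp: "X ^ (d - 3) = X * X ^ (d - 4)" "X ^ (d - 2) = X * X * X ^ (d - 4)" unfolding de by simp_all
      have tp: "t ^ d = t * t ^ (d - 1)" "t ^ (d + 1) = t\<^sup>2 * t ^ (d - 1)" 
      proof -
        have "Suc (d - 1) = d" using d7 by simp
        then show "t ^ d = t * t ^ (d - 1)" using power_Suc[of t "d - 1"] by simp
        then show "t ^ (d + 1) = t\<^sup>2 * t ^ (d - 1)" by (simp add: power2_eq_square)
      qed
      define Y Z where "Y = X ^ (d - 4)" and "Z = t ^ (d - 1)"
      have Y: "Y > 0" using X by (simp add: Y_def)
      have alt: "al * t\<^sup>2 = X - 1" by (simp add: X_def)
      have "(real d * Z * (X * Y) - t * Z * (real (d - 3) * Y * (2 * al * t))) / (X * Y * (X * Y))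
         = (real d * Z * X - 2 * real (d - 3) * Z * (al * t\<^sup>2)) / (X * X * Y)"
        using X Y by (simp add: field_simps power2_eq_square)
      also have "real d * Z * X - 2 * real (d - 3) * Z * (al * t\<^sup>2) = real d * Z - (real d - 6) * Z * (al * t\<^sup>2)"
        unfolding alt using d7 by (simp add: algebra_simps of_nat_diff)
      also have "(real d * Z - (real d - 6) * Z * (al * t\<^sup>2)) / (X * X * Y) = real d * (Z * (1 / (X * X * Y))) - (real d - 6) * al * (t\<^sup>2 * Z * (1 / (X * X * Y)))"
        by (simp add: diff_divide_distrib)
      finally show ?thesis unfolding bub_sq[OF t] al_def[symmetric] X_def[symmetric] xp tp Y_def[symmetric] Z_def[symmetric] by simp
    qed
    finally show "(?F has_real_derivative ?f t) (at t)" .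
    have "isCont bub t" using bub_cont t by (simp add: continuous_on_eq_continuous_at)
    then show "isCont ?f t" by (intro continuous_intros)
  next
    show "(?F \<longlongrightarrow> 0) (at_right 0)"
    proof -
      have "(?F \<longlongrightarrow> 0 ^ d / (1 + al * 0\<^sup>2) ^ (d - 3)) (at_right 0)" by (intro tendsto_intros) auto
      then show ?thesis using d7 by (simp add: power_0_left)
    qed
    show "(?F \<longlongrightarrow> 0) at_top"
    proof (rule Lim_null_comparison)
      show "\<forall>\<^sub>F t in at_top. norm (?F t) \<le> (1 / al ^ (d - 3)) * (1 / t)"
        using eventually_ge_at_top[of 1]
      proof eventually_elim
        case (elim t)
        have "al ^ (d - 3) * t ^ (d + 1) \<le> al ^ (d - 3) * t ^ (2 * (d - 3))"
          using elim al d7 by (intro mult_left_mono power_increasing) auto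
        also have "\<dots> = (al * t\<^sup>2) ^ (d - 3)" by (simp add: power_mult_distrib power_mult)
        also have "\<dots> \<le> (1 + al * t\<^sup>2) ^ (d - 3)" using al by (intro power_mono) auto
        finally have le: "al ^ (d - 3) * t ^ (d + 1) \<le> (1 + al * t\<^sup>2) ^ (d - 3)" .
        have "norm (?F t) = t ^ d / (1 + al * t\<^sup>2) ^ (d - 3)" using elim K[of t] by simp
        also have "\<dots> \<le> t ^ d / (al ^ (d - 3) * t ^ (d + 1))" using le elim al K[of t] by (intro divide_left_mono mult_pos_pos) auto
        also have "\<dots> = (1 / al ^ (d - 3)) * (1 / t)" using elim by simp
        finally show ?case .
      qed
      show "((\<lambda>t. (1 / al ^ (d - 3)) * (1 / t)) \<longlongrightarrow> 0) at_top"
        by (rule tendsto_mult_right_zero) real_asymp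
    qed
  qed
  moreover have "(LINT t:{0<..}|lborel. ?f t) = (LINT t:{0<..}|lborel. real d * (t ^ (d - 1) * (bub t)\<^sup>2)) - (LINT t:{0<..}|lborel. (real d - 6) * al * (t ^ (d + 1) * (bub t)\<^sup>2))"
    by (intro set_integral_diff(2) set_integrable_mult_right i1)
  ultimately show ?thesis unfolding set_integral_mult_right bmom_def al_def by simp
qed

text \<open>In dimension 6 the primitive is rational and its limit is
  \<open>24 ^ 3 / 6\<close>.\<close>

lemma bmom_6: "d = 6 \<Longrightarrow> bmom 5 = 2304"
proof -
  assume d6: "d = 6"
  have al: "alpha_p p = 1 / 24" using d6 by (simp add: alpha_p_def crit_p_def power2_eq_square)
  let ?F = "\<lambda>t::real. t ^ 6 / (6 * (1 + t\<^sup>2 / 24) ^ 3)"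
  have "(LINT t:{0<..}|lborel. t ^ 5 * (bub t)\<^sup>2) = 2304 - 0"
  proof (rule FTC_Ioi_nonneg(2)[where F="?F"])
    fix t :: real assume t: "t > 0"
    define X where "X = 1 + t\<^sup>2 / 24"
    have X: "X > 0" by (simp add: X_def add_pos_nonneg)
    have "((\<lambda>t::real. 6 * (1 + t\<^sup>2 / 24) ^ 3) has_real_derivative 6 * (3 * X\<^sup>2 * (t / 12))) (at t)"
      unfolding X_def by (auto intro!: derivative_eq_intros simp: power2_eq_square)
    moreover have "((\<lambda>t::real. t ^ 6) has_real_derivative 6 * t ^ 5) (at t)" by (auto intro!: derivative_eq_intros)
    ultimately have "(?F has_real_derivative (6 * t ^ 5 * (6 * X ^ 3) - t ^ 6 * (6 * (3 * X\<^sup>2 * (t / 12)))) / ((6 * X ^ 3) * (6 * X ^ 3))) (at t)"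
      unfolding X_def using X[unfolded X_def] by (intro DERIV_divide) auto
    also have "(6 * t ^ 5 * (6 * X ^ 3) - t ^ 6 * (6 * (3 * X\<^sup>2 * (t / 12)))) / ((6 * X ^ 3) * (6 * X ^ 3)) = t ^ 5 * (1 / X ^ 4) * (X - t\<^sup>2 / 24)"
      using X by (simp add: field_simps eval_nat_numeral)
    also have "\<dots> = t ^ 5 * (bub t)\<^sup>2" unfolding bub_sq[OF t] al by (simp add: X_def d6)
    finally show "(?F has_real_derivative t ^ 5 * (bub t)\<^sup>2) (at t)" .
    have "isCont bub t" using bub_cont t by (simp add: continuous_on_eq_continuous_at)
    then show "isCont (\<lambda>t. t ^ 5 * (bub t)\<^sup>2) t" by (intro continuous_intros)
    show "0 \<le> t ^ 5 * (bub t)\<^sup>2" using t by simp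
  next
    show "(?F \<longlongrightarrow> 0) (at_right 0)" by real_asymp
    have "(?F \<longlongrightarrow> inverse ((1 / 24) ^ 3) / 6) at_top" by real_asymp
    then show "(?F \<longlongrightarrow> 2304) at_top" by (simp add: eval_nat_numeral)
  qed
  then show ?thesis by (simp add: bmom_def)
qed

text \<open>With \<open>y = t / sqrt 15\<close> the integrand is a multiple of
  \<open>y ^ 4 / (1 + y\<^sup>2) ^ 3\<close>, whose primitive is an arctangent plus a rational
  function; \<open>225 * sqrt 15\<close> is the scaling factor
  \<open>15 powr (5 / 2)\<close>.\<close>

lemma bmom_5: "d = 5 \<Longrightarrow> bmom 4 = 225 * sqrt 15 * (3 * pi / 16)"
proof -
  assume d5: "d = 5"
  have al: "alpha_p p = 1 / 15" using d5 by (simp add: alpha_p_def crit_p_def power2_eq_square)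
  define s where "s = sqrt (15::real)"
  have s: "s > 0" "s * s = 15" by (simp_all add: s_def)
  let ?F = "\<lambda>t::real. 225 * s * (3 / 8 * arctan (t / s) - (5 * (t / s) ^ 3 + 3 * (t / s)) / (8 * (1 + (t / s)\<^sup>2)\<^sup>2))"
  have "(LINT t:{0<..}|lborel. t ^ 4 * (bub t)\<^sup>2) = 225 * s * (3 * pi / 16) - 0"
  proof (rule FTC_Ioi_nonneg(2)[where F="?F"])
    fix t :: real assume t: "t > 0"
    define y where "y = t / s"
    define X where "X = 1 + y\<^sup>2"
    have X: "X > 0" by (simp add: X_def add_pos_nonneg)
    have dy: "((\<lambda>t. t / s) has_real_derivative 1 / s) (at t)" by (rule DERIV_cdivide[OF DERIV_ident])
    have dH: "((\<lambda>y. 3 / 8 * arctan y - (5 * y ^ 3 + 3 * y) / (8 * (1 + y\<^sup>2)\<^sup>2)) has_real_derivative y ^ 4 / X ^ 3) (at y)"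
    proof -
      have "((\<lambda>y. 5 * y ^ 3 + 3 * y) has_real_derivative 15 * y\<^sup>2 + 3) (at y)" by (auto intro!: derivative_eq_intros)
      moreover have "((\<lambda>y. 8 * (1 + y\<^sup>2)\<^sup>2) has_real_derivative 32 * y * X) (at y)"
        unfolding X_def by (auto intro!: derivative_eq_intros)
      moreover have "((\<lambda>y. 3 / 8 * arctan y) has_real_derivative 3 / 8 * inverse X) (at y)"
        unfolding X_def by (intro DERIV_cmult DERIV_arctan)
      ultimately have "((\<lambda>y. 3 / 8 * arctan y - (5 * y ^ 3 + 3 * y) / (8 * (1 + y\<^sup>2)\<^sup>2)) has_real_derivative
         3 / 8 * inverse X - ((15 * y\<^sup>2 + 3) * (8 * X\<^sup>2) - (5 * y ^ 3 + 3 * y) * (32 * y * X)) / ((8 * X\<^sup>2) * (8 * X\<^sup>2))) (at y)"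
        unfolding X_def using X[unfolded X_def] by (intro DERIV_diff DERIV_divide) auto
      also have "3 / 8 * inverse X - ((15 * y\<^sup>2 + 3) * (8 * X\<^sup>2) - (5 * y ^ 3 + 3 * y) * (32 * y * X)) / ((8 * X\<^sup>2) * (8 * X\<^sup>2))
         = (3 * X\<^sup>2 - (15 * y\<^sup>2 + 3) * X + 4 * y * (5 * y ^ 3 + 3 * y)) / (8 * X ^ 3)"
        using X by (simp add: field_simps eval_nat_numeral)
      also have "3 * X\<^sup>2 - (15 * y\<^sup>2 + 3) * X + 4 * y * (5 * y ^ 3 + 3 * y) = 8 * y ^ 4"
        unfolding X_def by (simp add: algebra_simps eval_nat_numeral)
      finally show ?thesis by simp
    qed
    have "(?F has_real_derivative 225 * s * (y ^ 4 / X ^ 3 * (1 / s))) (at t)"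
      by (intro DERIV_cmult DERIV_chain2[where f="\<lambda>y. 3 / 8 * arctan y - (5 * y ^ 3 + 3 * y) / (8 * (1 + y\<^sup>2)\<^sup>2)", OF dH[unfolded y_def] dy, folded y_def])
    also have "225 * s * (y ^ 4 / X ^ 3 * (1 / s)) = t ^ 4 * (bub t)\<^sup>2"
    proof -
      have y2: "y\<^sup>2 = t\<^sup>2 / 15" using s by (simp add: y_def power2_eq_square)
      have "y ^ 4 = (y\<^sup>2)\<^sup>2" by simp
      also have "\<dots> = t ^ 4 / 225" unfolding y2 by (simp add: power_divide)
      finally show ?thesis unfolding bub_sq[OF t] al using s by (simp add: X_def y2 d5)
    qed
    finally show "(?F has_real_derivative t ^ 4 * (bub t)\<^sup>2) (at t)" .
    have "isCont bub t" using bub_cont t by (simp add: continuous_on_eq_continuous_at)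
    then show "isCont (\<lambda>t. t ^ 4 * (bub t)\<^sup>2) t" by (intro continuous_intros)
    show "0 \<le> t ^ 4 * (bub t)\<^sup>2" using t by simp
  next
    have "(?F \<longlongrightarrow> 225 * s * (3 / 8 * arctan (0 / s) - (5 * (0 / s) ^ 3 + 3 * (0 / s)) / (8 * (1 + (0 / s)\<^sup>2)\<^sup>2))) (at_right 0)"
      using s by (intro tendsto_intros) auto
    then show "(?F \<longlongrightarrow> 0) (at_right 0)" by simp
    have ys: "filterlim (\<lambda>t. t / s) at_top at_top" using s by real_asymp
    have "((\<lambda>y::real. 3 / 8 * arctan y - (5 * y ^ 3 + 3 * y) / (8 * (1 + y\<^sup>2)\<^sup>2)) \<longlongrightarrow> 3 / 8 * (pi / 2) - 0) at_top"
    proof (intro tendsto_diff tendsto_mult tendsto_const tendsto_arctan_at_top)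
      show "((\<lambda>y::real. (5 * y ^ 3 + 3 * y) / (8 * (1 + y\<^sup>2)\<^sup>2)) \<longlongrightarrow> 0) at_top" by real_asymp
    qed
    from tendsto_mult[OF tendsto_const[of "225 * s"] filterlim_compose[OF this ys]]
    show "(?F \<longlongrightarrow> 225 * s * (3 * pi / 16)) at_top" by simp
  qed
  then show ?thesis by (simp add: bmom_def s_def)
qed

end

context ground_family
begin

text \<open>The second moment in the original radius, normalised by \<open>b\<^sup>2\<close> because
  \<open>b * u b r\<close> has a limit at fixed \<open>r\<close>; this is the scale that matters for
  \<open>d = 5\<close> and \<open>d = 6\<close>.\<close>

definition outer where "outer b = (LINT r:{0<..}|lborel. r ^ (d + 1) * (b * u b r)\<^sup>2)"

lemma outer_eq: "b > 0 \<Longrightarrow> outer b = b powr (2 - 4 * p) * mom (d + 1) b"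
proof -
  assume b: "b > 0"
  have "outer b = (LINT r:{0<..}|lborel. b\<^sup>2 * (r ^ (d + 1) * (u b r)\<^sup>2))"
    unfolding outer_def by (intro set_lebesgue_integral_cong) (auto simp: power_mult_distrib)
  also have "\<dots> = b\<^sup>2 * (b powr (2 - p * (real (d + 1) + 1)) * mom (d + 1) b)"
    unfolding set_integral_mult_right mom_scale[OF b] ..
  also have "2 - p * (real (d + 1) + 1) = - 4 * p" using p(4) by (simp add: algebra_simps)
  also have "b\<^sup>2 * (b powr (- 4 * p) * mom (d + 1) b) = b powr (2 - 4 * p) * mom (d + 1) b"
    using b by (simp add: powr_diff powr_minus powr_numeral field_simps)
  finally show ?thesis .
qed

lemma lam_outer: "\<forall>\<^sub>F b in at_top. lam b = 2 * (b powr (2 * p - 2) * outer b) / mom (d - 1) b"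
  using lam_eq eventually_gt_at_top[of 0]
proof eventually_elim
  case (elim b)
  have "b powr (2 * p - 2) * outer b = (b powr (2 * p - 2) * b powr (2 - 4 * p)) * mom (d + 1) b"
    unfolding outer_eq[OF elim(2)] by simp
  also have "b powr (2 * p - 2) * b powr (2 - 4 * p) = b powr (- 2 * p)" by (simp add: powr_add[symmetric])
  finally show ?case using elim(1) by simp
qed

lemma mass_tendsto: "(mom (d - 1) \<longlongrightarrow> bmom (d - 1)) at_top" "bmom (d - 1) > 0"
  using d by (intro mom_tendsto bmom_pos; simp)+

lemma lam_asymp_ge7:
  assumes d7: "d \<ge> 7"
  shows "lam \<sim>[at_top] (\<lambda>b. const_C p * lam_rate p b)"
proof -
  have p: "0 < p" "p < 1 / 2" using d7 by (auto simp: crit_p_def field_simps)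
  have "((\<lambda>b. 2 * mom (d + 1) b / mom (d - 1) b) \<longlongrightarrow> 2 * bmom (d + 1) / bmom (d - 1)) at_top"
    using mass_tendsto d7 by (intro tendsto_intros mom_tendsto) auto
  moreover have "\<forall>\<^sub>F b in at_top. 2 * mom (d + 1) b / mom (d - 1) b = lam b / lam_rate p b"
    using lam_eq eventually_gt_at_top[of 0]
  proof eventually_elim
    case (elim b)
    have "lam_rate p b = b powr (- 2 * p)" using p by (simp add: lam_rate_def)
    then show ?case using elim by simp
  qed
  ultimately have "((\<lambda>b. lam b / lam_rate p b) \<longlongrightarrow> 2 * bmom (d + 1) / bmom (d - 1)) at_top"
    by (rule Lim_transform_eventually)
  also have "2 * bmom (d + 1) / bmom (d - 1) = const_C p"
  proof -
    have B: "bmom (d + 1) > 0" using d7 by (intro bmom_pos) simp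
    have "bmom (d + 1) / bmom (d - 1) = real d / ((real d - 6) * alpha_p p)"
      using bmom_ratio[OF d7] mass_tendsto(2) B alpha_p_eq(2) d7 by (simp add: field_simps)
    also have "\<dots> = 2 * (real d)\<^sup>2 / ((real d - 6) * p)"
      unfolding alpha_p_eq(1) using d7 p by (simp add: field_simps power2_eq_square)
    finally have 1: "2 * bmom (d + 1) / bmom (d - 1) = 4 * (real d)\<^sup>2 / ((real d - 6) * p)" by simp
    have d2: "real d - 2 > 0" "real d - 6 > 0" using d7 by auto
    have pe: "1 + p = real d / (real d - 2)" "1 - 2 * p = (real d - 6) / (real d - 2)" "p = 2 / (real d - 2)"
      using d2 by (simp_all add: crit_p_def field_simps)
    have "const_C p = 8 * (1 + p)\<^sup>2 / (p\<^sup>2 * (1 - 2 * p))" using p by (simp add: const_C_def)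
    also have "\<dots> = 8 * (real d / (real d - 2))\<^sup>2 / (p * (2 / (real d - 2)) * ((real d - 6) / (real d - 2)))"
      unfolding pe(1,2) power2_eq_square using pe(3) by simp
    also have "\<dots> = 4 * (real d)\<^sup>2 / ((real d - 6) * p)"
    proof -
      have "8 * (n / x)\<^sup>2 / (q * (2 / x) * (z / x)) = 4 * n\<^sup>2 / (z * q)" if "x > 0" "z > 0" "q > 0" for n x z q :: real
        using that by (simp add: field_simps power2_eq_square)
      from this[OF d2 p(1)] show ?thesis .
    qed
    finally show ?thesis using 1 by simp
  qed
  finally have l: "((\<lambda>b. lam b / lam_rate p b) \<longlongrightarrow> const_C p) at_top" .
  have "const_C p \<noteq> 0" using p by (simp add: const_C_def)
  with l show ?thesis by (rule asymp_equivI'_const)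
qed

text \<open>For \<open>d = 5\<close> the exponents meet, \<open>d + 1 = 2 * (d - 2)\<close>, so
  squaring the global bound with its factor \<open>1 + r\<close> gives directly an inverse square as
  dominating function.\<close>

lemma outer_5: "d = 5 \<Longrightarrow> (outer \<longlongrightarrow> A\<^sup>2 * (3 / 16 * Gamma (3 / 2) * Beta (1 / 4) (1 / 2) / (Gamma (5 / 4))\<^sup>2)) at_top"
proof -
  assume d5: "d = 5"
  obtain C where C: "C > 0" "\<forall>\<^sub>F b in at_top. b \<ge> 1 \<and> (\<forall>r>0. b * (r ^ (d - 2) * (1 + r) * u b r) \<le> C) \<and>
     (\<forall>t>0. 0 < sol b t \<and> sol b t \<le> 1 \<and> t ^ (d - 2) * (1 + b powr (- p) * t) * sol b t \<le> C)"
    using sol_bounds by blast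
  have a0: "a0 = 5 / 4" "g0 = 1 / 4" using d5 by simp_all
  have "(outer \<longlongrightarrow> (LINT r:{0<..}|lborel. r ^ (d + 1) * (A * lin_sol a0 g0 r)\<^sup>2)) at_top"
    unfolding outer_def
  proof (rule set_dominated_convergence_at_top[OF _ _ _ inverse_square_integrable[of "C\<^sup>2"]])
    show "\<forall>\<^sub>F b in at_top. set_borel_measurable lborel {0<..} (\<lambda>r. r ^ (d + 1) * (b * u b r)\<^sup>2)"
      using eventually_gt_at_top[of 0] by eventually_elim
        (intro set_borel_measurable_Ioi continuous_intros continuous_on_subset[OF ground_state.cont_u[OF gs]]; auto)
    show "set_borel_measurable lborel {0<..} (\<lambda>r. r ^ (d + 1) * (A * lin_sol a0 g0 r)\<^sup>2)"
      by (intro set_borel_measurable_Ioi continuous_intros continuous_at_imp_continuous_on ballI DERIV_isCont[OF lin_sol_deriv])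
        (use a0g0 in auto)
    show "\<forall>\<^sub>F b in at_top. \<forall>r\<in>{0<..}. \<bar>r ^ (d + 1) * (b * u b r)\<^sup>2\<bar> \<le> C\<^sup>2 / (1 + r)\<^sup>2"
      using C(2)
    proof eventually_elim
      case (elim b)
      show ?case
      proof
        fix r :: real assume "r \<in> {0<..}"
        then have r: "r > 0" by simp
        have u: "u b r > 0" using ground_state.u_pos[OF gs, of b r] elim r by auto
        have "b * (r ^ (d - 2) * (1 + r) * u b r) \<le> C" using elim r by blast
        then have "(b * (r ^ (d - 2) * (1 + r) * u b r))\<^sup>2 \<le> C\<^sup>2" using r u elim by (intro power_mono) auto
        also have "(b * (r ^ (d - 2) * (1 + r) * u b r))\<^sup>2 = (1 + r)\<^sup>2 * (r ^ (d + 1) * (b * u b r)\<^sup>2)"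
          by (simp add: d5 eval_nat_numeral algebra_simps)
        finally show "\<bar>r ^ (d + 1) * (b * u b r)\<^sup>2\<bar> \<le> C\<^sup>2 / (1 + r)\<^sup>2"
          using r by (simp add: field_simps)
      qed
    qed
    fix r :: real assume "r \<in> {0<..}"
    then show "((\<lambda>b. r ^ (d + 1) * (b * u b r)\<^sup>2) \<longlongrightarrow> r ^ (d + 1) * (A * lin_sol a0 g0 r)\<^sup>2) at_top"
      by (intro tendsto_intros bu_fixed) auto
  qed simp
  also have "(LINT r:{0<..}|lborel. r ^ (d + 1) * (A * lin_sol a0 g0 r)\<^sup>2) = (LINT r:{0<..}|lborel. A\<^sup>2 * (r ^ 6 * (lin_sol (5 / 4) (1 / 4) r)\<^sup>2))"
    unfolding a0 by (intro set_lebesgue_integral_cong) (auto simp: d5 power_mult_distrib)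
  also have "\<dots> = A\<^sup>2 * (3 / 16 * Gamma (3 / 2) * Beta (1 / 4) (1 / 2) / (Gamma (5 / 4))\<^sup>2)"
    unfolding set_integral_mult_right lin_sol_quarter_moment ..
  finally show ?thesis .
qed

end

lemma set_integrable_const_Ioo: "set_integrable lborel {x<..<y :: real} (\<lambda>_. c :: real)"
proof -
  have "integrable lborel (indicat_real {x<..<y})" by (rule integrable_real_indicator) (cases "x \<le> y"; simp)+
  then show ?thesis by (simp add: set_integrable_def)
qed

lemma Gamma_real_values:
  shows "Gamma (5 / 4) = Gamma (1 / 4) / (4 :: real)" "Gamma (- 1 / 4) = - 4 * Gamma (3 / 4 :: real)"
    "Gamma (1 / 2) = sqrt pi" "Gamma (3 / 2) = sqrt pi / 2" "Gamma (5 / 2) = 3 / 4 * sqrt pi"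
    "Gamma (- 3 / 2) = 4 / 3 * sqrt pi" "Gamma (3 :: real) = 2"
proof -
  have G: "Gamma (x + 1) = x * Gamma x" if "x \<notin> \<int>\<^sub>\<le>\<^sub>0" for x :: real using Gamma_plus1[OF that] .
  have ni: "x \<notin> \<int>\<^sub>\<le>\<^sub>0" if "x > 0" for x :: real using nonpos_Ints_nonpos[of x] that by fastforce
  have nq: "(- 1 / 4 :: real) \<notin> \<int>\<^sub>\<le>\<^sub>0" "(- 3 / 2 :: real) \<notin> \<int>\<^sub>\<le>\<^sub>0" "(- 1 / 2 :: real) \<notin> \<int>\<^sub>\<le>\<^sub>0"
  proof -
    have "(- 1 / 4 :: real) \<noteq> of_int n" "(- 3 / 2 :: real) \<noteq> of_int n" "(- 1 / 2 :: real) \<noteq> of_int n" for n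
    proof -
      have *: "x \<noteq> of_int n" if "of_int m < x" "x < of_int (m + 1)" for x :: real and m
        using that by force
      show "(- 1 / 4 :: real) \<noteq> of_int n" by (rule *[of "- 1"]) auto
      show "(- 3 / 2 :: real) \<noteq> of_int n" by (rule *[of "- 2"]) auto
      show "(- 1 / 2 :: real) \<noteq> of_int n" by (rule *[of "- 1"]) auto
    qed
    then show "(- 1 / 4 :: real) \<notin> \<int>\<^sub>\<le>\<^sub>0" "(- 3 / 2 :: real) \<notin> \<int>\<^sub>\<le>\<^sub>0" "(- 1 / 2 :: real) \<notin> \<int>\<^sub>\<le>\<^sub>0"
      by (auto elim!: nonpos_Ints_cases)
  qed
  show "Gamma (5 / 4) = Gamma (1 / 4) / (4 :: real)" using G[of "1 / 4"] ni[of "1 / 4"] by simp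
  show "Gamma (- 1 / 4) = - 4 * Gamma (3 / 4 :: real)" using G[OF nq(1)] by simp
  show h: "Gamma (1 / 2) = sqrt pi" by (rule Gamma_one_half_real)
  show h3: "Gamma (3 / 2) = sqrt pi / 2" using G[of "1 / 2"] ni[of "1 / 2"] h by simp
  show "Gamma (5 / 2) = 3 / 4 * sqrt pi" using G[of "3 / 2"] ni[of "3 / 2"] h3 by simp
  have "Gamma (- 1 / 2) = - 2 * sqrt pi" using G[OF nq(3)] h by simp
  then show "Gamma (- 3 / 2) = 4 / 3 * sqrt pi" using G[OF nq(2)] by simp
  show "Gamma (3 :: real) = 2" using Gamma_fact[of 2, where ?'a=real] by simp
qed

context ground_family
begin

text \<open>Dimension 5 means \<open>p = 2 / 3\<close>, so the Gamma quotient is compared at this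
  value. Reduced to \<open>Gamma (1 / 4)\<close>, \<open>Gamma (3 / 4)\<close> and
  \<open>sqrt pi\<close>, both constants equal
  \<open>4 * sqrt 15 * Gamma (1 / 4) / (Gamma (3 / 4) * pi)\<close>.\<close>

lemma lam_asymp_5:
  assumes d5: "d = 5"
  shows "lam \<sim>[at_top] (\<lambda>b. const_C p * lam_rate p b)"
proof -
  have p: "p = 2 / 3" using d5 by (simp add: crit_p_def)
  define N where "N = 3 / 16 * Gamma (3 / 2) * Beta (1 / 4) (1 / 2) / (Gamma (5 / 4 :: real))\<^sup>2"
  have "((\<lambda>b. 2 * outer b / mom (d - 1) b) \<longlongrightarrow> 2 * (A\<^sup>2 * N) / bmom (d - 1)) at_top"
    unfolding N_def using mass_tendsto by (intro tendsto_intros outer_5 d5) auto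
  moreover have "\<forall>\<^sub>F b in at_top. 2 * outer b / mom (d - 1) b = lam b / lam_rate p b"
    using lam_outer eventually_gt_at_top[of 0]
  proof eventually_elim
    case (elim b)
    have "lam_rate p b = b powr (2 * p - 2)" unfolding lam_rate_def p by simp
    then show ?case using elim by simp
  qed
  ultimately have "((\<lambda>b. lam b / lam_rate p b) \<longlongrightarrow> 2 * (A\<^sup>2 * N) / bmom (d - 1)) at_top"
    by (rule Lim_transform_eventually)
  also have "2 * (A\<^sup>2 * N) / bmom (d - 1) = const_C p"
  proof -
    define s where "s = sqrt (15 :: real)"
    have s: "s > 0" "s\<^sup>2 = 15" by (simp_all add: s_def)
    define t where "t = sqrt pi"
    have t: "t > 0" "t\<^sup>2 = pi" "pi > 0" by (simp_all add: t_def)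
    define X Y where "X = Gamma (1 / 4 :: real)" and "Y = Gamma (3 / 4 :: real)"
    have XY: "X > 0" "Y > 0" by (simp_all add: X_def Y_def)
    have s15: "15 powr (3 / 2) = 15 * s"
    proof -
      have "15 powr (3 / 2) = 15 powr (1 + 1 / 2 :: real)" by simp
      also have "\<dots> = 15 * s" unfolding powr_add s_def by (simp add: powr_half_sqrt)
      finally show ?thesis .
    qed
    have k: "\<kappa> = 15 * s"
    proof -
      have al: "alpha_p p = 1 / 15" unfolding p by (simp add: alpha_p_def power2_eq_square)
      have "\<kappa> = (1 / 15) powr (- (3 / 2))" unfolding \<kappa>_def al unfolding p by simp
      also have "\<dots> = 15 powr (3 / 2)" by (simp add: powr_divide powr_minus_divide)
      finally show ?thesis using s15 by simp
    qed
    have B: "Beta (1 / 4) (1 / 2 :: real) = X * t / Y"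
      unfolding Beta_def Gamma_real_values X_def Y_def t_def by simp
    have A': "A = 15 * s * (X / 4) / (t / 2)"
    proof -
      have "A = 15 * s * Gamma (5 / 4) / Gamma (3 / 2)" unfolding A_def k unfolding p unfolding d5 by simp
      then show ?thesis unfolding Gamma_real_values X_def t_def .
    qed
    have N': "N = 3 / 16 * (t / 2) * (X * t / Y) / (X / 4)\<^sup>2"
      unfolding N_def B Gamma_real_values X_def t_def by simp
    have b4: "bmom (d - 1) = 225 * s * (3 * t\<^sup>2 / 16)" using bmom_5[OF d5] t d5 by (simp add: s_def)
    have "2 * (A\<^sup>2 * N) / bmom (d - 1) = 4 * s * X / (Y * t\<^sup>2)"
    proof -
      have "A\<^sup>2 * N = (15 * s)\<^sup>2 * (3 / 16 * (X * t / Y)) / (t / 2)"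
        unfolding A' N' using t XY s by (simp add: field_simps power2_eq_square)
      then have "2 * (A\<^sup>2 * N) / bmom (d - 1) = 2 * ((225 * s\<^sup>2) * (3 / 16 * (X * t / Y)) / (t / 2)) / (225 * s * (3 * t\<^sup>2 / 16))"
        unfolding b4 by (simp add: power_mult_distrib)
      also have "\<dots> = 4 * s * X / (Y * t\<^sup>2)" using t XY s by (simp add: field_simps power2_eq_square)
      finally show ?thesis .
    qed
    moreover have "const_C p = 4 * s * X / (Y * t\<^sup>2)"
    proof -
      have c: "const_C (2 / 3) = - (Gamma (5 / 4) * Gamma (- 3 / 2) * Gamma 3) / (5 / 3 * Gamma (- 1 / 4) * Gamma (3 / 2) * Gamma (1 / 2) * Gamma (5 / 2)) * 15 powr (3 / 2)"
        by (simp add: const_C_def power2_eq_square)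
      show ?thesis unfolding p c Gamma_real_values s15 X_def[symmetric] Y_def[symmetric] t_def[symmetric]
        using t XY s by (simp add: field_simps power2_eq_square)
    qed
    ultimately show ?thesis by simp
  qed
  finally have l: "((\<lambda>b. lam b / lam_rate p b) \<longlongrightarrow> const_C p) at_top" .
  have "const_C p \<noteq> 0"
  proof -
    have "N > 0" unfolding N_def Beta_def using less_imp_neq[OF Gamma_real_pos[of "5 / 4"], symmetric]
      by (auto intro!: mult_pos_pos divide_pos_pos)
    then have "2 * (A\<^sup>2 * N) / bmom (d - 1) > 0" using kA mass_tendsto(2) by simp
    then show ?thesis using \<open>2 * (A\<^sup>2 * N) / bmom (d - 1) = const_C p\<close> by simp
  qed
  with l show ?thesis by (rule asymp_equivI'_const)
qed

text \<open>In the borderline dimension the moment is dominated by the logarithmically many scales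
  \<open>r = b powr (- s)\<close> with \<open>0 < s < 1/2\<close>, on each of which \<open>b * r ^ 4 * u b r\<close> tends to \<open>\<kappa>\<close>.\<close>

lemma outer_6:
  assumes d6: "d = 6"
  shows "((\<lambda>b. outer b / ln b) \<longlongrightarrow> \<kappa>\<^sup>2 / 2) at_top"
proof -
  have p: "p = 1 / 2" using d6 by (simp add: crit_p_def)
  obtain C where C: "C > 0" "\<forall>\<^sub>F b in at_top. b \<ge> 1 \<and> (\<forall>r>0. b * (r ^ (d - 2) * (1 + r) * u b r) \<le> C) \<and>
     (\<forall>t>0. 0 < sol b t \<and> sol b t \<le> 1 \<and> t ^ (d - 2) * (1 + b powr (- p) * t) * sol b t \<le> C)"
    using sol_bounds by blast
  define y where "y b s = b * ((b powr (- s)) ^ 4 * u b (b powr (- s)))" for b s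
  define I where "I b = (LINT s:{0<..<1/2}|lborel. (y b s)\<^sup>2)" for b
  have bnd: "\<forall>\<^sub>F b in at_top. b \<ge> 1 \<and> (\<forall>r>0. 0 < b * r ^ 4 * u b r \<and> b * r ^ 4 * u b r \<le> C \<and> (1 + r) * (b * r ^ 4 * u b r) \<le> C)"
    using C(2)
  proof eventually_elim
    case (elim b)
    have "0 < b * r ^ 4 * u b r \<and> b * r ^ 4 * u b r \<le> C \<and> (1 + r) * (b * r ^ 4 * u b r) \<le> C" if r: "r > 0" for r
    proof -
      have u: "u b r > 0" using ground_state.u_pos[OF gs, of b r] elim r by auto
      have 1: "(1 + r) * (b * r ^ 4 * u b r) \<le> C" using elim r by (simp add: d6 mult_ac)
      have 0: "0 < b * r ^ 4 * u b r" using u r elim by simp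
      have "1 * (b * r ^ 4 * u b r) \<le> (1 + r) * (b * r ^ 4 * u b r)" using 0 r by (intro mult_right_mono) auto
      then show ?thesis using 0 1 by linarith
    qed
    then show ?case using elim by blast
  qed
  have meas: "continuous_on {0<..} (u b)" if "b > 0" for b
    by (rule continuous_on_subset[OF ground_state.cont_u[OF gs[OF that]]]) auto
  have Ilim: "(I \<longlongrightarrow> (LINT s:{0<..<1/2::real}|lborel. \<kappa>\<^sup>2)) at_top"
    unfolding I_def
  proof (rule set_dominated_convergence_at_top[where w="\<lambda>_. C\<^sup>2"])
    show "\<forall>\<^sub>F b in at_top. set_borel_measurable lborel {0<..<1/2} (\<lambda>s. (y b s)\<^sup>2)"
      using eventually_gt_at_top[of 0]
    proof eventually_elim
      case (elim b)
      have "continuous_on {0<..<1/2} (\<lambda>s. (y b s)\<^sup>2)"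
        unfolding y_def using elim by (intro continuous_intros continuous_on_compose2[OF meas[OF elim]]) auto
      then show ?case using borel_measurable_continuous_on_indicator[of "{0<..<1/2}" "\<lambda>s. (y b s)\<^sup>2"]
        by (simp add: set_borel_measurable_def)
    qed
    show "set_borel_measurable lborel {0<..<1/2::real} (\<lambda>_. \<kappa>\<^sup>2)" by (simp add: set_borel_measurable_def)
    show "set_integrable lborel {0<..<1/2::real} (\<lambda>_. C\<^sup>2)" by (rule set_integrable_const_Ioo)
    show "\<forall>\<^sub>F b in at_top. \<forall>s\<in>{0<..<1/2}. \<bar>(y b s)\<^sup>2\<bar> \<le> C\<^sup>2"
      using bnd
    proof eventually_elim
      case (elim b)
      show ?case
      proof
        fix s :: real
        have "b powr (- s) > 0" using elim by simp
        then have "0 < y b s" "y b s \<le> C" using elim unfolding y_def mult.assoc[symmetric] by blast+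
        then show "\<bar>(y b s)\<^sup>2\<bar> \<le> C\<^sup>2" by (simp add: power_mono)
      qed
    qed
    fix s :: real assume s: "s \<in> {0<..<1/2}"
    then have "((\<lambda>b. b * ((b powr (- s)) ^ (d - 2) * u b (b powr (- s)))) \<longlongrightarrow> \<kappa>) at_top"
      using p by (intro bu_power) auto
    then show "((\<lambda>b. (y b s)\<^sup>2) \<longlongrightarrow> \<kappa>\<^sup>2) at_top" unfolding y_def by (intro tendsto_power) (simp add: d6)
  qed simp
  have "(LINT s:{0<..<1/2::real}|lborel. \<kappa>\<^sup>2) = \<kappa>\<^sup>2 / 2"
    by (simp add: set_lebesgue_integral_def)
  with Ilim have Ilim: "(I \<longlongrightarrow> \<kappa>\<^sup>2 / 2) at_top" by simp
  \<comment> \<open>Logarithmic variable \<open>r = b powr (- s)\<close>: the Jacobian is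
    \<open>- ln b * r\<close>, and the resulting \<open>r ^ 8 * (b * u b r)\<^sup>2\<close> is the
    square of \<open>y b s\<close>.\<close>
  have sub: "(LINT r:{b powr (- (1 / 2))..1}|lborel. r ^ 7 * (b * u b r)\<^sup>2) = ln b * I b" if b: "b > 1" for b
  proof -
    define L where "L = ln b"
    have L: "L > 0" using b by (simp add: L_def)
    define f where "f r = r ^ 7 * (b * u b r)\<^sup>2" for r
    define g where "g s = b powr (- s)" for s
    have dg: "(g has_real_derivative - L * g s) (at s within S)" for s S
      unfolding g_def powr_def L_def using b by (auto intro!: derivative_eq_intros)
    have contg: "continuous_on S g" for S unfolding g_def using b by (intro continuous_intros) auto
    have "(LBINT s=ereal 0..ereal (1/2). (- L * g s) *\<^sub>R f (g s)) = (LBINT r=ereal (g 0)..ereal (g (1/2)). f r)"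
    proof (rule interval_integral_substitution_finite)
      show "continuous_on (g ` {0..1/2}) f"
        unfolding f_def using b by (intro continuous_intros continuous_on_subset[OF meas[of b]]) (auto simp: g_def)
      show "continuous_on {0..1/2} (\<lambda>s. - L * g s)" by (intro continuous_intros contg)
    qed (use dg in auto)
    also have "g 0 = 1" using b by (simp add: g_def)
    also have "(LBINT r=ereal 1..ereal (g (1/2)). f r) = - (LBINT r=ereal (g (1/2))..ereal 1. f r)"
      by (rule interval_integral_endpoints_reverse)
    also have "(LBINT r=ereal (g (1/2))..ereal 1. f r) = (LINT r:{g (1/2)..1}|lborel. f r)"
      by (rule interval_integral_Icc) (use b powr_mono[of "- (1/2)" 0 b] in \<open>simp add: g_def\<close>)
    finally have 1: "(LINT r:{g (1/2)..1}|lborel. f r) = - (LBINT s=ereal 0..ereal (1/2). (- L * g s) *\<^sub>R f (g s))" by simp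
    have "(LBINT s=ereal 0..ereal (1/2). (- L * g s) *\<^sub>R f (g s)) = (LINT s:{0<..<1/2}|lborel. (- L * g s) *\<^sub>R f (g s))"
      by (subst interval_integral_Ioo) auto
    also have "\<dots> = (LINT s:{0<..<1/2}|lborel. - L * (y b s)\<^sup>2)"
    proof (intro set_lebesgue_integral_cong allI impI)
      fix s :: real
      show "(- L * g s) *\<^sub>R f (g s) = - L * (y b s)\<^sup>2"
        unfolding f_def y_def g_def[symmetric] by (simp add: power_mult_distrib eval_nat_numeral algebra_simps)
    qed simp
    also have "\<dots> = - L * I b" unfolding I_def set_integral_mult_right ..
    finally show ?thesis using 1 by (simp add: f_def L_def g_def)
  qed
  \<comment> \<open>Radii outside \<open>[b powr (- 1 / 2), 1]\<close> contribute a bounded amount: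
    the core at most \<open>(b * s\<^sup>2) ^ 4 = 1\<close>, with
    \<open>s = b powr (- 1 / 2)\<close> and \<open>u \<le> b\<close>, and the radii beyond 1 at most
    the integral of the inverse square.\<close>
  define K where "K = 1 + (LINT r:{0<..}|lborel. C\<^sup>2 / (1 + r)\<^sup>2)"
  have K: "\<forall>\<^sub>F b in at_top. ln b * I b \<le> outer b \<and> outer b \<le> ln b * I b + K"
    using bnd sol_integrable eventually_gt_at_top[of 1]
  proof eventually_elim
    case (elim b)
    have b: "b > 1" "b > 0" using elim by auto
    define f where "f r = r ^ 7 * (b * u b r)\<^sup>2" for r
    define s where "s = b powr (- (1 / 2))"
    have s: "0 < s" "s \<le> 1" using b powr_mono[of "- (1/2)" 0 b] by (auto simp: s_def)
    have f0: "f r \<ge> 0" if "r > 0" for r using that by (simp add: f_def)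
    have "set_integrable lborel {0<..} (\<lambda>r. b\<^sup>2 * (r ^ (d + 1) * (u b r)\<^sup>2))" using elim by (intro set_integrable_mult_right) auto
    then have fi: "set_integrable lborel {0<..} f"
      unfolding f_def by (rule set_integrable_cong[THEN iffD1, rotated -1]) (auto simp: d6 power_mult_distrib)
    have fi': "set_integrable lborel S f" if "S \<subseteq> {0<..}" "S \<in> sets lborel" for S
      by (rule set_integrable_subset[OF fi that(2,1)])
    have sets: "{0<..<s} \<subseteq> {0<..}" "{s..1} \<subseteq> {0<..}" "{1<..} \<subseteq> {0::real<..}" using s by auto
    have "outer b = (LINT r:({0<..<s} \<union> ({s..1} \<union> {1<..}))|lborel. f r)"
    proof -
      have "{0<..<s} \<union> ({s..1} \<union> {1<..}) = {0<..}" using s by auto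
      moreover have "outer b = (LINT r:{0<..}|lborel. f r)" unfolding outer_def f_def by (simp add: d6)
      ultimately show ?thesis by simp
    qed
    also have "\<dots> = (LINT r:{0<..<s}|lborel. f r) + (LINT r:({s..1} \<union> {1<..})|lborel. f r)"
      using s by (intro set_integral_Un fi') auto
    also have "(LINT r:({s..1} \<union> {1<..})|lborel. f r) = (LINT r:{s..1}|lborel. f r) + (LINT r:{1<..}|lborel. f r)"
      using s by (intro set_integral_Un fi') auto
    also have "(LINT r:{s..1}|lborel. f r) = ln b * I b"
      using sub[OF b(1)] by (simp add: s_def f_def)
    finally have o: "outer b = (LINT r:{0<..<s}|lborel. f r) + (ln b * I b + (LINT r:{1<..}|lborel. f r))" .
    have nn: "(LINT r:S|lborel. f r) \<ge> 0" if "S \<subseteq> {0<..}" for S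
      unfolding set_lebesgue_integral_def using that f0 by (intro Bochner_Integration.integral_nonneg) (auto simp: indicator_def)
    have l1: "(LINT r:{0<..<s}|lborel. f r) \<le> 1"
    proof -
      have "(LINT r:{0<..<s}|lborel. f r) \<le> (LINT r:{0<..<s}|lborel. b ^ 4 * s ^ 7)"
      proof (rule set_integral_mono)
        show "set_integrable lborel {0<..<s} f" using sets by (intro fi') auto
        show "set_integrable lborel {0<..<s} (\<lambda>r. b ^ 4 * s ^ 7)" by (rule set_integrable_const_Ioo)
        fix r assume "r \<in> {0<..<s}"
        then have r: "0 < r" "r \<le> s" by auto
        have "b * u b r \<le> b * b" using ground_state.u_le_b[OF gs[OF b(2)], of r] r b by (intro mult_left_mono) auto
        moreover have "0 \<le> b * u b r" using ground_state.u_pos[OF gs[OF b(2)], of r] r b by simp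
        ultimately have "(b * u b r)\<^sup>2 \<le> (b * b)\<^sup>2" by (intro power_mono)
        moreover have "r ^ 7 \<le> s ^ 7" using r by (intro power_mono) auto
        ultimately have "f r \<le> s ^ 7 * (b * b)\<^sup>2" unfolding f_def by (intro mult_mono[of "r ^ 7" "s ^ 7" "(b * u b r)\<^sup>2"]) (use s in auto)
        then show "f r \<le> b ^ 4 * s ^ 7" by (simp add: eval_nat_numeral mult_ac)
      qed
      also have "\<dots> = s * (b ^ 4 * s ^ 7)" using s by (simp add: set_lebesgue_integral_def)
      also have "\<dots> = (b * s\<^sup>2) ^ 4" by (simp add: eval_nat_numeral mult_ac)
      also have "b * s\<^sup>2 = 1"
        unfolding s_def power2_eq_square powr_add[symmetric] using b by (simp add: powr_minus)
      finally show ?thesis by simp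
    qed
    have l3: "(LINT r:{1<..}|lborel. f r) \<le> (LINT r:{0<..}|lborel. C\<^sup>2 / (1 + r)\<^sup>2)"
      unfolding set_lebesgue_integral_def
    proof (rule integral_mono)
      show "integrable lborel (\<lambda>x. indicat_real {1<..} x *\<^sub>R f x)"
        using fi'[of "{1<..}"] sets by (simp add: set_integrable_def)
      show "integrable lborel (\<lambda>x. indicat_real {0<..} x *\<^sub>R (C\<^sup>2 / (1 + x)\<^sup>2))"
        using inverse_square_integrable[of "C\<^sup>2"] by (simp add: set_integrable_def)
      fix r :: real
      have "f r \<le> C\<^sup>2 / (1 + r)\<^sup>2" if r: "r > 1"
      proof -
        have r0: "r > 0" using r by simp
        have "(1 + r) * (b * r ^ 4 * u b r) \<le> C" "0 < b * r ^ 4 * u b r" using elim r0 by blast+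
        then have "((1 + r) * (b * r ^ 4 * u b r))\<^sup>2 \<le> C\<^sup>2" using r by (intro power_mono) auto
        then have "(1 + r)\<^sup>2 * (r ^ 8 * (b * u b r)\<^sup>2) \<le> C\<^sup>2" by (simp add: power_mult_distrib eval_nat_numeral mult_ac)
        moreover have "(1 + r)\<^sup>2 * f r \<le> (1 + r)\<^sup>2 * (r ^ 8 * (b * u b r)\<^sup>2)"
          unfolding f_def using r by (intro mult_left_mono mult_right_mono power_increasing) auto
        ultimately have "(1 + r)\<^sup>2 * f r \<le> C\<^sup>2" by linarith
        then show ?thesis using r by (simp add: field_simps)
      qed
      then show "indicat_real {1<..} r *\<^sub>R f r \<le> indicat_real {0<..} r *\<^sub>R (C\<^sup>2 / (1 + r)\<^sup>2)"
        by (auto simp: indicator_def)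
    qed
    show ?case using o l1 l3 nn[OF sets(1)] nn[OF sets(3)] unfolding K_def by linarith
  qed
  have lnlim: "((\<lambda>b. K / ln b) \<longlongrightarrow> 0) at_top"
    by (intro tendsto_divide_0[OF tendsto_const] filterlim_at_top_imp_at_infinity ln_at_top)
  show ?thesis
  proof (rule tendsto_sandwich)
    show "\<forall>\<^sub>F b in at_top. I b \<le> outer b / ln b"
      using K eventually_gt_at_top[of 1] by eventually_elim (simp add: field_simps)
    show "\<forall>\<^sub>F b in at_top. outer b / ln b \<le> I b + K / ln b"
      using K eventually_gt_at_top[of 1] by eventually_elim (simp add: field_simps)
    show "((\<lambda>b. I b + K / ln b) \<longlongrightarrow> \<kappa>\<^sup>2 / 2) at_top"
      using tendsto_add[OF Ilim lnlim] by simp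
  qed (rule Ilim)
qed

lemma lam_asymp_6:
  assumes d6: "d = 6"
  shows "lam \<sim>[at_top] (\<lambda>b. const_C p * lam_rate p b)"
proof -
  have p: "p = 1 / 2" using d6 by (simp add: crit_p_def)
  have "((\<lambda>b. 2 * (outer b / ln b) / mom (d - 1) b) \<longlongrightarrow> 2 * (\<kappa>\<^sup>2 / 2) / bmom (d - 1)) at_top"
    using mass_tendsto by (intro tendsto_intros outer_6 d6) auto
  moreover have "\<forall>\<^sub>F b in at_top. 2 * (outer b / ln b) / mom (d - 1) b = lam b / lam_rate p b"
    using lam_outer eventually_gt_at_top[of 1]
  proof eventually_elim
    case (elim b)
    have "lam_rate p b = b powr (2 * p - 2) * ln b" unfolding lam_rate_def p using elim by (simp add: powr_minus field_simps)
    then show ?case using elim by simp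
  qed
  ultimately have "((\<lambda>b. lam b / lam_rate p b) \<longlongrightarrow> 2 * (\<kappa>\<^sup>2 / 2) / bmom (d - 1)) at_top"
    by (rule Lim_transform_eventually)
  \<comment> \<open>\<open>\<kappa> = 24\<^sup>2 = 576\<close> and the mass is 2304, so the constant
    is \<open>576\<^sup>2 / 2304 = 144\<close>.\<close>
  moreover have "2 * (\<kappa>\<^sup>2 / 2) / bmom (d - 1) = const_C p"
  proof -
    have al: "alpha_p p = 1 / 24" unfolding p by (simp add: alpha_p_def power2_eq_square)
    have "\<kappa> = (1 / 24) powr (- 2)" unfolding \<kappa>_def al unfolding p by simp
    also have "\<dots> = 576" by (simp add: powr_minus powr_numeral power2_eq_square)
    finally have "\<kappa> = 576" .
    moreover have "bmom (d - 1) = 2304" using bmom_6[OF d6] d6 by simp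
    ultimately show ?thesis unfolding p by (simp add: const_C_def)
  qed
  ultimately have l: "((\<lambda>b. lam b / lam_rate p b) \<longlongrightarrow> const_C p) at_top" by simp
  have "const_C p \<noteq> 0" unfolding p by (simp add: const_C_def)
  with l show ?thesis by (rule asymp_equivI'_const)
qed

lemma lam_asymp: "lam \<sim>[at_top] (\<lambda>b. const_C p * lam_rate p b)"
proof -
  consider "d = 5" | "d = 6" | "d \<ge> 7" using d by linarith
  then show ?thesis using lam_asymp_5 lam_asymp_6 lam_asymp_ge7 by cases auto
qed

lemma c_asymp: "c \<sim>[at_top] (\<lambda>b. A / b)"
proof -
  have "((\<lambda>b. c b / (1 / b)) \<longlongrightarrow> A) at_top" using c_tendsto by (simp add: mult.commute)
  then have "c \<sim>[at_top] (\<lambda>b. A * (1 / b))" using kA by (intro asymp_equivI'_const) auto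
  then show ?thesis by simp
qed

section \<open>Return to the Tricomi function and the matched estimates\<close>

lemma tail_const_eq_c: "b > 0 \<Longrightarrow> tail_const d (lam b) (u b) = c b"
  using ground_state.tail_const_eq[OF gs] by (simp add: c_def)

lemma tricomi_lin_sol:
  assumes b: "b > 0" and r: "r > 0"
  shows "exp (- r\<^sup>2 / 2) * tricomi_U (kummer_alpha p (lam b)) (kummer_beta p) (r\<^sup>2) = lin_sol (ka b) (kg b) r"
proof -
  interpret g: ground_state d "lam b" b "u b" "u' b" "u'' b" by (rule gs[OF b])
  have k: "g.ka = ka b" "g.kg = kg b" by (simp_all add: ka_def kg_def)
  have "(p + 1) / (2 * p) = real d / 4" using p(1,4) by (simp add: field_simps)
  then have al: "kummer_alpha p (lam b) = ka b" unfolding kummer_alpha_def ka_eq[OF b] by (simp add: diff_divide_distrib)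
  have be: "kummer_beta p = ka b + kg b + 1" using g.kag(5) p_eq(2) unfolding k kummer_beta_def by (simp add: field_simps)
  show ?thesis unfolding al be lin_sol_def
    using tricomi_U_eq_kummer_int[OF g.kag(1,3), of "r\<^sup>2"] r unfolding k by simp
qed

text \<open>The soliton error \<open>b powr (- 2 * p)\<close> is at most
  \<open>b powr (- 2 * p * (1 - a))\<close>, and in the middle region the loss
  \<open>1 / r\<^sup>2\<close> of \<open>tl_minus_quo\<close> is at most
  \<open>1 / r0\<^sup>2 = b powr (2 * p * (1 - a))\<close>.\<close>

lemma matched_estimates:
  assumes a: "0 < a" "a < p / (1 + p)"
  shows "\<exists>B>0. \<exists>C>0. \<forall>b\<ge>B.
            let c = tail_const d (lam b) (u b);
                al = kummer_alpha p (lam b); be = kummer_beta p;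
                r0 = b powr (- p * (1 - a))
            in (\<forall>r\<in>{0..r0}. \<bar>u b r - aubin_talenti p b r\<bar> / b \<le> C * b powr (- 2 * p * (1 - a)))
             \<and> (\<forall>r\<in>{r0..1}. r powr (2 / p) * \<bar>u b r - c * exp (- r\<^sup>2 / 2) * tricomi_U al be (r\<^sup>2)\<bar>
                   \<le> C * \<bar>c\<bar> powr (2 * p + 1) * b powr (2 * p * (1 - a)))
             \<and> (\<forall>r\<ge>1. \<bar>exp (r\<^sup>2 / 2) * r powr ((real d - lam b) / 2) * u b r
                        - c * r powr ((real d - lam b) / 2) * tricomi_U al be (r\<^sup>2)\<bar>
                   \<le> C * \<bar>c\<bar> powr (2 * p + 1))"
proof -
  obtain M where M: "M > 0" "\<forall>\<^sub>F b in at_top. b \<ge> 1 \<and> c b \<le> M / b \<and>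
     (\<forall>r. 0 < r \<longrightarrow> r \<le> 1 \<longrightarrow> r ^ (d - 2) * lin_sol (ka b) (kg b) r \<le> M \<and> c b - quo b r \<le> c b powr (2 * p + 1) * M / r\<^sup>2) \<and>
     (\<forall>r\<ge>1. r powr (2 * ka b) * exp (r\<^sup>2 / 2) * lin_sol (ka b) (kg b) r \<le> M \<and> c b - quo b r \<le> c b powr (2 * p + 1) * M)"
    using uniform_bounds by blast
  then obtain B0 where B0: "\<And>b. b \<ge> B0 \<Longrightarrow> b \<ge> 1 \<and> c b \<le> M / b \<and>
     (\<forall>r. 0 < r \<longrightarrow> r \<le> 1 \<longrightarrow> r ^ (d - 2) * lin_sol (ka b) (kg b) r \<le> M \<and> c b - quo b r \<le> c b powr (2 * p + 1) * M / r\<^sup>2) \<and>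
     (\<forall>r\<ge>1. r powr (2 * ka b) * exp (r\<^sup>2 / 2) * lin_sol (ka b) (kg b) r \<le> M \<and> c b - quo b r \<le> c b powr (2 * p + 1) * M)"
    unfolding eventually_at_top_linorder by blast
  define B where "B = max 1 B0"
  \<comment> \<open>\<open>D1\<close> serves the inner region; in the other two, one factor
    \<open>M\<close> bounds the weighted linear solution and the other the gap
    \<open>c b - quo b r\<close>.\<close>
  define C where "C = D1 + M * M"
  have C: "C > 0" "C \<ge> D1" "C \<ge> M * M" using M D1_nonneg by (auto simp: C_def add_nonneg_pos)
  have "p / (1 + p) < 1" using p by simp
  then have a1: "a < 1" using a by linarith
  have B: "B > 0" by (simp add: B_def)
  show ?thesis
  proof (rule exI[of _ B], rule conjI[OF B], rule exI[of _ C], rule conjI[OF C(1)], intro allI impI)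
    fix b assume "b \<ge> B"
    then have b: "b \<ge> 1" "b \<ge> B0" "b > 0" by (auto simp: B_def)
    note bb = B0[OF b(2)]
    interpret g: ground_state d "lam b" b "u b" "u' b" "u'' b" by (rule gs[OF b(3)])
    define r0 where "r0 = b powr (- p * (1 - a))"
    have r0: "0 < r0" "r0 \<le> 1" using b a1 p powr_mono[of "- p * (1 - a)" 0 b] by (auto simp: r0_def)
    define T where "T = c b powr (2 * p + 1)"
    have T: "T \<ge> 0" by (simp add: T_def)
    have cb: "c b > 0" by (rule c_pos[OF b(3)])
    have 1: "\<bar>u b r - aubin_talenti p b r\<bar> / b \<le> C * b powr (- 2 * p * (1 - a))" if r: "r \<in> {0..r0}" for r
    proof -
      have "\<bar>u b r - aubin_talenti p b r\<bar> / b \<le> D1 * b powr (1 - 2 * p) / b"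
        using g.u_minus_aubin_talenti[of r] r r0 b by (intro divide_right_mono) auto
      also have "\<dots> = D1 * b powr (- 2 * p)" using b by (simp add: powr_diff powr_minus field_simps)
      also have "\<dots> \<le> C * b powr (- 2 * p * (1 - a))"
      proof (rule mult_mono)
        have "p * a \<ge> 0" using a p by simp
        then show "b powr (- 2 * p) \<le> b powr (- 2 * p * (1 - a))"
          by (intro powr_mono b) (simp add: algebra_simps)
      qed (use C in auto)
      finally show ?thesis .
    qed
    have diff: "\<bar>u b r - c b * lin_sol (ka b) (kg b) r\<bar> = (c b - quo b r) * lin_sol (ka b) (kg b) r" if r: "r > 0" for r
    proof -
      have "u b r - c b * lin_sol (ka b) (kg b) r = - ((c b - quo b r) * lin_sol (ka b) (kg b) r)"
        unfolding u_eq[OF b(3) r] by (simp add: algebra_simps)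
      moreover have "(c b - quo b r) * lin_sol (ka b) (kg b) r \<ge> 0"
        using quo_le_c[OF b(3) r] g.phi_pos[OF r] by (simp add: ka_def kg_def)
      ultimately show ?thesis by simp
    qed
    have tri: "c b * exp (- r\<^sup>2 / 2) * tricomi_U (kummer_alpha p (lam b)) (kummer_beta p) (r\<^sup>2) = c b * lin_sol (ka b) (kg b) r"
      if "r > 0" for r
      using tricomi_lin_sol[OF b(3) that] by (simp only: mult.assoc)
    have 2: "r powr (2 / p) * \<bar>u b r - c b * exp (- r\<^sup>2 / 2) * tricomi_U (kummer_alpha p (lam b)) (kummer_beta p) (r\<^sup>2)\<bar>
          \<le> C * T * b powr (2 * p * (1 - a))" if r: "r \<in> {r0..1}" for r
    proof -
      have r': "0 < r" "r \<le> 1" "r0 \<le> r" using r r0 by auto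
      have pn: "r ^ (d - 2) * lin_sol (ka b) (kg b) r \<ge> 0" using g.phi_pos[OF r'(1)] r' by (simp add: ka_def kg_def)
      have "r powr (2 / p) * \<bar>u b r - c b * exp (- r\<^sup>2 / 2) * tricomi_U (kummer_alpha p (lam b)) (kummer_beta p) (r\<^sup>2)\<bar>
        = (r ^ (d - 2) * lin_sol (ka b) (kg b) r) * (c b - quo b r)"
        unfolding tri[OF r'(1)] diff[OF r'(1)] g.r_powr[OF r'(1)] by simp
      also have "\<dots> \<le> M * (T * M / r\<^sup>2)"
        using bb r' pn quo_le_c[OF b(3) r'(1)] M by (intro mult_mono) (auto simp: T_def)
      also have "\<dots> \<le> M * (T * M / r0\<^sup>2)"
        using r' r0 M T by (intro mult_left_mono divide_left_mono power_mono mult_pos_pos) auto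
      also have "\<dots> = (M * M) * T * (1 / r0\<^sup>2)" by simp
      also have "1 / r0\<^sup>2 = b powr (2 * p * (1 - a))"
        unfolding r0_def power2_eq_square powr_add[symmetric] using b by (simp add: powr_minus_divide[symmetric] algebra_simps)
      also have "(M * M) * T * b powr (2 * p * (1 - a)) \<le> C * T * b powr (2 * p * (1 - a))"
        using C T by (intro mult_right_mono) auto
      finally show ?thesis .
    qed
    have 3: "\<bar>exp (r\<^sup>2 / 2) * r powr ((real d - lam b) / 2) * u b r
          - c b * r powr ((real d - lam b) / 2) * tricomi_U (kummer_alpha p (lam b)) (kummer_beta p) (r\<^sup>2)\<bar> \<le> C * T" if r: "r \<ge> 1" for r
    proof -
      have r': "0 < r" using r by simp
      have e: "(real d - lam b) / 2 = 2 * ka b" using ka_eq[OF b(3)] by simp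
      define E where "E = r powr (2 * ka b) * exp (r\<^sup>2 / 2)"
      have E: "E \<ge> 0" by (simp add: E_def)
      have "tricomi_U (kummer_alpha p (lam b)) (kummer_beta p) (r\<^sup>2) = exp (r\<^sup>2 / 2) * lin_sol (ka b) (kg b) r"
        unfolding tricomi_lin_sol[OF b(3) r', symmetric] by (simp add: mult.assoc[symmetric] mult_exp_exp)
      then have "\<bar>exp (r\<^sup>2 / 2) * r powr ((real d - lam b) / 2) * u b r
          - c b * r powr ((real d - lam b) / 2) * tricomi_U (kummer_alpha p (lam b)) (kummer_beta p) (r\<^sup>2)\<bar>
        = \<bar>E * (u b r - c b * lin_sol (ka b) (kg b) r)\<bar>"
        unfolding e E_def by (simp add: algebra_simps)
      also have "\<dots> = (E * lin_sol (ka b) (kg b) r) * (c b - quo b r)"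
        unfolding abs_mult diff[OF r'] using E by simp
      also have "\<dots> \<le> M * (T * M)"
        using bb r M quo_le_c[OF b(3) r'] g.phi_pos[OF r'] E by (intro mult_mono) (auto simp: T_def E_def ka_def kg_def)
      also have "\<dots> = (M * M) * T" by simp
      also have "\<dots> \<le> C * T" using C T by (intro mult_right_mono)
      finally show ?thesis .
    qed
    show "let c = tail_const d (lam b) (u b);
                al = kummer_alpha p (lam b); be = kummer_beta p;
                r0 = b powr (- p * (1 - a))
            in (\<forall>r\<in>{0..r0}. \<bar>u b r - aubin_talenti p b r\<bar> / b \<le> C * b powr (- 2 * p * (1 - a)))
             \<and> (\<forall>r\<in>{r0..1}. r powr (2 / p) * \<bar>u b r - c * exp (- r\<^sup>2 / 2) * tricomi_U al be (r\<^sup>2)\<bar>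
                   \<le> C * \<bar>c\<bar> powr (2 * p + 1) * b powr (2 * p * (1 - a)))
             \<and> (\<forall>r\<ge>1. \<bar>exp (r\<^sup>2 / 2) * r powr ((real d - lam b) / 2) * u b r
                        - c * r powr ((real d - lam b) / 2) * tricomi_U al be (r\<^sup>2)\<bar>
                   \<le> C * \<bar>c\<bar> powr (2 * p + 1))"
      unfolding Let_def tail_const_eq_c[OF b(3)] abs_of_pos[OF cb] r0_def[symmetric] T_def[symmetric]
      using 1 2 3 by blast
  qed
qed

end

theorem theorem1p1:
  fixes d :: nat and lam :: "real \<Rightarrow> real" and u :: "real \<Rightarrow> real \<Rightarrow> real"
  assumes hd: "d > 4"
    and hgs: "\<forall>b>0. radial_ground_state d (lam b) b (u b)"
  shows "lam \<sim>[at_top] (\<lambda>b. const_C (crit_p d) * lam_rate (crit_p d) b)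
    \<and> (\<forall>b>0. ((\<lambda>r. u b r * exp (r\<^sup>2 / 2) * r powr ((real d - lam b) / 2))
                  \<longlongrightarrow> tail_const d (lam b) (u b)) at_top)
    \<and> (\<exists>A>0. (\<lambda>b. tail_const d (lam b) (u b)) \<sim>[at_top] (\<lambda>b. A / b))
    \<and> (\<forall>a. 0 < a \<and> a < crit_p d / (1 + crit_p d) \<longrightarrow>
         (\<exists>B>0. \<exists>C>0. \<forall>b\<ge>B.
            let p = crit_p d; c = tail_const d (lam b) (u b);
                al = kummer_alpha p (lam b); be = kummer_beta p;
                r0 = b powr (- p * (1 - a))
            in (\<forall>r\<in>{0..r0}. \<bar>u b r - aubin_talenti p b r\<bar> / b \<le> C * b powr (- 2 * p * (1 - a)))
             \<and> (\<forall>r\<in>{r0..1}. r powr (2 / p) * \<bar>u b r - c * exp (- r\<^sup>2 / 2) * tricomi_U al be (r\<^sup>2)\<bar>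
                   \<le> C * \<bar>c\<bar> powr (2 * p + 1) * b powr (2 * p * (1 - a)))
             \<and> (\<forall>r\<ge>1. \<bar>exp (r\<^sup>2 / 2) * r powr ((real d - lam b) / 2) * u b r
                        - c * r powr ((real d - lam b) / 2) * tricomi_U al be (r\<^sup>2)\<bar>
                   \<le> C * \<bar>c\<bar> powr (2 * p + 1))))"
proof -
  have "\<forall>b. \<exists>u' u''. b > 0 \<longrightarrow> ground_state d (lam b) b (u b) u' u''"
  proof
    fix b :: real
    show "\<exists>u' u''. b > 0 \<longrightarrow> ground_state d (lam b) b (u b) u' u''"
    proof (cases "b > 0")
      case True
      then have "radial_ground_state d (lam b) b (u b)" using hgs by blast
      then obtain u' u'' where h: "\<forall>r\<ge>0. (u b has_real_derivative u' r) (at r within {0..}) \<and>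
                 (u' has_real_derivative u'' r) (at r within {0..})"
        "continuous_on {0..} u''" "u' 0 = 0"
        "\<forall>r>0. - u'' r - (real d - 1) / r * u' r + r\<^sup>2 * u b r - \<bar>u b r\<bar> powr (2 * crit_p d) * u b r = lam b * u b r"
        "u b 0 = b" "\<forall>r>0. u' r < 0" "(u b \<longlongrightarrow> 0) at_top"
        unfolding radial_ground_state_def by blast
      have "ground_state d (lam b) b (u b) u' u''"
        by (rule ground_state.intro) (use h hd True in blast)+
      then show ?thesis by blast
    qed simp
  qed
  \<comment> \<open>The derivatives, existentially quantified for each \<open>b\<close>, are chosen
    for all \<open>b\<close> at once to form a \<open>ground_family\<close>.\<close>
  then obtain u' u'' where gs: "\<And>b. b > 0 \<Longrightarrow> ground_state d (lam b) b (u b) (u' b) (u'' b)" by metis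
  interpret ground_family d lam u u' u'' by (rule ground_family.intro) (rule gs)
  have 1: "\<forall>b>0. ((\<lambda>r. u b r * exp (r\<^sup>2 / 2) * r powr ((real d - lam b) / 2)) \<longlongrightarrow> tail_const d (lam b) (u b)) at_top"
    using ground_state.u_tail_tendsto[OF gs] by (simp add: tail_const_eq_c c_def)
  have "(\<lambda>b. tail_const d (lam b) (u b)) \<sim>[at_top] (\<lambda>b. A / b)"
  proof -
    have "\<forall>\<^sub>F b in at_top. c b = tail_const d (lam b) (u b)"
      using eventually_gt_at_top[of 0] by eventually_elim (simp add: tail_const_eq_c)
    then show ?thesis using c_asymp by (subst asymp_equiv_cong[OF _ always_eventually]) (auto elim: eventually_mono)
  qed
  then have 2: "\<exists>A>0. (\<lambda>b. tail_const d (lam b) (u b)) \<sim>[at_top] (\<lambda>b. A / b)" using kA(2) by blast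
  show ?thesis using lam_asymp 1 2 matched_estimates by (auto simp: Let_def)
qed

end
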